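(* Let $n,d,s\ge 2$ and let $\pi\colon\mathbb{A}^n\to\mathbb{A}^n/\mu_d$ be the algebraic quotient. Then: (1) the variety $\mathbb{A}^n/\mu_d$ is $\mathrm{SL}_n(\mathbf{k})$-spherical for the natural $\mathrm{SL}_n(\mathbf{k})$-action on $\mathbb{A}^n$ (i.e. for the action it induces on $\mathbb{A}^n/\mu_d$), and $\mathbb{A}^n/\mu_d$ is smooth outside $\pi(0,\ldots,0)$; (2) there is an $\mathrm{SL}_n(\mathbf{k})$-action on $A_{d,n}^s$ such that the morphism $\eta\colon\mathbb{A}^n/\mu_d\to A_{d,n}^s$ which is induced by the natural inclusion $\mathcal{O}(A_{d,n}^s)\subset\mathcal{O}(\mathbb{A}^n/\mu_d)$ is $\mathrm{SL}_n(\mathbf{k})$-equivariant; moreover, $\eta$ is the normalization map and it is bijective; (3) the natural group homomorphism $\mathrm{Aut}(A_{d,n}^s)\to\mathrm{Aut}(\mathbb{A}^n/\mu_d)$ (lifting automorphisms via the normalization map) is a group isomorphism that preserves algebraic subgroups; (4) the variety $A_{d,n}^s$ is not normal; (5) the weight monoids $\Lambda^+(A_{d,n}^s)$ and $\Lambda^+(\mathbb{A}^n/\mu_d)$ inside $\mathfrak{X}(B)$ are distinct when we fix a Borel subgroup $B\subset\mathrm{SL}_n(\mathbf{k})$.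
   Context: The ground field $\mathbf{k}$ is algebraically closed of characteristic zero. $\mu_d\subset\mathbf{k}^*$ is the finite cyclic subgroup of order $d$, acting on $\mathbb{A}^n$ by $t\cdot(x_1,\ldots,x_n)=(tx_1,\ldots,tx_n)$. With $\mathbf{k}[x_1,\ldots,x_n]_i$ the space of homogeneous polynomials of degree $i$, one has $\mathcal{O}(\mathbb{A}^n/\mu_d)=\bigoplus_{k\ge0}\mathbf{k}[x_1,\ldots,x_n]_{kd}$, and one defines \[ A_{d,n}^s=\mathrm{Spec}\Bigl(\mathbf{k}\oplus\bigoplus_{k\ge s}\mathbf{k}[x_1,\ldots,x_n]_{kd}\Bigr). \] For a connected reductive algebraic group $G$, a variety endowed with a faithful $G$-action is called $G$-spherical if some (and hence every) Borel subgroup of $G$ acts on it with an open dense orbit. An algebraic subgroup of $\mathrm{Aut}(X)$ is a subgroup $H$ that has the structure of an algebraic group such that $H\times X\to X$ is a regular action. A group homomorphism $\theta\colon\mathrm{Aut}(X)\to\mathrm{Aut}(Y)$ preserves algebraic subgroups if for each algebraic subgroup $H\subset\mathrm{Aut}(X)$ the image $\theta(H)$ is an algebraic subgroup of $\mathrm{Aut}(Y)$ and $\theta|_H\colon H\to\theta(H)$ is a homomorphism of algebraic groups; a group isomorphism $\theta$ preserves algebraic subgroups if both $\theta$ and $\theta^{-1}$ do. For a variety $X$ with an action of $\mathrm{SL}_n(\mathbf{k})$, $\Lambda^+(X)=\{\lambda\in\mathfrak{X}(B):\exists\,0\ne f\in\mathcal{O}(X),\ bf=\lambda(b)f\ \forall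 b\in B\}$, where $\mathfrak{X}(B)$ is the character group of $B$ and $(bf)(x)=f(b^{-1}x)$.
   Formalization: In (1), the action of SL_n on A^n/μ_d is not faithful when gcd(n,d)>1 (e.g. −I for n=d=2); so for all n,d it is shown that the action is regular and a Borel subgroup has an open dense orbit, and sphericity including faithfulness is shown when gcd(n,d)=1. *)

theory Defs
  imports
    "HOL-Analysis.Analysis"
    "HOL-Algebra.Group_Action"
    "HOL-Algebra.Solvable_Groups"
    "HOL-Computational_Algebra.Polynomial"
    "HOL-Library.Function_Algebras"
begin

section \<open>Algebras of functions\<close>

text \<open>
  All function algebras consist of extensional functions on a fixed set \<open>P\<close>, so that two of
  its members are equal iff they agree on \<open>P\<close>.
\<close>

definition subalg :: "'p set \<Rightarrow> ('p \<Rightarrow> 'k::field) set \<Rightarrow> bool" where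
  "subalg P A \<longleftrightarrow> A \<subseteq> extensional P \<and> (\<forall>c. (\<lambda>x\<in>P. c) \<in> A) \<and>
     (\<forall>f\<in>A. \<forall>g\<in>A. (\<lambda>x\<in>P. f x + g x) \<in> A \<and> (\<lambda>x\<in>P. f x * g x) \<in> A)"

definition alg_generated :: "'p set \<Rightarrow> ('p \<Rightarrow> 'k::field) set \<Rightarrow> ('p \<Rightarrow> 'k) set" where
  "alg_generated P F = \<Inter>{A. subalg P A \<and> F \<subseteq> A}"

definition alg_homs :: "'p set \<Rightarrow> ('p \<Rightarrow> 'k::field) set \<Rightarrow> (('p \<Rightarrow> 'k) \<Rightarrow> 'k) set" where
  "alg_homs P A = {\<phi> \<in> extensional A. (\<forall>c. \<phi> (\<lambda>x\<in>P. c) = c) \<and>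
     (\<forall>f\<in>A. \<forall>g\<in>A. \<phi> (\<lambda>x\<in>P. f x + g x) = \<phi> f + \<phi> g \<and> \<phi> (\<lambda>x\<in>P. f x * g x) = \<phi> f * \<phi> g)}"


section \<open>Spaces with functions and varieties\<close>

text \<open>
  Varieties over an algebraically closed field are treated classically, as spaces with
  functions: a topological space together with, for every open set, the algebra of regular
  functions on it.
\<close>

record ('p, 'k) fspace =
  ftop :: "'p topology"
  freg :: "'p set \<Rightarrow> ('p \<Rightarrow> 'k) set"

abbreviation pts :: "('p, 'k) fspace \<Rightarrow> 'p set" where
  "pts X \<equiv> topspace (ftop X)"

abbreviation coord_ring :: "('p, 'k) fspace \<Rightarrow> ('p \<Rightarrow> 'k) set" where
  "coord_ring X \<equiv> freg X (pts X)"

text \<open>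
  The space with functions generated by a family of pairs \<open>(U, F)\<close>, where \<open>F\<close> is an algebra of
  functions on \<open>U\<close>: the sets \<open>{x \<in> U. f x \<noteq> 0}\<close> generate the topology, and a function is regular
  if locally it is a quotient of two members of one of the algebras.
\<close>

definition frac_space :: "('p set \<times> ('p \<Rightarrow> 'k::field) set) set \<Rightarrow> ('p, 'k) fspace" where
  "frac_space \<B> =
     (let T = topology_generated_by {{x\<in>U. f x \<noteq> 0} |U F f. (U, F) \<in> \<B> \<and> f \<in> F} in
      \<lparr>ftop = T,
       freg = (\<lambda>W. {h. openin T W \<and> h \<in> extensional W \<and>
         (\<forall>x\<in>W. \<exists>(U, F)\<in>\<B>. \<exists>a\<in>F. \<exists>b\<in>F. \<exists>N. openin T N \<and> x \<in> N \<and> N \<subseteq> W \<inter> U \<and>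
            (\<forall>y\<in>N. b y \<noteq> 0 \<and> h y = a y / b y))})\<rparr>)"

definition fun_space :: "('p, 'k::field) fspace \<Rightarrow> bool" where
  "fun_space X \<longleftrightarrow>
     (\<forall>U. \<not> openin (ftop X) U \<longrightarrow> freg X U = {}) \<and>
     (\<forall>U. openin (ftop X) U \<longrightarrow> subalg U (freg X U)) \<and>
     (\<forall>\<U>. (\<forall>U\<in>\<U>. openin (ftop X) U) \<longrightarrow>
        (\<forall>f\<in>extensional (\<Union>\<U>). f \<in> freg X (\<Union>\<U>) \<longleftrightarrow> (\<forall>U\<in>\<U>. restrict f U \<in> freg X U))) \<and>
     (\<forall>U. \<forall>f\<in>freg X U. openin (ftop X) {x\<in>U. f x \<noteq> 0} \<and>
        (\<lambda>x\<in>{x\<in>U. f x \<noteq> 0}. inverse (f x)) \<in> freg X {x\<in>U. f x \<noteq> 0})"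

text \<open>The structure induced on an open or closed subset.\<close>

definition induced :: "('p, 'k::field) fspace \<Rightarrow> 'p set \<Rightarrow> ('p, 'k) fspace" where
  "induced X Z = frac_space {(U \<inter> Z, (\<lambda>f. restrict f (U \<inter> Z)) ` freg X U) |U. openin (ftop X) U}"

definition fprod :: "('p, 'k::field) fspace \<Rightarrow> ('q, 'k) fspace \<Rightarrow> ('p \<times> 'q, 'k) fspace" where
  "fprod X Y = frac_space
     {(U \<times> V, {\<lambda>z\<in>U \<times> V. \<Sum>i<m. f i (fst z) * g i (snd z) |m f g.
                 \<forall>i<(m::nat). f i \<in> freg X U \<and> g i \<in> freg Y V})
      |U V. openin (ftop X) U \<and> openin (ftop Y) V}"

definition morph :: "('p, 'k::field) fspace \<Rightarrow> ('q, 'k) fspace \<Rightarrow> ('p \<Rightarrow> 'q) \<Rightarrow> bool" where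
  "morph X Y \<phi> \<longleftrightarrow> continuous_map (ftop X) (ftop Y) \<phi> \<and>
     (\<forall>V f. openin (ftop Y) V \<and> f \<in> freg Y V \<longrightarrow>
        (\<lambda>x\<in>{x\<in>pts X. \<phi> x \<in> V}. f (\<phi> x)) \<in> freg X {x\<in>pts X. \<phi> x \<in> V})"

definition isomorph :: "('p, 'k::field) fspace \<Rightarrow> ('q, 'k) fspace \<Rightarrow> ('p \<Rightarrow> 'q) \<Rightarrow> bool" where
  "isomorph X Y \<phi> \<longleftrightarrow> bij_betw \<phi> (pts X) (pts Y) \<and> morph X Y \<phi> \<and> morph Y X (inv_into (pts X) \<phi>)"

text \<open>
  An affine variety is a set of points with a finitely generated algebra of functions whose
  algebra homomorphisms to the ground field are exactly the evaluations at the points.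
\<close>

definition affine_variety :: "('p, 'k::field) fspace \<Rightarrow> bool" where
  "affine_variety X \<longleftrightarrow>
     X = frac_space {(pts X, coord_ring X)} \<and>
     subalg (pts X) (coord_ring X) \<and>
     (\<exists>F. finite F \<and> F \<subseteq> coord_ring X \<and> coord_ring X = alg_generated (pts X) F) \<and>
     (\<forall>\<phi>\<in>alg_homs (pts X) (coord_ring X). \<exists>!x. x \<in> pts X \<and> (\<forall>f\<in>coord_ring X. \<phi> f = f x))"

definition variety :: "('p, 'k::field) fspace \<Rightarrow> bool" where
  "variety X \<longleftrightarrow> fun_space X \<and>
     (\<exists>\<U>. finite \<U> \<and> \<Union>\<U> = pts X \<and> (\<forall>U\<in>\<U>. openin (ftop X) U \<and> affine_variety (induced X U))) \<and>
     closedin (ftop (fprod X X)) {(x, x) |x. x \<in> pts X}"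

text \<open>
  For an algebra \<open>A\<close> of functions on \<open>P\<close>, the points of \<open>Spec P A\<close> are the \<open>k\<close>-algebra
  homomorphisms from \<open>A\<close> to \<open>k\<close>, which for finitely generated \<open>A\<close> over algebraically closed \<open>k\<close>
  correspond to the maximal ideals.
\<close>

definition Spec :: "'p set \<Rightarrow> ('p \<Rightarrow> 'k::field) set \<Rightarrow> (('p \<Rightarrow> 'k) \<Rightarrow> 'k, 'k) fspace" where
  "Spec P A = frac_space {(alg_homs P A, (\<lambda>f. \<lambda>\<phi>\<in>alg_homs P A. \<phi> f) ` A)}"

definition irreducible_space :: "'p topology \<Rightarrow> bool" where
  "irreducible_space T \<longleftrightarrow> topspace T \<noteq> {} \<and>
     (\<forall>U V. openin T U \<and> openin T V \<and> U \<noteq> {} \<and> V \<noteq> {} \<longrightarrow> U \<inter> V \<noteq> {})"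


section \<open>Normality and normalization\<close>

text \<open>
  The local ring at \<open>x\<close> is an integrally closed domain, spelled out on representatives of germs:
  if \<open>f / g\<close> is a root of a monic polynomial over the local ring, then \<open>f / g\<close> lies in it.
\<close>

definition normal_at :: "('p, 'k::field) fspace \<Rightarrow> 'p \<Rightarrow> bool" where
  "normal_at X x \<longleftrightarrow>
     (\<forall>U. \<forall>f\<in>freg X U. \<forall>g\<in>freg X U. x \<in> U \<and> (\<forall>y\<in>U. f y * g y = 0) \<longrightarrow>
        (\<exists>N. openin (ftop X) N \<and> x \<in> N \<and> N \<subseteq> U \<and> ((\<forall>y\<in>N. f y = 0) \<or> (\<forall>y\<in>N. g y = 0)))) \<and>
     (\<forall>U. \<forall>f\<in>freg X U. \<forall>g\<in>freg X U. \<forall>m. \<forall>c. x \<in> U \<and>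
        \<not> (\<exists>N. openin (ftop X) N \<and> x \<in> N \<and> N \<subseteq> U \<and> (\<forall>y\<in>N. g y = 0)) \<and>
        (\<forall>i<m. c i \<in> freg X U) \<and>
        (\<forall>y\<in>U. f y ^ m + (\<Sum>i<m. c i y * f y ^ i * g y ^ (m - i)) = 0) \<longrightarrow>
        (\<exists>N. \<exists>h\<in>freg X N. openin (ftop X) N \<and> x \<in> N \<and> N \<subseteq> U \<and> (\<forall>y\<in>N. f y = g y * h y)))"

definition normal_variety :: "('p, 'k::field) fspace \<Rightarrow> bool" where
  "normal_variety X \<longleftrightarrow> (\<forall>x\<in>pts X. normal_at X x)"

definition finite_morph :: "('p, 'k::field) fspace \<Rightarrow> ('q, 'k) fspace \<Rightarrow> ('p \<Rightarrow> 'q) \<Rightarrow> bool" where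
  "finite_morph X Y \<eta> \<longleftrightarrow> morph X Y \<eta> \<and>
     (\<exists>F. finite F \<and> F \<subseteq> coord_ring X \<and>
        (\<forall>h\<in>coord_ring X. \<exists>a. (\<forall>f\<in>F. a f \<in> coord_ring Y) \<and>
           (\<forall>x\<in>pts X. h x = (\<Sum>f\<in>F. a f (\<eta> x) * f x))))"

definition birational_morph :: "('p, 'k::field) fspace \<Rightarrow> ('q, 'k) fspace \<Rightarrow> ('p \<Rightarrow> 'q) \<Rightarrow> bool" where
  "birational_morph X Y \<eta> \<longleftrightarrow> morph X Y \<eta> \<and>
     (\<exists>U V. openin (ftop X) U \<and> openin (ftop Y) V \<and> U \<noteq> {} \<and> V \<noteq> {} \<and>
        isomorph (induced X U) (induced Y V) \<eta>)"

text \<open>The normalization of an irreducible affine variety: a finite birational morphism from a normal one.\<close>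

definition normalization_map :: "('p, 'k::field) fspace \<Rightarrow> ('q, 'k) fspace \<Rightarrow> ('p \<Rightarrow> 'q) \<Rightarrow> bool" where
  "normalization_map X Y \<eta> \<longleftrightarrow>
     affine_variety X \<and> irreducible_space (ftop X) \<and> normal_variety X \<and>
     affine_variety Y \<and> irreducible_space (ftop Y) \<and>
     finite_morph X Y \<eta> \<and> birational_morph X Y \<eta>"


section \<open>Dimension and smoothness\<close>

definition alg_indep_on :: "'p set \<Rightarrow> nat \<Rightarrow> (nat \<Rightarrow> 'p \<Rightarrow> 'k::field) \<Rightarrow> bool" where
  "alg_indep_on U m f \<longleftrightarrow>
     (\<forall>S c. finite S \<and> S \<subseteq> ({..<m} \<rightarrow>\<^sub>E (UNIV :: nat set)) \<and>
        (\<forall>x\<in>U. (\<Sum>e\<in>S. c e * (\<Prod>i<m. f i x ^ e i)) = 0) \<longrightarrow> (\<forall>e\<in>S. c e = 0))"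

text \<open>
  For irreducible \<open>X\<close>, rational functions are regular functions on nonempty open subsets, so this
  is the transcendence degree of the function field over the ground field.
\<close>

definition variety_dim :: "('p, 'k::field) fspace \<Rightarrow> enat" where
  "variety_dim X = Sup {enat m |m U f. openin (ftop X) U \<and> U \<noteq> {} \<and>
     (\<forall>i<m. f i \<in> freg X U) \<and> alg_indep_on U m f}"

text \<open>
  For affine \<open>X\<close>: the point derivations of the coordinate ring at \<open>x\<close>. They are set to \<open>0\<close> outside
  of the coordinate ring, so as to form a vector space under the pointwise operations.
\<close>

definition tangent_space :: "('p, 'k::field) fspace \<Rightarrow> 'p \<Rightarrow> (('p \<Rightarrow> 'k) \<Rightarrow> 'k) set" where
  "tangent_space X x = {D. (\<forall>f. f \<notin> coord_ring X \<longrightarrow> D f = 0) \<and>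
     (\<forall>c. \<forall>f\<in>coord_ring X. D (\<lambda>y\<in>pts X. c * f y) = c * D f) \<and>
     (\<forall>f\<in>coord_ring X. \<forall>g\<in>coord_ring X.
        D (\<lambda>y\<in>pts X. f y + g y) = D f + D g \<and>
        D (\<lambda>y\<in>pts X. f y * g y) = D f * g x + f x * D g)}"

text \<open>For irreducible affine \<open>X\<close>.\<close>

definition smooth_at :: "('p, 'k::field) fspace \<Rightarrow> 'p \<Rightarrow> bool" where
  "smooth_at X x \<longleftrightarrow>
     enat (vector_space.dim (\<lambda>c D f. c * D f) (tangent_space X x)) = variety_dim X"


section \<open>Algebraic groups and their actions\<close>

text \<open>An algebraic group is given by its abstract group and the variety carried by it.\<close>

definition algebraic_group :: "'g monoid \<Rightarrow> ('g, 'k::field) fspace \<Rightarrow> bool" where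
  "algebraic_group G V \<longleftrightarrow> group G \<and> variety V \<and> pts V = carrier G \<and>
     morph (fprod V V) V (\<lambda>(g, h). g \<otimes>\<^bsub>G\<^esub> h) \<and> morph V V (\<lambda>g. inv\<^bsub>G\<^esub> g)"

definition regular_action ::
  "'g monoid \<Rightarrow> ('g, 'k::field) fspace \<Rightarrow> ('p, 'k) fspace \<Rightarrow> ('g \<Rightarrow> 'p \<Rightarrow> 'p) \<Rightarrow> bool" where
  "regular_action G V X \<rho> \<longleftrightarrow> group_action G (pts X) \<rho> \<and> morph (fprod V X) X (\<lambda>(g, x). \<rho> g x)"

definition closed_conn_solvable :: "'g monoid \<Rightarrow> ('g, 'k::field) fspace \<Rightarrow> 'g set \<Rightarrow> bool" where
  "closed_conn_solvable G V B \<longleftrightarrow> subgroup B G \<and> closedin (ftop V) B \<and> connectedin (ftop V) B \<and>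
     solvable (G\<lparr>carrier := B\<rparr>)"

definition Borel_subgroup :: "'g monoid \<Rightarrow> ('g, 'k::field) fspace \<Rightarrow> 'g set \<Rightarrow> bool" where
  "Borel_subgroup G V B \<longleftrightarrow> closed_conn_solvable G V B \<and>
     (\<forall>B'. closed_conn_solvable G V B' \<and> B \<subseteq> B' \<longrightarrow> B' = B)"

definition has_open_dense_Borel_orbit ::
  "'g monoid \<Rightarrow> ('g, 'k::field) fspace \<Rightarrow> ('p, 'k) fspace \<Rightarrow> ('g \<Rightarrow> 'p \<Rightarrow> 'p) \<Rightarrow> bool" where
  "has_open_dense_Borel_orbit G V X \<rho> \<longleftrightarrow>
     (\<exists>B. Borel_subgroup G V B \<and>
        (\<exists>x\<in>pts X. openin (ftop X) (orbit (G\<lparr>carrier := B\<rparr>) \<rho> x) \<and>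
           ftop X closure_of orbit (G\<lparr>carrier := B\<rparr>) \<rho> x = pts X))"

text \<open>
  Sphericity for a not necessarily faithful action: a subgroup of \<open>G\<close> and its image in the
  automorphism group of \<open>X\<close> have the same orbits, and the Borel subgroups of the image of \<open>G\<close> are
  the images of those of \<open>G\<close>, so this is sphericity for the (faithfully acting) image of \<open>G\<close>.
\<close>

definition spherical_mod_kernel ::
  "'g monoid \<Rightarrow> ('g, 'k::field) fspace \<Rightarrow> ('p, 'k) fspace \<Rightarrow> ('g \<Rightarrow> 'p \<Rightarrow> 'p) \<Rightarrow> bool" where
  "spherical_mod_kernel G V X \<rho> \<longleftrightarrow> regular_action G V X \<rho> \<and> has_open_dense_Borel_orbit G V X \<rho>"

definition spherical ::
  "'g monoid \<Rightarrow> ('g, 'k::field) fspace \<Rightarrow> ('p, 'k) fspace \<Rightarrow> ('g \<Rightarrow> 'p \<Rightarrow> 'p) \<Rightarrow> bool" where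
  "spherical G V X \<rho> \<longleftrightarrow> faithful_action G (pts X) \<rho> \<and> spherical_mod_kernel G V X \<rho>"

definition mult_grp :: "'k::field monoid" where
  "mult_grp = \<lparr>carrier = - {0}, mult = (*), one = 1\<rparr>"

definition mult_grp_space :: "('k::field, 'k) fspace" where
  "mult_grp_space = frac_space
     {(- {0}, alg_generated (- {0}) {\<lambda>t\<in>- {0}. t, \<lambda>t\<in>- {0}. inverse t})}"

definition characters ::
  "'g monoid \<Rightarrow> ('g, 'k::field) fspace \<Rightarrow> 'g set \<Rightarrow> ('g \<Rightarrow> 'k) set" where
  "characters G V B = {\<omega> \<in> extensional B. \<omega> \<in> hom (G\<lparr>carrier := B\<rparr>) mult_grp \<and>
     morph (induced V B) mult_grp_space \<omega>}"

definition weight_monoid ::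
  "'g monoid \<Rightarrow> ('g, 'k::field) fspace \<Rightarrow> 'g set \<Rightarrow> ('p, 'k) fspace \<Rightarrow> ('g \<Rightarrow> 'p \<Rightarrow> 'p) \<Rightarrow>
     ('g \<Rightarrow> 'k) set" where
  "weight_monoid G V B X \<rho> = {\<omega> \<in> characters G V B.
     \<exists>f\<in>coord_ring X. (\<exists>x\<in>pts X. f x \<noteq> 0) \<and>
       (\<forall>b\<in>B. \<forall>x\<in>pts X. f (\<rho> (inv\<^bsub>G\<^esub> b) x) = \<omega> b * f x)}"


section \<open>Automorphism groups\<close>

definition Aut :: "('p, 'k::field) fspace \<Rightarrow> ('p \<Rightarrow> 'p) monoid" where
  "Aut X = (BijGroup (pts X))\<lparr>carrier := {\<phi> \<in> extensional (pts X). isomorph X X \<phi>}\<rparr>"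

text \<open>\<open>V\<close> is an algebraic group structure on \<open>H\<close> for which \<open>H\<close> acts regularly.\<close>

definition alg_subgroup_of_Aut ::
  "('p, 'k::field) fspace \<Rightarrow> ('p \<Rightarrow> 'p) set \<Rightarrow> ('p \<Rightarrow> 'p, 'k) fspace \<Rightarrow> bool" where
  "alg_subgroup_of_Aut X H V \<longleftrightarrow> subgroup H (Aut X) \<and>
     algebraic_group ((Aut X)\<lparr>carrier := H\<rparr>) V \<and> morph (fprod V X) X (\<lambda>(h, x). h x)"

definition hom_preserves_alg_subgroups ::
  "('p, 'k::field) fspace \<Rightarrow> ('q, 'k) fspace \<Rightarrow> (('p \<Rightarrow> 'p) \<Rightarrow> ('q \<Rightarrow> 'q)) \<Rightarrow> bool" where
  "hom_preserves_alg_subgroups X Y \<theta> \<longleftrightarrow> \<theta> \<in> hom (Aut X) (Aut Y) \<and>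
     (\<forall>H V. alg_subgroup_of_Aut X H V \<longrightarrow>
        (\<exists>W. alg_subgroup_of_Aut Y (\<theta> ` H) W \<and> morph V W \<theta>))"

definition iso_preserves_alg_subgroups ::
  "('p, 'k::field) fspace \<Rightarrow> ('q, 'k) fspace \<Rightarrow> (('p \<Rightarrow> 'p) \<Rightarrow> ('q \<Rightarrow> 'q)) \<Rightarrow> bool" where
  "iso_preserves_alg_subgroups X Y \<theta> \<longleftrightarrow> \<theta> \<in> iso (Aut X) (Aut Y) \<and>
     hom_preserves_alg_subgroups X Y \<theta> \<and>
     hom_preserves_alg_subgroups Y X (inv_into (carrier (Aut X)) \<theta>)"

definition is_lift ::
  "('p, 'k::field) fspace \<Rightarrow> ('p \<Rightarrow> 'q) \<Rightarrow> ('q \<Rightarrow> 'q) \<Rightarrow> ('p \<Rightarrow> 'p) \<Rightarrow> bool" where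
  "is_lift X \<eta> \<phi> \<psi> \<longleftrightarrow> \<psi> \<in> carrier (Aut X) \<and> (\<forall>x\<in>pts X. \<eta> (\<psi> x) = \<phi> (\<eta> x))"

definition lift_aut ::
  "('p, 'k::field) fspace \<Rightarrow> ('p \<Rightarrow> 'q) \<Rightarrow> ('q \<Rightarrow> 'q) \<Rightarrow> ('p \<Rightarrow> 'p)" where
  "lift_aut X \<eta> \<phi> = (THE \<psi>. is_lift X \<eta> \<phi> \<psi>)"


section \<open>Quotients of affine space and their non-normal variants\<close>

text \<open>
  Affine \<open>n\<close>-space is the type \<open>'k ^ 'n\<close> with \<open>n = CARD('n)\<close>. Polynomials are identified with
  polynomial functions, as the ground field is infinite.
\<close>

definition polys :: "('k::field ^ 'n::finite \<Rightarrow> 'k) set" where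
  "polys = alg_generated UNIV (range (\<lambda>i x. x $ i))"

definition homog_polys :: "nat \<Rightarrow> ('k::field ^ 'n::finite \<Rightarrow> 'k) set" where
  "homog_polys m = module.span (\<lambda>c f x. c * f x)
     {\<lambda>x. \<Prod>i\<in>UNIV. x $ i ^ e i |e. sum e UNIV = m}"

definition mu_invariants :: "nat \<Rightarrow> ('k::field ^ 'n::finite \<Rightarrow> 'k) set" where
  "mu_invariants d = {f \<in> polys. \<forall>t. t ^ d = 1 \<longrightarrow> (\<forall>x. f (t *s x) = f x)}"

definition mu_quotient :: "nat \<Rightarrow> (('k::field ^ 'n::finite \<Rightarrow> 'k) \<Rightarrow> 'k, 'k) fspace" where
  "mu_quotient d = Spec UNIV (mu_invariants d)"

definition mu_proj :: "nat \<Rightarrow> 'k::field ^ 'n::finite \<Rightarrow> ('k ^ 'n \<Rightarrow> 'k) \<Rightarrow> 'k" where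
  "mu_proj d x = (\<lambda>f\<in>mu_invariants d. f x)"

definition A_ring :: "nat \<Rightarrow> nat \<Rightarrow> ('k::field ^ 'n::finite \<Rightarrow> 'k) set" where
  "A_ring d s = module.span (\<lambda>c f x. c * f x)
     (range (\<lambda>c x. c) \<union> (\<Union>k\<in>{s..}. homog_polys (k * d)))"

definition A_var :: "nat \<Rightarrow> nat \<Rightarrow> (('k::field ^ 'n::finite \<Rightarrow> 'k) \<Rightarrow> 'k, 'k) fspace" where
  "A_var d s = Spec UNIV (A_ring d s)"

text \<open>
  The morphism of spectra induced by the inclusion of \<open>A_ring d s\<close> into \<open>mu_invariants d\<close>.
\<close>

definition eta_map :: "nat \<Rightarrow> nat \<Rightarrow>
    (('k::field ^ 'n::finite \<Rightarrow> 'k) \<Rightarrow> 'k) \<Rightarrow> (('k ^ 'n \<Rightarrow> 'k) \<Rightarrow> 'k)" where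
  "eta_map d s \<phi> = restrict \<phi> (A_ring d s)"

definition SL_grp :: "('k::field ^ 'n::finite ^ 'n) monoid" where
  "SL_grp = \<lparr>carrier = {M. det M = 1}, mult = (**), one = mat 1\<rparr>"

definition SL_space :: "('k::field ^ 'n::finite ^ 'n, 'k) fspace" where
  "SL_space = frac_space {({M. det M = 1},
     alg_generated {M. det M = 1} {\<lambda>M\<in>{M. det M = 1}. M $ i $ j |i j. True})}"

text \<open>
  The action on the quotient induced by \<open>x \<mapsto> M *v x\<close>; it satisfies
  \<open>SL_action d M (mu_proj d x) = mu_proj d (M *v x)\<close>.
\<close>

definition SL_action :: "nat \<Rightarrow> 'k::field ^ 'n::finite ^ 'n \<Rightarrow>
    (('k ^ 'n \<Rightarrow> 'k) \<Rightarrow> 'k) \<Rightarrow> (('k ^ 'n \<Rightarrow> 'k) \<Rightarrow> 'k)" where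
  "SL_action d M = (\<lambda>\<phi>\<in>pts (mu_quotient d). \<lambda>f\<in>mu_invariants d. \<phi> (\<lambda>x. f (M *v x)))"

end

theory Submission
  imports Defs
begin

text \<open>
  Both varieties are spectra of graded rings \<open>S\<close> of polynomials on \<open>k ^ n\<close> containing all forms of
  the degrees \<open>k d\<close> with \<open>k \<ge> s\<close>. Therefore their points are evaluations at points of \<open>k ^ n\<close>, two of
  which agree for the small ring iff they agree for the ring \<open>R\<close> of all invariants. That a function is
  a polynomial is tested on lines: a quotient of polynomials which is integral over the
  polynomials, or regular, divides out on every line, hence globally. This gives the coordinate
  rings, the normality of \<open>R\<close> and the lifting of automorphisms. The origin is the only singular point
  of the spectrum of \<open>R\<close>, so its automorphisms fix the origin and descend to the small ring; in
  families, they have locally bounded degree and are determined by their values at finitely many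
  points.

  By the Lie-Kolchin theorem the Borel subgroups of \<open>SL\<close> are the conjugates of the upper triangular
  matrices. The last coordinate \<open>l\<close> is a semi-invariant linear form, nonvanishing exactly on the open
  orbit, so every semi-invariant of the weight of \<open>l ^ d\<close> is a multiple of \<open>l ^ d\<close>. It lies in
  \<open>R\<close>, but not in the small ring, which has no forms of degree \<open>d\<close>.
\<close>

section \<open>Spaces with functions\<close>

text \<open>The comparison of the two rings rests on one fact: the product of an invariant with
  \<open>x j ^ (Suc s * d)\<close> lies in the small ring, so off the origin both rings have the
  same fractions. The exponent is positive for every \<open>s\<close>. At the origin no coordinate
  can serve as denominator; hence the appeal to the singularity, which is where
  \<open>n \<ge> 2\<close> and \<open>d \<ge> 2\<close> enter: the forms of degree \<open>d\<close>
  then give more than \<open>n\<close> independent point derivations. In families, the pullback of a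
  function is locally a quotient of sums of products; clearing the denominators that depend on the
  point of the spectrum bounds its degree, because the degrees of factors add up. The Lie-Kolchin
  theorem is proved for vectors modulo a stable subspace \<open>U\<close>, which stands for the
  quotient representation and lets the flag grow one vector at a time.\<close>

lemma subalg_ext: "subalg P A ==> f \<in> A ==> f \<in> extensional P"
 by (auto simp: subalg_def)

lemma subalg_const: "subalg P A ==> (\<lambda>x\<in>P. c) \<in> A"
 by (auto simp: subalg_def)

lemma subalg_add: "subalg P A ==> f \<in> A ==> g \<in> A ==> (\<lambda>x\<in>P. f x + g x) \<in> A"
 by (auto simp: subalg_def)

lemma subalg_mult: "subalg P A ==> f \<in> A ==> g \<in> A ==> (\<lambda>x\<in>P. f x * g x) \<in> A"
 by (auto simp: subalg_def)

lemma subalg_scale: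
 assumes "subalg P A" "f \<in> A" shows "(\<lambda>x\<in>P. c * f x) \<in> A"
proof -
 have "(\<lambda>x\<in>P. (\<lambda>x\<in>P. c) x * f x) = (\<lambda>x\<in>P. c * f x)" by (auto simp: restrict_def)
 thus ?thesis using subalg_mult[OF assms(1) subalg_const[OF assms(1)] assms(2)] by metis
qed

lemma subalg_sum:
 assumes "subalg P A" "!!i. i \<in> I ==> f i \<in> A"
 shows "(\<lambda>x\<in>P. \<Sum>i\<in>I. f i x) \<in> A"
 using assms(2)
proof (induction I rule: infinite_finite_induct)
 case (insert i I)
 have "(\<lambda>x\<in>P. f i x + (\<lambda>x\<in>P. \<Sum>i\<in>I. f i x) x) \<in> A"
  using insert by (intro subalg_add[OF assms(1)]) auto
 moreover have "(\<lambda>x\<in>P. f i x + (\<lambda>x\<in>P. \<Sum>i\<in>I. f i x) x) = (\<lambda>x\<in>P. \<Sum>i\<in>insert i I. f i x)"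
  using insert by (auto simp: restrict_def)
 ultimately show ?case by metis
qed (use subalg_const[OF assms(1)] in auto)

lemma subalg_prod:
 assumes "subalg P A" "!!i. i \<in> I ==> f i \<in> A"
 shows "(\<lambda>x\<in>P. \<Prod>i\<in>I. f i x) \<in> A"
 using assms(2)
proof (induction I rule: infinite_finite_induct)
 case (insert i I)
 have "(\<lambda>x\<in>P. f i x * (\<lambda>x\<in>P. \<Prod>i\<in>I. f i x) x) \<in> A"
  using insert by (intro subalg_mult[OF assms(1)]) auto
 moreover have "(\<lambda>x\<in>P. f i x * (\<lambda>x\<in>P. \<Prod>i\<in>I. f i x) x) = (\<lambda>x\<in>P. \<Prod>i\<in>insert i I. f i x)"
  using insert by (auto simp: restrict_def)
 ultimately show ?case by metis
qed (use subalg_const[OF assms(1)] in auto)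

lemma subalg_power:
 assumes "subalg P A" "f \<in> A" shows "(\<lambda>x\<in>P. f x ^ n) \<in> A"
 using subalg_prod[OF assms(1), of "{..<n}" "\<lambda>_. f"] assms(2) by simp

lemma subalg_alg_generated:
 assumes "F \<subseteq> extensional P" shows "subalg P (alg_generated P F)"
proof -
 have "subalg P (extensional P)" by (auto simp: subalg_def)
 hence "alg_generated P F \<subseteq> extensional P" using assms by (auto simp: alg_generated_def)
 thus ?thesis unfolding subalg_def alg_generated_def by auto
qed

lemma alg_generated_incl: "F \<subseteq> alg_generated P F"
 by (auto simp: alg_generated_def)

lemma alg_generated_least: "subalg P A ==> F \<subseteq> A ==> alg_generated P F \<subseteq> A"
 by (auto simp: alg_generated_def)

lemma alg_generated_induct [consumes 2, case_names const gen add mult]: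
 assumes f: "f \<in> alg_generated P F" and F: "F \<subseteq> extensional P"
  and "!!c. Q (\<lambda>x\<in>P. c)" and "!!f. f \<in> F ==> Q f"
  and "!!f g. f \<in> alg_generated P F ==> g \<in> alg_generated P F ==> Q f ==> Q g ==> Q (\<lambda>x\<in>P. f x + g x)"
  and "!!f g. f \<in> alg_generated P F ==> g \<in> alg_generated P F ==> Q f ==> Q g ==> Q (\<lambda>x\<in>P. f x * g x)"
 shows "Q f"
proof -
 have "subalg P {f \<in> alg_generated P F. Q f}"
  using subalg_alg_generated[OF F] assms(3,5,6) unfolding subalg_def by auto
 moreover have "F \<subseteq> {f \<in> alg_generated P F. Q f}" using assms(4) alg_generated_incl by auto
 ultimately show ?thesis using alg_generated_least f by blast
qed

section \<open>Sheaf properties of regular functions\<close>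

lemma fun_space_subalg: "fun_space X ==> openin (ftop X) U ==> subalg U (freg X U)"
 by (auto simp: fun_space_def)

lemma fun_space_freg_openin: "fun_space X ==> f \<in> freg X U ==> openin (ftop X) U"
 by (auto simp: fun_space_def)

lemma fun_space_freg_ext: "fun_space X ==> f \<in> freg X U ==> f \<in> extensional U"
 using fun_space_subalg fun_space_freg_openin subalg_ext by metis

lemma fun_space_nonzero: "fun_space X ==> f \<in> freg X U ==> openin (ftop X) {x\<in>U. f x ~= 0}"
 by (simp add: fun_space_def)

lemma fun_space_inverse:
 "fun_space X ==> f \<in> freg X U ==> (\<lambda>x\<in>{x\<in>U. f x ~= 0}. inverse (f x)) \<in> freg X {x\<in>U. f x ~= 0}"
 by (simp add: fun_space_def)

lemma fun_space_glue:
 assumes "fun_space X" "!!U. U \<in> \<U> ==> openin (ftop X) U" "f \<in> extensional (\<Union>\<U>)"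
 shows "f \<in> freg X (\<Union>\<U>) \<longleftrightarrow> (\<forall>U\<in>\<U>. restrict f U \<in> freg X U)"
 using assms(2,3) assms(1)[unfolded fun_space_def, THEN conjunct2, THEN conjunct2, THEN conjunct1, rule_format, of \<U> f]
 by metis

lemma fun_space_restrict:
 assumes "fun_space X" "f \<in> freg X U" "openin (ftop X) W" "W \<subseteq> U"
 shows "restrict f W \<in> freg X W"
proof -
 have "\<Union>{U, W} = U" using assms by auto
 thus ?thesis
  using fun_space_glue[OF assms(1), of "{U, W}" f] fun_space_freg_openin[OF assms(1,2)]
   fun_space_freg_ext[OF assms(1,2)] assms by auto
qed

lemma fun_space_local:
 assumes "fun_space X" "h \<in> extensional U"
  and loc: "!!x. x \<in> U ==> \<exists>N. x \<in> N \<and> N \<subseteq> U \<and> restrict h N \<in> freg X N"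
 shows "h \<in> freg X U"
proof -
 let ?\<U> = "{N. N \<subseteq> U \<and> restrict h N \<in> freg X N}"
 have U: "\<Union>?\<U> = U"
 proof (intro equalityI subsetI)
  fix x assume "x \<in> U"
  from loc[OF this] obtain N where N: "x \<in> N" "N \<subseteq> U" "restrict h N \<in> freg X N"
   by (elim exE conjE)
  show "x \<in> \<Union>?\<U>" by (rule UnionI[of N]) (simp_all add: N)
 next
  fix x assume "x \<in> \<Union>?\<U>"
  thus "x \<in> U" by (elim UnionE CollectE conjE) (rule subsetD)
 qed
 have o: "openin (ftop X) N" if "N \<in> ?\<U>" for N
  using that fun_space_freg_openin[OF assms(1), of "restrict h N" N] by simp
 have "h \<in> freg X (\<Union>?\<U>)"
  by (rule fun_space_glue[THEN iffD2, OF assms(1) o]) (simp_all add: U assms(2))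
 thus ?thesis unfolding U .
qed

lemma fun_space_divide:
 assumes X: "fun_space X" and "a \<in> freg X U" "b \<in> freg X U" "!!x. x \<in> U ==> b x ~= 0"
 shows "(\<lambda>x\<in>U. a x / b x) \<in> freg X U"
proof -
 have U: "{x\<in>U. b x ~= 0} = U" using assms(4) by auto
 have "(\<lambda>x\<in>U. a x * (\<lambda>x\<in>U. inverse (b x)) x) \<in> freg X U"
  using fun_space_inverse[OF X assms(3)] fun_space_subalg[OF X fun_space_freg_openin[OF X assms(2)]] assms(2)
  unfolding U by (intro subalg_mult)
 moreover have "(\<lambda>x\<in>U. a x * (\<lambda>x\<in>U. inverse (b x)) x) = (\<lambda>x\<in>U. a x / b x)"
  by (auto simp: restrict_def field_simps)
 ultimately show ?thesis by simp
qed

section \<open>Spaces generated by local quotients\<close>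

lemma freg_frac_space:
 "h \<in> freg (frac_space \<B>) W \<longleftrightarrow> openin (ftop (frac_space \<B>)) W \<and> h \<in> extensional W \<and>
   (\<forall>x\<in>W. \<exists>U F a b N. (U, F) \<in> \<B> \<and> a \<in> F \<and> b \<in> F \<and> openin (ftop (frac_space \<B>)) N \<and>
    x \<in> N \<and> N \<subseteq> W \<and> N \<subseteq> U \<and> (\<forall>y\<in>N. b y ~= 0 \<and> h y = a y / b y))"
 unfolding frac_space_def Let_def by (simp add: split_beta' Bex_def)

lemma freg_frac_spaceE:
 assumes "h \<in> freg (frac_space \<B>) W" "x \<in> W"
 obtains U F a b N where "(U, F) \<in> \<B>" "a \<in> F" "b \<in> F" "openin (ftop (frac_space \<B>)) N"
  "x \<in> N" "N \<subseteq> W" "N \<subseteq> U" "!!y. y \<in> N ==> b y ~= 0 \<and> h y = a y / b y"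
proof -
 obtain U F a b N where *: "(U, F) \<in> \<B>" "a \<in> F" "b \<in> F" "openin (ftop (frac_space \<B>)) N"
  "x \<in> N" "N \<subseteq> W" "N \<subseteq> U" "\<forall>y\<in>N. b y ~= 0 \<and> h y = a y / b y"
  using freg_frac_space[THEN iffD1, OF assms(1), THEN conjunct2, THEN conjunct2, THEN bspec, OF assms(2)]
  by (elim exE conjE)
 show ?thesis by (rule that[OF *(1-7)]) (use *(8) in blast)
qed

lemma openin_frac_space_nonzero:
 "(U, F) \<in> \<B> ==> f \<in> F ==> openin (ftop (frac_space \<B>)) {x\<in>U. f x ~= 0}"
 unfolding frac_space_def Let_def by (auto intro!: topology_generated_by_Basis)

text \<open>The conditions under which the sets \<open>{x \<in> U. f x \<noteq> 0}\<close> form a base of the topology.\<close>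

definition frac_base :: "('p set \<times> ('p => 'k::field) set) set => bool" where
 "frac_base \<B> \<longleftrightarrow> (\<forall>(U, F)\<in>\<B>. subalg U F) \<and>
   (\<forall>(U, F)\<in>\<B>. \<forall>(U', F')\<in>\<B>. \<exists>F''. (U \<inter> U', F'') \<in> \<B> \<and>
    (\<forall>f\<in>F \<union> F'. restrict f (U \<inter> U') \<in> F''))"

lemma frac_baseI:
 assumes "!!i. i \<in> I ==> subalg (U i) (F i)"
  and "!!i j. i \<in> I ==> j \<in> I ==> \<exists>k\<in>I. U k = U i \<inter> U j \<and>
   (\<forall>f\<in>F i \<union> F j. restrict f (U i \<inter> U j) \<in> F k)"
 shows "frac_base {(U i, F i) |i. i \<in> I}"
 unfolding frac_base_def
proof (intro conjI ballI)
 fix p assume "p \<in> {(U i, F i) |i. i \<in> I}"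
 then obtain i where i: "i \<in> I" "p = (U i, F i)" by auto
 thus "case p of (U, F) => subalg U F" using assms(1) by simp
 show "case p of (W, G) => \<forall>(W', G')\<in>{(U i, F i) |i. i \<in> I}. \<exists>G''. (W \<inter> W', G'') \<in> {(U i, F i) |i. i \<in> I} \<and>
    (\<forall>f\<in>G \<union> G'. restrict f (W \<inter> W') \<in> G'')"
  unfolding i(2) prod.case
 proof
  fix q assume "q \<in> {(U i, F i) |i. i \<in> I}"
  then obtain j where j: "j \<in> I" "q = (U j, F j)" by auto
  obtain k where k: "k \<in> I" "U k = U i \<inter> U j" "\<forall>f\<in>F i \<union> F j. restrict f (U i \<inter> U j) \<in> F k"
   using assms(2)[OF i(1) j(1)] by (elim bexE conjE)
  show "case q of (W', G') => \<exists>G''. (U i \<inter> W', G'') \<in> {(U i, F i) |i. i \<in> I} \<and>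
    (\<forall>f\<in>F i \<union> G'. restrict f (U i \<inter> W') \<in> G'')"
   unfolding j(2) prod.case
   by (rule exI[of _ "F k"], rule conjI[OF _ k(3)]) (use k in auto)
 qed
qed

lemma frac_base_subalg: "frac_base \<B> ==> (U, F) \<in> \<B> ==> subalg U F"
 by (auto simp: frac_base_def)

lemma frac_base_Int:
 assumes "frac_base \<B>" "(U, F) \<in> \<B>" "(U', F') \<in> \<B>"
 obtains F'' where "(U \<inter> U', F'') \<in> \<B>" "!!f. f \<in> F \<union> F' ==> restrict f (U \<inter> U') \<in> F''"
 using assms unfolding frac_base_def by fast

lemma frac_base_single: "subalg P F ==> frac_base {(P, F)}"
proof -
 assume *: "subalg P F"
 have "restrict f P = f" if "f \<in> F" for f
  using subalg_ext[OF * that] by (simp add: extensional_restrict)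
 thus ?thesis using * by (auto simp: frac_base_def)
qed

text \<open>On \<open>U \<inter> U'\<close> the product of the restrictions of \<open>u\<close> and
  \<open>u'\<close> is nonzero exactly where both are, and \<open>frac_base\<close> provides an
  algebra containing it. So the generating sets form a base, not only a subbase.\<close>

lemma openin_frac_space:
 assumes "frac_base \<B>"
 shows "openin (ftop (frac_space \<B>)) W \<longleftrightarrow>
  (\<forall>x\<in>W. \<exists>U F u. (U, F) \<in> \<B> \<and> u \<in> F \<and> x \<in> U \<and> u x ~= 0 \<and> {y\<in>U. u y ~= 0} \<subseteq> W)"
  (is "_ \<longleftrightarrow> (\<forall>x\<in>W. ?R W x)")
proof
 assume *: "\<forall>x\<in>W. ?R W x"
 show "openin (ftop (frac_space \<B>)) W"
 proof (subst openin_subopen, intro ballI)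
  fix x assume "x \<in> W"
  from bspec[OF * this] obtain U F u where
   1: "(U, F) \<in> \<B>" "u \<in> F" "x \<in> U" "u x ~= 0" "{y\<in>U. u y ~= 0} \<subseteq> W" by (elim exE conjE)
  show "\<exists>T. openin (ftop (frac_space \<B>)) T \<and> x \<in> T \<and> T \<subseteq> W"
   by (rule exI[of _ "{y\<in>U. u y ~= 0}"])
    (use 1 openin_frac_space_nonzero[OF 1(1,2)] in simp)
 qed
next
 assume "openin (ftop (frac_space \<B>)) W"
 hence "generate_topology_on {{x\<in>U. f x ~= 0} |U F f. (U, F) \<in> \<B> \<and> f \<in> F} W"
  by (simp add: frac_space_def Let_def openin_topology_generated_by_iff)
 thus "\<forall>x\<in>W. ?R W x"
 proof induction
  case (Int A B)
  show ?case
  proof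
   fix x assume x: "x \<in> A \<inter> B"
   from Int.IH(1) x have "?R A x" by simp
   then obtain U F u where 1: "(U, F) \<in> \<B>" "u \<in> F" "x \<in> U" "u x ~= 0" "{y\<in>U. u y ~= 0} \<subseteq> A"
    by (elim exE conjE)
   from Int.IH(2) x have "?R B x" by simp
   then obtain U' F' u' where
    2: "(U', F') \<in> \<B>" "u' \<in> F'" "x \<in> U'" "u' x ~= 0" "{y\<in>U'. u' y ~= 0} \<subseteq> B"
    by (elim exE conjE)
   obtain F'' where 3: "(U \<inter> U', F'') \<in> \<B>" "!!f. f \<in> F \<union> F' ==> restrict f (U \<inter> U') \<in> F''"
    using frac_base_Int[OF assms 1(1) 2(1)] by metis
   have m: "(\<lambda>y\<in>U \<inter> U'. restrict u (U \<inter> U') y * restrict u' (U \<inter> U') y) \<in> F''"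
    using subalg_mult[OF frac_base_subalg[OF assms 3(1)] 3(2)[of u] 3(2)[of u']] 1(2) 2(2) by simp
   show "?R (A \<inter> B) x"
    by (intro exI[of _ "U \<inter> U'"] exI[of _ F'']
      exI[of _ "\<lambda>y\<in>U \<inter> U'. restrict u (U \<inter> U') y * restrict u' (U \<inter> U') y"] conjI 3(1) m)
     (use 1 2 in auto)
  qed
 next
  case (UN K)
  show ?case
  proof
   fix x assume "x \<in> \<Union>K"
   then obtain k where k: "k \<in> K" "x \<in> k" by auto
   from bspec[OF UN.IH[OF k(1)] k(2)] obtain U F u where
    1: "(U, F) \<in> \<B>" "u \<in> F" "x \<in> U" "u x ~= 0" "{y\<in>U. u y ~= 0} \<subseteq> k" by (elim exE conjE)
   show "?R (\<Union>K) x"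
    by (intro exI[of _ U] exI[of _ F] exI[of _ u] conjI 1) (use 1(5) k(1) in auto)
  qed
 next
  case (Basis S)
  then obtain U F f where 1: "S = {x\<in>U. f x ~= 0}" "(U, F) \<in> \<B>" "f \<in> F" by auto
  show ?case
  proof
   fix x assume "x \<in> S"
   thus "?R S x" using 1 by (intro exI[of _ U] exI[of _ F] exI[of _ f]) simp
  qed
 qed simp
qed

lemma openin_frac_spaceE:
 assumes "frac_base \<B>" "openin (ftop (frac_space \<B>)) W" "x \<in> W"
 obtains U F u where "(U, F) \<in> \<B>" "u \<in> F" "x \<in> U" "u x ~= 0" "{y\<in>U. u y ~= 0} \<subseteq> W"
 using bspec[OF openin_frac_space[THEN iffD1, OF assms(1,2)] assms(3)] by (elim exE conjE)

lemma pts_frac_space: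
 assumes "frac_base \<B>" shows "pts (frac_space \<B>) = \<Union>(fst ` \<B>)"
proof (rule subset_antisym)
 show "pts (frac_space \<B>) \<subseteq> \<Union>(fst ` \<B>)"
 proof
  fix x assume "x \<in> pts (frac_space \<B>)"
  from openin_frac_spaceE[OF assms openin_topspace this] obtain U F where "(U, F) \<in> \<B>" "x \<in> U" by metis
  thus "x \<in> \<Union>(fst ` \<B>)" by (metis UN_I fst_conv)
 qed
 show "\<Union>(fst ` \<B>) \<subseteq> pts (frac_space \<B>)"
 proof (intro UN_least)
  fix p assume p: "p \<in> \<B>"
  hence *: "(fst p, snd p) \<in> \<B>" by simp
  show "fst p \<subseteq> pts (frac_space \<B>)"
   using openin_subset[OF openin_frac_space_nonzero[OF * subalg_const[OF frac_base_subalg[OF assms *], of 1]]]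
   by auto
 qed
qed

lemma openin_frac_space_base:
 fixes \<B> :: "('p set \<times> ('p => 'k::field) set) set"
 assumes "frac_base \<B>" "(U, F) \<in> \<B>" shows "openin (ftop (frac_space \<B>)) U"
proof -
 have "{x \<in> U. (\<lambda>x\<in>U. 1::'k) x ~= 0} = U" by auto
 thus ?thesis
  using openin_frac_space_nonzero[OF assms(2) subalg_const[OF frac_base_subalg[OF assms], of 1]] by simp
qed

text \<open>Multiplying numerator and denominator by some \<open>u\<close> whose nonvanishing set
  lies in the given neighbourhood makes the nonvanishing set of the denominator itself the
  neighbourhood.\<close>

lemma freg_frac_space_base:
 assumes "frac_base \<B>"
 shows "h \<in> freg (frac_space \<B>) W \<longleftrightarrow> openin (ftop (frac_space \<B>)) W \<and> h \<in> extensional W \<and>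
   (\<forall>x\<in>W. \<exists>U F a b. (U, F) \<in> \<B> \<and> a \<in> F \<and> b \<in> F \<and> x \<in> U \<and> b x ~= 0 \<and>
    (\<forall>y\<in>U. b y ~= 0 --> y \<in> W \<and> h y = a y / b y))" (is "_ \<longleftrightarrow> ?R")
proof
 assume h: "h \<in> freg (frac_space \<B>) W"
 show ?R
 proof (intro conjI ballI)
  fix x assume "x \<in> W"
  obtain U F a b N where 1: "(U, F) \<in> \<B>" "a \<in> F" "b \<in> F" "openin (ftop (frac_space \<B>)) N"
    "x \<in> N" "N \<subseteq> W" "N \<subseteq> U" "!!y. y \<in> N ==> b y ~= 0 \<and> h y = a y / b y"
   using freg_frac_spaceE[OF h \<open>x \<in> W\<close>] by metis
  obtain U' F' u where 2: "(U', F') \<in> \<B>" "u \<in> F'" "x \<in> U'" "u x ~= 0" "{y\<in>U'. u y ~= 0} \<subseteq> N"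
   by (rule openin_frac_spaceE[OF assms 1(4,5)])
  obtain F'' where 3: "(U \<inter> U', F'') \<in> \<B>" "!!f. f \<in> F \<union> F' ==> restrict f (U \<inter> U') \<in> F''"
   using frac_base_Int[OF assms 1(1) 2(1)] by metis
  have m: "(\<lambda>y\<in>U \<inter> U'. restrict f (U \<inter> U') y * restrict u (U \<inter> U') y) \<in> F''" if "f \<in> F" for f
   using subalg_mult[OF frac_base_subalg[OF assms 3(1)] 3(2)[of f] 3(2)[of u]] that 2(2) by simp
  show "\<exists>U F a b. (U, F) \<in> \<B> \<and> a \<in> F \<and> b \<in> F \<and> x \<in> U \<and> b x ~= 0 \<and>
    (\<forall>y\<in>U. b y ~= 0 --> y \<in> W \<and> h y = a y / b y)"
   using 3(1) m[OF 1(2)] m[OF 1(3)] 1(5-8) 2(3-5)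
   apply -
    apply (rule exI[of _ "U \<inter> U'"], rule exI[of _ F''],
     rule exI[of _ "\<lambda>y\<in>U \<inter> U'. restrict a (U \<inter> U') y * restrict u (U \<inter> U') y"],
     rule exI[of _ "\<lambda>y\<in>U \<inter> U'. restrict b (U \<inter> U') y * restrict u (U \<inter> U') y"])
    by auto
 qed (use h in "auto simp: freg_frac_space")
next
 assume *: ?R
 show "h \<in> freg (frac_space \<B>) W"
  unfolding freg_frac_space
 proof (intro conjI ballI)
  fix x assume "x \<in> W"
  with * have "\<exists>U F a b. (U, F) \<in> \<B> \<and> a \<in> F \<and> b \<in> F \<and> x \<in> U \<and> b x ~= 0 \<and>
    (\<forall>y\<in>U. b y ~= 0 --> y \<in> W \<and> h y = a y / b y)" by simp
  then obtain U F a b where "(U, F) \<in> \<B>" "a \<in> F" "b \<in> F" "x \<in> U" "b x ~= 0"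
    "\<forall>y\<in>U. b y ~= 0 --> y \<in> W \<and> h y = a y / b y" by (elim exE conjE)
  thus "\<exists>U F a b N. (U, F) \<in> \<B> \<and> a \<in> F \<and> b \<in> F \<and> openin (ftop (frac_space \<B>)) N \<and>
    x \<in> N \<and> N \<subseteq> W \<and> N \<subseteq> U \<and> (\<forall>y\<in>N. b y ~= 0 \<and> h y = a y / b y)"
   using openin_frac_space_nonzero[of U F \<B> b]
   apply -
    apply (rule exI[of _ U], rule exI[of _ F], rule exI[of _ a], rule exI[of _ b],
     rule exI[of _ "{y\<in>U. b y ~= 0}"])
    by auto
 qed (use * in auto)
qed

lemma freg_frac_space_incl:
 assumes "frac_base \<B>" "(U, F) \<in> \<B>" "f \<in> F" shows "f \<in> freg (frac_space \<B>) U"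
 unfolding freg_frac_space_base[OF assms(1)]
proof (intro conjI ballI)
 show "f \<in> extensional U" using subalg_ext frac_base_subalg assms by metis
 fix x assume "x \<in> U"
 thus "\<exists>U' F a b. (U', F) \<in> \<B> \<and> a \<in> F \<and> b \<in> F \<and> x \<in> U' \<and> b x ~= 0 \<and>
    (\<forall>y\<in>U'. b y ~= 0 --> y \<in> U \<and> f y = a y / b y)"
  using subalg_const[OF frac_base_subalg[OF assms(1,2)], of 1] assms
  apply -
    apply (rule exI[of _ U], rule exI[of _ F], rule exI[of _ f],
     rule exI[of _ "\<lambda>x\<in>U. 1"])
    by auto
qed (use openin_frac_space_base assms in auto)

lemma fun_space_frac_space:
 assumes B: "frac_base \<B>" shows "fun_space (frac_space \<B>)"
proof -
 let ?T = "ftop (frac_space \<B>)" and ?r = "freg (frac_space \<B>)"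
 have 1: "?r U = {}" if "\<not> openin ?T U" for U
  using that by (simp add: set_eq_iff freg_frac_space)
 \<comment> \<open>Two functions get their numerators and denominators in one algebra, over
   \<open>U \<inter> U'\<close>, where sums and products of the quotients can be formed.\<close>
 have common: "\<exists>U F a b a' b' N. (U, F) \<in> \<B> \<and> a \<in> F \<and> b \<in> F \<and> a' \<in> F \<and> b' \<in> F \<and> openin ?T N \<and>
    x \<in> N \<and> N \<subseteq> W \<and> N \<subseteq> U \<and> (\<forall>y\<in>N. b y ~= 0 \<and> h y = a y / b y \<and> b' y ~= 0 \<and> h' y = a' y / b' y)"
  if h: "h \<in> ?r W" "h' \<in> ?r W" and x: "x \<in> W" for h h' W x
 proof -
  obtain U F a b N where 1: "(U, F) \<in> \<B>" "a \<in> F" "b \<in> F" "openin ?T N"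
    "x \<in> N" "N \<subseteq> W" "N \<subseteq> U" "!!y. y \<in> N ==> b y ~= 0 \<and> h y = a y / b y"
   using freg_frac_spaceE[OF h(1) x] by metis
  obtain U' F' a' b' N' where 2: "(U', F') \<in> \<B>" "a' \<in> F'" "b' \<in> F'" "openin ?T N'"
    "x \<in> N'" "N' \<subseteq> W" "N' \<subseteq> U'" "!!y. y \<in> N' ==> b' y ~= 0 \<and> h' y = a' y / b' y"
   using freg_frac_spaceE[OF h(2) x] by metis
  obtain F'' where 3: "(U \<inter> U', F'') \<in> \<B>" "!!f. f \<in> F \<union> F' ==> restrict f (U \<inter> U') \<in> F''"
   using frac_base_Int[OF B 1(1) 2(1)] by metis
  have o: "openin ?T (N \<inter> N')" using 1(4) 2(4) by (rule openin_Int)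
  show ?thesis
  proof (rule exI[of _ "U \<inter> U'"], rule exI[of _ F''], rule exI[of _ "restrict a (U \<inter> U')"],
     rule exI[of _ "restrict b (U \<inter> U')"], rule exI[of _ "restrict a' (U \<inter> U')"],
     rule exI[of _ "restrict b' (U \<inter> U')"], rule exI[of _ "N \<inter> N'"], intro conjI ballI 3 o)
   show "x \<in> N \<inter> N'" "N \<inter> N' \<subseteq> W" "N \<inter> N' \<subseteq> U \<inter> U'" using 1(5-7) 2(5-7) by auto
   fix y assume y: "y \<in> N \<inter> N'"
   hence "y \<in> U" "y \<in> U'" using 1(7) 2(7) by auto
   thus "restrict b (U \<inter> U') y ~= 0" "restrict b' (U \<inter> U') y ~= 0"
    "h y = restrict a (U \<inter> U') y / restrict b (U \<inter> U') y"
    "h' y = restrict a' (U \<inter> U') y / restrict b' (U \<inter> U') y"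
    using 1(8)[of y] 2(8)[of y] y by simp_all
  qed (use 1(2,3) 2(2,3) in simp_all)
 qed
 have 2: "subalg W (?r W)" if W: "openin ?T W" for W
  unfolding subalg_def
 proof (intro conjI ballI allI)
  show "?r W \<subseteq> extensional W" by (auto simp: freg_frac_space)
  fix c
  show "(\<lambda>x\<in>W. c) \<in> ?r W"
   unfolding freg_frac_space
  proof (intro conjI ballI)
   fix x assume "x \<in> W"
   hence "x \<in> \<Union>(fst ` \<B>)" using openin_subset[OF W] pts_frac_space[OF B] by blast
   then obtain p where p: "p \<in> \<B>" "x \<in> fst p" by blast
   obtain U F where "p = (U, F)" by (cases p)
   with p have U: "(U, F) \<in> \<B>" "x \<in> U" by simp_all
   thus "\<exists>U F a b N. (U, F) \<in> \<B> \<and> a \<in> F \<and> b \<in> F \<and> openin ?T N \<and>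
    x \<in> N \<and> N \<subseteq> W \<and> N \<subseteq> U \<and> (\<forall>y\<in>N. b y ~= 0 \<and> (\<lambda>x\<in>W. c) y = a y / b y)"
    using subalg_const[OF frac_base_subalg[OF B U(1)]] W openin_frac_space_base[OF B U(1)] \<open>x \<in> W\<close>
    apply -
    apply (rule exI[of _ U], rule exI[of _ F],
     rule exI[of _ "\<lambda>x\<in>U. c"],
     rule exI[of _ "\<lambda>x\<in>U. 1"],
     rule exI[of _ "U \<inter> W"])
    by (auto simp: openin_Int)
  qed (use W in auto)
 next
  fix h h' assume h: "h \<in> ?r W" "h' \<in> ?r W"
  show "(\<lambda>x\<in>W. h x + h' x) \<in> ?r W"
   unfolding freg_frac_space
  proof (intro conjI ballI)
   fix x assume x: "x \<in> W"
   obtain U F a b a' b' N where *: "(U, F) \<in> \<B>" "a \<in> F" "b \<in> F" "a' \<in> F" "b' \<in> F" "openin ?T N"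
    "x \<in> N" "N \<subseteq> W" "N \<subseteq> U" "!!y. y \<in> N ==> b y ~= 0 \<and> h y = a y / b y \<and> b' y ~= 0 \<and> h' y = a' y / b' y"
    by (rule exE[OF common[OF h x]], elim exE conjE) metis
   note A = frac_base_subalg[OF B *(1)]
   have "(\<lambda>x\<in>U. (\<lambda>x\<in>U. a x * b' x) x + (\<lambda>x\<in>U. a' x * b x) x) \<in> F" "(\<lambda>x\<in>U. b x * b' x) \<in> F"
    by (rule subalg_add[OF A subalg_mult[OF A *(2,5)] subalg_mult[OF A *(4,3)]],
      rule subalg_mult[OF A *(3,5)])
   thus "\<exists>U F a b N. (U, F) \<in> \<B> \<and> a \<in> F \<and> b \<in> F \<and> openin ?T N \<and>
    x \<in> N \<and> N \<subseteq> W \<and> N \<subseteq> U \<and> (\<forall>y\<in>N. b y ~= 0 \<and> (\<lambda>x\<in>W. h x + h' x) y = a y / b y)"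
    using *
    apply -
    apply (rule exI[of _ U], rule exI[of _ F],
     rule exI[of _ "\<lambda>x\<in>U. (\<lambda>x\<in>U. a x * b' x) x + (\<lambda>x\<in>U. a' x * b x) x"],
     rule exI[of _ "\<lambda>x\<in>U. b x * b' x"], rule exI[of _ N])
    by (auto simp: add_frac_eq subset_iff)
  qed (use W in auto)
  show "(\<lambda>x\<in>W. h x * h' x) \<in> ?r W"
   unfolding freg_frac_space
  proof (intro conjI ballI)
   fix x assume x: "x \<in> W"
   obtain U F a b a' b' N where *: "(U, F) \<in> \<B>" "a \<in> F" "b \<in> F" "a' \<in> F" "b' \<in> F" "openin ?T N"
    "x \<in> N" "N \<subseteq> W" "N \<subseteq> U" "!!y. y \<in> N ==> b y ~= 0 \<and> h y = a y / b y \<and> b' y ~= 0 \<and> h' y = a' y / b' y"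
    by (rule exE[OF common[OF h x]], elim exE conjE) metis
   note A = frac_base_subalg[OF B *(1)]
   have "(\<lambda>x\<in>U. a x * a' x) \<in> F" "(\<lambda>x\<in>U. b x * b' x) \<in> F"
    using * by (auto intro!: subalg_mult[OF A])
   thus "\<exists>U F a b N. (U, F) \<in> \<B> \<and> a \<in> F \<and> b \<in> F \<and> openin ?T N \<and>
    x \<in> N \<and> N \<subseteq> W \<and> N \<subseteq> U \<and> (\<forall>y\<in>N. b y ~= 0 \<and> (\<lambda>x\<in>W. h x * h' x) y = a y / b y)"
    using *
    apply -
    apply (rule exI[of _ U], rule exI[of _ F],
     rule exI[of _ "\<lambda>x\<in>U. a x * a' x"],
     rule exI[of _ "\<lambda>x\<in>U. b x * b' x"], rule exI[of _ N])
    by (auto simp: subset_iff)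
  qed (use W in auto)
 qed
 have 3: "f \<in> ?r (\<Union>\<U>) \<longleftrightarrow> (\<forall>U\<in>\<U>. restrict f U \<in> ?r U)"
  if U: "\<forall>U\<in>\<U>. openin ?T U" and f: "f \<in> extensional (\<Union>\<U>)" for \<U> f
 proof
  assume *: "f \<in> ?r (\<Union>\<U>)"
  show "\<forall>U\<in>\<U>. restrict f U \<in> ?r U"
  proof
   fix W assume W: "W \<in> \<U>"
   show "restrict f W \<in> ?r W"
    unfolding freg_frac_space
   proof (intro conjI ballI)
    fix x assume x: "x \<in> W"
    hence xU: "x \<in> \<Union>\<U>" using W by auto
    obtain U F a b N where 1: "(U, F) \<in> \<B>" "a \<in> F" "b \<in> F" "openin ?T N"
     "x \<in> N" "N \<subseteq> \<Union>\<U>" "N \<subseteq> U" "!!y. y \<in> N ==> b y ~= 0 \<and> f y = a y / b y"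
     using freg_frac_spaceE[OF * xU] by metis
    show "\<exists>U F a b N. (U, F) \<in> \<B> \<and> a \<in> F \<and> b \<in> F \<and> openin ?T N \<and>
     x \<in> N \<and> N \<subseteq> W \<and> N \<subseteq> U \<and> (\<forall>y\<in>N. b y ~= 0 \<and> restrict f W y = a y / b y)"
     using U W x 1
     apply -
    apply (rule exI[of _ U], rule exI[of _ F], rule exI[of _ a], rule exI[of _ b],
     rule exI[of _ "N \<inter> W"])
    by (auto simp: openin_Int)
   qed (use U W in auto)
  qed
 next
  assume *: "\<forall>U\<in>\<U>. restrict f U \<in> ?r U"
  show "f \<in> ?r (\<Union>\<U>)"
   unfolding freg_frac_space
  proof (intro conjI ballI)
   fix x assume "x \<in> \<Union>\<U>"
   then obtain W where W: "W \<in> \<U>" "x \<in> W" by auto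
   have fW: "restrict f W \<in> ?r W" using * W by blast
   obtain U F a b N where 1: "(U, F) \<in> \<B>" "a \<in> F" "b \<in> F" "openin ?T N"
     "x \<in> N" "N \<subseteq> W" "N \<subseteq> U" "!!y. y \<in> N ==> b y ~= 0 \<and> restrict f W y = a y / b y"
    using freg_frac_spaceE[OF fW W(2)] by metis
   moreover have "f y = a y / b y" if "y \<in> N" for y using 1(8)[OF that] 1(6) that by auto
   ultimately show "\<exists>U F a b N. (U, F) \<in> \<B> \<and> a \<in> F \<and> b \<in> F \<and> openin ?T N \<and>
     x \<in> N \<and> N \<subseteq> \<Union>\<U> \<and> N \<subseteq> U \<and> (\<forall>y\<in>N. b y ~= 0 \<and> f y = a y / b y)"
    using W apply -
    apply (rule exI[of _ U], rule exI[of _ F], rule exI[of _ a], rule exI[of _ b], rule exI[of _ N])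
    by auto
  qed (use U f in auto)
 qed
 have 4: "openin ?T {x\<in>W. f x ~= 0}" if f: "f \<in> ?r W" for f W
 proof (subst openin_subopen, intro ballI)
  fix x assume x: "x \<in> {x\<in>W. f x ~= 0}"
  hence xW: "x \<in> W" by simp
  obtain U F a b N where 1: "(U, F) \<in> \<B>" "a \<in> F" "b \<in> F" "openin ?T N"
     "x \<in> N" "N \<subseteq> W" "N \<subseteq> U" "!!y. y \<in> N ==> b y ~= 0 \<and> f y = a y / b y"
   using freg_frac_spaceE[OF f xW] by metis
  have "openin ?T (N \<inter> {x\<in>U. a x ~= 0})"
   using 1 openin_frac_space_nonzero by (intro openin_Int) auto
  thus "\<exists>T. openin ?T T \<and> x \<in> T \<and> T \<subseteq> {x\<in>W. f x ~= 0}"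
   using 1 x apply -
    apply (rule exI[of _ "N \<inter> {x\<in>U. a x ~= 0}"])
    by auto
 qed
 have 5: "(\<lambda>x\<in>{x\<in>W. f x ~= 0}. inverse (f x)) \<in> ?r {x\<in>W. f x ~= 0}" if f: "f \<in> ?r W" for f W
  unfolding freg_frac_space
 proof (intro conjI ballI)
  fix x assume x: "x \<in> {x\<in>W. f x ~= 0}"
  hence xW: "x \<in> W" by simp
  obtain U F a b N where 1: "(U, F) \<in> \<B>" "a \<in> F" "b \<in> F" "openin ?T N"
     "x \<in> N" "N \<subseteq> W" "N \<subseteq> U" "!!y. y \<in> N ==> b y ~= 0 \<and> f y = a y / b y"
   using freg_frac_spaceE[OF f xW] by metis
  show "\<exists>U F a b N. (U, F) \<in> \<B> \<and> a \<in> F \<and> b \<in> F \<and> openin ?T N \<and>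
     x \<in> N \<and> N \<subseteq> {x\<in>W. f x ~= 0} \<and> N \<subseteq> U \<and>
     (\<forall>y\<in>N. b y ~= 0 \<and> (\<lambda>x\<in>{x\<in>W. f x ~= 0}. inverse (f x)) y = a y / b y)"
   using x 1 openin_Int[OF 1(4) openin_frac_space_nonzero[OF 1(1,2)]]
   apply -
    apply (rule exI[of _ U], rule exI[of _ F], rule exI[of _ b], rule exI[of _ a],
     rule exI[of _ "N \<inter> {x\<in>U. a x ~= 0}"])
    by auto
 qed (use 4[OF f] in auto)
 show ?thesis
  unfolding fun_space_def
 proof (intro conjI allI impI ballI)
 qed (use 1 2 3 4 5 in auto)
qed

section \<open>Morphisms\<close>

lemma morph_freg:
 "morph X Y \<phi> ==> f \<in> freg Y V ==> openin (ftop Y) V ==>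
  (\<lambda>x\<in>{x\<in>pts X. \<phi> x \<in> V}. f (\<phi> x)) \<in> freg X {x\<in>pts X. \<phi> x \<in> V}"
 by (auto simp: morph_def)

lemma morph_funcset: "morph X Y \<phi> ==> x \<in> pts X ==> \<phi> x \<in> pts Y"
 by (auto simp: morph_def continuous_map_def)

lemma morph_coord_ring:
 assumes "morph X Y \<phi>" "f \<in> coord_ring Y"
 shows "(\<lambda>x\<in>pts X. f (\<phi> x)) \<in> coord_ring X"
proof -
 have "{x\<in>pts X. \<phi> x \<in> pts Y} = pts X" using morph_funcset[OF assms(1)] by auto
 thus ?thesis using morph_freg[OF assms openin_topspace] by simp
qed

lemma morph_preimage: "morph X Y \<phi> ==> openin (ftop Y) V ==> openin (ftop X) {x\<in>pts X. \<phi> x \<in> V}"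
 by (auto simp: morph_def continuous_map_def)

lemma morph_cong:
 fixes X :: "('p, 'k::field) fspace" and Y :: "('q, 'k) fspace"
 assumes "!!x. x \<in> pts X ==> \<phi> x = \<psi> x" "morph X Y \<phi>" shows "morph X Y \<psi>"
proof -
 have *: "{x\<in>pts X. \<phi> x \<in> V} = {x\<in>pts X. \<psi> x \<in> V}" for V using assms(1) by auto
 have "(\<lambda>x\<in>{x\<in>pts X. \<phi> x \<in> V}. f (\<phi> x)) = (\<lambda>x\<in>{x\<in>pts X. \<psi> x \<in> V}. f (\<psi> x))" for f :: "'q => 'k" and V
  unfolding * using assms(1) by (auto simp: restrict_def)
 moreover have "continuous_map (ftop X) (ftop Y) \<psi>"
  using assms by (intro continuous_map_eq[of "ftop X" "ftop Y" \<phi> \<psi>]) (simp_all add: morph_def)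
 ultimately show ?thesis using assms(2) unfolding morph_def by (simp add: *)
qed

lemma morph_compose:
 assumes "morph X Y \<phi>" "morph Y Z \<psi>" shows "morph X Z (\<lambda>x. \<psi> (\<phi> x))"
 unfolding morph_def
proof (intro conjI allI impI)
 show "continuous_map (ftop X) (ftop Z) (\<lambda>x. \<psi> (\<phi> x))"
  using assms continuous_map_compose[of "ftop X" "ftop Y" \<phi> "ftop Z" \<psi>] by (auto simp: morph_def o_def)
 fix V f assume f: "openin (ftop Z) V \<and> f \<in> freg Z V"
 have e: "{x\<in>pts X. \<phi> x \<in> {y\<in>pts Y. \<psi> y \<in> V}} = {x\<in>pts X. \<psi> (\<phi> x) \<in> V}"
  using morph_funcset[OF assms(1)] by auto
 have "(\<lambda>x\<in>{x\<in>pts X. \<phi> x \<in> {y\<in>pts Y. \<psi> y \<in> V}}. (\<lambda>y\<in>{y\<in>pts Y. \<psi> y \<in> V}. f (\<psi> y)) (\<phi> x))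
   = (\<lambda>x\<in>{x\<in>pts X. \<psi> (\<phi> x) \<in> V}. f (\<psi> (\<phi> x)))"
  unfolding e using morph_funcset[OF assms(1)] by (auto simp: restrict_def)
 thus "(\<lambda>x\<in>{x\<in>pts X. \<psi> (\<phi> x) \<in> V}. f (\<psi> (\<phi> x))) \<in> freg X {x\<in>pts X. \<psi> (\<phi> x) \<in> V}"
  using morph_freg[OF assms(1) morph_freg[OF assms(2)], of f V] morph_preimage[OF assms(2)] f
  unfolding e by metis
qed

text \<open>Only the generating functions have to be pulled back: the preimages of the generating
  open sets are nonvanishing sets of pullbacks, and locally a regular function pulls back to a
  quotient of two pullbacks.\<close>

lemma morph_into_frac:
 assumes X: "fun_space X" and fs: "!!x. x \<in> pts X ==> \<phi> x \<in> pts (frac_space \<B>)"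
  and reg: "!!U F f. (U, F) \<in> \<B> ==> f \<in> F ==>
    (\<lambda>x\<in>{x\<in>pts X. \<phi> x \<in> U}. f (\<phi> x)) \<in> freg X {x\<in>pts X. \<phi> x \<in> U}"
 shows "morph X (frac_space \<B>) \<phi>"
proof -
 have cont: "continuous_map (ftop X) (ftop (frac_space \<B>)) \<phi>"
  unfolding frac_space_def Let_def fspace.select_convs
 proof (rule continuous_on_generated_topo)
  fix W assume "W \<in> {{x\<in>U. f x ~= 0} |U F f. (U, F) \<in> \<B> \<and> f \<in> F}"
  then obtain U F f where W: "W = {x\<in>U. f x ~= 0}" "(U, F) \<in> \<B>" "f \<in> F" by auto
  have "openin (ftop X) {x \<in> {x\<in>pts X. \<phi> x \<in> U}. (\<lambda>x\<in>{x\<in>pts X. \<phi> x \<in> U}. f (\<phi> x)) x ~= 0}"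
   by (rule fun_space_nonzero[OF X reg[OF W(2,3)]])
  also have "{x \<in> {x\<in>pts X. \<phi> x \<in> U}. (\<lambda>x\<in>{x\<in>pts X. \<phi> x \<in> U}. f (\<phi> x)) x ~= 0} = \<phi> -` W \<inter> topspace (ftop X)"
   unfolding W by auto
  finally show "openin (ftop X) (\<phi> -` W \<inter> topspace (ftop X))" .
 next
  show "\<phi> ` topspace (ftop X) \<subseteq> \<Union>{{x\<in>U. f x ~= 0} |U F f. (U, F) \<in> \<B> \<and> f \<in> F}"
   using fs by (auto simp: frac_space_def Let_def)
 qed
 show ?thesis
  unfolding morph_def
 proof (intro conjI allI impI cont)
  fix V h assume h: "openin (ftop (frac_space \<B>)) V \<and> h \<in> freg (frac_space \<B>) V"
  show "(\<lambda>x\<in>{x\<in>pts X. \<phi> x \<in> V}. h (\<phi> x)) \<in> freg X {x\<in>pts X. \<phi> x \<in> V}"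
  proof (rule fun_space_local[OF X])
   fix x assume x: "x \<in> {x\<in>pts X. \<phi> x \<in> V}"
   hence hV: "h \<in> freg (frac_space \<B>) V" "\<phi> x \<in> V" using h by auto
   obtain U F a b N where 1: "(U, F) \<in> \<B>" "a \<in> F" "b \<in> F" "openin (ftop (frac_space \<B>)) N"
     "\<phi> x \<in> N" "N \<subseteq> V" "N \<subseteq> U" "!!y. y \<in> N ==> b y ~= 0 \<and> h y = a y / b y"
    using freg_frac_spaceE[OF hV] by metis
   define M where "M = {x\<in>pts X. \<phi> x \<in> N}"
   have M: "openin (ftop X) M" using 1(4) cont by (auto simp: M_def continuous_map_def)
   have r: "restrict (\<lambda>x\<in>{x\<in>pts X. \<phi> x \<in> U}. f (\<phi> x)) M \<in> freg X M" if "f \<in> F" for f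
    using fun_space_restrict[OF X reg[OF 1(1) that] M] 1(7) by (auto simp: M_def)
   have "(\<lambda>x\<in>M. restrict (\<lambda>x\<in>{x\<in>pts X. \<phi> x \<in> U}. a (\<phi> x)) M x / restrict (\<lambda>x\<in>{x\<in>pts X. \<phi> x \<in> U}. b (\<phi> x)) M x)
     \<in> freg X M"
    using 1 by (intro fun_space_divide[OF X] r) (auto simp: M_def)
   also have "(\<lambda>x\<in>M. restrict (\<lambda>x\<in>{x\<in>pts X. \<phi> x \<in> U}. a (\<phi> x)) M x / restrict (\<lambda>x\<in>{x\<in>pts X. \<phi> x \<in> U}. b (\<phi> x)) M x)
     = restrict (\<lambda>x\<in>{x\<in>pts X. \<phi> x \<in> V}. h (\<phi> x)) M"
    using 1(6-8) unfolding M_def restrict_def by (intro ext) auto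
   finally have "restrict (\<lambda>x\<in>{x\<in>pts X. \<phi> x \<in> V}. h (\<phi> x)) M \<in> freg X M" .
   moreover have "x \<in> M" "M \<subseteq> {x\<in>pts X. \<phi> x \<in> V}" using x 1(5,6) by (auto simp: M_def)
   ultimately show "\<exists>N. x \<in> N \<and> N \<subseteq> {x\<in>pts X. \<phi> x \<in> V} \<and>
     restrict (\<lambda>x\<in>{x\<in>pts X. \<phi> x \<in> V}. h (\<phi> x)) N \<in> freg X N"
    by (intro exI conjI)
  qed auto
 qed
qed

lemma morph_into_single:
 assumes X: "fun_space X" and F: "subalg P F" and fs: "!!x. x \<in> pts X ==> \<phi> x \<in> P"
  and reg: "!!f. f \<in> F ==> (\<lambda>x\<in>pts X. f (\<phi> x)) \<in> coord_ring X"
 shows "morph X (frac_space {(P, F)}) \<phi>"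
proof (rule morph_into_frac[OF X])
 have *: "{x\<in>pts X. \<phi> x \<in> P} = pts X" using fs by auto
 show "\<phi> x \<in> pts (frac_space {(P, F)})" if "x \<in> pts X" for x
  using fs[OF that] pts_frac_space[OF frac_base_single[OF F]] by simp
 fix U F' f assume "(U, F') \<in> {(P, F)}" "f \<in> F'"
 thus "(\<lambda>x\<in>{x \<in> pts X. \<phi> x \<in> U}. f (\<phi> x)) \<in> freg X {x \<in> pts X. \<phi> x \<in> U}"
  using reg * by auto
qed

lemma morph_into_alg_generated:
 fixes X :: "('p, 'k::field) fspace" and \<phi> :: "'p => 'q"
 assumes X: "fun_space X" and F: "F \<subseteq> extensional P" and fs: "!!x. x \<in> pts X ==> \<phi> x \<in> P"
  and reg: "!!f. f \<in> F ==> (\<lambda>x\<in>pts X. f (\<phi> x)) \<in> coord_ring X"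
 shows "morph X (frac_space {(P, alg_generated P F)}) \<phi>"
proof (rule morph_into_single[OF X subalg_alg_generated[OF F] fs])
 fix f assume f: "f \<in> alg_generated P F"
 have S: "subalg (pts X) (coord_ring X)" by (rule fun_space_subalg[OF X openin_topspace])
 show "(\<lambda>x\<in>pts X. f (\<phi> x)) \<in> coord_ring X"
 proof (rule alg_generated_induct[OF f F, of "\<lambda>f. (\<lambda>x\<in>pts X. f (\<phi> x)) \<in> coord_ring X"])
  have "(\<lambda>x\<in>pts X. (\<lambda>y\<in>P. c) (\<phi> x)) = (\<lambda>x\<in>pts X. c)" for c :: 'k using fs by (intro restrict_ext) simp
  thus "(\<lambda>x\<in>pts X. (\<lambda>y\<in>P. c) (\<phi> x)) \<in> coord_ring X" for c using subalg_const[OF S] by simp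
 next
  fix f g assume fg: "(\<lambda>x\<in>pts X. f (\<phi> x)) \<in> coord_ring X" "(\<lambda>x\<in>pts X. g (\<phi> x)) \<in> coord_ring X"
  have "(\<lambda>x\<in>pts X. (\<lambda>y\<in>P. f y + g y) (\<phi> x)) = (\<lambda>x\<in>pts X. (\<lambda>x\<in>pts X. f (\<phi> x)) x + (\<lambda>x\<in>pts X. g (\<phi> x)) x)"
   "(\<lambda>x\<in>pts X. (\<lambda>y\<in>P. f y * g y) (\<phi> x)) = (\<lambda>x\<in>pts X. (\<lambda>x\<in>pts X. f (\<phi> x)) x * (\<lambda>x\<in>pts X. g (\<phi> x)) x)"
   using fs by (auto intro!: restrict_ext)
  thus "(\<lambda>x\<in>pts X. (\<lambda>y\<in>P. f y + g y) (\<phi> x)) \<in> coord_ring X"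
   "(\<lambda>x\<in>pts X. (\<lambda>y\<in>P. f y * g y) (\<phi> x)) \<in> coord_ring X"
   using subalg_add[OF S fg] subalg_mult[OF S fg] by simp_all
 qed (rule reg)
qed

subsection \<open>Products\<close>

definition tensor_algebra :: "('p => 'k::field) set => ('q => 'k) set => 'p set => 'q set => ('p \<times> 'q => 'k) set" where
 "tensor_algebra A B U V = {\<lambda>z\<in>U \<times> V. \<Sum>i<m. f i (fst z) * g i (snd z) |m f g. \<forall>i<(m::nat). f i \<in> A \<and> g i \<in> B}"

lemma fprod_eq:
 "fprod X Y = frac_space {(U \<times> V, tensor_algebra (freg X U) (freg Y V) U V) |U V. openin (ftop X) U \<and> openin (ftop Y) V}"
 unfolding fprod_def tensor_algebra_def ..

text \<open>Arbitrary finite index sets are allowed, since sums of tensors are indexed by disjoint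
  unions and products of tensors by cartesian products.\<close>

lemma tensor_algebraI:
 assumes "finite J" "!!j. j \<in> J ==> f j \<in> A" "!!j. j \<in> J ==> g j \<in> B"
 shows "(\<lambda>z\<in>U \<times> V. \<Sum>j\<in>J. f j (fst z) * g j (snd z)) \<in> tensor_algebra A B U V"
proof -
 obtain e where e: "bij_betw e {..<card J} J"
  using ex_bij_betw_nat_finite[OF assms(1)] by (auto simp: atLeast0LessThan)
 have "(\<Sum>j\<in>J. f j x * g j y) = (\<Sum>i<card J. f (e i) x * g (e i) y)" for x y
  by (rule sum.reindex_bij_betw[OF e, symmetric])
 moreover have "f (e i) \<in> A \<and> g (e i) \<in> B" if "i < card J" for i
  using bij_betwE[OF e] that assms by auto
 ultimately show ?thesis unfolding tensor_algebra_def
  by (intro CollectI exI[of _ "card J"] exI[of _ "\<lambda>i. f (e i)"] exI[of _ "\<lambda>i. g (e i)"]) auto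
qed

lemma tensor_algebraE:
 assumes "h \<in> tensor_algebra A B U V"
 obtains m :: nat and f g where "h = (\<lambda>z\<in>U \<times> V. \<Sum>i<m. f i (fst z) * g i (snd z))"
  "!!i. i < m ==> f i \<in> A" "!!i. i < m ==> g i \<in> B"
 using assms unfolding tensor_algebra_def by blast

lemma subalg_tensor_algebra:
 fixes A :: "('p => 'k::field) set" and B :: "('q => 'k) set"
 assumes A: "subalg U A" and B: "subalg V B"
 shows "subalg (U \<times> V) (tensor_algebra A B U V)"
 unfolding subalg_def
proof (intro conjI allI ballI)
 show "tensor_algebra A B U V \<subseteq> extensional (U \<times> V)" by (auto simp: tensor_algebra_def)
 show "(\<lambda>x\<in>U \<times> V. c) \<in> tensor_algebra A B U V" for c
 proof -
  have "(\<lambda>z\<in>U \<times> V. \<Sum>j\<in>{()}. (\<lambda>x\<in>U. c) (fst z) * (\<lambda>x\<in>V. 1) (snd z)) \<in> tensor_algebra A B U V"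
   by (rule tensor_algebraI[OF _ subalg_const[OF A] subalg_const[OF B]]) simp
  also have "(\<lambda>z\<in>U \<times> V. \<Sum>j\<in>{()}. (\<lambda>x\<in>U. c) (fst z) * (\<lambda>x\<in>V. 1) (snd z)) = (\<lambda>x\<in>U \<times> V. c)"
   by (auto simp: restrict_def)
  finally show ?thesis .
 qed
 fix h h' assume h: "h \<in> tensor_algebra A B U V" "h' \<in> tensor_algebra A B U V"
 obtain m :: nat and f g where 1: "h = (\<lambda>z\<in>U \<times> V. \<Sum>i<m. f i (fst z) * g i (snd z))"
  "!!i. i < m ==> f i \<in> A" "!!i. i < m ==> g i \<in> B" using h(1) by (rule tensor_algebraE) blast
 obtain m' :: nat and f' g' where 2: "h' = (\<lambda>z\<in>U \<times> V. \<Sum>i<m'. f' i (fst z) * g' i (snd z))"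
  "!!i. i < m' ==> f' i \<in> A" "!!i. i < m' ==> g' i \<in> B" using h(2) by (rule tensor_algebraE) blast
 let ?J = "{..<m} <+> {..<m'}"
 have "(\<lambda>z\<in>U \<times> V. \<Sum>j\<in>?J. case_sum f f' j (fst z) * case_sum g g' j (snd z)) \<in> tensor_algebra A B U V"
  using 1 2 by (intro tensor_algebraI) auto
 also have "(\<lambda>z\<in>U \<times> V. \<Sum>j\<in>?J. case_sum f f' j (fst z) * case_sum g g' j (snd z)) = (\<lambda>z\<in>U \<times> V. h z + h' z)"
  unfolding 1 2 by (auto simp: restrict_def sum.Plus)
 finally show "(\<lambda>z\<in>U \<times> V. h z + h' z) \<in> tensor_algebra A B U V" .
 let ?J = "{..<m} \<times> {..<m'}"
 let ?f = "\<lambda>p. \<lambda>x\<in>U. f (fst p) x * f' (snd p) x" and ?g = "\<lambda>p. \<lambda>x\<in>V. g (fst p) x * g' (snd p) x"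
 have "(\<lambda>z\<in>U \<times> V. \<Sum>j\<in>?J. ?f j (fst z) * ?g j (snd z)) \<in> tensor_algebra A B U V"
  by (rule tensor_algebraI[OF _ subalg_mult[OF A] subalg_mult[OF B]]) (use 1 2 in auto)
 also have "(\<lambda>z\<in>U \<times> V. \<Sum>j\<in>?J. ?f j (fst z) * ?g j (snd z)) = (\<lambda>z\<in>U \<times> V. h z * h' z)"
 proof -
  have "sum F {..<m} * sum G {..<m'} = (\<Sum>p\<in>?J. F (fst p) * G (snd p))" for F G :: "nat => 'k"
   by (simp add: sum_product sum.cartesian_product case_prod_beta)
  thus ?thesis unfolding 1 2 restrict_def
   by (intro ext) (clarsimp, rule sum.cong[OF refl], auto simp: mult_ac)
 qed
 finally show "(\<lambda>z\<in>U \<times> V. h z * h' z) \<in> tensor_algebra A B U V" .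
qed

lemma frac_base_fprod:
 assumes X: "fun_space X" and Y: "fun_space Y"
 shows "frac_base {(U \<times> V, tensor_algebra (freg X U) (freg Y V) U V) |U V. openin (ftop X) U \<and> openin (ftop Y) V}"
proof -
 have *: "restrict h ((U \<inter> U') \<times> (V \<inter> V')) \<in> tensor_algebra (freg X (U \<inter> U')) (freg Y (V \<inter> V')) (U \<inter> U') (V \<inter> V')"
  if U: "openin (ftop X) (U \<inter> U')" "openin (ftop Y) (V \<inter> V')"
   and h: "h \<in> tensor_algebra (freg X U) (freg Y V) U V" for h U V U' V'
 proof -
  obtain m :: nat and f g where 1: "h = (\<lambda>z\<in>U \<times> V. \<Sum>i<m. f i (fst z) * g i (snd z))"
   "!!i. i < m ==> f i \<in> freg X U" "!!i. i < m ==> g i \<in> freg Y V" using h by (rule tensor_algebraE) blast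
  have "(\<lambda>z\<in>(U \<inter> U') \<times> (V \<inter> V'). \<Sum>i<m. restrict (f i) (U \<inter> U') (fst z) * restrict (g i) (V \<inter> V') (snd z))
    \<in> tensor_algebra (freg X (U \<inter> U')) (freg Y (V \<inter> V')) (U \<inter> U') (V \<inter> V')"
   by (rule tensor_algebraI[OF _ fun_space_restrict[OF X] fun_space_restrict[OF Y]]) (use 1 U in auto)
  also have "(\<lambda>z\<in>(U \<inter> U') \<times> (V \<inter> V'). \<Sum>i<m. restrict (f i) (U \<inter> U') (fst z) * restrict (g i) (V \<inter> V') (snd z))
    = restrict h ((U \<inter> U') \<times> (V \<inter> V'))"
   unfolding 1 restrict_def by (intro ext) auto
  finally show ?thesis .
 qed
 let ?I = "{U. openin (ftop X) U} \<times> {V. openin (ftop Y) V}"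
 have e: "{(U \<times> V, tensor_algebra (freg X U) (freg Y V) U V) |U V. openin (ftop X) U \<and> openin (ftop Y) V}
   = {(fst i \<times> snd i, tensor_algebra (freg X (fst i)) (freg Y (snd i)) (fst i) (snd i)) |i. i \<in> ?I}"
  by auto
 show ?thesis
  unfolding e
 proof (rule frac_baseI)
  fix i assume "i \<in> ?I"
  thus "subalg (fst i \<times> snd i) (tensor_algebra (freg X (fst i)) (freg Y (snd i)) (fst i) (snd i))"
   by (intro subalg_tensor_algebra fun_space_subalg[OF X] fun_space_subalg[OF Y]) auto
 next
  fix i j assume i: "i \<in> ?I" and j: "j \<in> ?I"
  obtain U V U' V' where ij: "i = (U, V)" "j = (U', V')" by (cases i, cases j)
  have o: "openin (ftop X) (U \<inter> U')" "openin (ftop Y) (V \<inter> V')"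
   using i j ij by auto
  have e: "U \<times> V \<inter> U' \<times> V' = (U \<inter> U') \<times> (V \<inter> V')" by auto
  have r: "restrict f ((U \<inter> U') \<times> (V \<inter> V'))
    \<in> tensor_algebra (freg X (U \<inter> U')) (freg Y (V \<inter> V')) (U \<inter> U') (V \<inter> V')"
   if "f \<in> tensor_algebra (freg X U) (freg Y V) U V \<union> tensor_algebra (freg X U') (freg Y V') U' V'" for f
   using that *[OF o, of f] *[of U' U V' V f] o by (auto simp: Int_commute)
  show "\<exists>k\<in>?I. fst k \<times> snd k = fst i \<times> snd i \<inter> fst j \<times> snd j \<and>
    (\<forall>f\<in>tensor_algebra (freg X (fst i)) (freg Y (snd i)) (fst i) (snd i) \<union>
      tensor_algebra (freg X (fst j)) (freg Y (snd j)) (fst j) (snd j).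
     restrict f (fst i \<times> snd i \<inter> fst j \<times> snd j) \<in>
      tensor_algebra (freg X (fst k)) (freg Y (snd k)) (fst k) (snd k))"
   unfolding ij fst_conv snd_conv e
   by (rule bexI[of _ "(U \<inter> U', V \<inter> V')"]) (use r o in "simp_all only: fst_conv snd_conv, auto")
 qed
qed

lemma fun_space_fprod: "fun_space X ==> fun_space Y ==> fun_space (fprod X Y)"
 unfolding fprod_eq by (intro fun_space_frac_space frac_base_fprod)

lemma pts_fprod:
 assumes "fun_space X" "fun_space Y" shows "pts (fprod X Y) = pts X \<times> pts Y"
 unfolding fprod_eq pts_frac_space[OF frac_base_fprod[OF assms]]
proof (rule subset_antisym)
 show "pts X \<times> pts Y \<subseteq> \<Union>(fst ` {(U \<times> V, tensor_algebra (freg X U) (freg Y V) U V) |U V. openin (ftop X) U \<and> openin (ftop Y) V})"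
  by (intro Union_upper image_eqI[where x = "(pts X \<times> pts Y, tensor_algebra (freg X (pts X)) (freg Y (pts Y)) (pts X) (pts Y))"])
   auto
qed (auto, (meson openin_subset subsetD)+)

lemma morph_slice:
 assumes X: "fun_space X" and Y: "fun_space Y" and y: "y \<in> pts Y"
 shows "morph X (fprod X Y) (\<lambda>x. (x, y))"
 unfolding fprod_eq
proof (rule morph_into_frac[OF X])
 show "(x, y) \<in> pts (frac_space {(U \<times> V, tensor_algebra (freg X U) (freg Y V) U V) |U V. openin (ftop X) U \<and> openin (ftop Y) V})"
  if "x \<in> pts X" for x
  using pts_fprod[OF X Y] that y unfolding fprod_eq by auto
 fix W F h assume "(W, F) \<in> {(U \<times> V, tensor_algebra (freg X U) (freg Y V) U V) |U V. openin (ftop X) U \<and> openin (ftop Y) V}"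
  and h: "h \<in> F"
 then obtain U V where W: "W = U \<times> V" "F = tensor_algebra (freg X U) (freg Y V) U V" "openin (ftop X) U" "openin (ftop Y) V"
  by auto
 show "(\<lambda>x\<in>{x \<in> pts X. (x, y) \<in> W}. h (x, y)) \<in> freg X {x \<in> pts X. (x, y) \<in> W}"
 proof (cases "y \<in> V")
  case True
  obtain m :: nat and f g where 1: "h = (\<lambda>z\<in>U \<times> V. \<Sum>i<m. f i (fst z) * g i (snd z))"
   "!!i. i < m ==> f i \<in> freg X U" "!!i. i < m ==> g i \<in> freg Y V"
   using h unfolding W by (rule tensor_algebraE) blast
  have e: "{x \<in> pts X. (x, y) \<in> W} = U" using W True openin_subset[OF W(3)] by auto
  have "(\<lambda>x\<in>U. \<Sum>i<m. (\<lambda>x\<in>U. g i y * f i x) x) \<in> freg X U"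
   using 1 W by (intro subalg_sum[OF fun_space_subalg[OF X]] subalg_scale[OF fun_space_subalg[OF X]]) auto
  also have "(\<lambda>x\<in>U. \<Sum>i<m. (\<lambda>x\<in>U. g i y * f i x) x) = (\<lambda>x\<in>U. h (x, y))"
   unfolding 1 using True by (intro ext) (auto simp: restrict_def mult.commute)
  finally show ?thesis unfolding e .
 next
  case False
  hence e: "{x \<in> pts X. (x, y) \<in> W} = {}" using W by auto
  show ?thesis unfolding e by (rule fun_space_local[OF X]) (auto simp: extensional_def)
 qed
qed

subsection \<open>Induced structures\<close>

lemma frac_base_induced:
 assumes X: "fun_space X"
 shows "frac_base {(U \<inter> Z, (\<lambda>f. restrict f (U \<inter> Z)) ` freg X U) |U. openin (ftop X) U}"
proof -
 have "frac_base {(U \<inter> Z, (\<lambda>f. restrict f (U \<inter> Z)) ` freg X U) |U. U \<in> Collect (openin (ftop X))}"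
 proof (rule frac_baseI)
  fix U assume "U \<in> Collect (openin (ftop X))"
  hence U: "openin (ftop X) U" by simp
  note S = fun_space_subalg[OF X U]
  show "subalg (U \<inter> Z) ((\<lambda>f. restrict f (U \<inter> Z)) ` freg X U)"
   unfolding subalg_def
  proof (intro conjI allI ballI)
   fix c
   show "(\<lambda>x\<in>U \<inter> Z. c) \<in> (\<lambda>f. restrict f (U \<inter> Z)) ` freg X U"
    by (rule image_eqI[OF _ subalg_const[OF S, of c]]) (auto simp: restrict_def)
  next
   fix f g assume "f \<in> (\<lambda>f. restrict f (U \<inter> Z)) ` freg X U" "g \<in> (\<lambda>f. restrict f (U \<inter> Z)) ` freg X U"
   then obtain f' g' where *: "f = restrict f' (U \<inter> Z)" "g = restrict g' (U \<inter> Z)" "f' \<in> freg X U" "g' \<in> freg X U"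
    by auto
   show "(\<lambda>x\<in>U \<inter> Z. f x + g x) \<in> (\<lambda>f. restrict f (U \<inter> Z)) ` freg X U"
    by (rule image_eqI[OF _ subalg_add[OF S *(3,4)]]) (auto simp: restrict_def *)
   show "(\<lambda>x\<in>U \<inter> Z. f x * g x) \<in> (\<lambda>f. restrict f (U \<inter> Z)) ` freg X U"
    by (rule image_eqI[OF _ subalg_mult[OF S *(3,4)]]) (auto simp: restrict_def *)
  qed auto
 next
  fix U U' assume "U \<in> Collect (openin (ftop X))" "U' \<in> Collect (openin (ftop X))"
  hence o: "openin (ftop X) (U \<inter> U')" by auto
  have e: "U \<inter> Z \<inter> (U' \<inter> Z) = U \<inter> U' \<inter> Z" by auto
  have r: "restrict (restrict f (V \<inter> Z)) (U \<inter> U' \<inter> Z) \<in> (\<lambda>f. restrict f (U \<inter> U' \<inter> Z)) ` freg X (U \<inter> U')"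
   if "f \<in> freg X V" "U \<inter> U' \<subseteq> V" for f V
   by (rule image_eqI[OF _ fun_space_restrict[OF X that(1) o that(2)]]) (intro ext, use that(2) in "auto simp: restrict_def")
  show "\<exists>k\<in>Collect (openin (ftop X)). k \<inter> Z = U \<inter> Z \<inter> (U' \<inter> Z) \<and>
    (\<forall>f\<in>(\<lambda>f. restrict f (U \<inter> Z)) ` freg X U \<union> (\<lambda>f. restrict f (U' \<inter> Z)) ` freg X U'.
     restrict f (U \<inter> Z \<inter> (U' \<inter> Z)) \<in> (\<lambda>f. restrict f (k \<inter> Z)) ` freg X k)"
   unfolding e
  proof (rule bexI[of _ "U \<inter> U'"], intro conjI refl ballI)
   fix f assume "f \<in> (\<lambda>f. restrict f (U \<inter> Z)) ` freg X U \<union> (\<lambda>f. restrict f (U' \<inter> Z)) ` freg X U'"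
   thus "restrict f (U \<inter> U' \<inter> Z) \<in> (\<lambda>f. restrict f (U \<inter> U' \<inter> Z)) ` freg X (U \<inter> U')"
    by (elim UnE imageE) (simp_all only: r Int_lower1 Int_lower2)
  qed (use o in simp)
 qed
 thus ?thesis by simp
qed

lemma fun_space_induced: "fun_space X ==> fun_space (induced X Z)"
 unfolding induced_def by (intro fun_space_frac_space frac_base_induced)

lemma pts_induced:
 assumes "fun_space X" shows "pts (induced X Z) = pts X \<inter> Z"
 unfolding induced_def pts_frac_space[OF frac_base_induced[OF assms]]
proof (rule subset_antisym)
 show "pts X \<inter> Z \<subseteq> \<Union>(fst ` {(U \<inter> Z, (\<lambda>f. restrict f (U \<inter> Z)) ` freg X U) |U. openin (ftop X) U})"
  by (intro Union_upper image_eqI[where x = "(pts X \<inter> Z, (\<lambda>f. restrict f (pts X \<inter> Z)) ` freg X (pts X))"])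
   auto
qed (auto, (meson openin_subset subsetD)+)

lemma freg_induced_restrict:
 assumes "fun_space X" "f \<in> freg X U" shows "restrict f (U \<inter> Z) \<in> freg (induced X Z) (U \<inter> Z)"
 unfolding induced_def
 using fun_space_freg_openin[OF assms] assms(2)
 by (intro freg_frac_space_incl[OF frac_base_induced[OF assms(1)]]) auto

text \<open>The functions generating the induced structure are restrictions from the ambient space,
  so it is enough to find \<open>g\<close> on an open subset of \<open>X\<close> with the right
  values along \<open>Z\<close>.\<close>

lemma morph_induced:
 assumes X: "fun_space X" and Y: "fun_space Y" and "Z \<subseteq> pts X" "\<phi> ` Z \<subseteq> Z'" "\<phi> ` Z \<subseteq> pts Y"
  and reg: "!!U f. f \<in> freg Y U ==> \<exists>g W. g \<in> freg X W \<and> W \<inter> Z = {x\<in>Z. \<phi> x \<in> U} \<and> (\<forall>x\<in>Z. \<phi> x \<in> U --> g x = f (\<phi> x))"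
 shows "morph (induced X Z) (induced Y Z') \<phi>"
proof -
 have p: "pts (induced X Z) = Z" using pts_induced[OF X] assms(3) by auto
 have "morph (induced X Z) (frac_space {(U \<inter> Z', (\<lambda>f. restrict f (U \<inter> Z')) ` freg Y U) |U. openin (ftop Y) U}) \<phi>"
 proof (rule morph_into_frac[OF fun_space_induced[OF X]])
  show "\<phi> x \<in> pts (frac_space {(U \<inter> Z', (\<lambda>f. restrict f (U \<inter> Z')) ` freg Y U) |U. openin (ftop Y) U})"
   if "x \<in> pts (induced X Z)" for x
   using pts_induced[OF Y, of Z'] that p assms(4,5) unfolding induced_def by auto
  fix W F f' assume "(W, F) \<in> {(U \<inter> Z', (\<lambda>f. restrict f (U \<inter> Z')) ` freg Y U) |U. openin (ftop Y) U}" "f' \<in> F"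
  then obtain U f where 1: "W = U \<inter> Z'" "openin (ftop Y) U" "f \<in> freg Y U" "f' = restrict f (U \<inter> Z')" by auto
  obtain g V where 2: "g \<in> freg X V" "V \<inter> Z = {x\<in>Z. \<phi> x \<in> U}" "!!x. x \<in> Z ==> \<phi> x \<in> U ==> g x = f (\<phi> x)"
   using reg[OF 1(3)] by blast
  have e: "{x \<in> Z. \<phi> x \<in> W} = V \<inter> Z" using 1 2 assms(4) by auto
  have "restrict g (V \<inter> Z) = (\<lambda>x\<in>V \<inter> Z. f' (\<phi> x))"
   using 2 1 assms(4) by (intro ext) (auto simp: restrict_def)
  thus "(\<lambda>x\<in>{x \<in> pts (induced X Z). \<phi> x \<in> W}. f' (\<phi> x)) \<in> freg (induced X Z) {x \<in> pts (induced X Z). \<phi> x \<in> W}"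
   using freg_induced_restrict[OF X 2(1), of Z] unfolding p e by metis
 qed
 thus ?thesis unfolding induced_def .
qed

section \<open>Polynomial functions on affine space\<close>

lemma restrict_UNIV_eq [simp]: "restrict f UNIV = f"
 by (simp add: restrict_def)

lemma subalg_polys: "subalg UNIV (polys :: ('k::field ^ 'n::finite => 'k) set)"
 unfolding polys_def by (rule subalg_alg_generated) (simp add: extensional_def)

lemma polys_const [intro, simp]: "(\<lambda>x. c) \<in> polys"
 using subalg_const[OF subalg_polys] by simp

lemma polys_coord [intro, simp]: "(\<lambda>x. x $ i) \<in> polys"
 unfolding polys_def by (rule subsetD[OF alg_generated_incl]) simp

lemma polys_add [intro]: "f \<in> polys ==> g \<in> polys ==> (\<lambda>x. f x + g x) \<in> polys"
 using subalg_add[OF subalg_polys] by simp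

lemma polys_mult [intro]: "f \<in> polys ==> g \<in> polys ==> (\<lambda>x. f x * g x) \<in> polys"
 using subalg_mult[OF subalg_polys] by simp

lemma polys_scale [intro]: "f \<in> polys ==> (\<lambda>x. c * f x) \<in> polys"
 by (rule polys_mult) auto

lemma polys_diff [intro]: "f \<in> polys ==> g \<in> polys ==> (\<lambda>x. f x - g x) \<in> polys"
 using polys_add[OF _ polys_scale[of g "-1"], of f] by simp

lemma polys_sum [intro]: "(!!i. i \<in> I ==> f i \<in> polys) ==> (\<lambda>x. \<Sum>i\<in>I. f i x) \<in> polys"
 using subalg_sum[OF subalg_polys, of I f] by simp

lemma polys_prod [intro]: "(!!i. i \<in> I ==> f i \<in> polys) ==> (\<lambda>x. \<Prod>i\<in>I. f i x) \<in> polys"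
 using subalg_prod[OF subalg_polys, of I f] by simp

lemma polys_power [intro]: "f \<in> polys ==> (\<lambda>x. f x ^ m) \<in> polys"
 using subalg_power[OF subalg_polys, of f m] by simp

lemma polys_induct [consumes 1, case_names const coord add mult]:
 assumes "f \<in> polys" "!!c. Q (\<lambda>x. c)" "!!i. Q (\<lambda>x. x $ i)"
  and "!!f g. f \<in> polys ==> g \<in> polys ==> Q f ==> Q g ==> Q (\<lambda>x. f x + g x)"
  and "!!f g. f \<in> polys ==> g \<in> polys ==> Q f ==> Q g ==> Q (\<lambda>x. f x * g x)"
 shows "Q f"
proof -
 have "range (\<lambda>i x. x $ i) \<subseteq> extensional UNIV" by (simp add: extensional_def)
 with assms(1) show ?thesis unfolding polys_def
 proof (induction rule: alg_generated_induct)
 case (gen f)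
 thus ?case using assms(3) by auto
next
 case (add f g)
 thus ?case using assms(4)[unfolded polys_def] by simp
next
 case (mult f g)
 thus ?case using assms(5)[unfolded polys_def] by simp
 qed (use assms(2) in simp_all)
qed

text \<open>Later \<open>A\<close> is a graded ring of polynomials or the algebra of regular
  functions on \<open>SL\<close>.\<close>

lemma polys_subst:
 assumes "f \<in> polys" "subalg P A" "!!i. w i \<in> A"
 shows "(\<lambda>x\<in>P. f (\<chi> i. w i x)) \<in> A"
 using assms(1)
proof (induction rule: polys_induct)
 case (const c)
 thus ?case by (rule subalg_const[OF assms(2)])
next
 case (coord i)
 have "(\<lambda>x\<in>P. (\<chi> i. w i x) $ i) = w i"
  using subalg_ext[OF assms(2,3)] by (auto simp: restrict_def extensional_def fun_eq_iff)
 thus ?case using assms(3) by simp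
next
 case (add f g)
 have "(\<lambda>x\<in>P. f (\<chi> i. w i x) + g (\<chi> i. w i x)) = (\<lambda>x\<in>P. (\<lambda>x\<in>P. f (\<chi> i. w i x)) x + (\<lambda>x\<in>P. g (\<chi> i. w i x)) x)"
  by (auto simp: restrict_def)
 thus ?case using subalg_add[OF assms(2) add(3,4)] by (simp only:)
next
 case (mult f g)
 have "(\<lambda>x\<in>P. f (\<chi> i. w i x) * g (\<chi> i. w i x)) = (\<lambda>x\<in>P. (\<lambda>x\<in>P. f (\<chi> i. w i x)) x * (\<lambda>x\<in>P. g (\<chi> i. w i x)) x)"
  by (auto simp: restrict_def)
 thus ?case using subalg_mult[OF assms(2) mult(3,4)] by (simp only:)
qed

lemma polys_comp: "f \<in> polys ==> (!!i. (\<lambda>x. w x $ i) \<in> polys) ==> (\<lambda>x. f (w x)) \<in> polys"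
 using polys_subst[OF _ subalg_polys, of f "\<lambda>i x. w x $ i"] by simp

subsection \<open>Restriction to lines\<close>

lemma poly_eq_infinite:
 fixes p q :: "'a::idom poly"
 assumes "infinite {t. poly p t = poly q t}" shows "p = q"
 using poly_roots_finite[of "p - q"] assms by auto

lemma poly_eq_cofinite:
 fixes p q :: "'a::field_char_0 poly"
 assumes "finite A" "!!t. t \<notin> A ==> poly p t = poly q t" shows "p = q"
proof (rule poly_eq_infinite, rule ccontr)
 assume "\<not> infinite {t. poly p t = poly q t}"
 hence "finite (A \<union> {t. poly p t = poly q t})" using assms(1) by simp
 moreover have "A \<union> {t. poly p t = poly q t} = UNIV" using assms(2) by auto
 ultimately show False using infinite_UNIV_char_0[where 'a = 'a] by simp
qed

text \<open>Members of \<open>polys\<close> are mere functions; on a line they become univariate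
  polynomials, with coefficients, degrees and division. The description is unique because a field of
  characteristic zero is infinite.\<close>

definition line_poly :: "('k::field_char_0 ^ 'n::finite => 'k) => 'k ^ 'n => 'k ^ 'n => 'k poly" where
 "line_poly f x v = (THE p. \<forall>t. poly p t = f (x + t *s v))"

lemma line_polyI:
 assumes "!!t. poly p t = f (x + t *s v)" shows "line_poly f x v = p"
 unfolding line_poly_def
proof (rule the_equality)
 fix q assume "\<forall>t. poly q t = f (x + t *s v)"
 thus "q = p" using assms by (intro poly_eq_cofinite[of "{}"]) simp_all
qed (use assms in simp)

lemma poly_line_poly:
 assumes "f \<in> polys" shows "poly (line_poly f x v) t = f (x + t *s v)"
proof -
 have "\<exists>p. \<forall>t. poly p t = f (x + t *s v)"
  using assms
 proof (induction rule: polys_induct)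
  case (const c)
  thus ?case by (intro exI[of _ "[:c:]"]) simp
 next
  case (coord i)
  thus ?case by (intro exI[of _ "[:x $ i, v $ i:]"]) simp
 next
  case (add f g)
  thus ?case by (metis poly_add)
 next
  case (mult f g)
  thus ?case by (metis poly_mult)
 qed
 thus ?thesis using line_polyI by metis
qed

lemma line_poly_const [simp]: "line_poly (\<lambda>x. c) x v = [:c:]"
 by (rule line_polyI) simp

lemma line_poly_coord [simp]: "line_poly (\<lambda>x. x $ i) x v = [:x $ i, v $ i:]"
 by (rule line_polyI) simp

lemma line_poly_add: "f \<in> polys ==> g \<in> polys ==> line_poly (\<lambda>x. f x + g x) x v = line_poly f x v + line_poly g x v"
 by (rule line_polyI) (simp add: poly_line_poly)

lemma line_poly_mult: "f \<in> polys ==> g \<in> polys ==> line_poly (\<lambda>x. f x * g x) x v = line_poly f x v * line_poly g x v"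
 by (rule line_polyI) (simp add: poly_line_poly)

lemma line_poly_sum:
 "(!!i. i \<in> I ==> f i \<in> polys) ==> line_poly (\<lambda>x. \<Sum>i\<in>I. f i x) x v = (\<Sum>i\<in>I. line_poly (f i) x v)"
 by (rule line_polyI) (simp add: poly_line_poly poly_sum)

lemma coeff_line_poly_polys:
 assumes "f \<in> polys" shows "(\<lambda>x. coeff (line_poly f x v) j) \<in> polys"
 using assms
proof (induction arbitrary: j rule: polys_induct)
 case (coord i)
 have "(\<lambda>x. coeff [:x $ i, v $ i:] j) \<in> polys"
 proof (cases j)
  case (Suc k) thus ?thesis by (cases k) auto
 qed auto
 thus ?case by simp
next
 case (add f g)
 thus ?case by (simp add: line_poly_add) auto
next
 case (mult f g)
 thus ?case by (simp add: line_poly_mult coeff_mult) (intro polys_sum polys_mult)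
qed auto

lemma coeff_line_poly_polys':
 assumes "f \<in> polys" shows "(\<lambda>v. coeff (line_poly f x v) j) \<in> polys"
 using assms
proof (induction arbitrary: j rule: polys_induct)
 case (coord i)
 have "(\<lambda>v. coeff [:x $ i, v $ i:] j) \<in> polys"
 proof (cases j)
  case (Suc k) thus ?thesis by (cases k) auto
 qed auto
 thus ?case by simp
next
 case (add f g)
 thus ?case by (simp add: line_poly_add) auto
next
 case (mult f g)
 thus ?case by (simp add: line_poly_mult coeff_mult) (intro polys_sum polys_mult)
qed auto

lemma degree_line_poly_bounded:
 assumes "f \<in> polys" obtains M where "!!x v. degree (line_poly f x v) \<le> M"
proof -
 have "\<exists>M. \<forall>x v. degree (line_poly f x v) \<le> M"
  using assms
 proof (induction rule: polys_induct)
  case (const c)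
  thus ?case by simp
 next
  case (coord i)
  have "degree (line_poly (\<lambda>x. x $ i) x v) \<le> 1" for x v :: "'a ^ 'b"
   by (auto intro: order_trans[OF degree_pCons_le])
  thus ?case by blast
 next
  case (add f g)
  then obtain M N where "!!x v. degree (line_poly f x v) \<le> M" "!!x v. degree (line_poly g x v) \<le> N" by blast
  hence "degree (line_poly (\<lambda>x. f x + g x) x v) \<le> max M N" for x v
   using add by (auto simp: line_poly_add intro!: degree_add_le intro: le_max_iff_disj[THEN iffD2])
  thus ?case by blast
 next
  case (mult f g)
  then obtain M N where "!!x v. degree (line_poly f x v) \<le> M" "!!x v. degree (line_poly g x v) \<le> N" by blast
  hence "degree (line_poly (\<lambda>x. f x * g x) x v) \<le> M + N" for x v
   using mult by (auto simp: line_poly_mult intro!: order_trans[OF degree_mult_le] add_mono)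
  thus ?case by blast
 qed
 thus ?thesis using that by blast
qed

text \<open>On the line joining \<open>x\<close> and \<open>y\<close> the product of two univariate
  polynomials vanishes, so one of them is zero.\<close>

lemma polys_domain:
 fixes f g :: "'k::field_char_0 ^ 'n::finite => 'k"
 assumes "f \<in> polys" "g \<in> polys" "!!x. f x * g x = 0" and "f x ~= 0"
 shows "g y = 0"
proof -
 have "line_poly f x (y - x) * line_poly g x (y - x) = 0"
  by (rule poly_eq_cofinite[of "{}"]) (simp_all add: poly_line_poly assms del: mult_eq_0_iff)
 hence "line_poly f x (y - x) = 0 \<or> line_poly g x (y - x) = 0"
  by simp
 moreover have "poly (line_poly f x (y - x)) 0 = f x" "poly (line_poly g x (y - x)) 1 = g y"
  using assms by (simp_all add: poly_line_poly)
 ultimately show ?thesis using assms(4) by auto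
qed

text \<open>This is \<open>polys_domain\<close> for \<open>u\<close> and \<open>f - g\<close>: a
  nonempty principal open set is dense. Identities between quotients are extended in this way over
  the zeros of the denominators.\<close>

lemma polys_eq_dense:
 fixes f g :: "'k::field_char_0 ^ 'n::finite => 'k"
 assumes "f \<in> polys" "g \<in> polys" "u \<in> polys" "u x ~= 0" "!!y. u y ~= 0 ==> f y = g y"
 shows "f z = g z"
proof -
 have "f z - g z = 0"
  by (rule polys_domain[of u "\<lambda>z. f z - g z", OF _ _ _ assms(4)]) (use assms in auto)
 thus ?thesis by simp
qed

subsection \<open>Homogeneous components\<close>

text \<open>The component of degree \<open>i\<close> at \<open>x\<close> is the coefficient of
  \<open>t ^ i\<close> in \<open>f (t x)\<close>; no expansion into monomials has to be
  chosen.\<close>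

definition hcomp :: "nat => ('k::field_char_0 ^ 'n::finite => 'k) => 'k ^ 'n => 'k" where
 "hcomp i f = (\<lambda>x. coeff (line_poly f 0 x) i)"

lemma hcomp_polys [intro, simp]: "f \<in> polys ==> hcomp i f \<in> polys"
 unfolding hcomp_def by (rule coeff_line_poly_polys')

lemma hcomp_const: "hcomp i (\<lambda>x. c) = (\<lambda>x. if i = 0 then c else 0)"
 by (auto simp: hcomp_def coeff_pCons split: nat.split)

lemma hcomp_add: "f \<in> polys ==> g \<in> polys ==> hcomp i (\<lambda>x. f x + g x) = (\<lambda>x. hcomp i f x + hcomp i g x)"
 by (simp add: hcomp_def line_poly_add)

lemma hcomp_mult:
 "f \<in> polys ==> g \<in> polys ==> hcomp i (\<lambda>x. f x * g x) = (\<lambda>x. \<Sum>k\<le>i. hcomp k f x * hcomp (i - k) g x)"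
 by (simp add: hcomp_def line_poly_mult coeff_mult)

lemma hcomp_sum:
 "(!!j. j \<in> J ==> f j \<in> polys) ==> hcomp i (\<lambda>x. \<Sum>j\<in>J. f j x) = (\<lambda>x. \<Sum>j\<in>J. hcomp i (f j) x)"
 by (simp add: hcomp_def line_poly_sum coeff_sum)

lemma hcomp_scale: "f \<in> polys ==> hcomp i (\<lambda>x. c * f x) = (\<lambda>x. c * hcomp i f x)"
 by (simp add: hcomp_def line_poly_mult)

lemma hcomp_homogeneous:
 assumes "!!t x. f (t *s x) = t ^ m * f x"
 shows "hcomp i f = (\<lambda>x. if i = m then f x else 0)"
proof -
 have "line_poly f 0 x = monom (f x) m" for x
  by (rule line_polyI) (simp add: poly_monom assms mult.commute)
 thus ?thesis by (auto simp: hcomp_def)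
qed

lemma hcomp_smult:
 assumes "f \<in> polys" shows "hcomp i f (t *s x) = t ^ i * hcomp i f x"
proof -
 have "line_poly f 0 (t *s x) = (\<Sum>j\<le>degree (line_poly f 0 x). monom (t ^ j * coeff (line_poly f 0 x) j) j)"
 proof (rule line_polyI)
  fix u
  have "f (0 + u *s (t *s x)) = poly (line_poly f 0 x) (u * t)"
   using assms by (simp add: poly_line_poly vector_smult_assoc)
  also have "\<dots> = (\<Sum>i\<le>degree (line_poly f 0 x). coeff (line_poly f 0 x) i * (u * t) ^ i)"
   by (rule poly_altdef)
  finally show "poly (\<Sum>j\<le>degree (line_poly f 0 x). monom (t ^ j * coeff (line_poly f 0 x) j) j) u = f (0 + u *s (t *s x))"
   by (simp add: poly_sum poly_monom power_mult_distrib mult_ac)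
 qed
 thus ?thesis
  by (cases "i \<le> degree (line_poly f 0 x)") (auto simp: hcomp_def coeff_sum coeff_eq_0)
qed

lemma hcomp_matrix:
 assumes "f \<in> polys" shows "hcomp i (\<lambda>x. f (M *v x)) = (\<lambda>x. hcomp i f (M *v x))"
proof
 fix x
 have "line_poly (\<lambda>x. f (M *v x)) 0 x = line_poly f 0 (M *v x)"
  using assms by (intro line_polyI) (simp add: poly_line_poly vector_scalar_commute)
 thus "hcomp i (\<lambda>x. f (M *v x)) x = hcomp i f (M *v x)" by (simp add: hcomp_def)
qed

lemma hcomp_hcomp: "f \<in> polys ==> hcomp i (hcomp j f) = (\<lambda>x. if i = j then hcomp j f x else 0)"
 by (rule hcomp_homogeneous) (rule hcomp_smult)

lemma hcomp_smult_arg: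
 assumes "f \<in> polys" shows "hcomp i (\<lambda>x. f (t *s x)) = (\<lambda>x. t ^ i * hcomp i f x)"
proof -
 have "line_poly (\<lambda>x. f (t *s x)) 0 x = line_poly f 0 (t *s x)" for x
  using assms by (intro line_polyI) (simp add: poly_line_poly vector_smult_assoc mult.commute)
 hence "hcomp i (\<lambda>x. f (t *s x)) = (\<lambda>x. hcomp i f (t *s x))" by (simp add: hcomp_def)
 thus ?thesis using hcomp_smult[OF assms] by simp
qed

lemma hcomp_bounded:
 assumes "f \<in> polys" obtains N where "!!i x. N < i ==> hcomp i f x = 0"
proof -
 obtain N where N: "!!x v. degree (line_poly f x v) \<le> N" using degree_line_poly_bounded[OF assms] by blast
 have "hcomp i f x = 0" if "N < i" for i x
  using N[of 0 x] that by (auto simp: hcomp_def intro: coeff_eq_0)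
 thus ?thesis using that by blast
qed

lemma hcomp_expand:
 assumes "f \<in> polys" "!!i. M < i ==> hcomp i f x = 0"
 shows "f x = (\<Sum>i\<le>M. hcomp i f x)"
proof -
 have "degree (line_poly f 0 x) \<le> M" using assms(2) by (intro degree_le) (simp add: hcomp_def)
 moreover have "f x = poly (line_poly f 0 x) 1" using assms by (simp add: poly_line_poly)
 moreover have "\<dots> = (\<Sum>i\<le>degree (line_poly f 0 x). hcomp i f x)" by (simp add: poly_altdef hcomp_def)
 ultimately show ?thesis
  by (simp add: sum.mono_neutral_left[of "{..M}" "{..degree (line_poly f 0 x)}"] hcomp_def coeff_eq_0)
qed

lemma hcomp_eqI:
 assumes "f \<in> polys" "g \<in> polys" "!!i x. hcomp i f x = hcomp i g x" shows "f = g"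
proof
 fix x
 have "line_poly f 0 x = line_poly g 0 x" using assms(3) by (auto simp: hcomp_def intro: poly_eqI)
 thus "f x = g x" using poly_line_poly[OF assms(1), of 0 x 1] poly_line_poly[OF assms(2), of 0 x 1] by simp
qed

lemma hcomp_0: "f \<in> polys ==> hcomp 0 f x = f 0"
 using poly_line_poly[of f 0 x 0] by (simp add: hcomp_def poly_0_coeff_0)

text \<open>In the direction \<open>v\<close>, a form \<open>g\<close> of degree \<open>m\<close>
  has the leading coefficient \<open>g v\<close>, independently of the base point. For a general
  \<open>f\<close> only the top form contributes in degree \<open>N\<close>.\<close>

lemma coeff_line_poly_top:
 assumes f: "f \<in> polys" and N: "!!i x. N < i ==> hcomp i f x = 0"
 shows "coeff (line_poly f x v) N = hcomp N f v" "degree (line_poly f x v) \<le> N"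
proof -
 have hom: "coeff (line_poly g x v) m = g v \<and> (\<forall>i>m. coeff (line_poly g x v) i = 0)"
  if g: "g \<in> polys" "!!t x. g (t *s x) = t ^ m * g x" for g m
 proof -
  let ?P = "line_poly g v x" and ?Q = "line_poly g x v"
  \<comment> \<open>The identity \<open>g (x + t v) = t ^ m * g (v + x / t)\<close> makes the
    polynomial on the line the reflection of \<open>?P\<close>, up to a power of \<open>t\<close>;
    the monomials on both sides make up for the difference between \<open>m\<close> and the degree
    of \<open>?P\<close>.\<close>
  have "monom 1 (degree ?P) * ?Q = monom 1 m * reflect_poly ?P"
  proof (rule poly_eq_cofinite[of "{0}"])
   fix t :: 'a assume "t \<notin> {0}"
   hence t: "t ~= 0" by simp
   have "x + t *s v = t *s (v + inverse t *s x)"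
    using t by (simp add: vector_add_ldistrib vector_smult_assoc add.commute)
   hence "g (x + t *s v) = t ^ m * g (v + inverse t *s x)" by (simp only: g(2))
   hence "g (x + t *s v) = t ^ m * poly ?P (inverse t)" using g(1) by (simp add: poly_line_poly)
   thus "poly (monom 1 (degree ?P) * ?Q) t = poly (monom 1 m * reflect_poly ?P) t"
    using t g by (simp add: poly_line_poly poly_monom poly_reflect_poly_nz)
  qed simp
  hence *: "coeff (monom 1 (degree ?P) * ?Q) (degree ?P + i) = coeff (monom 1 m * reflect_poly ?P) (degree ?P + i)" for i
   by simp
  have "coeff ?Q i = (if degree ?P + i < m then 0 else coeff (reflect_poly ?P) (degree ?P + i - m))" for i
   using *[of i] by (simp add: coeff_monom_mult)
  moreover have "coeff ?P 0 = g v" using poly_line_poly[OF g(1), of v x 0] by (simp add: poly_0_coeff_0)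
  ultimately show ?thesis by (auto simp: coeff_reflect_poly)
 qed
 define M where "M = N"
 have M: "f = (\<lambda>x. \<Sum>i\<le>M. hcomp i f x)" "N \<le> M" using hcomp_expand[OF f N] by (auto simp: M_def)
 have "line_poly f x v = line_poly (\<lambda>x. \<Sum>i\<le>M. hcomp i f x) x v"
  by (rule arg_cong[OF M(1), of "\<lambda>g. line_poly g x v"])
 hence *: "coeff (line_poly f x v) j = (\<Sum>i\<le>M. coeff (line_poly (hcomp i f) x v) j)" for j
  using f by (simp add: line_poly_sum coeff_sum)
 have z: "coeff (line_poly (hcomp i f) x v) j = 0" if "N \<le> j" "j ~= i" for i j
 proof (cases "i < j")
  case True
  thus ?thesis using hom[OF hcomp_polys[OF f] hcomp_smult[OF f]] by simp
 next
  case False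
  hence "hcomp i f = (\<lambda>x. 0)" using N that by auto
  thus ?thesis by simp
 qed
 have "(\<Sum>i\<le>M. coeff (line_poly (hcomp i f) x v) N) = (\<Sum>i\<le>M. if i = N then hcomp N f v else 0)"
  using z[of N] hom[OF hcomp_polys[OF f] hcomp_smult[OF f]] by (intro sum.cong) auto
 thus "coeff (line_poly f x v) N = hcomp N f v" using M(2) * by simp
 have "coeff (line_poly f x v) j = 0" if "N < j" for j
 proof -
  have "coeff (line_poly (hcomp i f) x v) j = 0" for i
  proof (cases "i = j")
   case True
   hence "hcomp i f = (\<lambda>x. 0)" using N that by auto
   thus ?thesis using that by simp
  qed (use z that in simp)
  thus ?thesis using * by simp
 qed
 thus "degree (line_poly f x v) \<le> N" by (intro degree_le) simp
qed

subsection \<open>Divisibility\<close>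

text \<open>The coefficient of \<open>B\<close> in degree \<open>N\<close> is the constant
  \<open>c\<close>. Long division therefore divides by \<open>c\<close> only, and the coefficients
  of the quotient are polynomial in those of \<open>F\<close> and \<open>B\<close>.\<close>

lemma coeff_div_polys:
 fixes F B :: "'k::field_char_0 ^ 'n::finite => 'k poly"
 assumes F: "!!j. (\<lambda>x. coeff (F x) j) \<in> polys" "!!x. degree (F x) \<le> M"
  and B: "!!j. (\<lambda>x. coeff (B x) j) \<in> polys" "!!x. degree (B x) \<le> N" "!!x. coeff (B x) N = c" "c ~= 0"
  and dvd: "!!x. B x dvd F x"
 shows "(\<lambda>x. coeff (F x div B x) j) \<in> polys"
proof -
 let ?Q = "\<lambda>x. F x div B x"
 have Q: "F x = ?Q x * B x" for x using dvd by simp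
 have B0: "B x ~= 0" for x using B(3)[of x] B(4) by auto
 have dQ: "degree (?Q x) \<le> M" for x
 proof (cases "?Q x = 0")
  case False
  hence "degree (F x) = degree (?Q x) + degree (B x)" using degree_mult_eq[OF False B0] Q by metis
  thus ?thesis using F(2)[of x] by simp
 qed simp
 have rec: "coeff (?Q x) j = (coeff (F x) (N + j) - (\<Sum>i\<in>{j<..N + j}. coeff (?Q x) i * coeff (B x) (N + j - i))) / c" for x j
 proof -
  have "coeff (F x) (N + j) = (\<Sum>i\<le>N + j. coeff (?Q x) i * coeff (B x) (N + j - i))"
   by (subst Q) (rule coeff_mult)
  also have "\<dots> = (\<Sum>i\<in>{j..N + j}. coeff (?Q x) i * coeff (B x) (N + j - i))"
   using B(2)[of x] by (intro sum.mono_neutral_right) (auto intro!: coeff_eq_0)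
  also have "{j..N + j} = insert j {j<..N + j}" by auto
  also have "(\<Sum>i\<in>\<dots>. coeff (?Q x) i * coeff (B x) (N + j - i))
    = coeff (?Q x) j * c + (\<Sum>i\<in>{j<..N + j}. coeff (?Q x) i * coeff (B x) (N + j - i))"
   using B(3)[of x] by simp
  finally show ?thesis using B(4) by (simp add: field_simps)
 qed
 show ?thesis
 \<comment> \<open>The recursion expresses the coefficient \<open>j\<close> by those of larger
   index, so it runs downwards from \<open>M\<close>, above which all coefficients of the quotient
   vanish.\<close>
 proof (induction "Suc M - j" arbitrary: j rule: less_induct)
  case less
  show ?case
  proof (cases "M < j")
   case True
   hence "coeff (?Q x) j = 0" for x using dQ[of x] by (intro coeff_eq_0) simp
   thus ?thesis by simp
  next
   case False
   have *: "(\<lambda>x. coeff (?Q x) i) \<in> polys" if "j < i" for i using that False by (intro less) auto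
   have "(\<lambda>x. (inverse c) * (coeff (F x) (N + j) - (\<Sum>i\<in>{j<..N + j}. coeff (?Q x) i * coeff (B x) (N + j - i)))) \<in> polys"
    using F(1) B(1) * by (intro polys_scale polys_diff polys_sum polys_mult) auto
   moreover have "(\<lambda>x. coeff (?Q x) j) = (\<lambda>x. (inverse c) * (coeff (F x) (N + j) - (\<Sum>i\<in>{j<..N + j}. coeff (?Q x) i * coeff (B x) (N + j - i))))"
    by (rule ext, subst rec) (simp add: field_simps)
   ultimately show ?thesis by (simp only:)
  qed
 qed
qed

text \<open>
 In a direction \<open>v\<close> in which the top form of \<open>b\<close> does not vanish, \<open>b\<close> is monic up to a constant
 on every line, so the quotients on the lines fit together to a polynomial.
\<close>

lemma polys_dvd_lines:
 assumes f: "f \<in> polys" and b: "b \<in> polys" and nz: "b x0 ~= 0"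
  and dvd: "!!x v. line_poly b x v ~= 0 ==> line_poly b x v dvd line_poly f x v"
 obtains q where "q \<in> polys" "!!x. f x = b x * q x"
proof -
 obtain N0 where N0: "!!i x. N0 < i ==> hcomp i b x = 0" using hcomp_bounded[OF b] by blast
 let ?S = "{i. \<exists>x. hcomp i b x ~= 0}"
 have "finite ?S" using N0 by (intro finite_subset[of ?S "{..N0}"]) (auto simp: not_le[symmetric])
 moreover have "?S ~= {}"
 proof
  assume "?S = {}"
  hence "b = (\<lambda>x. 0)" using b by (intro hcomp_eqI) (auto simp: hcomp_const)
  thus False using nz by simp
 qed
 ultimately have "Max ?S \<in> ?S" by (rule Max_in)
 then obtain v where v: "hcomp (Max ?S) b v ~= 0" by auto
 have top: "hcomp i b x = 0" if "Max ?S < i" for i x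
  using that Max_ge[OF \<open>finite ?S\<close>, of i] by (auto simp: not_le[symmetric])
 have B: "coeff (line_poly b x v) (Max ?S) = hcomp (Max ?S) b v" "degree (line_poly b x v) \<le> Max ?S" for x v
  by (rule coeff_line_poly_top[OF b], erule top)+
 have lb: "line_poly b x v ~= 0" for x using B(1)[of x v] v by auto
 obtain M where M: "!!x v. degree (line_poly f x v) \<le> M" using degree_line_poly_bounded[OF f] by blast
 \<comment> \<open>The constant coefficient of the quotient on the line through \<open>x\<close> is
   its value at \<open>x\<close> itself.\<close>
 define q where "q = (\<lambda>x. coeff (line_poly f x v div line_poly b x v) 0)"
 have "q \<in> polys" unfolding q_def
  by (rule coeff_div_polys[OF _ _ _ _ _ v]) (rule coeff_line_poly_polys f b M B(2) dvd[OF lb] | rule B(1))+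
 moreover have "f x = b x * q x" for x
 proof -
  have "line_poly f x v = line_poly b x v * (line_poly f x v div line_poly b x v)" using dvd[OF lb] by simp
  hence "poly (line_poly f x v) 0 = poly (line_poly b x v) 0 * poly (line_poly f x v div line_poly b x v) 0"
   by (metis poly_mult)
  moreover have "poly (line_poly f x v) 0 = f x" "poly (line_poly b x v) 0 = b x"
   using f b by (simp_all add: poly_line_poly)
  ultimately show ?thesis by (simp add: q_def poly_0_coeff_0)
 qed
 ultimately show ?thesis using that by blast
qed

text \<open>Integral closedness of the univariate polynomial ring: at a root of \<open>B\<close> all
  terms of the sum vanish, so it is a root of \<open>A\<close> as well; the common linear factor
  cancels from the homogeneous equation.\<close>

lemma poly_integral_dvd:
 fixes A B :: "'k::alg_closed_field poly"
 assumes "B ~= 0" "A ^ m + (\<Sum>i<m. C i * A ^ i * B ^ (m - i)) = 0"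
 shows "B dvd A"
 using assms
proof (induction "degree B" arbitrary: A B rule: less_induct)
 case less
 show ?case
 proof (cases "degree B = 0")
  case True
  thus ?thesis using less.prems(1) is_unit_iff_degree unit_imp_dvd by blast
 next
  case False
  then obtain r where "poly B r = 0" using alg_closed_imp_poly_has_root by blast
  then obtain B1 where B1: "B = [:-r, 1:] * B1" by (auto simp: poly_eq_0_iff_dvd)
  have "poly (A ^ m + (\<Sum>i<m. C i * A ^ i * B ^ (m - i))) r = poly A r ^ m"
   using \<open>poly B r = 0\<close> by (simp add: poly_sum) (intro sum.neutral, auto)
  hence "poly A r ^ m = 0" using less.prems(2) by simp
  then obtain A1 where A1: "A = [:-r, 1:] * A1" by (auto simp: poly_eq_0_iff_dvd)
  have "[:-r, 1:] ^ i * [:-r, 1:] ^ (m - i) = [:-r, 1:] ^ m" if "i < m" for i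
   using that by (simp flip: power_add)
  hence "[:-r, 1:] ^ m * (A1 ^ m + (\<Sum>i<m. C i * A1 ^ i * B1 ^ (m - i))) = A ^ m + (\<Sum>i<m. C i * A ^ i * B ^ (m - i))"
   unfolding A1 B1 power_mult_distrib distrib_left sum_distrib_left
   by (intro arg_cong2[of _ _ _ _ "(+)"] refl sum.cong) (simp_all add: mult_ac)
  hence "A1 ^ m + (\<Sum>i<m. C i * A1 ^ i * B1 ^ (m - i)) = 0" using less.prems(2) by simp
  moreover have "B1 ~= 0" "degree B1 < degree B"
   using less.prems(1) B1 by (auto simp: degree_mult_eq simp del: mult_pCons_left)
  ultimately have "B1 dvd A1" using less.hyps by blast
  thus ?thesis unfolding A1 B1 by (rule mult_dvd_mono[OF dvd_refl])
 qed
qed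

lemma polys_integral:
 fixes a b :: "'k::{alg_closed_field, field_char_0} ^ 'n::finite => 'k"
 assumes a: "a \<in> polys" and b: "b \<in> polys" "b x0 ~= 0" and c: "!!i. i < m ==> c i \<in> polys"
  and eq: "!!x. a x ^ m + (\<Sum>i<m. c i x * a x ^ i * b x ^ (m - i)) = 0"
 obtains q where "q \<in> polys" "!!x. a x = b x * q x"
proof (rule polys_dvd_lines[OF a b])
 fix x v assume "line_poly b x v ~= 0"
 moreover have "line_poly (\<lambda>x. a x ^ m + (\<Sum>i<m. c i x * a x ^ i * b x ^ (m - i))) x v = [:0:]" using eq by simp
 moreover have "line_poly (\<lambda>x. a x ^ m + (\<Sum>i<m. c i x * a x ^ i * b x ^ (m - i))) x v =
   line_poly a x v ^ m + (\<Sum>i<m. line_poly (c i) x v * line_poly a x v ^ i * line_poly b x v ^ (m - i))"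
  using a b c by (intro line_polyI) (simp add: poly_line_poly poly_sum)
 ultimately show "line_poly b x v dvd line_poly a x v"
  by (intro poly_integral_dvd[of _ _ m "\<lambda>i. line_poly (c i) x v"]) auto
qed (use that in blast)

text \<open>Near a root \<open>r\<close> of \<open>Q\<close> there is another representation
  \<open>p / q\<close> of \<open>h\<close>. It gives \<open>P * q = Q * p\<close>, so
  \<open>r\<close> is a root of \<open>P\<close>, and the linear factor can be cancelled without
  changing \<open>h\<close>.\<close>

lemma poly_regular_dvd:
 fixes P Q :: "'k::{alg_closed_field, field_char_0} poly" and h :: "'k => 'k"
 assumes "Q ~= 0" "!!t. poly Q t ~= 0 ==> poly P t = h t * poly Q t"
  and loc: "!!t. \<exists>p q. poly q t ~= 0 \<and> (\<forall>u. poly q u ~= 0 --> h u * poly q u = poly p u)"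
 shows "Q dvd P"
 using assms(1,2)
proof (induction "degree Q" arbitrary: P Q rule: less_induct)
 case less
 show ?case
 proof (cases "degree Q = 0")
  case True
  thus ?thesis using less.prems(1) is_unit_iff_degree unit_imp_dvd by blast
 next
  case False
  then obtain r where r: "poly Q r = 0" using alg_closed_imp_poly_has_root by blast
  then obtain Q1 where Q1: "Q = [:-r, 1:] * Q1" by (auto simp: poly_eq_0_iff_dvd)
  obtain p q where pq: "poly q r ~= 0" "!!u. poly q u ~= 0 ==> h u * poly q u = poly p u" using loc[of r] by blast
  have "q ~= 0" using pq(1) by auto
  have PQ: "P * q = Q * p"
  proof (rule poly_eq_cofinite[of "{t. poly Q t = 0} \<union> {t. poly q t = 0}"])
   show "finite ({t. poly Q t = 0} \<union> {t. poly q t = 0})"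
    using less.prems(1) \<open>q ~= 0\<close> by (simp add: poly_roots_finite)
   fix t assume "t \<notin> {t. poly Q t = 0} \<union> {t. poly q t = 0}"
   hence "poly P t = h t * poly Q t" "h t * poly q t = poly p t" using less.prems(2) pq(2) by auto
   thus "poly (P * q) t = poly (Q * p) t" by (metis mult.assoc mult.commute poly_mult)
  qed
  hence "poly P r * poly q r = poly Q r * poly p r" by (metis poly_mult)
  hence "poly P r = 0" using r pq(1) by simp
  then obtain P1 where P1: "P = [:-r, 1:] * P1" by (auto simp: poly_eq_0_iff_dvd)
  have "[:-r, 1:] * (P1 * q) = [:-r, 1:] * (Q1 * p)"
   using PQ unfolding P1 Q1 by (simp only: mult.assoc)
  hence PQ1: "P1 * q = Q1 * p" by (subst (asm) mult_left_cancel) auto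
  \<comment> \<open>After the cancellation, \<open>r\<close> itself may be a new point with nonzero
    denominator; there the equation comes from the local representation.\<close>
  have "poly P1 t = h t * poly Q1 t" if "poly Q1 t ~= 0" for t
  proof (cases "t = r")
   case True
   have "poly P1 r * poly q r = poly Q1 r * (h r * poly q r)"
    using PQ1 pq by (metis poly_mult)
   thus ?thesis using pq(1) True by simp
  next
   case False
   hence "poly Q t ~= 0" using that Q1 by simp
   hence "(t - r) * poly P1 t = (t - r) * (h t * poly Q1 t)"
    using less.prems(2)[of t] unfolding P1 Q1 by (simp add: algebra_simps)
   thus ?thesis using False by simp
  qed
  moreover have "Q1 ~= 0" "degree Q1 < degree Q"
   using less.prems(1) Q1 by (auto simp: degree_mult_eq simp del: mult_pCons_left)
  ultimately have "Q1 dvd P1" using less.hyps by blast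
  thus ?thesis unfolding P1 Q1 by (rule mult_dvd_mono[OF dvd_refl])
 qed
qed

text \<open>One local quotient \<open>a0 / b0\<close> already determines the polynomial: it divides
  out on every line, and the result agrees by density with the quotients near all other
  points.\<close>

lemma polys_regular:
 fixes h :: "'k::{alg_closed_field, field_char_0} ^ 'n::finite => 'k"
 assumes loc: "!!x. \<exists>a\<in>polys. \<exists>b\<in>polys. b x ~= 0 \<and> (\<forall>y. b y ~= 0 --> h y = a y / b y)"
 shows "h \<in> polys"
proof -
 obtain a0 b0 where 0: "a0 \<in> polys" "b0 \<in> polys" "b0 0 ~= 0" "!!y. b0 y ~= 0 ==> h y = a0 y / b0 y"
  using loc[of 0] by blast
 obtain q where q: "q \<in> polys" "!!x. a0 x = b0 x * q x"
 proof (rule polys_dvd_lines[OF 0(1-3)])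
  fix x v assume "line_poly b0 x v ~= 0"
  thus "line_poly b0 x v dvd line_poly a0 x v"
  proof (rule poly_regular_dvd[where h = "\<lambda>t. h (x + t *s v)"])
   show "poly (line_poly a0 x v) t = h (x + t *s v) * poly (line_poly b0 x v) t" if "poly (line_poly b0 x v) t ~= 0" for t
    using that 0 by (simp add: poly_line_poly)
   fix t
   obtain a b where ab: "a \<in> polys" "b \<in> polys" "b (x + t *s v) ~= 0" "!!y. b y ~= 0 ==> h y = a y / b y"
    using loc[of "x + t *s v"] by blast
   thus "\<exists>p q. poly q t ~= 0 \<and> (\<forall>u. poly q u ~= 0 --> h (x + u *s v) * poly q u = poly p u)"
    by (intro exI[of _ "line_poly a x v"] exI[of _ "line_poly b x v"]) (simp add: poly_line_poly)
  qed
 qed blast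
 have "h x = q x" for x
 proof -
  obtain a b where ab: "a \<in> polys" "b \<in> polys" "b x ~= 0" "!!y. b y ~= 0 ==> h y = a y / b y"
   using loc[of x] by blast
  have "a x = b x * q x"
  proof (rule polys_eq_dense[of a "\<lambda>x. b x * q x" b0 0])
   fix y assume y: "b0 y ~= 0"
   show "a y = b y * q y"
   proof (cases "b y = 0")
    case True
    \<comment> \<open>At a zero of \<open>b\<close> nothing is known about \<open>h\<close> from
      this representation. The factor \<open>b\<close> makes the identity true everywhere; it is
      then removed by density.\<close>
    have *: "a z * b0 z * b z = b z * q z * b0 z * b z" for z
     using 0(4)[of z] ab(4)[of z] q(2)[of z]
     by (cases "b0 z = 0"; cases "b z = 0") (auto simp: nonzero_divide_eq_eq mult.commute)
    have "a z * b0 z = b z * q z * b0 z" for z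
    proof (rule polys_eq_dense[of "\<lambda>z. a z * b0 z" "\<lambda>z. b z * q z * b0 z" b x])
     show "a y * b0 y = b y * q y * b0 y" if "b y ~= 0" for y using *[of y] that by simp
    qed (intro polys_mult 0 ab q)+
    from this[of y] y show ?thesis by simp
   next
    case False
    thus ?thesis using 0(4)[OF y] ab(4)[OF False] q(2)[of y] y by (simp add: field_simps)
   qed
  qed (intro polys_mult 0 ab q)+
  thus ?thesis using ab(3,4) by simp
 qed
 hence "h = q" by auto
 thus ?thesis using q(1) by simp
qed

subsection \<open>Directional derivatives\<close>

definition dir_deriv :: "('k::field_char_0 ^ 'n::finite => 'k) => 'k ^ 'n => 'k ^ 'n => 'k" where
 "dir_deriv f x v = coeff (line_poly f x v) 1"

lemma dir_deriv_const [simp]: "dir_deriv (\<lambda>x. c) x v = 0"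
 by (simp add: dir_deriv_def)

lemma dir_deriv_coord [simp]: "dir_deriv (\<lambda>x. x $ i) x v = v $ i"
 by (simp add: dir_deriv_def)

lemma dir_deriv_add:
 "f \<in> polys ==> g \<in> polys ==> dir_deriv (\<lambda>x. f x + g x) x v = dir_deriv f x v + dir_deriv g x v"
 by (simp add: dir_deriv_def line_poly_add)

lemma dir_deriv_mult:
 "f \<in> polys ==> g \<in> polys ==> dir_deriv (\<lambda>x. f x * g x) x v = dir_deriv f x v * g x + f x * dir_deriv g x v"
 using poly_line_poly[of f x v 0] poly_line_poly[of g x v 0]
 by (simp add: dir_deriv_def line_poly_mult coeff_mult poly_0_coeff_0)

lemma dir_deriv_power:
 assumes "f \<in> polys" shows "dir_deriv (\<lambda>x. f x ^ m) x v = of_nat m * f x ^ (m - 1) * dir_deriv f x v"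
proof (induction m)
 case (Suc m)
 have "dir_deriv (\<lambda>x. f x * f x ^ m) x v = dir_deriv f x v * f x ^ m + f x * dir_deriv (\<lambda>x. f x ^ m) x v"
  using assms by (intro dir_deriv_mult) auto
 thus ?case unfolding Suc by (cases m) (simp_all add: algebra_simps)
qed simp

lemma dir_deriv_linear:
 assumes "f \<in> polys"
 shows "dir_deriv f x (u + v) = dir_deriv f x u + dir_deriv f x v" "dir_deriv f x (c *s v) = c * dir_deriv f x v"
 using assms by (induction rule: polys_induct) (simp_all add: dir_deriv_add dir_deriv_mult algebra_simps)

section \<open>Graded rings of polynomial functions\<close>

interpretation fun_vs: vector_space "\<lambda>(c::'k::field) (f::'p => 'k) x. c * f x"
 by unfold_locales (auto simp: algebra_simps fun_eq_iff)

lemma sum_fun_eq: "(\<lambda>x. \<Sum>i\<in>I. f i x) = (\<Sum>i\<in>I. f i)" for f :: "'i => 'p => 'k::comm_monoid_add"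
 by (induction I rule: infinite_finite_induct) (auto simp: fun_eq_iff)

lemma fun_span_sum:
 fixes f :: "'i => 'p => 'k::field"
 assumes "!!i. i \<in> I ==> f i \<in> fun_vs.span S"
 shows "(\<lambda>x. \<Sum>i\<in>I. f i x) \<in> fun_vs.span S"
 unfolding sum_fun_eq using assms by (rule fun_vs.span_sum)

lemma fun_span_induct [consumes 1, case_names zero step]:
 fixes f :: "'p => 'k::field"
 assumes "f \<in> fun_vs.span S" "Q (\<lambda>x. 0)"
  and "!!c f g. f \<in> S ==> g \<in> fun_vs.span S ==> Q g ==> Q (\<lambda>x. c * f x + g x)"
 shows "Q f"
proof -
 have "f \<in> fun_vs.span S \<and> Q f"
  using assms(1)
 proof (induction rule: fun_vs.span_induct_alt)
  case base
  thus ?case using assms(2) fun_vs.span_zero by (simp add: zero_fun_def)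
 next
  case (step c f g)
  have e: "(\<lambda>x. c * f x + g x) = (\<lambda>x. c * f x) + g" by (simp add: fun_eq_iff)
  have "(\<lambda>x. c * f x) + g \<in> fun_vs.span S"
   by (rule fun_vs.span_add[OF fun_vs.span_scale[OF fun_vs.span_base[OF step(1)]] conjunct1[OF step(2)]])
  thus ?case using assms(3)[of f g c] step unfolding e by blast
 qed
 thus ?thesis ..
qed

lemma fun_span_lin:
 fixes f g :: "'p => 'k::field"
 assumes "f \<in> fun_vs.span S" "g \<in> fun_vs.span S"
 shows "(\<lambda>x. c * f x + g x) \<in> fun_vs.span S"
proof -
 have e: "(\<lambda>x. c * f x + g x) = (\<lambda>x. c * f x) + g" by (simp add: fun_eq_iff)
 show ?thesis unfolding e by (intro fun_vs.span_add fun_vs.span_scale assms)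
qed

section \<open>Monomials and homogeneous polynomials\<close>

definition monomial :: "('n::finite => nat) => 'k::field ^ 'n => 'k" where
 "monomial e x = (\<Prod>i\<in>UNIV. x $ i ^ e i)"

lemma homog_polys_eq: "homog_polys m = fun_vs.span {monomial e |e. sum e UNIV = m}"
 by (simp add: homog_polys_def monomial_def[abs_def])

lemma monomial_polys [simp]: "monomial e \<in> polys"
 unfolding monomial_def[abs_def] by (intro polys_prod polys_power polys_coord)

lemma monomial_smult: "monomial e (t *s x) = t ^ sum e UNIV * monomial e x"
 by (simp add: monomial_def power_mult_distrib prod.distrib power_sum)

lemma monomial_mult: "monomial e x * monomial e' x = monomial (\<lambda>i. e i + e' i) x"
 by (simp add: monomial_def power_add prod.distrib)

lemma homog_polysD:
 assumes "f \<in> homog_polys m" shows "f \<in> polys" "f (t *s x) = t ^ m * f x"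
proof -
 have "f \<in> polys \<and> (\<forall>t x. f (t *s x) = t ^ m * f x)"
  using assms unfolding homog_polys_eq
 proof (induction rule: fun_span_induct)
  case (step c f g)
  then obtain e where "f = monomial e" "sum e UNIV = m" by auto
  thus ?case using step by (auto simp: monomial_smult algebra_simps intro!: polys_add polys_scale)
 qed auto
 thus "f \<in> polys" "f (t *s x) = t ^ m * f x" by auto
qed

lemma homog_polys_mult:
 fixes f g :: "'k::field ^ 'n::finite => 'k"
 assumes "f \<in> homog_polys i" "g \<in> homog_polys j" shows "(\<lambda>x. f x * g x) \<in> homog_polys (i + j)"
 using assms(1) unfolding homog_polys_eq
proof (induction rule: fun_span_induct)
 case zero
 thus ?case using fun_vs.span_zero by (simp add: zero_fun_def)
next
 case (step c f h)
 obtain e where e: "f = monomial e" "sum e UNIV = i" using step by auto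
 have "(\<lambda>x. f x * g x) \<in> fun_vs.span {monomial e |e. sum e UNIV = i + j}"
  using assms(2) unfolding homog_polys_eq
 proof (induction rule: fun_span_induct)
  case zero
  thus ?case using fun_vs.span_zero by (simp add: zero_fun_def)
 next
  case (step c g h)
  obtain e' where e': "g = monomial e'" "sum e' UNIV = j" using step by auto
  have "(\<lambda>x. f x * g x) = monomial (\<lambda>i. e i + e' i)" by (simp add: e e' monomial_mult)
  moreover have "(monomial (\<lambda>i. e i + e' i) :: 'k ^ 'n => 'k) \<in> {monomial e |e. sum e UNIV = i + j}"
   using e e' by (auto simp: sum.distrib)
  ultimately have "(\<lambda>x. f x * g x) \<in> fun_vs.span {monomial e |e. sum e UNIV = i + j}"
   by (simp only: fun_vs.span_base)
  from fun_span_lin[OF this step(3), of c] show ?case by (simp add: algebra_simps)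
 qed
 from fun_span_lin[OF this step(3), of c] show ?case by (simp add: algebra_simps)
qed

lemma hcomp_coord: "hcomp i (\<lambda>x. x $ j) = (\<lambda>x. if i = 1 then x $ j else 0)"
 by (rule hcomp_homogeneous) simp

text \<open>The bridge between homogeneity as a scaling rule, on which \<open>hcomp\<close> is
  built, and homogeneity as membership in a span of monomials.\<close>

lemma hcomp_homog_polys:
 fixes f :: "'k::field_char_0 ^ 'n::finite => 'k"
 assumes "f \<in> polys" shows "hcomp m f \<in> homog_polys m"
 using assms
proof (induction arbitrary: m rule: polys_induct)
 case (const c)
 have *: "(\<lambda>x. 0) \<in> homog_polys m"
  unfolding homog_polys_eq using fun_vs.span_zero by (simp add: zero_fun_def)
 show ?case
 proof (cases "m = 0")
  case True
  have "monomial (\<lambda>_. 0) \<in> homog_polys 0" unfolding homog_polys_eq by (rule fun_vs.span_base) auto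
  hence "(\<lambda>x. c * monomial (\<lambda>_. 0) x) \<in> homog_polys 0"
   unfolding homog_polys_eq by (rule fun_vs.span_scale)
  thus ?thesis using True by (simp add: hcomp_const monomial_def)
 qed (use * in "simp add: hcomp_const")
next
 case (coord i)
 have *: "(\<lambda>x. 0) \<in> homog_polys m"
  unfolding homog_polys_eq using fun_vs.span_zero by (simp add: zero_fun_def)
 show ?case
 proof (cases "m = 1")
  case True
  have "(monomial (\<lambda>j. if j = i then 1 else 0) :: 'k ^ 'n => 'k) = (\<lambda>x. x $ i)"
  proof
   fix x :: "'k ^ 'n"
   have "monomial (\<lambda>j. if j = i then 1 else 0) x = (\<Prod>j\<in>UNIV. if j = i then x $ j else 1)"
    unfolding monomial_def by (intro prod.cong) auto
   thus "monomial (\<lambda>j. if j = i then 1 else 0) x = x $ i" by simp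
  qed
  moreover have "(monomial (\<lambda>j. if j = i then 1 else 0) :: 'k ^ 'n => 'k) \<in> homog_polys 1"
   unfolding homog_polys_eq by (rule fun_vs.span_base) (auto intro!: exI[of _ "\<lambda>j. if j = i then 1 else 0"])
  ultimately have "(\<lambda>x::'k ^ 'n. x $ i) \<in> homog_polys 1" by (simp only:)
  thus ?thesis using True by (simp add: hcomp_coord)
 qed (use * in "simp add: hcomp_coord")
next
 case (add f g)
 have "(\<lambda>x. 1 * hcomp m f x + hcomp m g x) \<in> homog_polys m"
  using add unfolding homog_polys_eq by (intro fun_span_lin) auto
 thus ?case using add by (simp add: hcomp_add)
next
 case (mult f g)
 have "(\<lambda>x. \<Sum>k\<le>m. hcomp k f x * hcomp (m - k) g x) \<in> homog_polys m"
  unfolding homog_polys_eq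
 proof (rule fun_span_sum)
  fix k assume "k \<in> {..m}"
  thus "(\<lambda>x. hcomp k f x * hcomp (m - k) g x) \<in> fun_vs.span {monomial e |e. sum e UNIV = m}"
   using homog_polys_mult[OF mult(3)[of k] mult(4)[of "m - k"]] unfolding homog_polys_eq by simp
 qed
 thus ?case using mult by (simp add: hcomp_mult)
qed

lemma homog_polysI:
 fixes f :: "'k::field_char_0 ^ 'n::finite => 'k"
 assumes "f \<in> polys" "!!t x. f (t *s x) = t ^ m * f x" shows "f \<in> homog_polys m"
 using hcomp_homog_polys[OF assms(1), of m] hcomp_homogeneous[of f m m] assms(2) by simp

text \<open>The degrees of the forms occurring in the ring with parameters \<open>d\<close> and
  \<open>s\<close>. For \<open>s = 0\<close> these are all multiples of \<open>d\<close>, the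
  degrees of invariants of the roots of unity.\<close>

definition admissible :: "nat => nat => nat => bool" where
 "admissible d s i \<longleftrightarrow> i = 0 \<or> d dvd i \<and> s * d \<le> i"

lemma admissible_add: "admissible d s i ==> admissible d s j ==> admissible d s (i + j)"
 by (auto simp: admissible_def)

lemma admissible_add_large: "admissible d 0 i ==> admissible d s j ==> 0 < j ==> admissible d s (i + j)"
 by (auto simp: admissible_def)

lemma admissible_mono: "admissible d s i ==> admissible d 0 i"
 by (auto simp: admissible_def)

lemma admissible_large: "s \<le> k ==> admissible d s (k * d)"
 by (auto simp: admissible_def)

text \<open>The direct sum is turned into a condition on components, so that membership can be
  checked degree by degree.\<close>

lemma A_ring_iff:
 fixes f :: "'k::field_char_0 ^ 'n::finite => 'k"
 assumes d: "0 < d"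
 shows "f \<in> A_ring d s \<longleftrightarrow> f \<in> polys \<and> (\<forall>i. \<not> admissible d s i --> hcomp i f = (\<lambda>x. 0))"
proof
 assume "f \<in> A_ring d s"
 thus "f \<in> polys \<and> (\<forall>i. \<not> admissible d s i --> hcomp i f = (\<lambda>x. 0))"
  unfolding A_ring_def
 proof (induction rule: fun_span_induct)
  case (step c f g)
  consider a where "f = (\<lambda>x. a)" | k where "k \<ge> s" "f \<in> homog_polys (k * d)" using step(1) by auto
  hence "f \<in> polys \<and> (\<forall>i. \<not> admissible d s i --> hcomp i f = (\<lambda>x. 0))"
  proof cases
   case 1
   thus ?thesis by (auto simp: hcomp_const admissible_def)
  next
   case 2
   have "hcomp i f = (\<lambda>x. if i = k * d then f x else 0)" for i
    by (rule hcomp_homogeneous) (rule homog_polysD[OF 2(2)])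
   thus ?thesis using 2 homog_polysD(1)[OF 2(2)] by (auto simp: admissible_def fun_eq_iff)
  qed
  thus ?case using step(3) by (auto simp: hcomp_add hcomp_scale polys_scale intro!: polys_add)
 qed (auto simp: hcomp_const)
next
 assume f: "f \<in> polys \<and> (\<forall>i. \<not> admissible d s i --> hcomp i f = (\<lambda>x. 0))"
 obtain N where N: "!!i x. N < i ==> hcomp i f x = 0" using hcomp_bounded f by blast
 have "(\<lambda>x. \<Sum>i\<le>N. hcomp i f x) \<in> A_ring d s"
  unfolding A_ring_def
 proof (rule fun_span_sum)
  fix i assume "i \<in> {..N}"
  show "hcomp i f \<in> fun_vs.span (range (\<lambda>c x. c) \<union> (\<Union>k\<in>{s..}. homog_polys (k * d)))"
  proof (cases "admissible d s i")
   case False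
   thus ?thesis using f fun_vs.span_zero by (simp add: zero_fun_def)
  next
   case True
   have "hcomp 0 f = (\<lambda>x. f 0)" using f hcomp_0 by auto
   moreover have "hcomp i f \<in> homog_polys i" using f hcomp_homog_polys by blast
   moreover have "\<exists>k\<ge>s. i = k * d" if "i ~= 0"
    using True that d by (auto simp: admissible_def mult.commute elim!: dvdE)
   ultimately show ?thesis by (cases "i = 0") (auto intro!: fun_vs.span_base)
  qed
 qed
 moreover have "f = (\<lambda>x. \<Sum>i\<le>N. hcomp i f x)" using hcomp_expand[of f N] f N by auto
 ultimately show "f \<in> A_ring d s" by (simp only:)
qed

text \<open>Both rings are instances, with \<open>s = 0\<close> for the invariants. Keeping
  \<open>S\<close> as a parameter lets the two instances be compared inside one larger
  locale.\<close>

locale graded_ring =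
 fixes d s :: nat and S :: "('k::{alg_closed_field, field_char_0} ^ 'n::finite => 'k) set"
 assumes d_pos: "0 < d" and S_eq: "S = A_ring d s"
begin

lemma polys: "f \<in> S ==> f \<in> polys"
 by (simp add: S_eq A_ring_iff[OF d_pos])

lemma hcomp_zero: "f \<in> S ==> \<not> admissible d s i ==> hcomp i f = (\<lambda>x. 0)"
 by (simp add: S_eq A_ring_iff[OF d_pos])

lemma subalg_S: "subalg UNIV S"
 unfolding subalg_def
proof (intro conjI ballI allI)
 fix f g assume fg: "f \<in> S" "g \<in> S"
 show "(\<lambda>x\<in>UNIV. f x + g x) \<in> S"
  using fg by (auto simp: S_eq A_ring_iff[OF d_pos] hcomp_add)
 have "hcomp i (\<lambda>x. f x * g x) = (\<lambda>x. 0)" if "\<not> admissible d s i" for i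
 proof -
  have "hcomp k f x * hcomp (i - k) g x = 0" if "k \<le> i" for k x
  proof (cases "admissible d s k")
   case True
   hence "\<not> admissible d s (i - k)"
    using admissible_add[of d s k "i - k"] \<open>\<not> admissible d s i\<close> that by auto
   thus ?thesis using hcomp_zero[OF fg(2)] by simp
  qed (use hcomp_zero[OF fg(1)] in simp)
  thus ?thesis using fg
   by (subst hcomp_mult) (auto simp: local.polys intro!: ext sum.neutral simp del: mult_eq_0_iff)
 qed
 thus "(\<lambda>x\<in>UNIV. f x * g x) \<in> S"
  using fg by (auto simp: S_eq A_ring_iff[OF d_pos])
qed (auto simp: S_eq A_ring_iff[OF d_pos] hcomp_const admissible_def extensional_def)

lemma const: "(\<lambda>x. c) \<in> S"
 using subalg_const[OF subalg_S, of c] by simp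

lemma add: "f \<in> S ==> g \<in> S ==> (\<lambda>x. f x + g x) \<in> S"
 using subalg_add[OF subalg_S, of f g] by simp

lemma mult: "f \<in> S ==> g \<in> S ==> (\<lambda>x. f x * g x) \<in> S"
 using subalg_mult[OF subalg_S, of f g] by simp

lemma scale: "f \<in> S ==> (\<lambda>x. c * f x) \<in> S"
 using subalg_scale[OF subalg_S, of f c] by simp

lemma power: "f \<in> S ==> (\<lambda>x. f x ^ m) \<in> S"
 using subalg_power[OF subalg_S, of f m] by simp

lemma sum: "(!!i. i \<in> I ==> f i \<in> S) ==> (\<lambda>x. \<Sum>i\<in>I. f i x) \<in> S"
 using subalg_sum[OF subalg_S, of I f] by simp

lemma prod: "(!!i. i \<in> I ==> f i \<in> S) ==> (\<lambda>x. \<Prod>i\<in>I. f i x) \<in> S"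
 using subalg_prod[OF subalg_S, of I f] by simp

lemma subst: "f \<in> polys ==> (!!i. w i \<in> S) ==> (\<lambda>x. f (\<chi> i. w i x)) \<in> S"
 using polys_subst[OF _ subalg_S, of f w] by simp

lemma homogI:
 assumes "f \<in> polys" "!!t x. f (t *s x) = t ^ m * f x" "admissible d s m" shows "f \<in> S"
 using assms hcomp_homogeneous[OF assms(2)] by (auto simp: S_eq A_ring_iff[OF d_pos])

lemma hcomp: "f \<in> S ==> hcomp i f \<in> S"
 by (auto simp: S_eq A_ring_iff[OF d_pos] hcomp_hcomp fun_eq_iff)

lemma monomial: "admissible d s (sum e UNIV) ==> monomial e \<in> S"
 by (rule local.homogI) (auto simp: monomial_smult)

lemma coord_power: "admissible d s m ==> (\<lambda>x. x $ i ^ m) \<in> S"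
 by (rule local.homogI) (auto simp: power_mult_distrib)

lemma matrix:
 assumes "f \<in> S" shows "(\<lambda>x. f (M *v x)) \<in> S"
proof -
 have f: "f \<in> polys" using local.polys assms by simp
 have "(\<lambda>x. f (M *v x)) \<in> polys"
  by (rule polys_comp[OF f]) (simp add: matrix_vector_mult_def, intro polys_sum polys_scale polys_coord)
 thus ?thesis using assms by (simp add: S_eq A_ring_iff[OF d_pos] hcomp_matrix)
qed

text \<open>Multiplication by \<open>b\<close> shifts all degrees by \<open>k * d\<close>, into the
  range where the ring contains all multiples of \<open>d\<close>. Such forms lie in the conductor
  of \<open>S\<close> in the invariant ring.\<close>

lemma conductor:
 assumes "f \<in> A_ring d 0" "b \<in> polys" "!!t x. b (t *s x) = t ^ (k * d) * b x" "s \<le> k" "0 < k"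
 shows "(\<lambda>x. f x * b x) \<in> S"
proof -
 have f: "f \<in> polys" "!!i. \<not> admissible d 0 i ==> hcomp i f = (\<lambda>x. 0)"
  using assms(1) by (auto simp: A_ring_iff[OF d_pos])
 have b: "hcomp j b = (\<lambda>x. if j = k * d then b x else 0)" for j
  by (rule hcomp_homogeneous) (rule assms(3))
 have "hcomp i (\<lambda>x. f x * b x) = (\<lambda>x. 0)" if i: "\<not> admissible d s i" for i
 proof -
  have "hcomp j f x * hcomp (i - j) b x = 0" if "j \<le> i" for j x
  proof (cases "admissible d 0 j \<and> i - j = k * d")
   case True
   hence "admissible d s (j + k * d)"
    using assms(4,5) d_pos by (intro admissible_add_large admissible_large) auto
   moreover have "j + k * d = i" using True that by linarith
   ultimately show ?thesis using i by simp
  qed (use f(2)[of j] b in auto)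
  thus ?thesis using f(1) assms(2)
   by (subst hcomp_mult) (auto intro!: ext sum.neutral simp del: mult_eq_0_iff)
 qed
 thus ?thesis using f(1) assms(2) by (auto simp: S_eq A_ring_iff[OF d_pos])
qed

lemma subset_invariants: "S \<subseteq> A_ring d 0"
 using admissible_mono[of d s] unfolding S_eq A_ring_iff[OF d_pos] subset_iff by metis

subsection \<open>Points of the spectrum\<close>

definition ev :: "'k ^ 'n => ('k ^ 'n => 'k) => 'k" where
 "ev x = (\<lambda>f\<in>S. f x)"

lemma ev_apply [simp]: "f \<in> S ==> ev x f = f x"
 by (simp add: ev_def)

lemma ev_eq_iff: "ev x = ev y \<longleftrightarrow> (\<forall>f\<in>S. f x = f y)"
 by (auto simp: ev_def restrict_def fun_eq_iff)

context
 fixes \<phi> assumes \<phi>: "\<phi> \<in> alg_homs UNIV S"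
begin

lemma hom_const: "\<phi> (\<lambda>x. c) = c"
 using \<phi> by (simp add: alg_homs_def)

lemma hom_add: "f \<in> S ==> g \<in> S ==> \<phi> (\<lambda>x. f x + g x) = \<phi> f + \<phi> g"
 using \<phi> by (simp add: alg_homs_def)

lemma hom_mult: "f \<in> S ==> g \<in> S ==> \<phi> (\<lambda>x. f x * g x) = \<phi> f * \<phi> g"
 using \<phi> by (simp add: alg_homs_def)

lemma hom_scale: "f \<in> S ==> \<phi> (\<lambda>x. c * f x) = c * \<phi> f"
 using hom_mult[OF const, of f c] hom_const by simp

lemma hom_power: "f \<in> S ==> \<phi> (\<lambda>x. f x ^ m) = \<phi> f ^ m"
proof (induction m)
 case (Suc m)
 thus ?case using hom_mult[OF Suc.prems power[OF Suc.prems]] by simp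
qed (simp add: hom_const)

lemma hom_sum: "(!!i. i \<in> I ==> f i \<in> S) ==> \<phi> (\<lambda>x. \<Sum>i\<in>I. f i x) = (\<Sum>i\<in>I. \<phi> (f i))"
proof (induction I rule: infinite_finite_induct)
 case (insert i I)
 have "\<phi> (\<lambda>x. f i x + (\<Sum>i\<in>I. f i x)) = \<phi> (f i) + \<phi> (\<lambda>x. \<Sum>i\<in>I. f i x)"
  using insert.prems by (intro hom_add sum) auto
 thus ?case using insert by simp
qed (simp_all add: hom_const)

lemma hom_subst: "g \<in> polys ==> (!!i. w i \<in> S) ==> \<phi> (\<lambda>x. g (\<chi> i. w i x)) = g (\<chi> i. \<phi> (w i))"
proof (induction rule: polys_induct)
 case (add f g)
 thus ?case using hom_add[OF subst subst, of f w g w] by simp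
next
 case (mult f g)
 thus ?case using hom_mult[OF subst subst, of f w g w] by simp
qed (simp_all add: hom_const)

lemma hom_eq_evI:
 assumes "!!g m. g \<in> S ==> (!!t x. g (t *s x) = t ^ m * g x) ==> admissible d s m ==> \<phi> g = g z"
 shows "\<phi> = ev z"
proof
 fix f
 show "\<phi> f = ev z f"
 proof (cases "f \<in> S")
  case True
  note f = polys[OF True]
  obtain N where N: "!!i x. N < i ==> hcomp i f x = 0" using hcomp_bounded[OF f] by blast
  have *: "f = (\<lambda>x. \<Sum>i\<le>N. hcomp i f x)" using hcomp_expand[OF f N] by auto
  have **: "\<phi> (hcomp i f) = hcomp i f z" for i
  proof (cases "admissible d s i")
   case True
   thus ?thesis using hcomp[OF \<open>f \<in> S\<close>] hcomp_smult[OF f] by (intro assms) auto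
  next
   case False
   thus ?thesis using hcomp_zero[OF \<open>f \<in> S\<close> False] hom_const by simp
  qed
  have "\<phi> f = \<phi> (\<lambda>x. \<Sum>i\<le>N. hcomp i f x)" by (rule arg_cong[OF *])
  also have "\<dots> = (\<Sum>i\<le>N. hcomp i f z)" using hcomp[OF True] by (simp add: hom_sum **)
  also have "\<dots> = f z" using hcomp_expand[OF f N] by simp
  finally show ?thesis using True by simp
 next
  case False
  thus ?thesis using \<phi> by (auto simp: alg_homs_def ev_def extensional_def)
 qed
qed

text \<open>
 A homogeneous \<open>g\<close> of degree \<open>m\<close> satisfies \<open>g x * x j ^ ((M - 1) * m) = g w\<close> for
 \<open>w i = x i * x j ^ (M - 1)\<close>, so \<open>\<phi>\<close> is determined by its values on the \<open>w i\<close> and on the powers of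
 a coordinate on which it does not vanish.
\<close>

lemma hom_is_ev: "\<exists>z. \<phi> = ev z"
proof -
 \<comment> \<open>One more than \<open>s\<close>: then \<open>M\<close> is positive even for
   \<open>s = 0\<close>, and \<open>s \<le> M - 1\<close>, so that the powers of \<open>x j\<close>
   used below lie in \<open>S\<close>.\<close>
 define K where "K = Suc s"
 define M where "M = K * d"
 have M: "admissible d s M" "0 < M" using d_pos admissible_large[of s K d] by (simp_all add: M_def K_def)
 show ?thesis
 proof (cases "\<forall>j. \<phi> (\<lambda>x. x $ j ^ M) = 0")
  case True
  have "\<phi> g = g 0" if g: "g \<in> S" "!!t x. g (t *s x) = t ^ m * g x" "admissible d s m" for g m
  proof (cases "m = 0")
   case True
   have "g x = g 0" for x using g(2)[of 0 x] True by simp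
   hence "g = (\<lambda>x. g 0)" by auto
   thus ?thesis using hom_const by metis
  next
   case False
   \<comment> \<open>The \<open>M\<close>-th power of the monomial is the same monomial in the
     functions \<open>x i ^ M\<close>, on which \<open>\<phi>\<close> vanishes.\<close>
   have mon: "monomial e \<in> S \<and> \<phi> (monomial e) = 0" if e: "sum e UNIV = m" for e
   proof
    show e': "monomial e \<in> S" using monomial g(3) e by simp
    obtain j where j: "e j ~= 0" using e False by (metis sum.neutral)
    have "monomial e (\<chi> i. x $ i ^ M) = monomial e x ^ M" for x :: "'k ^ 'n"
     by (simp add: monomial_def prod_power_distrib flip: power_mult) (simp add: mult.commute)
    moreover have "\<phi> (\<lambda>x. monomial e (\<chi> i. x $ i ^ M)) = monomial e (\<chi> i. \<phi> (\<lambda>x. x $ i ^ M))"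
     using coord_power[OF M(1)] by (intro hom_subst) auto
    moreover have "monomial e (\<chi> i. \<phi> (\<lambda>x. x $ i ^ M)) = 0"
     using j True by (auto simp: monomial_def zero_vec_def prod_zero_iff intro!: exI[of _ j])
    ultimately have "\<phi> (monomial e) ^ M = 0" using hom_power[OF e', of M] by simp
    thus "\<phi> (monomial e) = 0" by simp
   qed
   have "g \<in> homog_polys m" using g polys by (intro homog_polysI) auto
   hence "g \<in> S \<and> \<phi> g = 0" unfolding homog_polys_eq
   proof (induction rule: fun_span_induct)
    case (step c f g)
    hence "f \<in> S \<and> \<phi> f = 0" using mon by auto
    thus ?case using step(3) hom_add[OF scale, of f g c] hom_scale[of f c] add[OF scale, of f g c] by simp
   qed (use const hom_const in auto)
   moreover have "g 0 = 0" using g(2)[of 0 0] False by (simp add: power_0_left)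
   ultimately show ?thesis by simp
  qed
  hence "\<phi> = ev 0" by (intro hom_eq_evI) auto
  thus ?thesis by blast
 next
  case False
  then obtain j where j: "\<phi> (\<lambda>x. x $ j ^ M) ~= 0" by auto
  define a where "a l = \<phi> (\<lambda>x. x $ j ^ (l * d))" for l
  have aS: "(\<lambda>x. x $ j ^ (l * d)) \<in> S" if "s \<le> l" for l
   using that by (intro coord_power admissible_large)
  have aK: "a K ~= 0" using j by (simp add: a_def M_def)
  \<comment> \<open>The value which \<open>\<phi>\<close> would take at \<open>x j ^ d\<close>, a
    function that need not lie in \<open>S\<close>.\<close>
  define c where "c = a (Suc K) / a K"
  have ac: "a l = c ^ l" if l: "s \<le> l" for l
  proof -
   have "a l * a K ^ l = \<phi> (\<lambda>x. x $ j ^ (l * d) * (x $ j ^ (K * d)) ^ l)"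
    using aS[OF l] aS[of K] by (simp add: hom_mult hom_power power a_def K_def)
   also have "(\<lambda>x. x $ j ^ (l * d) * (x $ j ^ (K * d)) ^ l) = (\<lambda>x::'k ^ 'n. (x $ j ^ (Suc K * d)) ^ l)"
    by (simp add: algebra_simps flip: power_mult power_add)
   also have "\<phi> \<dots> = a (Suc K) ^ l" using aS[of "Suc K"] unfolding a_def K_def by (intro hom_power) auto
   finally show ?thesis using aK by (simp add: c_def power_divide field_simps)
  qed
  have "c ~= 0" using ac[of K] aK by (auto simp: K_def)
  \<comment> \<open>The root \<open>t\<close> is to be the coordinate \<open>j\<close> of the point.
    Another choice of root changes the whole point by a root of unity.\<close>
  obtain t where t: "t ^ d = c" using nth_root_exists[OF d_pos] by blast
  hence t0: "t ~= 0" using \<open>c ~= 0\<close> d_pos by auto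
  define w where "w i = (\<lambda>x::'k ^ 'n. x $ i * x $ j ^ (M - 1))" for i
  have wS: "w i \<in> S" for i
  proof (rule homogI[OF _ _ M(1)])
   show "w i \<in> polys" unfolding w_def by (intro polys_mult polys_power polys_coord)
   have "t ^ M = t * t ^ (M - 1)" for t :: 'k using M(2) by (simp flip: power_Suc)
   thus "w i (t *s x) = t ^ M * w i x" for t x by (simp add: w_def power_mult_distrib)
  qed
  define z where "z = (\<chi> i. \<phi> (w i) / t ^ (M - 1))"
  have z: "(\<chi> i. \<phi> (w i)) = t ^ (M - 1) *s z" using t0 by (simp add: z_def vec_eq_iff)
  have "\<phi> g = g z" if g: "g \<in> S" "!!t x. g (t *s x) = t ^ m * g x" "admissible d s m" for g m
  proof -
   have 1: "\<phi> (\<lambda>x. x $ j ^ ((M - 1) * m)) = t ^ ((M - 1) * m) \<and> (\<lambda>x. x $ j ^ ((M - 1) * m)) \<in> S"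
   proof (cases "m = 0")
    case False
    then obtain k where k: "m = k * d" using g(3) by (auto simp: admissible_def elim!: dvdE simp: mult.commute)
    have "s \<le> (M - 1) * k"
    proof -
     have "1 \<le> k" using k False by (cases k) auto
     moreover have "s \<le> M - 1" using d_pos by (cases d) (auto simp: M_def K_def)
     ultimately show ?thesis using mult_le_mono[of s "M - 1" 1 k] by simp
    qed
    thus ?thesis using ac[of "(M - 1) * k"] aS[of "(M - 1) * k"] t
     by (simp add: a_def k mult.assoc flip: power_mult) (simp add: mult_ac power_mult)
   qed (use const hom_const in simp)
   have "(\<lambda>x. g x * x $ j ^ ((M - 1) * m)) = (\<lambda>x. g (\<chi> i. w i x))"
   proof
    fix x
    have "(\<chi> i. w i x) = x $ j ^ (M - 1) *s x" by (simp add: w_def vec_eq_iff mult.commute)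
    thus "g x * x $ j ^ ((M - 1) * m) = g (\<chi> i. w i x)" using g(2) by (simp add: mult.commute flip: power_mult)
   qed
   hence "\<phi> g * t ^ ((M - 1) * m) = g (\<chi> i. \<phi> (w i))"
    using hom_mult[OF g(1) conjunct2[OF 1]] 1 hom_subst[OF polys[OF g(1)] wS] by simp
   thus ?thesis using g(2) t0 unfolding z by (simp add: power_mult)
  qed
  hence "\<phi> = ev z" by (intro hom_eq_evI) auto
  thus ?thesis by blast
 qed
qed

end

lemma ev_in_homs: "ev x \<in> alg_homs UNIV S"
 using const add mult by (auto simp: alg_homs_def ev_def)

lemma alg_homs_S: "alg_homs UNIV S = range ev"
 using hom_is_ev ev_in_homs by auto

subsection \<open>The spectrum as a space with functions\<close>

abbreviation Z :: "(('k ^ 'n => 'k) => 'k, 'k) fspace" where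
 "Z \<equiv> A_var d s"

definition hat :: "('k ^ 'n => 'k) => (('k ^ 'n => 'k) => 'k) => 'k" where
 "hat f = (\<lambda>\<phi>\<in>range ev. \<phi> f)"

lemma hat_ev: "f \<in> S ==> hat f (ev x) = f x"
 by (simp add: hat_def)

lemma A_var_eq: "Z = frac_space {(range ev, hat ` S)}"
 unfolding A_var_def Spec_def S_eq[symmetric] alg_homs_S hat_def ..

lemma restrict_hat:
 assumes "g \<in> S" "!!x. h (ev x) = g x" shows "restrict h (range ev) = hat g"
 using assms by (auto simp: hat_def restrict_def fun_eq_iff)

lemma subalg_hat: "subalg (range ev) (hat ` S)"
 unfolding subalg_def
proof (intro conjI allI ballI)
 show "(\<lambda>x\<in>range ev. c) \<in> hat ` S" for c
  by (rule image_eqI[OF restrict_hat const]) (auto intro: const)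
 fix f g assume "f \<in> hat ` S" "g \<in> hat ` S"
 then obtain f' g' where *: "f = hat f'" "g = hat g'" "f' \<in> S" "g' \<in> S" by auto
 show "(\<lambda>x\<in>range ev. f x + g x) \<in> hat ` S"
  by (rule image_eqI[OF restrict_hat add[OF *(3,4)]]) (use * in "auto intro: add simp: hat_ev")
 show "(\<lambda>x\<in>range ev. f x * g x) \<in> hat ` S"
  by (rule image_eqI[OF restrict_hat mult[OF *(3,4)]]) (use * in "auto intro: mult simp: hat_ev")
qed (auto simp: hat_def)

lemma fun_space_A_var: "fun_space (Z)"
 unfolding A_var_eq by (intro fun_space_frac_space frac_base_single subalg_hat)

lemma pts_A_var: "pts (Z) = range ev"
 unfolding A_var_eq pts_frac_space[OF frac_base_single[OF subalg_hat]] by simp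

text \<open>Points of the spectrum are replaced by representatives in \<open>k ^ n\<close>; from
  here on open sets and regular functions are handled through elements of \<open>S\<close>,
  evaluated at representatives.\<close>

lemma openin_A_var:
 "openin (ftop (Z)) W \<longleftrightarrow> W \<subseteq> range ev \<and>
   (\<forall>x. ev x \<in> W --> (\<exists>u\<in>S. u x ~= 0 \<and> (\<forall>y. u y ~= 0 --> ev y \<in> W)))" (is "_ \<longleftrightarrow> ?R")
proof
 assume W: "openin (ftop (Z)) W"
 show ?R
 proof (intro conjI allI impI)
  show "W \<subseteq> range ev" using openin_subset[OF W] pts_A_var by simp
  fix x assume xW: "ev x \<in> W"
  obtain U F u where 1: "(U, F) \<in> {(range ev, hat ` S)}" "u \<in> F" "ev x \<in> U" "u (ev x) ~= 0" "{y\<in>U. u y ~= 0} \<subseteq> W"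
   by (rule openin_frac_spaceE[OF frac_base_single[OF subalg_hat] W[unfolded A_var_eq] xW])
  from 1(1,2) obtain f where f: "f \<in> S" "u = hat f" by auto
  show "\<exists>u\<in>S. u x ~= 0 \<and> (\<forall>y. u y ~= 0 --> ev y \<in> W)"
  proof (rule bexI[of _ f], intro conjI allI impI)
   show "f x ~= 0" using 1(4) f by (simp add: hat_ev)
   show "ev y \<in> W" if "f y ~= 0" for y
    using subsetD[OF 1(5), of "ev y"] 1(1) that f by (simp add: hat_ev)
  qed (rule f(1))
 qed
next
 assume R: ?R
 show "openin (ftop (Z)) W"
  unfolding A_var_eq openin_frac_space[OF frac_base_single[OF subalg_hat]]
 proof
  fix p assume p: "p \<in> W"
  then obtain x where x: "p = ev x" using R by auto
  from R p x have "\<exists>u\<in>S. u x ~= 0 \<and> (\<forall>y. u y ~= 0 --> ev y \<in> W)" by simp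
  then obtain u where u: "u \<in> S" "u x ~= 0" "!!y. u y ~= 0 ==> ev y \<in> W" by (elim bexE conjE) simp
  show "\<exists>U F u. (U, F) \<in> {(range ev, hat ` S)} \<and> u \<in> F \<and> p \<in> U \<and> u p ~= 0 \<and> {y \<in> U. u y ~= 0} \<subseteq> W"
   by (intro exI[of _ "range ev"] exI[of _ "hat ` S"] exI[of _ "hat u"])
    (use u x in "auto simp: hat_ev")
 qed
qed

lemma openin_A_var_nonzero: "u \<in> S ==> openin (ftop (Z)) (ev ` {x. u x ~= 0})"
 unfolding openin_A_var by (auto simp: ev_eq_iff intro!: bexI[of _ u]; metis)

lemma freg_A_var:
 "h \<in> freg (Z) W \<longleftrightarrow> openin (ftop (Z)) W \<and> h \<in> extensional W \<and>
   (\<forall>x. ev x \<in> W --> (\<exists>a\<in>S. \<exists>b\<in>S. b x ~= 0 \<and> (\<forall>y. b y ~= 0 --> ev y \<in> W \<and> h (ev y) = a y / b y)))"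
  (is "_ \<longleftrightarrow> _ \<and> _ \<and> ?R")
proof -
 have "(\<forall>p\<in>W. \<exists>U F a b. (U, F) \<in> {(range ev, hat ` S)} \<and> a \<in> F \<and> b \<in> F \<and> p \<in> U \<and> b p ~= 0 \<and>
    (\<forall>y\<in>U. b y ~= 0 --> y \<in> W \<and> h y = a y / b y)) \<longleftrightarrow> ?R" (is "?L \<longleftrightarrow> _")
  if W: "openin (ftop (Z)) W"
 proof
  assume L: ?L
  show ?R
  proof (intro allI impI)
   fix x assume "ev x \<in> W"
   from bspec[OF L this] obtain f g where fg: "f \<in> S" "g \<in> S" "hat g (ev x) ~= 0"
    "\<forall>y\<in>range ev. hat g y ~= 0 --> y \<in> W \<and> h y = hat f y / hat g y"
   proof (elim exE conjE)
    fix U F a b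
    assume *: "(U, F) \<in> {(range ev, hat ` S)}" "a \<in> F" "b \<in> F" "b (ev x) ~= 0"
     "\<forall>y\<in>U. b y ~= 0 --> y \<in> W \<and> h y = a y / b y"
    then obtain f g where "f \<in> S" "g \<in> S" "a = hat f" "b = hat g" "U = range ev" by auto
    with * show thesis by (intro that[of f g]) simp_all
   qed
   thus "\<exists>a\<in>S. \<exists>b\<in>S. b x ~= 0 \<and> (\<forall>y. b y ~= 0 --> ev y \<in> W \<and> h (ev y) = a y / b y)"
    by (intro bexI[of _ f] bexI[of _ g]) (auto simp: hat_ev)
  qed
 next
  assume R: ?R
  show ?L
  proof
   fix p assume p: "p \<in> W"
   then obtain x where x: "p = ev x" using openin_subset[OF W] pts_A_var by auto
   from R p x have "\<exists>a\<in>S. \<exists>b\<in>S. b x ~= 0 \<and> (\<forall>y. b y ~= 0 --> ev y \<in> W \<and> h (ev y) = a y / b y)" by simp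
   then obtain a b where ab: "a \<in> S" "b \<in> S" "b x ~= 0" "!!y. b y ~= 0 ==> ev y \<in> W \<and> h (ev y) = a y / b y"
    by (elim bexE conjE) simp
   show "\<exists>U F a b. (U, F) \<in> {(range ev, hat ` S)} \<and> a \<in> F \<and> b \<in> F \<and> p \<in> U \<and> b p ~= 0 \<and>
    (\<forall>y\<in>U. b y ~= 0 --> y \<in> W \<and> h y = a y / b y)"
    apply (rule exI[of _ "range ev"], rule exI[of _ "hat ` S"], rule exI[of _ "hat a"], rule exI[of _ "hat b"])
    using ab x by (simp add: hat_ev)
  qed
 qed
 thus ?thesis
  using freg_frac_space_base[OF frac_base_single[OF subalg_hat], of h W, folded A_var_eq]
  by (cases "openin (ftop Z) W") simp_all
qed

lemma freg_A_varE:
 assumes "h \<in> freg Z W" "ev x \<in> W"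
 obtains a b where "a \<in> S" "b \<in> S" "b x ~= 0" "!!y. b y ~= 0 ==> ev y \<in> W" "!!y. b y ~= 0 ==> h (ev y) = a y / b y"
proof -
 from assms have "\<exists>a\<in>S. \<exists>b\<in>S. b x ~= 0 \<and> (\<forall>y. b y ~= 0 --> ev y \<in> W \<and> h (ev y) = a y / b y)"
  unfolding freg_A_var by simp
 then obtain a b where "a \<in> S" "b \<in> S" "b x ~= 0" "\<forall>y. b y ~= 0 --> ev y \<in> W \<and> h (ev y) = a y / b y"
  by (elim bexE conjE)
 thus ?thesis by (intro that[of a b]) simp_all
qed

lemma openin_A_varE:
 assumes "openin (ftop Z) W" "ev x \<in> W"
 obtains u where "u \<in> S" "u x ~= 0" "!!y. u y ~= 0 ==> ev y \<in> W"
proof -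
 from assms have "\<exists>u\<in>S. u x ~= 0 \<and> (\<forall>y. u y ~= 0 --> ev y \<in> W)"
  unfolding openin_A_var by simp
 then obtain u where "u \<in> S" "u x ~= 0" "\<forall>y. u y ~= 0 --> ev y \<in> W"
  by (elim bexE conjE)
 thus ?thesis by (intro that[of u]) simp_all
qed

text \<open>A globally regular function is a polynomial \<open>f\<close> with \<open>a = b f\<close>
  and \<open>b 0\<close> nonzero. Comparing components in this identity, from low degree upwards,
  shows that \<open>f\<close> has none in the excluded degrees.\<close>

lemma regular_function:
 assumes loc: "!!x. \<exists>a\<in>S. \<exists>b\<in>S. b x ~= 0 \<and> (\<forall>y. b y ~= 0 --> f y = a y / b y)"
 shows "f \<in> S"
proof -
 have f: "f \<in> polys"
 proof (rule polys_regular)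
  fix x
  obtain a b where "a \<in> S" "b \<in> S" "b x ~= 0" "\<forall>y. b y ~= 0 --> f y = a y / b y"
   using loc[of x] by (elim bexE conjE)
  thus "\<exists>a\<in>polys. \<exists>b\<in>polys. b x ~= 0 \<and> (\<forall>y. b y ~= 0 --> f y = a y / b y)"
   by (intro bexI[of _ a] bexI[of _ b] conjI polys)
 qed
 obtain a b where ab: "a \<in> S" "b \<in> S" "b 0 ~= 0" "\<forall>y. b y ~= 0 --> f y = a y / b y"
  using loc[of 0] by (elim bexE conjE)
 have "a z = b z * f z" for z
 proof (rule polys_eq_dense[of a "\<lambda>z. b z * f z" b 0])
  show "a y = b y * f y" if "b y ~= 0" for y using ab(4) that by simp
 qed (use ab(3) in "auto intro: polys ab f polys_mult")
 hence "a = (\<lambda>z. b z * f z)" by auto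
 hence eq: "hcomp i a x = (\<Sum>k\<le>i. hcomp k b x * hcomp (i - k) f x)" for i x
  using f polys[OF ab(2)] by (simp add: hcomp_mult)
 have "hcomp i f x = 0" if "\<not> admissible d s i" for i x
  using that
 proof (induction i rule: less_induct)
  case (less i)
  \<comment> \<open>If \<open>k\<close> is admissible and \<open>i\<close> is not, then
    \<open>i - k\<close> is not; for \<open>k > 0\<close> the induction hypothesis applies to it.
    Only the term with \<open>b 0\<close> survives.\<close>
  have "hcomp k b x * hcomp (i - k) f x = (if k = 0 then b 0 * hcomp i f x else 0)" if "k \<le> i" for k
  proof (cases "k = 0 \<or> \<not> admissible d s k")
   case True
   thus ?thesis using hcomp_0[OF polys[OF ab(2)]] hcomp_zero[OF ab(2), of k] by auto
  next
   case False
   hence "\<not> admissible d s (i - k)" using admissible_add[of d s k "i - k"] less.prems that by auto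
   moreover have "i - k < i" using False that by auto
   ultimately show ?thesis using less.IH False by simp
  qed
  hence "hcomp i a x = (\<Sum>k\<le>i. if k = 0 then b 0 * hcomp i f x else 0)" unfolding eq by (intro sum.cong) auto
  hence "b 0 * hcomp i f x = 0" using hcomp_zero[OF ab(1) less.prems] by simp
  thus ?case using ab(3) by simp
 qed
 thus ?thesis using f by (auto simp: S_eq A_ring_iff[OF d_pos])
qed

lemma coord_ring_A_var: "coord_ring (Z) = hat ` S"
proof (intro equalityI subsetI)
 fix h assume h: "h \<in> coord_ring (Z)"
 have "(\<lambda>x. h (ev x)) \<in> S"
 proof (rule regular_function)
  fix x
  have "ev x \<in> pts (Z)" unfolding pts_A_var by simp
  then obtain a b where "a \<in> S" "b \<in> S" "b x ~= 0" "!!y. b y ~= 0 ==> h (ev y) = a y / b y"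
   by (rule freg_A_varE[OF h]) simp
  thus "\<exists>a\<in>S. \<exists>b\<in>S. b x ~= 0 \<and> (\<forall>y. b y ~= 0 --> h (ev y) = a y / b y)" by blast
 qed
 moreover have "h = hat (\<lambda>x. h (ev x))"
 proof -
  have "restrict h (range ev) = hat (\<lambda>x. h (ev x))" by (rule restrict_hat) (use calculation in simp_all)
  moreover have "h \<in> extensional (range ev)" using h freg_A_var pts_A_var by metis
  ultimately show ?thesis by (simp add: extensional_restrict)
 qed
 ultimately show "h \<in> hat ` S" by blast
next
 fix h assume "h \<in> hat ` S"
 thus "h \<in> coord_ring (Z)"
  unfolding pts_A_var unfolding A_var_eq by (intro freg_frac_space_incl frac_base_single subalg_hat) auto
qed

lemma irreducible_A_var: "irreducible_space (ftop (Z))"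
 unfolding irreducible_space_def
proof (intro conjI allI impI; (elim conjE)?)
 show "pts (Z) ~= {}" by (simp add: pts_A_var)
 fix U V assume o: "openin (ftop (Z)) U" "openin (ftop (Z)) V" and ne: "U ~= {}" "V ~= {}"
 have "U \<subseteq> range ev" "V \<subseteq> range ev" using o by (simp_all add: openin_A_var)
 then obtain x y where xy: "ev x \<in> U" "ev y \<in> V" using ne by blast
 obtain u where u: "u \<in> S" "u x ~= 0" "!!y. u y ~= 0 ==> ev y \<in> U" by (rule openin_A_varE[OF o(1) xy(1)]) blast
 obtain v where v: "v \<in> S" "v y ~= 0" "!!y. v y ~= 0 ==> ev y \<in> V" by (rule openin_A_varE[OF o(2) xy(2)]) blast
 obtain z where "u z * v z ~= 0" using polys_domain[OF polys[OF u(1)] polys[OF v(1)] _ u(2), of y] v(2) by blast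
 thus "U \<inter> V ~= {}" using u(3) v(3) by auto
qed

end

subsection \<open>Invariants of roots of unity\<close>

text \<open>A common linear factor is cancelled; the remaining roots of \<open>p\<close> stay simple
  and differ from the cancelled one. It is applied to \<open>X ^ d - 1\<close>.\<close>

lemma poly_dvd_simple_roots:
 fixes p q :: "'k::{alg_closed_field, field_char_0} poly"
 assumes "p ~= 0" "!!t. poly p t = 0 ==> poly q t = 0 \<and> poly (pderiv p) t ~= 0"
 shows "p dvd q"
 using assms
proof (induction "degree p" arbitrary: p q rule: less_induct)
 case less
 show ?case
 proof (cases "degree p = 0")
  case True
  thus ?thesis using less.prems(1) is_unit_iff_degree unit_imp_dvd by blast
 next
  case False
  then obtain r where r: "poly p r = 0" using alg_closed_imp_poly_has_root by blast
  then obtain p1 where p1: "p = [:-r, 1:] * p1" by (auto simp: poly_eq_0_iff_dvd)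
  obtain q1 where q1: "q = [:-r, 1:] * q1" using less.prems(2)[OF r] by (auto simp: poly_eq_0_iff_dvd)
  have d: "poly (pderiv p) t = (t - r) * poly (pderiv p1) t + poly p1 t" for t
   unfolding p1 pderiv_mult by (simp add: pderiv_pCons algebra_simps)
  have "p1 ~= 0" "degree p1 < degree p"
   using less.prems(1) p1 by (auto simp: degree_mult_eq simp del: mult_pCons_left)
  moreover have "poly q1 t = 0 \<and> poly (pderiv p1) t ~= 0" if t: "poly p1 t = 0" for t
  proof -
   have "poly p t = 0" using t by (simp add: p1)
   hence "poly q t = 0" "poly (pderiv p) t ~= 0" using less.prems(2) by auto
   thus ?thesis using t by (auto simp: d q1)
  qed
  ultimately have "p1 dvd q1" using less.hyps by blast
  thus ?thesis unfolding p1 q1 by (rule mult_dvd_mono[OF dvd_refl])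
 qed
qed

text \<open>Otherwise all roots of \<open>X ^ d - 1\<close> are roots of
  \<open>X ^ (i mod d) - 1\<close>. In characteristic zero they are simple, so the former would
  divide the latter, which is nonzero of smaller degree.\<close>

lemma root_of_unity_exists:
 assumes "0 < d" "\<not> d dvd i"
 obtains t :: "'k::{alg_closed_field, field_char_0}" where "t ^ d = 1" "t ^ i ~= 1"
proof (rule ccontr)
 assume "\<not> thesis"
 hence *: "t ^ i = 1" if "t ^ d = 1" for t :: 'k using that \<open>!!t. t ^ d = 1 ==> t ^ i ~= 1 ==> thesis\<close> by blast
 let ?p = "monom 1 d - 1 :: 'k poly" and ?q = "monom 1 (i mod d) - 1 :: 'k poly"
 have i: "0 < i mod d" "i mod d < d" using assms by (auto simp: dvd_eq_mod_eq_0)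
 have nz: "monom 1 m - 1 ~= (0 :: 'k poly)" "degree (monom 1 m - 1 :: 'k poly) = m" if "0 < m" for m
 proof -
  have c: "coeff (monom 1 m - 1 :: 'k poly) m = 1" using that by simp
  thus "monom 1 m - 1 ~= (0 :: 'k poly)" by (metis coeff_0 zero_neq_one)
  show "degree (monom 1 m - 1 :: 'k poly) = m"
   using c by (intro antisym degree_diff_le le_degree) (auto simp: degree_monom_eq)
 qed
 have "?p dvd ?q"
 proof (rule poly_dvd_simple_roots)
  fix t assume "poly ?p t = 0"
  hence t: "t ^ d = 1" by (simp add: poly_monom)
  hence "t ~= 0" using assms(1) by (auto simp: power_0_left)
  have "t ^ i = t ^ (d * (i div d) + i mod d)" by simp
  also have "\<dots> = t ^ (i mod d)" using t by (simp only: power_add power_mult) simp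
  finally show "poly ?q t = 0 \<and> poly (pderiv ?p) t ~= 0"
   using *[OF t] \<open>t ~= 0\<close> assms(1) by (simp add: poly_monom pderiv_diff pderiv_monom)
 qed (use nz assms in simp)
 hence "degree ?p \<le> degree ?q" using nz(1)[OF i(1)] by (intro dvd_imp_degree_le)
 thus False using nz(2) i assms(1) by simp
qed

text \<open>Replacing \<open>x\<close> by \<open>t x\<close> multiplies the component of degree
  \<open>i\<close> by \<open>t ^ i\<close>. If \<open>d\<close> does not divide \<open>i\<close>,
  some root of unity has \<open>t ^ i\<close> different from 1 and kills this component.\<close>

lemma invariants_iff:
 fixes f :: "'k::{alg_closed_field, field_char_0} ^ 'n::finite => 'k"
 assumes d: "0 < d"
 shows "f \<in> A_ring d 0 \<longleftrightarrow> f \<in> polys \<and> (\<forall>t. t ^ d = 1 --> (\<forall>x. f (t *s x) = f x))"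
proof
 assume "f \<in> A_ring d 0"
 have f: "f \<in> polys" "!!i. \<not> d dvd i ==> hcomp i f = (\<lambda>x. 0)"
 proof -
  have "\<not> admissible d 0 i" if "\<not> d dvd i" for i using that unfolding admissible_def by (metis dvd_0_right)
  thus "f \<in> polys" "!!i. \<not> d dvd i ==> hcomp i f = (\<lambda>x. 0)"
   using \<open>f \<in> A_ring d 0\<close> unfolding A_ring_iff[OF d] by blast+
 qed
 have "f (t *s x) = f x" if t: "t ^ d = 1" for t x
 proof -
  have "(\<lambda>x. f (t *s x)) = f"
  proof (rule hcomp_eqI)
   show "(\<lambda>x. f (t *s x)) \<in> polys" by (rule polys_comp[OF f(1)]) (simp add: polys_scale)
   show "hcomp i (\<lambda>x. f (t *s x)) x = hcomp i f x" for i x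
   proof (cases "d dvd i")
    case True
    hence "t ^ i = 1" using t by (auto simp: power_mult elim!: dvdE)
    thus ?thesis using f(1) by (simp add: hcomp_smult_arg)
   qed (use f in "simp add: hcomp_smult_arg")
  qed (rule f)
  thus ?thesis by (rule fun_cong)
 qed
 thus "f \<in> polys \<and> (\<forall>t. t ^ d = 1 --> (\<forall>x. f (t *s x) = f x))" using f(1) by blast
next
 assume f: "f \<in> polys \<and> (\<forall>t. t ^ d = 1 --> (\<forall>x. f (t *s x) = f x))"
 have "hcomp i f = (\<lambda>x. 0)" if "\<not> admissible d 0 i" for i
 proof
  fix x
  have "\<not> d dvd i" using that by (auto simp: admissible_def)
  then obtain t :: 'k where t: "t ^ d = 1" "t ^ i ~= 1" using root_of_unity_exists[OF d] by blast
  hence "(\<lambda>x. f (t *s x)) = f" using f by auto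
  hence "hcomp i f x = t ^ i * hcomp i f x" using hcomp_smult_arg[of f i t] f by (metis (full_types))
  thus "hcomp i f x = 0" using t(2) by simp
 qed
 thus "f \<in> A_ring d 0" using f by (simp add: A_ring_iff[OF d])
qed

lemma mu_invariants_eq: "0 < d ==> mu_invariants d = (A_ring d 0 :: ('k::{alg_closed_field, field_char_0} ^ 'n::finite => 'k) set)"
 by (auto simp: mu_invariants_def invariants_iff)

lemma hcomp_mult_homog:
 assumes "f \<in> polys" "g \<in> polys" "!!t x. g (t *s x) = t ^ m * g x"
 shows "hcomp (m + i) (\<lambda>x. g x * f x) = (\<lambda>x. g x * hcomp i f x)"
proof
 fix x
 have "hcomp k g x * hcomp (m + i - k) f x = (if k = m then g x * hcomp i f x else 0)" for k
  using hcomp_homogeneous[OF assms(3), of k] by simp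
 thus "hcomp (m + i) (\<lambda>x. g x * f x) x = g x * hcomp i f x"
  using assms by (simp add: hcomp_mult)
qed

subsection \<open>Finite generation\<close>

text \<open>Read on exponents: a monomial has a divisor of every degree up to its own.\<close>

lemma exists_sum_le:
 fixes e :: "'n::finite => nat"
 assumes "k \<le> sum e UNIV" shows "\<exists>e'. (\<forall>i. e' i \<le> e i) \<and> sum e' UNIV = k"
 using assms
proof (induction k)
 case 0
 thus ?case by (intro exI[of _ "\<lambda>_. 0"]) simp
next
 case (Suc k)
 then obtain e' where e': "!!i. e' i \<le> e i" "sum e' UNIV = k" by auto
 have "\<exists>j. e' j < e j"
 proof (rule ccontr)
  assume "\<not> (\<exists>j. e' j < e j)"
  hence "sum e UNIV \<le> sum e' UNIV" by (intro sum_mono) (auto simp: not_less)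
  thus False using Suc.prems e'(2) by simp
 qed
 then obtain j where j: "e' j < e j" by blast
 have "(\<Sum>i\<in>UNIV. e' i + (if i = j then 1 else 0)) = Suc k" using e'(2) by (simp add: sum.distrib)
 moreover have "e' i + (if i = j then 1 else 0) \<le> e i" for i using e'(1)[of i] j by auto
 ultimately show ?case by (intro exI[of _ "\<lambda>i. e' i + (if i = j then 1 else 0)"]) blast
qed

lemma finite_exponents: "finite {e :: 'n::finite => nat. sum e UNIV \<le> D}"
proof (rule finite_subset)
 show "{e :: 'n => nat. sum e UNIV \<le> D} \<subseteq> (UNIV \<rightarrow>\<^sub>E {..D})"
 proof
  fix e :: "'n => nat" assume "e \<in> {e. sum e UNIV \<le> D}"
  moreover have "e i \<le> sum e UNIV" for i by (rule member_le_sum) auto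
  ultimately show "e \<in> UNIV \<rightarrow>\<^sub>E {..D}" by (auto simp: PiE_UNIV_domain intro: order_trans)
 qed
qed (simp add: finite_PiE)

lemma finite_monomials: "finite {monomial e |e. P e \<and> sum e UNIV \<le> D}"
 by (rule finite_subset[OF _ finite_imageI[OF finite_exponents[of D]], of _ monomial]) auto

context graded_ring
begin

lemma span_monomials:
 assumes f: "f \<in> S" and D: "!!i. D < i ==> hcomp i f = (\<lambda>x. 0)"
 shows "f \<in> fun_vs.span {monomial e |e. admissible d s (sum e UNIV) \<and> sum e UNIV \<le> D}"
proof -
 have "(\<lambda>x. \<Sum>i\<le>D. hcomp i f x) \<in> fun_vs.span {monomial e |e. admissible d s (sum e UNIV) \<and> sum e UNIV \<le> D}"
 proof (rule fun_span_sum)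
  fix i assume i: "i \<in> {..D}"
  show "hcomp i f \<in> fun_vs.span {monomial e |e. admissible d s (sum e UNIV) \<and> sum e UNIV \<le> D}"
  proof (cases "admissible d s i")
   case True
   have "hcomp i f \<in> fun_vs.span {monomial e |e. sum e UNIV = i}"
    using hcomp_homog_polys[OF polys[OF f]] unfolding homog_polys_eq .
   thus ?thesis using i True by (elim subsetD[OF fun_vs.span_mono, rotated]) auto
  next
   case False
   thus ?thesis using hcomp_zero[OF f] fun_vs.span_zero by (simp add: zero_fun_def)
  qed
 qed
 moreover have "f = (\<lambda>x. \<Sum>i\<le>D. hcomp i f x)" using hcomp_expand[OF polys[OF f], of D] D by auto
 ultimately show ?thesis by (simp only:)
qed

lemma hat_const: "hat (\<lambda>x. c) = (\<lambda>p\<in>range ev. c)"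
 by (rule restrict_hat[symmetric]) (auto intro: const)

lemma hat_add: "f \<in> S ==> g \<in> S ==> hat (\<lambda>x. f x + g x) = (\<lambda>p\<in>range ev. hat f p + hat g p)"
 by (rule restrict_hat[symmetric]) (auto intro: add simp: hat_ev)

lemma hat_mult: "f \<in> S ==> g \<in> S ==> hat (\<lambda>x. f x * g x) = (\<lambda>p\<in>range ev. hat f p * hat g p)"
 by (rule restrict_hat[symmetric]) (auto intro: mult simp: hat_ev)

text \<open>A monomial of degree above \<open>2 * (s + 1) * d\<close> has a divisor of degree
  \<open>(s + 1) * d\<close>, and the cofactor still has more than this degree. Both are admissible
  and of smaller degree, so finitely many monomials generate.\<close>

lemma finitely_generated: "\<exists>F. finite F \<and> F \<subseteq> hat ` S \<and> hat ` S = alg_generated (range ev) F"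
proof -
 define F where "F = hat ` {monomial e |e. admissible d s (sum e UNIV) \<and> sum e UNIV \<le> 2 * (s + 1) * d}"
 have F: "finite F" unfolding F_def by (intro finite_imageI finite_monomials)
 have FS: "F \<subseteq> hat ` S" unfolding F_def using monomial by auto
 hence ext: "F \<subseteq> extensional (range ev)" by (auto simp: hat_def)
 note G = subalg_alg_generated[OF ext]
 have mon: "hat (monomial e) \<in> alg_generated (range ev) F" if "admissible d s (sum e UNIV)" for e
  using that
 proof (induction "sum e UNIV" arbitrary: e rule: less_induct)
  case less
  show ?case
  proof (cases "sum e UNIV \<le> 2 * (s + 1) * d")
   case True
   hence "hat (monomial e) \<in> F" using less.prems by (auto simp: F_def)
   thus ?thesis using alg_generated_incl by blast
  next
   case False
   hence le: "(s + 1) * d \<le> sum e UNIV" by simp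
   then obtain e1 where e1: "!!i. e1 i \<le> e i" "sum e1 UNIV = (s + 1) * d" using exists_sum_le by blast
   have e2: "sum (\<lambda>i. e i - e1 i) UNIV = sum e UNIV - (s + 1) * d"
    using e1 by (simp add: sum_subtractf_nat)
   have dv: "d dvd sum e UNIV" using less.prems by (auto simp: admissible_def)
   have a1: "admissible d s (sum e1 UNIV)" unfolding e1 by (rule admissible_large) simp
   have a2: "admissible d s (sum (\<lambda>i. e i - e1 i) UNIV)"
    unfolding e2 using False dv by (auto simp: admissible_def algebra_simps intro: dvd_diff_nat)
   have "sum e1 UNIV < sum e UNIV" "sum (\<lambda>i. e i - e1 i) UNIV < sum e UNIV"
    using False d_pos e1 e2 by (auto simp: algebra_simps)
   hence "(\<lambda>p\<in>range ev. hat (monomial e1) p * hat (monomial (\<lambda>i. e i - e1 i)) p) \<in> alg_generated (range ev) F"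
    using less.hyps a1 a2 by (intro subalg_mult[OF G]) blast+
   moreover have m: "monomial e = (\<lambda>x. monomial e1 x * monomial (\<lambda>i. e i - e1 i) x)"
    using e1(1) by (simp add: monomial_mult fun_eq_iff)
   moreover have "hat (monomial e) = (\<lambda>p\<in>range ev. hat (monomial e1) p * hat (monomial (\<lambda>i. e i - e1 i)) p)"
    by (rule trans[OF arg_cong[OF m, of hat] hat_mult[OF monomial[OF a1] monomial[OF a2]]])
   ultimately show ?thesis by (simp only:)
  qed
 qed
 have "hat f \<in> alg_generated (range ev) F" if f: "f \<in> S" for f
 proof -
  obtain D where D: "!!i x. D < i ==> hcomp i f x = 0" using hcomp_bounded[OF polys[OF f]] by blast
  have "f \<in> fun_vs.span {monomial e |e. admissible d s (sum e UNIV) \<and> sum e UNIV \<le> D}"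
   using D by (intro span_monomials[OF f]) auto
  hence "f \<in> S \<and> hat f \<in> alg_generated (range ev) F"
  proof (induction rule: fun_span_induct)
   case zero
   thus ?case unfolding hat_const by (intro conjI const subalg_const[OF G])
  next
   case (step c f g)
   then obtain e where e: "f = monomial e" "admissible d s (sum e UNIV)" by auto
   hence fS: "f \<in> S" using monomial by simp
   have cf: "hat (\<lambda>x. c * f x) = (\<lambda>p\<in>range ev. c * hat f p)"
    by (rule restrict_hat[symmetric]) (use fS in "auto intro: scale simp: hat_ev")
   have "hat (\<lambda>x. c * f x + g x) = (\<lambda>p\<in>range ev. (\<lambda>p\<in>range ev. c * hat f p) p + hat g p)"
    using hat_add[OF scale[OF fS, of c] conjunct1[OF step(3)]] by (simp only: cf)
   moreover have "\<dots> \<in> alg_generated (range ev) F"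
    by (rule subalg_add[OF G subalg_scale[OF G] conjunct2[OF step(3)]]) (use mon e in simp)
   ultimately have "hat (\<lambda>x. c * f x + g x) \<in> alg_generated (range ev) F" by (simp only:)
   thus ?case by (rule conjI[OF add[OF scale[OF fS, of c] conjunct1[OF step(3)]]])
  qed
  thus ?thesis ..
 qed
 moreover have "alg_generated (range ev) F \<subseteq> hat ` S" by (rule alg_generated_least[OF subalg_hat FS])
 ultimately have "hat ` S = alg_generated (range ev) F" by blast
 thus ?thesis using F FS by blast
qed

lemma hat_inj: "hat f = hat g ==> f \<in> S ==> g \<in> S ==> f = g"
 by (rule ext) (metis hat_ev)

lemma affine_variety_A_var: "affine_variety Z"
 unfolding affine_variety_def coord_ring_A_var
proof (intro conjI ballI)
 show "Z = frac_space {(pts Z, hat ` S)}" unfolding pts_A_var by (rule A_var_eq)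
 show "subalg (pts Z) (hat ` S)" unfolding pts_A_var by (rule subalg_hat)
 show "\<exists>F. finite F \<and> F \<subseteq> hat ` S \<and> hat ` S = alg_generated (pts Z) F"
  unfolding pts_A_var by (rule finitely_generated)
 fix \<psi> assume "\<psi> \<in> alg_homs (pts Z) (hat ` S)"
 hence \<psi>: "!!c. \<psi> (\<lambda>x\<in>range ev. c) = c"
  "!!f g. f \<in> S ==> g \<in> S ==> \<psi> (\<lambda>x\<in>range ev. hat f x + hat g x) = \<psi> (hat f) + \<psi> (hat g)"
  "!!f g. f \<in> S ==> g \<in> S ==> \<psi> (\<lambda>x\<in>range ev. hat f x * hat g x) = \<psi> (hat f) * \<psi> (hat g)"
  unfolding pts_A_var alg_homs_def by blast+
 have "(\<lambda>f\<in>S. \<psi> (hat f)) \<in> alg_homs UNIV S"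
  unfolding alg_homs_def
  using \<psi> const add mult by (simp add: hat_const hat_add hat_mult)
 then obtain x where x: "(\<lambda>f\<in>S. \<psi> (hat f)) = ev x" unfolding alg_homs_S by auto
 have *: "\<psi> (hat f) = f x" if "f \<in> S" for f using fun_cong[OF x, of f] that by simp
 show "\<exists>!p. p \<in> pts Z \<and> (\<forall>f\<in>hat ` S. \<psi> f = f p)"
 proof (rule ex1I[of _ "ev x"])
  show "ev x \<in> pts Z \<and> (\<forall>f\<in>hat ` S. \<psi> f = f (ev x))" using * by (auto simp: pts_A_var hat_ev)
  fix p assume p: "p \<in> pts Z \<and> (\<forall>f\<in>hat ` S. \<psi> f = f p)"
  then obtain y where y: "p = ev y" by (auto simp: pts_A_var)
  have "f x = f y" if "f \<in> S" for f using p *[OF that] that unfolding y by (simp add: hat_ev)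
  thus "p = ev x" unfolding y ev_eq_iff by metis
 qed
qed

subsection \<open>Normality\<close>

text \<open>The denominators of the quotients near \<open>x\<close> are multiplied together, one
  function at a time.\<close>

lemma common_denominator:
 assumes "finite I" "!!i. i \<in> I ==> f i \<in> freg Z W" "openin (ftop Z) W" "ev x \<in> W"
 shows "\<exists>e\<in>S. e x ~= 0 \<and> (\<forall>y. e y ~= 0 --> ev y \<in> W) \<and>
  (\<forall>i\<in>I. \<exists>a\<in>S. \<forall>y. e y ~= 0 --> a y = e y * f i (ev y))"
 using assms(1,2)
proof (induction I)
 case empty
 obtain u where "u \<in> S" "u x ~= 0" "!!y. u y ~= 0 ==> ev y \<in> W"
  by (rule openin_A_varE[OF assms(3,4)]) blast
 thus ?case by (intro bexI[of _ u]) auto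
next
 case (insert i I)
 then obtain e where e: "e \<in> S" "e x ~= 0" "\<forall>y. e y ~= 0 --> ev y \<in> W"
  "\<forall>i\<in>I. \<exists>a\<in>S. \<forall>y. e y ~= 0 --> a y = e y * f i (ev y)" by (auto simp del: all_simps ball_simps)
 have fi: "f i \<in> freg Z W" using insert.prems by simp
 obtain a b where ab: "a \<in> S" "b \<in> S" "b x ~= 0" "!!y. b y ~= 0 ==> f i (ev y) = a y / b y"
  by (rule freg_A_varE[OF fi assms(4)]) blast
 show ?case
 proof (rule bexI[of _ "\<lambda>y. e y * b y"], intro conjI ballI allI impI)
  fix j assume j: "j \<in> insert i I"
  show "\<exists>a\<in>S. \<forall>y. e y * b y ~= 0 --> a y = e y * b y * f j (ev y)"
  proof (cases "j = i")
   case True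
   thus ?thesis using ab(4) by (intro bexI[of _ "\<lambda>y. e y * a y"] mult e ab) auto
  next
   case False
   hence "\<exists>a\<in>S. \<forall>y. e y ~= 0 --> a y = e y * f j (ev y)" using e(4) j by simp
   then obtain a' where "a' \<in> S" "\<forall>y. e y ~= 0 --> a' y = e y * f j (ev y)" by (elim bexE)
   thus ?thesis by (intro bexI[of _ "\<lambda>y. b y * a' y"] mult ab) auto
  qed
 qed (use e(2,3) ab(3) mult[OF e(1) ab(2)] in auto)
qed

text \<open>After clearing denominators, \<open>e f / g\<close> is integral over the polynomials,
  hence a polynomial \<open>q\<close>. It is invariant as a quotient of invariants, and
  \<open>f = g (q / e)\<close> near the point. For zero divisors, the domain property of
  \<open>polys\<close> is used.\<close>

lemma normal_A_var:
 assumes s: "s = 0" shows "normal_variety Z"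
 unfolding normal_variety_def
proof
 fix p assume "p \<in> pts Z"
 then obtain x where x: "p = ev x" by (auto simp: pts_A_var)
 have nbhd: "openin (ftop Z) (ev ` {y. e y ~= 0}) \<and> p \<in> ev ` {y. e y ~= 0}" if "e \<in> S" "e x ~= 0" for e
  using openin_A_var_nonzero that x by auto
 show "normal_at Z p"
  unfolding normal_at_def
 proof (intro conjI allI ballI impI; elim conjE)
  fix U f g assume f: "f \<in> freg Z U" and g: "g \<in> freg Z U" and p: "p \<in> U" and z: "\<forall>y\<in>U. f y * g y = 0"
  obtain a b where ab: "a \<in> S" "b \<in> S" "b x ~= 0" "!!y. b y ~= 0 ==> ev y \<in> U" "!!y. b y ~= 0 ==> f (ev y) = a y / b y"
   by (rule freg_A_varE[OF f p[unfolded x]]) blast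
  obtain a' b' where ab': "a' \<in> S" "b' \<in> S" "b' x ~= 0" "!!y. b' y ~= 0 ==> ev y \<in> U" "!!y. b' y ~= 0 ==> g (ev y) = a' y / b' y"
   by (rule freg_A_varE[OF g p[unfolded x]]) blast
  have aa: "a y * a' y = 0" for y
  proof (rule polys_eq_dense[of "\<lambda>y. a y * a' y" "\<lambda>_. 0" "\<lambda>y. b y * b' y" x])
   fix y assume "b y * b' y ~= 0"
   hence "b y ~= 0" "b' y ~= 0" by auto
   thus "a y * a' y = 0" using ab(4,5)[of y] ab'(5)[of y] z by auto
  qed (use ab(3) ab'(3) in "auto intro!: polys_mult polys[OF ab(1)] polys[OF ab(2)] polys[OF ab'(1)] polys[OF ab'(2)]")
  show "\<exists>N. openin (ftop Z) N \<and> p \<in> N \<and> N \<subseteq> U \<and> ((\<forall>y\<in>N. f y = 0) \<or> (\<forall>y\<in>N. g y = 0))"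
  proof (cases "\<forall>y. a y = 0")
   case True
   thus ?thesis using nbhd[OF ab(2,3)] ab(4,5)
    by (intro exI[of _ "ev ` {y. b y ~= 0}"]) auto
  next
   case False
   then obtain y0 where "a y0 ~= 0" by auto
   hence "a' y = 0" for y by (rule polys_domain[OF polys[OF ab(1)] polys[OF ab'(1)] aa])
   thus ?thesis using nbhd[OF ab'(2,3)] ab'(4,5)
    by (intro exI[of _ "ev ` {y. b' y ~= 0}"]) auto
  qed
 next
  fix U f g and m :: nat and c
  assume f: "f \<in> freg Z U" and g: "g \<in> freg Z U" and p: "p \<in> U"
   and gz: "\<not> (\<exists>N. openin (ftop Z) N \<and> p \<in> N \<and> N \<subseteq> U \<and> (\<forall>y\<in>N. g y = 0))"
   and c: "\<forall>i<m. c i \<in> freg Z U"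
   and eq: "\<forall>y\<in>U. f y ^ m + (\<Sum>i<m. c i y * f y ^ i * g y ^ (m - i)) = 0"
  \<comment> \<open>The coefficients, \<open>f\<close> and \<open>g\<close> form one family, so that
    a single denominator serves all of them.\<close>
  let ?k = "\<lambda>i::nat. if i < m then c i else if i = m then f else g"
  have "\<exists>e\<in>S. e x ~= 0 \<and> (\<forall>y. e y ~= 0 --> ev y \<in> U) \<and>
   (\<forall>i\<in>{..Suc m}. \<exists>a\<in>S. \<forall>y. e y ~= 0 --> a y = e y * ?k i (ev y))"
   by (rule common_denominator) (use f g c p x fun_space_freg_openin[OF fun_space_A_var f] in auto)
  then obtain e where e: "e \<in> S" "e x ~= 0" "\<forall>y. e y ~= 0 --> ev y \<in> U"
   "\<forall>i\<in>{..Suc m}. \<exists>a\<in>S. \<forall>y. e y ~= 0 --> a y = e y * ?k i (ev y)" by (elim bexE conjE)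
  from bchoice[OF e(4)[unfolded Bex_def]] obtain a
   where a: "!!i. i \<le> Suc m ==> a i \<in> S" "!!i y. i \<le> Suc m ==> e y ~= 0 ==> a i y = e y * ?k i (ev y)"
   by (elim exE) (simp only: atMost_iff Ball_def, metis)
  define F where "F = a m"
  define G where "G = a (Suc m)"
  have F: "F \<in> S" "!!y. e y ~= 0 ==> F y = e y * f (ev y)" using a(1)[of m] a(2)[of m] by (simp_all add: F_def)
  have G: "G \<in> S" "!!y. e y ~= 0 ==> G y = e y * g (ev y)" using a(1)[of "Suc m"] a(2)[of "Suc m"] by (simp_all add: G_def)
  have C: "!!i. i < m ==> a i \<in> S" "!!i y. i < m ==> e y ~= 0 ==> a i y = e y * c i (ev y)" using a by simp_all
  have "\<exists>y. G y ~= 0"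
  proof (rule ccontr)
   assume "\<nexists>y. G y ~= 0"
   hence "\<forall>y\<in>ev ` {y. e y ~= 0}. g y = 0" using G(2) by auto
   thus False using gz nbhd[OF e(1,2)] e(3) by blast
  qed
  then obtain y0 where y0: "G y0 ~= 0" by auto
  \<comment> \<open>The equation multiplied by \<open>e ^ (2 * m)\<close>. It is an equation for
    \<open>e f / g\<close> with the coefficients \<open>e ^ (m - i)\<close> times
    \<open>c i\<close>, and these are polynomials, namely
    \<open>a i * e ^ (m - 1 - i)\<close>.\<close>
  have id: "(e y * F y) ^ m + (\<Sum>i<m. (a i y * e y ^ (m - 1 - i)) * (e y * F y) ^ i * G y ^ (m - i)) = 0" for y
  proof (rule polys_eq_dense[of "\<lambda>y. (e y * F y) ^ m + (\<Sum>i<m. (a i y * e y ^ (m - 1 - i)) * (e y * F y) ^ i * G y ^ (m - i))" "\<lambda>_. 0" e x])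
   fix y assume ey: "e y ~= 0"
   have "(a i y * e y ^ (m - 1 - i)) * (e y * F y) ^ i * G y ^ (m - i) =
     e y ^ (2 * m) * (c i (ev y) * f (ev y) ^ i * g (ev y) ^ (m - i))" if i: "i < m" for i
   proof -
    have "2 * m = 1 + (m - 1 - i) + (i + i) + (m - i)" using i by simp
    hence "e y ^ (2 * m) = e y * e y ^ (m - 1 - i) * (e y ^ i * e y ^ i) * e y ^ (m - i)"
     by (simp only: power_add power_one_right)
    thus ?thesis using F(2)[OF ey] G(2)[OF ey] C(2)[OF i ey] by (simp add: power_mult_distrib)
   qed
   hence i1: "(\<Sum>i<m. (a i y * e y ^ (m - 1 - i)) * (e y * F y) ^ i * G y ^ (m - i))
     = e y ^ (2 * m) * (\<Sum>i<m. c i (ev y) * f (ev y) ^ i * g (ev y) ^ (m - i))"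
    unfolding sum_distrib_left by (intro sum.cong) auto
   have i2: "(e y * F y) ^ m = e y ^ (2 * m) * f (ev y) ^ m"
    using F(2)[OF ey] by (simp add: power_mult_distrib mult_2 power_add)
   have i3: "f (ev y) ^ m + (\<Sum>i<m. c i (ev y) * f (ev y) ^ i * g (ev y) ^ (m - i)) = 0"
    using eq e(3) ey by blast
   show "(e y * F y) ^ m + (\<Sum>i<m. (a i y * e y ^ (m - 1 - i)) * (e y * F y) ^ i * G y ^ (m - i)) = 0"
    unfolding i1 i2 by (simp only: distrib_left[symmetric] i3 mult_zero_right)
  qed (use e(2) in "auto intro!: polys_add polys_sum polys_mult polys_power polys[OF e(1)] polys[OF F(1)] polys[OF G(1)] polys[OF C(1)]")
  obtain q where q: "q \<in> polys" "!!y. e y * F y = G y * q y"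
  proof (rule polys_integral[of "\<lambda>y. e y * F y" G y0 m "\<lambda>i y. a i y * e y ^ (m - 1 - i)"])
   show "(\<lambda>y. a i y * e y ^ (m - 1 - i)) \<in> polys" if "i < m" for i
    using that by (intro polys_mult polys_power polys e(1) C(1))
  qed (use y0 id that in "auto intro!: polys_mult polys[OF e(1)] polys[OF F(1)] polys[OF G(1)]")
  \<comment> \<open>Only for \<open>s = 0\<close> does invariance under roots of unity suffice for
    membership in \<open>S\<close>.\<close>
  have "q (t *s y) = q y" if t: "t ^ d = 1" for t y
  proof (rule polys_eq_dense[of "\<lambda>y. q (t *s y)" q G y0])
   show "(\<lambda>y. q (t *s y)) \<in> polys" by (rule polys_comp[OF q(1)]) (simp add: polys_scale)
   fix y assume "G y ~= 0"
   have inv: "h (t *s y) = h y" if "h \<in> S" for h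
    using that t unfolding S_eq s invariants_iff[OF d_pos] by simp
   have "G y * q (t *s y) = G y * q y"
    using q(2)[of "t *s y", unfolded inv[OF e(1)] inv[OF F(1)] inv[OF G(1)], symmetric] q(2)[of y] by (rule trans)
   thus "q (t *s y) = q y" using \<open>G y ~= 0\<close> by simp
  qed (use q y0 polys[OF G(1)] in auto)
  hence qS: "q \<in> S" using q(1) unfolding S_eq s invariants_iff[OF d_pos] by blast
  define N where "N = ev ` {y. e y ~= 0}"
  define h where "h = (\<lambda>p\<in>N. hat q p / hat e p)"
  have eN: "e y ~= 0" if "ev y \<in> N" for y using that e(1) unfolding N_def by (metis (mono_tags, lifting) ev_apply imageE mem_Collect_eq)
  have "h \<in> freg Z N"
   unfolding freg_A_var
  proof (intro conjI allI impI)
   show "openin (ftop Z) N" using nbhd[OF e(1,2)] by (simp add: N_def)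
   fix y assume "ev y \<in> N"
   hence ey: "e y ~= 0" by (rule eN)
   have inN: "ev z \<in> N" if "e z ~= 0" for z using that unfolding N_def by (intro imageI) simp
   have hz: "h (ev z) = q z / e z" if "e z ~= 0" for z
    using inN[OF that] unfolding h_def by (simp add: hat_ev qS e(1))
   have *: "e y ~= 0 \<and> (\<forall>z. e z ~= 0 --> ev z \<in> N \<and> h (ev z) = q z / e z)"
    by (intro conjI allI impI ey inN hz)
   show "\<exists>a\<in>S. \<exists>b\<in>S. b y ~= 0 \<and> (\<forall>y. b y ~= 0 --> ev y \<in> N \<and> h (ev y) = a y / b y)"
    by (rule bexI[where x = q], rule bexI[where x = e], rule *, rule e(1), rule qS)
  qed (simp add: h_def)
  moreover have "\<forall>y\<in>N. f y = g y * h y"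
  proof
   fix r assume r: "r \<in> N"
   then obtain y where y: "r = ev y" "e y ~= 0" by (auto simp: N_def)
   have "h r = q y / e y" using r y qS e(1) by (simp add: h_def hat_ev)
   moreover have "e y * (e y * f r) = e y * g r * q y" using q(2)[of y] F(2)[OF y(2)] G(2)[OF y(2)] y(1) by simp
   ultimately have "e y * f r = e y * (g r * h r)" using y(2) by (simp add: field_simps)
   thus "f r = g r * h r" using y(2) by simp
  qed
  moreover have "openin (ftop Z) N" "p \<in> N" "N \<subseteq> U" using nbhd[OF e(1,2)] e(3) by (auto simp: N_def)
  ultimately show "\<exists>N. \<exists>h\<in>freg Z N. openin (ftop Z) N \<and> p \<in> N \<and> N \<subseteq> U \<and> (\<forall>y\<in>N. f y = g y * h y)"
   by blast
 qed
qed

text \<open>The quotient \<open>f / g\<close> is \<open>x j ^ d\<close>, whose \<open>s\<close>-th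
  power lies in \<open>S\<close>. It is therefore integral, but a local representation at the origin
  would require a component of degree \<open>d\<close> in \<open>S\<close>.\<close>

lemma not_normal_A_var:
 assumes s: "2 \<le> s" shows "\<not> normal_variety Z"
proof
 assume n: "normal_variety Z"
 define j :: 'n where "j = undefined"
 define f where "f = hat (\<lambda>x. x $ j ^ ((s + 1) * d))"
 define g where "g = hat (\<lambda>x. x $ j ^ (s * d))"
 \<comment> \<open>The coefficients of the equation \<open>X ^ s - x j ^ (s * d) = 0\<close>, of
   which only the one of index 0 is nonzero.\<close>
 define c where "c i = hat (if i = 0 then (\<lambda>x. - 1 * x $ j ^ (s * d)) else (\<lambda>x. 0))" for i :: nat
 have xS: "(\<lambda>x. x $ j ^ ((s + 1) * d)) \<in> S" "(\<lambda>x. x $ j ^ (s * d)) \<in> S"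
  by (intro coord_power admissible_large; simp)+
 have reg: "hat h \<in> freg Z (range ev)" if "h \<in> S" for h
  using that coord_ring_A_var unfolding pts_A_var by blast
 have fg: "f \<in> freg Z (range ev)" "g \<in> freg Z (range ev)" "\<forall>i<s. c i \<in> freg Z (range ev)"
  using xS const scale[OF xS(2), of "-1"] by (auto simp: f_def g_def c_def intro!: reg)
 have ev0: "ev 0 \<in> range ev" by simp
 have gz: "\<not> (\<exists>N. openin (ftop Z) N \<and> ev 0 \<in> N \<and> N \<subseteq> range ev \<and> (\<forall>y\<in>N. g y = 0))"
 proof (intro notI, elim exE conjE)
  fix N assume N: "openin (ftop Z) N" "ev 0 \<in> N" "\<forall>y\<in>N. g y = 0"
  obtain u where u: "u \<in> S" "u 0 ~= 0" "!!y. u y ~= 0 ==> ev y \<in> N" by (rule openin_A_varE[OF N(1,2)]) blast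
  have "(vec 1 :: 'k ^ 'n) $ j ^ (s * d) = 0"
  proof (rule polys_eq_dense[of "\<lambda>x. x $ j ^ (s * d)" "\<lambda>_. 0" u 0])
   fix y assume "u y ~= 0"
   hence "g (ev y) = 0" using u(3) N(3) by blast
   thus "y $ j ^ (s * d) = 0" using xS(2) by (simp add: g_def hat_ev)
  qed (use u polys xS in auto)
  thus False by simp
 qed
 have eq: "\<forall>y\<in>range ev. f y ^ s + (\<Sum>i<s. c i y * f y ^ i * g y ^ (s - i)) = 0"
 proof
  fix y assume "y \<in> range ev"
  then obtain x where y: "y = ev x" by auto
  have f: "f y = x $ j ^ ((s + 1) * d)" and g: "g y = x $ j ^ (s * d)"
   using xS by (simp_all only: f_def g_def y hat_ev)
  have c: "c i y = (if i = 0 then - (x $ j ^ (s * d)) else 0)" for i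
   using scale[OF xS(2), of "-1"] const by (simp add: c_def y hat_ev)
  have "(\<Sum>i<s. c i y * f y ^ i * g y ^ (s - i)) = (\<Sum>i<s. if i = 0 then - (x $ j ^ (s * d)) * (x $ j ^ (s * d)) ^ s else 0)"
   by (intro sum.cong) (auto simp: c g)
  also have "\<dots> = - (x $ j ^ (s * d)) * (x $ j ^ (s * d)) ^ s" using s by simp
  also have "\<dots> = - (f y ^ s)" unfolding f by (simp add: algebra_simps flip: power_mult power_add)
  finally show "f y ^ s + (\<Sum>i<s. c i y * f y ^ i * g y ^ (s - i)) = 0" by simp
 qed
 have na: "normal_at Z (ev 0)" using n ev0 unfolding normal_variety_def pts_A_var by blast
 have "\<exists>N. \<exists>h\<in>freg Z N. openin (ftop Z) N \<and> ev 0 \<in> N \<and> N \<subseteq> range ev \<and> (\<forall>y\<in>N. f y = g y * h y)"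
  by (rule bspec[OF bspec[OF spec[OF na[unfolded normal_at_def, THEN conjunct2], of "range ev"] fg(1)] fg(2),
     THEN spec[of _ s], THEN spec[of _ c], THEN mp]) (intro conjI ev0 gz fg(3) eq)
 then obtain N h where h: "h \<in> freg Z N" "ev 0 \<in> N" "\<forall>y\<in>N. f y = g y * h y" by (elim exE bexE conjE)
 obtain a b where ab: "a \<in> S" "b \<in> S" "b 0 ~= 0" "!!y. b y ~= 0 ==> ev y \<in> N" "!!y. b y ~= 0 ==> h (ev y) = a y / b y"
  by (rule freg_A_varE[OF h(1,2)]) blast
 have "x $ j ^ ((s + 1) * d) * b x = x $ j ^ (s * d) * a x" for x
 proof (rule polys_eq_dense[of "\<lambda>x. x $ j ^ ((s + 1) * d) * b x" "\<lambda>x. x $ j ^ (s * d) * a x" b 0])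
  fix y assume b: "b y ~= 0"
  hence "f (ev y) = g (ev y) * (a y / b y)" using h(3) ab(4,5) by auto
  hence "y $ j ^ ((s + 1) * d) = y $ j ^ (s * d) * (a y / b y)"
   using xS by (simp only: f_def g_def hat_ev)
  thus "y $ j ^ ((s + 1) * d) * b y = y $ j ^ (s * d) * a y" using b by (simp add: field_simps)
 qed (use ab(3) in "auto intro!: polys_mult polys_power polys[OF ab(1)] polys[OF ab(2)]")
 hence "(\<lambda>x. x $ j ^ ((s + 1) * d) * b x) = (\<lambda>x. x $ j ^ (s * d) * a x)" by auto
 \<comment> \<open>In degree \<open>(s + 1) * d\<close> the left side retains the constant
   \<open>b 0\<close>, the right side the component of degree \<open>d\<close> of \<open>a\<close>,
   which is zero.\<close>
 hence "hcomp ((s + 1) * d + 0) (\<lambda>x. x $ j ^ ((s + 1) * d) * b x) = hcomp (s * d + d) (\<lambda>x. x $ j ^ (s * d) * a x)"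
  by (simp add: add.commute)
 moreover have "hcomp ((s + 1) * d + 0) (\<lambda>x. x $ j ^ ((s + 1) * d) * b x) = (\<lambda>x. x $ j ^ ((s + 1) * d) * hcomp 0 b x)"
  by (rule hcomp_mult_homog[OF polys[OF ab(2)] polys[OF xS(1)]]) (simp add: power_mult_distrib)
 moreover have "hcomp (s * d + d) (\<lambda>x. x $ j ^ (s * d) * a x) = (\<lambda>x. x $ j ^ (s * d) * hcomp d a x)"
  by (rule hcomp_mult_homog[OF polys[OF ab(1)] polys[OF xS(2)]]) (simp add: power_mult_distrib)
 ultimately have e: "(\<lambda>x. x $ j ^ ((s + 1) * d) * hcomp 0 b x) = (\<lambda>x. x $ j ^ (s * d) * hcomp d a x)" by (simp only:)
 have "\<not> admissible d s d" using s d_pos by (simp add: admissible_def)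
 hence "hcomp d a = (\<lambda>x. 0)" by (rule hcomp_zero[OF ab(1)])
 hence "(vec 1 :: 'k ^ 'n) $ j ^ ((s + 1) * d) * hcomp 0 b (vec 1) = 0" using fun_cong[OF e, of "vec 1"] by simp
 thus False using hcomp_0[OF polys[OF ab(2)]] ab(3) by simp
qed

end

text \<open>Families rather than sets are needed; a repeated vector already gives a
  relation.\<close>

lemma (in vector_space) family_dependent:
 assumes I: "finite I" and T: "finite T" "!!i. i \<in> I ==> f i \<in> span T" "card T < card I"
 shows "\<exists>c. (\<exists>i\<in>I. c i ~= 0) \<and> (\<Sum>i\<in>I. scale (c i) (f i)) = 0"
proof (cases "inj_on f I")
 case True
 have "dependent (f ` I)"
 proof (rule ccontr)
  assume "independent (f ` I)"
  hence "card (f ` I) \<le> card T" using independent_span_bound[OF T(1), of "f ` I"] T(2) by auto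
  thus False using T(3) card_image[OF True] by simp
 qed
 then obtain u where u: "\<exists>v\<in>f ` I. u v ~= 0" "(\<Sum>v\<in>f ` I. scale (u v) v) = 0"
  using dependent_finite[of "f ` I"] I by auto
 thus ?thesis by (intro exI[of _ "\<lambda>i. u (f i)"]) (auto simp: sum.reindex[OF True])
next
 case False
 then obtain i j where ij: "i \<in> I" "j \<in> I" "i ~= j" "f i = f j" by (auto simp: inj_on_def)
 let ?c = "\<lambda>k. if k = i then 1 else if k = j then -1 else 0"
 have "(\<Sum>k\<in>I. scale (?c k) (f k)) = (\<Sum>k\<in>{i, j}. scale (?c k) (f k))"
  using I ij by (intro sum.mono_neutral_right) auto
 also have "\<dots> = 0" using ij by simp
 finally show ?thesis using ij(1) by (intro exI[of _ ?c]) auto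
qed

subsection \<open>Interpolation\<close>

text \<open>Generators are added one by one. If the present interpolation \<open>P\<close> fails to
  reproduce \<open>g\<close>, some point \<open>x0\<close> witnesses this and becomes a new
  node.\<close>

lemma interpolation:
 fixes F :: "('p => 'k::field) set"
 assumes "finite F"
 shows "\<exists>(N::nat) x L. (\<forall>l<N. L l \<in> fun_vs.span F) \<and> (\<forall>f\<in>fun_vs.span F. \<forall>z. f z = (\<Sum>l<N. f (x l) * L l z))"
 using assms
proof induction
 case empty
 thus ?case by (intro exI[of _ 0]) (simp add: zero_fun_def)
next
 case (insert g F)
 then obtain N :: nat and x L where NL: "\<forall>l<N. L l \<in> fun_vs.span F"
  "\<forall>f\<in>fun_vs.span F. \<forall>z. f z = (\<Sum>l<N. f (x l) * L l z)" by (elim exE conjE)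
 have L: "L l \<in> fun_vs.span F" if "l < N" for l using NL(1) that by simp
 have rep: "f z = (\<Sum>l<N. f (x l) * L l z)" if "f \<in> fun_vs.span F" for f z
  using bspec[OF NL(2) that] by (rule spec)
 define P where "P f = (\<lambda>z. \<Sum>l<N. f (x l) * L l z)" for f
 have Lspan: "L l \<in> fun_vs.span (insert g F)" if "l < N" for l
  using L[OF that] fun_vs.span_mono[of F "insert g F"] by auto
 have Pspan: "P f \<in> fun_vs.span (insert g F)" for f
  unfolding P_def by (rule fun_span_sum) (use Lspan in "auto intro: fun_vs.span_scale")
 have Plin: "P (\<lambda>z. h z + c * g z) w = P h w + c * P g w" for h c w
  by (simp add: P_def algebra_simps sum.distrib sum_distrib_left)
 have decomp: "\<exists>c h. h \<in> fun_vs.span F \<and> f = (\<lambda>z. h z + c * g z)" if f: "f \<in> fun_vs.span (insert g F)" for f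
 proof -
  obtain c where c: "f - (\<lambda>z. c * g z) \<in> fun_vs.span F" using f unfolding fun_vs.span_insert by auto
  thus ?thesis by (intro exI[of _ c] exI[of _ "f - (\<lambda>z. c * g z)"]) (simp add: fun_eq_iff)
 qed
 show ?case
 proof (cases "\<forall>z. g z = P g z")
  case True
  have "f z = (\<Sum>l<N. f (x l) * L l z)" if f: "f \<in> fun_vs.span (insert g F)" for f z
  proof -
   obtain c h where h: "h \<in> fun_vs.span F" "f = (\<lambda>z. h z + c * g z)" using decomp[OF f] by (elim exE conjE)
   have hz: "f z = h z + c * g z" by (simp only: h(2))
   have hP: "h z = P h z" unfolding P_def by (rule rep[OF h(1)])
   have gP: "g z = P g z" using True by (rule spec)
   have "f z = P h z + c * P g z" by (simp only: hz hP[symmetric] gP[symmetric])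
   also have "\<dots> = P f z" unfolding h(2) by (rule Plin[symmetric])
   finally show ?thesis unfolding P_def .
  qed
  thus ?thesis using Lspan by (intro exI[of _ N] exI[of _ x] exI[of _ L]) simp
 next
  case False
  then obtain x0 where x0: "g x0 ~= P g x0" by auto
  \<comment> \<open>The error of interpolating \<open>g\<close>, scaled to be 1 at
    \<open>x0\<close>. The interpolation error of every function in the larger span is a multiple of
    it.\<close>
  define L0 where "L0 = (\<lambda>z. inverse (g x0 - P g x0) * (g z - P g z))"
  have L0span: "L0 \<in> fun_vs.span (insert g F)"
  proof -
   have "g - P g \<in> fun_vs.span (insert g F)" by (intro fun_vs.span_diff Pspan fun_vs.span_base) simp
   from fun_vs.span_scale[OF this, of "inverse (g x0 - P g x0)"] show ?thesis by (simp add: L0_def)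
  qed
  define x' where "x' l = (if l < N then x l else x0)" for l
  define L' where "L' l = (if l < N then (\<lambda>z. L l z - L l x0 * L0 z) else L0)" for l
  have "f z = (\<Sum>l<Suc N. f (x' l) * L' l z)" if f: "f \<in> fun_vs.span (insert g F)" for f z
  proof -
   obtain c h where h: "h \<in> fun_vs.span F" "f = (\<lambda>z. h z + c * g z)" using decomp[OF f] by (elim exE conjE)
   have hP: "h w = P h w" for w unfolding P_def by (rule rep[OF h(1)])
   have Pf: "P f w = P h w + c * P g w" for w unfolding h(2) by (rule Plin)
   have fw: "f w = h w + c * g w" for w by (simp only: h(2))
   have "f w - P f w = c * (g w - P g w)" for w unfolding fw Pf hP[symmetric] by (simp add: algebra_simps)
   hence d: "f z - P f z = (f x0 - P f x0) * L0 z" using x0 by (simp add: L0_def)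
   have "(\<Sum>l<Suc N. f (x' l) * L' l z) = (\<Sum>l<N. f (x l) * (L l z - L l x0 * L0 z)) + f x0 * L0 z"
    by (simp add: x'_def L'_def)
   also have "(\<Sum>l<N. f (x l) * (L l z - L l x0 * L0 z)) = P f z - P f x0 * L0 z"
    by (simp add: P_def algebra_simps sum_subtractf sum_distrib_left)
   also have "P f z - P f x0 * L0 z + f x0 * L0 z = f z" using d by (simp add: algebra_simps)
   finally show ?thesis by simp
  qed
  moreover have "L' l \<in> fun_vs.span (insert g F)" for l
  proof (cases "l < N")
   case True
   have "L l - (\<lambda>z. L l x0 * L0 z) \<in> fun_vs.span (insert g F)"
    by (intro fun_vs.span_diff Lspan True fun_vs.span_scale L0span)
   moreover have "L' l = L l - (\<lambda>z. L l x0 * L0 z)" using True by (simp add: L'_def fun_eq_iff)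
   ultimately show ?thesis by (simp only:)
  qed (simp add: L'_def L0span)
  ultimately show ?thesis by (intro exI[of _ "Suc N"] exI[of _ x'] exI[of _ L']) simp
 qed
qed

section \<open>Bounded degree and algebraic independence\<close>

definition degree_le :: "('k::field_char_0 ^ 'n::finite => 'k) => nat => bool" where
 "degree_le f D \<longleftrightarrow> (\<forall>i>D. hcomp i f = (\<lambda>x. 0))"

lemma degree_le_exists:
 assumes "f \<in> polys" obtains D where "degree_le f D"
proof -
 obtain D where D: "!!i x. D < i ==> hcomp i f x = 0" using hcomp_bounded[OF assms] by blast
 show ?thesis by (rule that[of D]) (simp add: degree_le_def fun_eq_iff D)
qed

lemma degree_le_mono: "degree_le f D ==> D \<le> D' ==> degree_le f D'"
 by (auto simp: degree_le_def)

lemma degree_le_mult: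
 assumes "f \<in> polys" "g \<in> polys" "degree_le f a" "degree_le g b"
 shows "degree_le (\<lambda>x. f x * g x) (a + b)"
 unfolding degree_le_def
proof (intro allI impI)
 fix i assume i: "a + b < i"
 have "hcomp k f x * hcomp (i - k) g x = 0" if "k \<le> i" for k x
 proof (cases "a < k")
  case True
  thus ?thesis using assms(3) by (simp add: degree_le_def)
 next
  case False
  hence "b < i - k" using i by simp
  thus ?thesis using assms(4) by (simp add: degree_le_def)
 qed
 thus "hcomp i (\<lambda>x. f x * g x) = (\<lambda>x. 0)"
  by (subst hcomp_mult[OF assms(1,2)]) (auto intro!: ext sum.neutral simp del: mult_eq_0_iff)
qed

lemma degree_le_power:
 assumes "f \<in> polys" "degree_le f a" shows "degree_le (\<lambda>x. f x ^ m) (m * a)"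
proof (induction m)
 case 0
 thus ?case by (simp add: degree_le_def hcomp_const)
next
 case (Suc m)
 thus ?case using degree_le_mult[OF assms(1) polys_power[OF assms(1)] assms(2) Suc] by simp
qed

lemma degree_le_prod:
 assumes "finite I" "!!i. i \<in> I ==> f i \<in> polys" "!!i. i \<in> I ==> degree_le (f i) a"
 shows "degree_le (\<lambda>x. \<Prod>i\<in>I. f i x) (card I * a)"
 using assms
proof induction
 case empty
 thus ?case by (simp add: degree_le_def hcomp_const)
next
 case (insert i I)
 thus ?case
  using degree_le_mult[of "f i" "\<lambda>x. \<Prod>i\<in>I. f i x" a "card I * a"] by (auto intro: polys_prod)
qed

text \<open>The degrees in a product add up, because the top forms multiply to a nonzero form.\<close>

lemma degree_le_factor:
 assumes f: "f \<in> polys" and g: "g \<in> polys" and nz: "g x0 ~= 0" and D: "degree_le (\<lambda>x. g x * f x) D"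
 shows "degree_le f D"
proof -
 obtain N where N: "degree_le f N" using degree_le_exists[OF f] by blast
 obtain M where M: "degree_le g M" using degree_le_exists[OF g] by blast
 have "\<exists>m y. hcomp m g y ~= 0 \<and> degree_le g m"
  using M
 proof (induction M)
  case 0
  have "g = hcomp 0 g"
  proof (rule hcomp_eqI[OF g])
   show "hcomp i g x = hcomp i (hcomp 0 g) x" for i x using 0 g by (cases i) (auto simp: hcomp_hcomp degree_le_def)
  qed (use g in simp)
  hence "hcomp 0 g x0 ~= 0" using nz by metis
  thus ?case using 0 by blast
 next
  case (Suc M)
  show ?case
  proof (cases "\<exists>y. hcomp (Suc M) g y ~= 0")
   case False
   hence "degree_le g M"
    using Suc.prems unfolding degree_le_def by (metis Suc_lessI)
   thus ?thesis by (rule Suc.IH)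
  qed (use Suc.prems in blast)
 qed
 then obtain m y where m: "hcomp m g y ~= 0" "degree_le g m" by blast
 show ?thesis
  using N
 proof (induction N)
  case 0
  thus ?case by (rule degree_le_mono) simp
 next
  case (Suc N)
  show ?case
  proof (cases "Suc N \<le> D")
   case True
   thus ?thesis by (rule degree_le_mono[OF Suc.prems])
  next
   case False
   have "hcomp (m + Suc N) (\<lambda>x. g x * f x) x = hcomp m g x * hcomp (Suc N) f x" for x
   proof -
    have "hcomp k g x * hcomp (m + Suc N - k) f x = (if k = m then hcomp m g x * hcomp (Suc N) f x else 0)" for k
    proof (cases "k < m")
     case True
     thus ?thesis using Suc.prems by (simp add: degree_le_def)
    next
     case False
     thus ?thesis using m(2) by (cases "k = m") (auto simp: degree_le_def)
    qed
    hence "hcomp (m + Suc N) (\<lambda>x. g x * f x) x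
      = (\<Sum>k\<le>m + Suc N. if k = m then hcomp m g x * hcomp (Suc N) f x else 0)"
     by (simp only: hcomp_mult[OF g f])
    also have "\<dots> = hcomp m g x * hcomp (Suc N) f x" by (subst sum.delta) auto
    finally show ?thesis .
   qed
   hence z: "hcomp m g x * hcomp (Suc N) f x = 0" for x
    using D False by (simp add: degree_le_def)
   have "hcomp (Suc N) f x = 0" for x
    by (rule polys_domain[OF hcomp_polys[OF g] hcomp_polys[OF f] z m(1)])
   hence "hcomp (Suc N) f = (\<lambda>x. 0)" by auto
   hence "degree_le f N" using Suc.prems unfolding degree_le_def by (metis Suc_lessI)
   thus ?thesis by (rule Suc.IH)
  qed
 qed
qed

text \<open>By induction on the number of variables: as a polynomial in the last variable the sum
  vanishes identically, so the coefficient of each power \<open>a\<close> vanishes, and this is a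
  sum in the remaining variables.\<close>

lemma alg_indep_power_functions:
 fixes c :: "(nat => nat) => 'k::field_char_0"
 assumes "finite E" "E \<subseteq> ({..<m} \<rightarrow>\<^sub>E UNIV)" "!!y. (\<Sum>e\<in>E. c e * (\<Prod>i<m. y i ^ e i)) = 0" "e \<in> E"
 shows "c e = 0"
 using assms
proof (induction m arbitrary: E c e)
 case 0
 hence "E = {e}" by auto
 thus ?case using 0(3)[of "\<lambda>_. 0"] by simp
next
 case (Suc m)
 define a where "a = e m"
 define E' where "E' = (\<lambda>e. restrict e {..<m}) ` {e\<in>E. e m = a}"
 have rest_upd: "(restrict f {..<m})(m := a) = f" if "f \<in> {e\<in>E. e m = a}" for f
 proof
  fix i
  have "f \<in> {..<Suc m} \<rightarrow>\<^sub>E UNIV" using that Suc.prems(2) by auto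
  hence "f i = undefined" if "\<not> i < Suc m" using that by (auto simp: PiE_def extensional_def)
  thus "((restrict f {..<m})(m := a)) i = f i" using that \<open>f \<in> {e\<in>E. e m = a}\<close>
   by (auto simp: restrict_def less_Suc_eq)
 qed
 hence inj: "inj_on (\<lambda>e. restrict e {..<m}) {e\<in>E. e m = a}" by (metis (no_types, lifting) inj_onI)
 have "c ((restrict e {..<m})(m := a)) = 0"
 proof (rule Suc.IH[of E' "\<lambda>f. c (f(m := a))"])
  show "finite E'" using Suc.prems(1) by (simp add: E'_def)
  show "E' \<subseteq> {..<m} \<rightarrow>\<^sub>E UNIV" unfolding E'_def by (simp only: image_subset_iff restrict_PiE_iff) simp
  show "restrict e {..<m} \<in> E'" using Suc.prems(4) by (auto simp: E'_def a_def)
  fix y :: "nat => 'k"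
  define p where "p = (\<Sum>f\<in>E. monom (c f * (\<Prod>i<m. y i ^ f i)) (f m))"
  have "poly p t = 0" for t
  proof -
   have "poly p t = (\<Sum>f\<in>E. c f * (\<Prod>i<Suc m. (y(m := t)) i ^ f i))"
    unfolding p_def poly_sum by (intro sum.cong) (simp_all add: poly_monom)
   thus ?thesis using Suc.prems(3)[of "y(m := t)"] by (rule trans)
  qed
  hence "p = 0" by (intro poly_eq_cofinite[of "{}"]) simp_all
  hence "0 = coeff p a" by simp
  also have "\<dots> = (\<Sum>f\<in>E. if f m = a then c f * (\<Prod>i<m. y i ^ f i) else 0)"
   unfolding p_def coeff_sum by (intro sum.cong) auto
  also have "\<dots> = (\<Sum>f\<in>{e\<in>E. e m = a}. c f * (\<Prod>i<m. y i ^ f i))"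
   using Suc.prems(1) by (simp add: sum.inter_filter)
  also have "\<dots> = (\<Sum>f\<in>E'. c (f(m := a)) * (\<Prod>i<m. y i ^ f i))"
   unfolding E'_def sum.reindex[OF inj] o_def using rest_upd by (intro sum.cong) auto
  finally show "(\<Sum>f\<in>E'. c (f(m := a)) * (\<Prod>i<m. y i ^ f i)) = 0" by simp
 qed
 thus ?case using rest_upd[of e] Suc.prems(4) by (simp add: a_def)
qed

lemma sum_mult_delta [simp]:
 fixes g :: "'i::finite => 'k::semiring_1"
 shows "(\<Sum>l\<in>UNIV. g l * (if i = l then 1 else 0)) = g i" "(\<Sum>l\<in>UNIV. g l * (if l = i then 1 else 0)) = g i"
 by (simp_all add: if_distrib[of "\<lambda>x. _ * x"] cong: if_cong)

context graded_ring
begin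

lemma interpolation_A_ring:
 obtains N :: nat and x L where "!!l. l < N ==> L l \<in> S"
  "!!f z. f \<in> S ==> degree_le f D ==> f z = (\<Sum>l<N. f (x l) * L l z)"
proof -
 let ?F = "{monomial e |e. admissible d s (sum e UNIV) \<and> sum e UNIV \<le> D} :: ('k ^ 'n => 'k) set"
 obtain N :: nat and x L where NL: "\<forall>l<N. L l \<in> fun_vs.span ?F"
  "\<forall>f\<in>fun_vs.span ?F. \<forall>z. f z = (\<Sum>l<N. f (x l) * L l z)"
  using interpolation[OF finite_monomials, of "\<lambda>e. admissible d s (sum e UNIV)" D] by (elim exE conjE)
 have "f \<in> S" if "f \<in> fun_vs.span ?F" for f
  using that
 proof (induction rule: fun_span_induct)
  case (step c f g)
  thus ?case using monomial by (auto intro!: add scale)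
 qed (rule const)
 moreover have "f \<in> fun_vs.span ?F" if "f \<in> S" "degree_le f D" for f
  by (rule span_monomials) (use that in "auto simp: degree_le_def")
 ultimately show ?thesis using NL by (intro that[of N L x]) blast+
qed

subsection \<open>Dimension\<close>

text \<open>The upper bound counts: for more than \<open>n\<close> functions, their monomials with
  exponents up to \<open>D\<close> outnumber, for large \<open>D\<close>, the monomials on
  \<open>k ^ n\<close> of the degree reached after clearing denominators. The lower bound uses
  powers of the coordinates.\<close>

lemma variety_dim_A_var: "variety_dim Z = enat CARD('n)"
proof (rule antisym)
 show "variety_dim Z \<le> enat CARD('n)"
  unfolding variety_dim_def
 proof (rule Sup_least, clarify)
  fix m U f assume U: "openin (ftop Z) U" "U ~= {}" and f: "\<forall>i<m. f i \<in> freg Z U" and ind: "alg_indep_on U m f"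
  have "m \<le> CARD('n)"
  proof (rule ccontr)
   assume "\<not> m \<le> CARD('n)"
   hence m: "CARD('n) < m" by simp
   have "U \<subseteq> range ev" using U(1) by (simp add: openin_A_var)
   then obtain x where x: "ev x \<in> U" using U(2) by blast
   have "\<exists>e\<in>S. e x ~= 0 \<and> (\<forall>y. e y ~= 0 --> ev y \<in> U) \<and> (\<forall>i\<in>{..<m}. \<exists>a\<in>S. \<forall>y. e y ~= 0 --> a y = e y * f i (ev y))"
    by (rule common_denominator) (use f U x in auto)
   then obtain e where e: "e \<in> S" "e x ~= 0" "\<forall>y. e y ~= 0 --> ev y \<in> U"
    "\<forall>i\<in>{..<m}. \<exists>a\<in>S. \<forall>y. e y ~= 0 --> a y = e y * f i (ev y)" by (elim bexE conjE)
   from bchoice[OF e(4)[unfolded Bex_def]] obtain a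
    where a: "\<forall>i\<in>{..<m}. a i \<in> S \<and> (\<forall>y. e y ~= 0 --> a i y = e y * f i (ev y))" by (elim exE)
   have aS: "a i \<in> S" and ae: "!!y. e y ~= 0 ==> a i y = e y * f i (ev y)" if "i < m" for i
    using a that by auto
   have "\<exists>\<delta>. degree_le e \<delta> \<and> (\<forall>i\<in>{..<m}. degree_le (a i) \<delta>)"
   proof -
    have "\<exists>\<delta>. \<forall>h\<in>insert e (a ` {..<m}). degree_le h \<delta>"
    proof (rule finite_induct[of "insert e (a ` {..<m})" "\<lambda>H. H \<subseteq> polys --> (\<exists>\<delta>. \<forall>h\<in>H. degree_le h \<delta>)", THEN mp])
     fix h H assume "H \<subseteq> polys --> (\<exists>\<delta>. \<forall>h\<in>H. degree_le h \<delta>)"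
     show "insert h H \<subseteq> polys --> (\<exists>\<delta>. \<forall>h\<in>insert h H. degree_le h \<delta>)"
     proof
      assume i: "insert h H \<subseteq> polys"
      then obtain \<delta> where "\<forall>h\<in>H. degree_le h \<delta>" using \<open>H \<subseteq> polys --> _\<close> by auto
      moreover obtain \<delta>' where "degree_le h \<delta>'" using degree_le_exists[of h] i by auto
      ultimately show "\<exists>\<delta>. \<forall>h\<in>insert h H. degree_le h \<delta>"
       by (intro exI[of _ "max \<delta> \<delta>'"]) (auto intro: degree_le_mono)
     qed
    qed (use e(1) aS polys in auto)
    thus ?thesis by auto
   qed
   then obtain \<delta>0 where \<delta>0: "degree_le e \<delta>0" "\<forall>i\<in>{..<m}. degree_le (a i) \<delta>0" by blast
   \<comment> \<open>The degree bound is made positive for the sake of the estimate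
     \<open>Suc (m * (D * \<delta>)) \<le> m * \<delta> * Suc D\<close>.\<close>
   define \<delta> where "\<delta> = Suc \<delta>0"
   have \<delta>: "degree_le e \<delta>" "!!i. i < m ==> degree_le (a i) \<delta>"
    using \<delta>0 degree_le_mono[of _ \<delta>0 \<delta>] by (auto simp: \<delta>_def)
   \<comment> \<open>Chosen so that \<open>(m * \<delta> * Suc D) ^ n = D * Suc D ^ n\<close>, which
     is less than \<open>Suc D ^ (n + 1)\<close>, hence less than the number of exponents when
     \<open>m > n\<close>.\<close>
   define D where "D = (m * \<delta>) ^ CARD('n)"
   define I where "I = ({..<m} \<rightarrow>\<^sub>E {..D})"
   \<comment> \<open>On \<open>e \<noteq> 0\<close> this is the monomial in the \<open>f i\<close>
     with exponents \<open>\<epsilon>\<close>, times \<open>e ^ (m * D)\<close>; the power of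
     \<open>e\<close> is the same for all \<open>\<epsilon>\<close>.\<close>
   define G where "G \<epsilon> = (\<lambda>x. \<Prod>i<m. a i x ^ \<epsilon> i * e x ^ (D - \<epsilon> i))" for \<epsilon>
   define T :: "('k ^ 'n => 'k) set" where "T = monomial ` {e :: 'n => nat. sum e UNIV \<le> m * (D * \<delta>)}"
   have finT: "finite T" unfolding T_def by (intro finite_imageI finite_exponents)
   have "finite I" unfolding I_def by (intro finite_PiE) auto
   have GS: "G \<epsilon> \<in> S" and Gd: "degree_le (G \<epsilon>) (m * (D * \<delta>))" if "\<epsilon> \<in> I" for \<epsilon>
   proof -
    have \<epsilon>: "\<epsilon> i \<le> D" if "i < m" for i using \<open>\<epsilon> \<in> I\<close> that by (auto simp: I_def)
    show "G \<epsilon> \<in> S" unfolding G_def using aS e(1) by (intro prod mult power) auto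
    have "degree_le (\<lambda>x. a i x ^ \<epsilon> i * e x ^ (D - \<epsilon> i)) (D * \<delta>)" if "i < m" for i
    proof -
     have "degree_le (\<lambda>x. a i x ^ \<epsilon> i * e x ^ (D - \<epsilon> i)) (\<epsilon> i * \<delta> + (D - \<epsilon> i) * \<delta>)"
      using that by (intro degree_le_mult degree_le_power polys_power \<delta> polys[OF e(1)] polys[OF aS])
     moreover have "\<epsilon> i * \<delta> + (D - \<epsilon> i) * \<delta> = D * \<delta>" using \<epsilon>[OF that] by (simp flip: add_mult_distrib)
     ultimately show ?thesis by (simp only:)
    qed
    hence "degree_le (G \<epsilon>) (card {..<m} * (D * \<delta>))" unfolding G_def
     by (intro degree_le_prod polys_mult polys_power polys[OF e(1)] polys[OF aS]) auto
    thus "degree_le (G \<epsilon>) (m * (D * \<delta>))" by simp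
   qed
   have Gspan: "G \<epsilon> \<in> fun_vs.span T" if "\<epsilon> \<in> I" for \<epsilon>
   proof -
    have "G \<epsilon> \<in> fun_vs.span {monomial e |e. admissible d s (sum e UNIV) \<and> sum e UNIV \<le> m * (D * \<delta>)}"
     using Gd[OF that] by (intro span_monomials[OF GS[OF that]]) (auto simp: degree_le_def)
    thus ?thesis by (elim subsetD[OF fun_vs.span_mono, rotated]) (auto simp: T_def)
   qed
   have "card T \<le> card {e :: 'n => nat. sum e UNIV \<le> m * (D * \<delta>)}"
    unfolding T_def by (intro card_image_le finite_exponents)
   also have "\<dots> \<le> card ((UNIV :: 'n set) \<rightarrow>\<^sub>E {..m * (D * \<delta>)})"
   proof (rule card_mono)
    show "{e :: 'n => nat. sum e UNIV \<le> m * (D * \<delta>)} \<subseteq> UNIV \<rightarrow>\<^sub>E {..m * (D * \<delta>)}"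
    proof
     fix e :: "'n => nat" assume "e \<in> {e. sum e UNIV \<le> m * (D * \<delta>)}"
     moreover have "e i \<le> sum e UNIV" for i by (rule member_le_sum) auto
     ultimately show "e \<in> UNIV \<rightarrow>\<^sub>E {..m * (D * \<delta>)}" by (auto simp: PiE_UNIV_domain intro: order_trans)
    qed
   qed (simp add: finite_PiE)
   also have "\<dots> = Suc (m * (D * \<delta>)) ^ CARD('n)" by (simp add: card_PiE)
   also have "\<dots> \<le> (m * \<delta> * Suc D) ^ CARD('n)"
    using m by (intro power_mono) (auto simp: \<delta>_def algebra_simps)
   also have "\<dots> = D * Suc D ^ CARD('n)" by (simp only: D_def power_mult_distrib)
   also have "\<dots> < Suc D * Suc D ^ CARD('n)" by simp
   also have "\<dots> = Suc D ^ Suc CARD('n)" by simp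
   also have "\<dots> \<le> Suc D ^ m" using m by (intro power_increasing) auto
   also have "\<dots> = card I" by (simp add: I_def card_PiE)
   finally have "card T < card I" .
   have "\<exists>c. (\<exists>\<epsilon>\<in>I. c \<epsilon> ~= 0) \<and> (\<Sum>\<epsilon>\<in>I. (\<lambda>x. c \<epsilon> * G \<epsilon> x)) = 0"
    by (rule fun_vs.family_dependent[OF \<open>finite I\<close> finT]) (rule Gspan, assumption, rule \<open>card T < card I\<close>)
   then obtain c where c: "\<exists>\<epsilon>\<in>I. c \<epsilon> ~= 0" "(\<Sum>\<epsilon>\<in>I. (\<lambda>x. c \<epsilon> * G \<epsilon> x)) = 0" by (elim exE conjE)
   have cG: "(\<Sum>\<epsilon>\<in>I. c \<epsilon> * G \<epsilon> x) = 0" for x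
    using fun_cong[OF c(2), of x] unfolding sum_fun_eq[symmetric] by simp
   define h where "h = (\<lambda>p\<in>U. \<Sum>\<epsilon>\<in>I. c \<epsilon> * (\<Prod>i<m. f i p ^ \<epsilon> i))"
   have A: "subalg U (freg Z U)" by (rule fun_space_subalg[OF fun_space_A_var U(1)])
   have "(\<lambda>p\<in>U. \<Sum>\<epsilon>\<in>I. (\<lambda>p\<in>U. c \<epsilon> * (\<lambda>p\<in>U. \<Prod>i<m. (\<lambda>p\<in>U. f i p ^ \<epsilon> i) p) p) p) \<in> freg Z U"
    using f by (intro subalg_sum[OF A] subalg_scale[OF A] subalg_prod[OF A] subalg_power[OF A]) auto
   also have "(\<lambda>p\<in>U. \<Sum>\<epsilon>\<in>I. (\<lambda>p\<in>U. c \<epsilon> * (\<lambda>p\<in>U. \<Prod>i<m. (\<lambda>p\<in>U. f i p ^ \<epsilon> i) p) p) p) = h"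
    by (auto simp: h_def restrict_def)
   finally have hreg: "h \<in> freg Z U" .
   have h0: "h (ev y) = 0" if ey: "e y ~= 0" for y
   proof -
    have "G \<epsilon> y = e y ^ (m * D) * (\<Prod>i<m. f i (ev y) ^ \<epsilon> i)" if "\<epsilon> \<in> I" for \<epsilon>
    proof -
     have "a i y ^ \<epsilon> i * e y ^ (D - \<epsilon> i) = e y ^ D * f i (ev y) ^ \<epsilon> i" if "i < m" for i
     proof -
      have "\<epsilon> i \<le> D" using \<open>\<epsilon> \<in> I\<close> that by (auto simp: I_def)
      hence "e y ^ D = e y ^ \<epsilon> i * e y ^ (D - \<epsilon> i)" by (simp flip: power_add)
      thus ?thesis using ae[OF that ey] by (simp add: power_mult_distrib)
     qed
     hence "G \<epsilon> y = (\<Prod>i<m. e y ^ D * f i (ev y) ^ \<epsilon> i)" by (simp add: G_def)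
     thus ?thesis by (simp add: prod.distrib mult.commute flip: power_mult)
    qed
    hence "e y ^ (m * D) * (\<Sum>\<epsilon>\<in>I. c \<epsilon> * (\<Prod>i<m. f i (ev y) ^ \<epsilon> i)) = (\<Sum>\<epsilon>\<in>I. c \<epsilon> * G \<epsilon> y)"
     unfolding sum_distrib_left by (intro sum.cong) (auto simp: mult_ac)
    hence "(\<Sum>\<epsilon>\<in>I. c \<epsilon> * (\<Prod>i<m. f i (ev y) ^ \<epsilon> i)) = 0" using cG ey by simp
    thus ?thesis using e(3) ey by (simp add: h_def)
   qed
   \<comment> \<open>The relation is known where \<open>e\<close> does not vanish; regularity of
     \<open>h\<close> and density extend it to all of \<open>U\<close>.\<close>
   have hz: "h p = 0" if p: "p \<in> U" for p
   proof -
    obtain z where z: "p = ev z" using \<open>U \<subseteq> range ev\<close> p by blast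
    obtain a' b' where ab: "a' \<in> S" "b' \<in> S" "b' z ~= 0" "!!y. b' y ~= 0 ==> h (ev y) = a' y / b' y"
     by (rule freg_A_varE[OF hreg p[unfolded z]]) blast
    have "a' z * b' z = 0"
    proof (rule polys_eq_dense[of "\<lambda>z. a' z * b' z" "\<lambda>_. 0" e x])
     show "a' y * b' y = 0" if "e y ~= 0" for y using h0[OF that] ab(4)[of y] by (cases "b' y = 0") auto
    qed (use e(2) in "auto intro!: polys_mult polys[OF ab(1)] polys[OF ab(2)] polys[OF e(1)]")
    thus ?thesis using ab(3) ab(4)[of z] z by simp
   qed
   have "\<forall>\<epsilon>\<in>I. c \<epsilon> = 0"
    by (rule ind[unfolded alg_indep_on_def, THEN spec[of _ I], THEN spec[of _ c], THEN mp])
     (use \<open>finite I\<close> hz in "auto simp: I_def h_def")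
   thus False using c(1) by blast
  qed
  thus "enat m \<le> enat CARD('n)" by simp
 qed
next
 obtain \<iota> where \<iota>: "bij_betw \<iota> {..<CARD('n)} (UNIV :: 'n set)"
  using ex_bij_betw_nat_finite[of "UNIV :: 'n set"] by (auto simp: atLeast0LessThan)
 \<comment> \<open>The powers \<open>x i ^ M\<close> lie in the ring and take arbitrary values
   simultaneously, as \<open>M\<close>-th roots exist. Hence a relation among them is a relation
   among free variables.\<close>
 define M where "M = Suc s * d"
 define f where "f i = hat (\<lambda>x. x $ \<iota> i ^ M)" for i
 have xS: "(\<lambda>x. x $ j ^ M) \<in> S" for j unfolding M_def by (intro coord_power admissible_large) simp
 have M: "0 < M" using d_pos by (simp add: M_def)
 have "alg_indep_on (range ev) CARD('n) f"
  unfolding alg_indep_on_def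
 proof (intro allI impI ballI)
  fix E c and e assume E: "finite E \<and> E \<subseteq> ({..<CARD('n)} \<rightarrow>\<^sub>E UNIV) \<and>
   (\<forall>x\<in>range ev. (\<Sum>e\<in>E. c e * (\<Prod>i<CARD('n). f i x ^ e i)) = 0)" and e: "e \<in> E"
  show "c e = 0"
  proof (rule alg_indep_power_functions[OF _ _ _ e])
   fix y :: "nat => 'k"
   have "\<exists>t. t ^ M = y i" for i using nth_root_exists[OF M] by blast
   then obtain t where t: "!!i. t i ^ M = y i" by metis
   define x :: "'k ^ 'n" where "x = (\<chi> j. t (inv_into {..<CARD('n)} \<iota> j))"
   have "f i (ev x) = y i" if "i < CARD('n)" for i
    using that xS t by (simp add: f_def hat_ev x_def inv_into_f_f[OF bij_betw_imp_inj_on[OF \<iota>]])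
   hence "(\<Sum>e\<in>E. c e * (\<Prod>i<CARD('n). y i ^ e i)) = (\<Sum>e\<in>E. c e * (\<Prod>i<CARD('n). f i (ev x) ^ e i))"
    by (intro sum.cong arg_cong2[of _ _ _ _ "(*)"] prod.cong) auto
   thus "(\<Sum>e\<in>E. c e * (\<Prod>i<CARD('n). y i ^ e i)) = 0" using E by simp
  qed (use E in auto)
 qed
 moreover have "f i \<in> freg Z (range ev)" for i
  using xS coord_ring_A_var unfolding pts_A_var f_def by blast
 moreover have "openin (ftop Z) (range ev)" using openin_topspace[of "ftop Z"] by (simp only: pts_A_var)
 ultimately show "enat CARD('n) \<le> variety_dim Z"
  unfolding variety_dim_def by (intro Sup_upper CollectI exI[of _ "CARD('n)"] exI[of _ "range ev"] exI[of _ f]) auto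
qed

subsection \<open>Tangent spaces\<close>

definition point_derivation :: "'k ^ 'n => (('k ^ 'n => 'k) => 'k) => bool" where
 "point_derivation x \<delta> \<longleftrightarrow> (\<forall>c. \<forall>f\<in>S. \<delta> (\<lambda>x. c * f x) = c * \<delta> f) \<and>
   (\<forall>f\<in>S. \<forall>g\<in>S. \<delta> (\<lambda>x. f x + g x) = \<delta> f + \<delta> g \<and> \<delta> (\<lambda>x. f x * g x) = \<delta> f * g x + f x * \<delta> g)"

lemma hat_scale: "f \<in> S ==> hat (\<lambda>x. c * f x) = (\<lambda>p\<in>range ev. c * hat f p)"
 by (rule restrict_hat[symmetric]) (auto intro: scale simp: hat_ev)

lemma tangent_space_iff:
 "D \<in> tangent_space Z (ev x) \<longleftrightarrow> (\<forall>f. f \<notin> hat ` S --> D f = 0) \<and> point_derivation x (\<lambda>f. D (hat f))"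
 unfolding tangent_space_def point_derivation_def coord_ring_A_var unfolding pts_A_var
 by (simp add: ball_simps(9) hat_add[symmetric] hat_mult[symmetric] hat_scale[symmetric] hat_ev cong: ball_cong)

context
 fixes x \<delta> assumes pd: "point_derivation x \<delta>"
begin

lemma pd_scale: "f \<in> S ==> \<delta> (\<lambda>x. c * f x) = c * \<delta> f"
 using pd by (simp add: point_derivation_def)

lemma pd_add: "f \<in> S ==> g \<in> S ==> \<delta> (\<lambda>x. f x + g x) = \<delta> f + \<delta> g"
 using pd by (simp add: point_derivation_def)

lemma pd_mult: "f \<in> S ==> g \<in> S ==> \<delta> (\<lambda>x. f x * g x) = \<delta> f * g x + f x * \<delta> g"
 using pd by (simp add: point_derivation_def)

lemma pd_const: "\<delta> (\<lambda>x. c) = 0"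
proof -
 have "\<delta> (\<lambda>x. 1 * 1) = \<delta> (\<lambda>x. 1) * 1 + 1 * \<delta> (\<lambda>x. 1)" by (rule pd_mult[OF const const])
 hence "\<delta> (\<lambda>x. 1) = 0" by simp
 thus ?thesis using pd_scale[OF const, of c 1] by simp
qed

lemma pd_power: "f \<in> S ==> \<delta> f = 0 ==> \<delta> (\<lambda>x. f x ^ m) = 0"
proof (induction m)
 case (Suc m)
 thus ?case using pd_mult[OF Suc.prems(1) power[OF Suc.prems(1)], of m] by simp
qed (simp add: pd_const)

lemma pd_sum: "(!!i. i \<in> I ==> f i \<in> S) ==> \<delta> (\<lambda>x. \<Sum>i\<in>I. f i x) = (\<Sum>i\<in>I. \<delta> (f i))"
proof (induction I rule: infinite_finite_induct)
 case (insert i I)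
 have "\<delta> (\<lambda>x. f i x + (\<Sum>i\<in>I. f i x)) = \<delta> (f i) + \<delta> (\<lambda>x. \<Sum>i\<in>I. f i x)"
  using insert.prems by (intro pd_add sum) auto
 thus ?case using insert by simp
qed (simp_all add: pd_const)

lemma pd_subst:
 "g \<in> polys ==> (!!i. w i \<in> S) ==> \<delta> (\<lambda>x. g (\<chi> i. w i x)) = dir_deriv g (\<chi> i. w i x) (\<chi> i. \<delta> (w i))"
proof (induction rule: polys_induct)
 case (add f g)
 thus ?case using pd_add[OF subst subst, of f w g w] by (simp add: dir_deriv_add)
next
 case (mult f g)
 thus ?case using pd_mult[OF subst subst, of f w g w] by (simp add: dir_deriv_mult)
qed (simp_all add: pd_const)

end

lemma dir_deriv_is_point_derivation: "point_derivation x (\<lambda>f. dir_deriv f x v)"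
 unfolding point_derivation_def
 using dir_deriv_mult[OF polys_const] by (auto simp: dir_deriv_add dir_deriv_mult polys)

text \<open>Invariants have no components of degree strictly between 0 and \<open>d\<close>. In the
  component of degree \<open>d\<close> of a product, only the two terms with a constant factor
  remain, which is the Leibniz rule at the origin.\<close>

lemma hcomp_is_point_derivation: "s = 0 ==> point_derivation 0 (\<lambda>f. hcomp d f z)"
 unfolding point_derivation_def
proof (intro conjI allI ballI)
 fix f g assume s: "s = 0" and f: "f \<in> S" and g: "g \<in> S"
 show "hcomp d (\<lambda>x. f x + g x) z = hcomp d f z + hcomp d g z" using f g by (simp add: hcomp_add polys)
 have "hcomp k f z * hcomp (d - k) g z =
   (if k = 0 then f 0 * hcomp d g z else 0) + (if k = d then hcomp d f z * g 0 else 0)" if "k \<le> d" for k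
 proof (cases "k = 0 \<or> k = d")
  case True
  thus ?thesis using d_pos hcomp_0[OF polys[OF f]] hcomp_0[OF polys[OF g]] by auto
 next
  case False
  hence "\<not> d dvd k" using that by (auto dest: dvd_imp_le)
  hence "\<not> admissible d s k" using False by (simp add: admissible_def)
  thus ?thesis using False hcomp_zero[OF f] by simp
 qed
 hence "hcomp d (\<lambda>x. f x * g x) z = (\<Sum>k\<le>d. (if k = 0 then f 0 * hcomp d g z else 0) + (if k = d then hcomp d f z * g 0 else 0))"
  unfolding hcomp_mult[OF polys[OF f] polys[OF g]] by (intro sum.cong) auto
 thus "hcomp d (\<lambda>x. f x * g x) z = hcomp d f z * g 0 + f 0 * hcomp d g z"
  by (simp add: sum.distrib)
qed (simp add: hcomp_scale polys)

text \<open>The forms of degree \<open>d\<close> that serve as local coordinates of the quotient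
  where \<open>x j\<close> is nonzero.\<close>

definition chart :: "'n => 'n => 'k ^ 'n => 'k" where
 "chart j i = (\<lambda>x. x $ i * x $ j ^ (d - 1))"

lemma chart_S: "s = 0 ==> chart j i \<in> S"
proof (rule homogI)
 show "chart j i \<in> polys" unfolding chart_def by (intro polys_mult polys_power polys_coord)
 have "t ^ d = t * t ^ (d - 1)" for t :: 'k using d_pos by (simp flip: power_Suc)
 thus "chart j i (t *s x) = t ^ d * chart j i x" for t x by (simp add: chart_def power_mult_distrib)
qed (simp add: admissible_def)

text \<open>A form \<open>g\<close> of degree \<open>m = d * k\<close> satisfies
  \<open>g x * x j ^ ((d - 1) * m) = g w\<close>, where \<open>w\<close> is the vector of charts.
  The chain rule makes the derivation vanish on the right side, and on the power of
  \<open>x j\<close>, which is a power of \<open>chart j j\<close>.\<close>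

lemma point_derivation_chart_unique:
 assumes s: "s = 0" and x: "x $ j ~= 0" and pd: "point_derivation x \<delta>" and z: "!!i. \<delta> (chart j i) = 0"
  and f: "f \<in> S"
 shows "\<delta> f = 0"
proof -
 have hom: "\<delta> (hcomp m f) = 0" for m
 proof (cases "d dvd m")
  case False
  hence "\<not> admissible d s m" unfolding admissible_def by (metis dvd_0_right)
  thus ?thesis using hcomp_zero[OF f] pd_const[OF pd, of 0] by simp
 next
  case True
  then obtain k where k: "m = d * k" by auto
  let ?g = "hcomp m f" and ?c = "\<lambda>x::'k ^ 'n. x $ j ^ ((d - 1) * m)"
  have cj: "chart j j = (\<lambda>x. x $ j ^ d)" using d_pos by (simp add: chart_def fun_eq_iff flip: power_Suc)
  have c: "?c = (\<lambda>x. chart j j x ^ ((d - 1) * k))" unfolding cj k by (simp add: mult_ac flip: power_mult)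
  have cS: "?c \<in> S" unfolding c using chart_S[OF s] by (rule power)
  have "\<delta> ?c = 0" unfolding c by (rule pd_power[OF pd chart_S[OF s] z])
  moreover have "(\<lambda>x. ?g x * ?c x) = (\<lambda>x. ?g (\<chi> i. chart j i x))"
  proof
   fix x
   have "(\<chi> i. chart j i x) = x $ j ^ (d - 1) *s x" by (simp add: chart_def vec_eq_iff mult.commute)
   thus "?g x * ?c x = ?g (\<chi> i. chart j i x)"
    using hcomp_smult[OF polys[OF f]] by (simp add: mult.commute flip: power_mult)
  qed
  moreover have "\<delta> (\<lambda>x. ?g (\<chi> i. chart j i x)) = 0"
  proof -
   have "(\<chi> i. \<delta> (chart j i)) = 0 *s (0 :: 'k ^ 'n)" using z by (simp add: vec_eq_iff)
   thus ?thesis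
    using pd_subst[OF pd polys[OF hcomp[OF f]] chart_S[OF s], of m]
     dir_deriv_linear(2)[OF polys[OF hcomp[OF f]], of m _ 0 0] by simp
  qed
  ultimately have "\<delta> ?g * ?c x = 0" using pd_mult[OF pd hcomp[OF f] cS, of m] by simp
  thus ?thesis using x by simp
 qed
 obtain N where N: "!!i x. N < i ==> hcomp i f x = 0" using hcomp_bounded[OF polys[OF f]] by blast
 have "f = (\<lambda>x. \<Sum>i\<le>N. hcomp i f x)" using hcomp_expand[OF polys[OF f] N] by auto
 hence "\<delta> f = \<delta> (\<lambda>x. \<Sum>i\<le>N. hcomp i f x)" by (rule arg_cong)
 also have "\<dots> = 0" using hcomp[OF f] by (simp add: pd_sum[OF pd] hom)
 finally show ?thesis .
qed

lemma chart_direction: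
 assumes x: "x $ j ~= 0"
 shows "\<exists>v. \<forall>i. dir_deriv (chart j i) x v = u i"
proof -
 \<comment> \<open>The system is triangular: \<open>chart j j\<close> is \<open>x j ^ d\<close>,
   whose derivative determines the coordinate \<open>j\<close> of the direction, as \<open>d\<close>
   is invertible. Each other equation then contains one further coordinate.\<close>
 define w where "w = u j / (of_nat d * x $ j ^ (d - 1))"
 define v where "v = (\<chi> i. if i = j then w else (u i - x $ i * (of_nat (d - 1) * x $ j ^ (d - 2) * w)) / x $ j ^ (d - 1))"
 have dd: "dir_deriv (chart j i) x v = v $ i * x $ j ^ (d - 1) + x $ i * (of_nat (d - 1) * x $ j ^ (d - 2) * v $ j)" for i
  unfolding chart_def by (subst dir_deriv_mult) (auto simp: dir_deriv_power numeral_2_eq_2)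
 have "dir_deriv (chart j i) x v = u i" for i
 proof (cases "i = j")
  case True
  have "x $ j * (of_nat (d - 1) * x $ j ^ (d - 2)) = of_nat (d - 1) * x $ j ^ (d - 1)"
  proof (cases "d = 1")
   case False
   hence "d - 1 = Suc (d - 2)" using d_pos by simp
   thus ?thesis by simp
  qed simp
  hence "dir_deriv (chart j j) x v = w * x $ j ^ (d - 1) + of_nat (d - 1) * x $ j ^ (d - 1) * w"
   unfolding dd by (simp add: v_def mult.assoc[symmetric])
  also have "\<dots> = of_nat (Suc (d - 1)) * x $ j ^ (d - 1) * w" by (simp add: algebra_simps)
  also have "\<dots> = u j" using x d_pos by (simp add: w_def)
  finally show ?thesis using True by simp
 next
  case False
  thus ?thesis unfolding dd using x by (simp add: v_def)
 qed
 thus ?thesis by blast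
qed

text \<open>The derivatives in suitable directions \<open>b l\<close> are dual to the charts. They
  are independent, and they span because a point derivation is determined by its values on the
  charts.\<close>

lemma smooth_A_var:
 assumes s: "s = 0" and x: "x ~= 0" shows "smooth_at Z (ev x)"
proof -
 obtain j where j: "x $ j ~= 0" using x by (auto simp: vec_eq_iff)
 have "\<forall>l. \<exists>v. \<forall>i. dir_deriv (chart j i) x v = (if i = l then 1 else 0)"
  by (rule allI, rule chart_direction[OF j])
 then obtain b where b: "!!l i. dir_deriv (chart j i) x (b l) = (if i = l then 1 else 0)" by metis
 define \<beta> where "\<beta> l = (\<lambda>h. if h \<in> hat ` S then dir_deriv (\<lambda>y. h (ev y)) x (b l) else 0)" for l
 have \<beta>hat: "\<beta> l (hat f) = dir_deriv f x (b l)" if "f \<in> S" for l f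
 proof -
  have "(\<lambda>y. hat f (ev y)) = f" using that by (simp add: hat_ev)
  thus ?thesis using that by (simp add: \<beta>_def)
 qed
 have \<beta>chart: "\<beta> l (hat (chart j i)) = (if i = l then 1 else 0)" for l i
  using \<beta>hat[OF chart_S[OF s]] b by simp
 let ?T = "tangent_space Z (ev x)"
 have \<beta>T: "\<beta> l \<in> ?T" for l
  unfolding tangent_space_iff
 proof
  show "\<forall>f. f \<notin> hat ` S --> \<beta> l f = 0" by (simp add: \<beta>_def)
  have "point_derivation x (\<lambda>f. \<beta> l (hat f)) \<longleftrightarrow> point_derivation x (\<lambda>f. dir_deriv f x (b l))"
   unfolding point_derivation_def using add mult scale by (auto simp: \<beta>hat)
  thus "point_derivation x (\<lambda>f. \<beta> l (hat f))" using dir_deriv_is_point_derivation by blast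
 qed
 have inj: "inj \<beta>"
 proof (rule injI)
  fix l l' assume "\<beta> l = \<beta> l'"
  hence "\<beta> l (hat (chart j l)) = \<beta> l' (hat (chart j l))" by simp
  thus "l = l'" unfolding \<beta>chart by (simp split: if_splits)
 qed
 have ind: "fun_vs.independent (range \<beta>)"
 proof
  assume "fun_vs.dependent (range \<beta>)"
  then obtain u where u: "\<exists>v\<in>range \<beta>. u v ~= 0" "(\<Sum>v\<in>range \<beta>. (\<lambda>h. u v * v h)) = 0"
   using fun_vs.dependent_finite[of "range \<beta>"] by auto
  have "(\<Sum>l\<in>UNIV. (\<lambda>h. u (\<beta> l) * \<beta> l h)) = 0" using u(2) by (simp add: sum.reindex[OF inj])
  hence "(\<lambda>h. \<Sum>l\<in>UNIV. u (\<beta> l) * \<beta> l h) = 0" unfolding sum_fun_eq .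
  hence e: "(\<Sum>l\<in>UNIV. u (\<beta> l) * \<beta> l (hat (chart j i))) = 0" for i by (rule fun_cong[where x = "hat (chart j i)", THEN trans]) simp
  have "u (\<beta> i) = 0" for i using e[of i] by (simp add: \<beta>chart)
  thus False using u(1) by auto
 qed
 have span: "?T \<subseteq> fun_vs.span (range \<beta>)"
 proof
  fix D assume D: "D \<in> ?T"
  have pd: "point_derivation x (\<lambda>f. D (hat f))" using D unfolding tangent_space_iff by blast
  define \<delta> where "\<delta> f = D (hat f) + (-1) * (\<Sum>l\<in>UNIV. D (hat (chart j l)) * dir_deriv f x (b l))" for f
  have pdd: "point_derivation x (\<lambda>f. dir_deriv f x (b l))" for l by (rule dir_deriv_is_point_derivation)
  have "point_derivation x \<delta>"
   unfolding point_derivation_def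
  proof (intro conjI allI ballI)
   fix f g c assume f: "f \<in> S" and g: "g \<in> S"
   show "\<delta> (\<lambda>x. f x + g x) = \<delta> f + \<delta> g"
    unfolding \<delta>_def pd_add[OF pd f g] pd_add[OF pdd f g] by (simp add: algebra_simps sum.distrib)
   show "\<delta> (\<lambda>x. f x * g x) = \<delta> f * g x + f x * \<delta> g"
    unfolding \<delta>_def pd_mult[OF pd f g] pd_mult[OF pdd f g]
    by (simp add: algebra_simps sum.distrib sum_distrib_left)
  next
   fix f c assume f: "f \<in> S"
   show "\<delta> (\<lambda>x. c * f x) = c * \<delta> f"
    unfolding \<delta>_def pd_scale[OF pd f] pd_scale[OF pdd f] by (simp add: algebra_simps sum_distrib_left)
  qed
  moreover have "\<delta> (chart j i) = 0" for i by (simp add: \<delta>_def b)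
  ultimately have \<delta>0: "\<delta> f = 0" if "f \<in> S" for f by (rule point_derivation_chart_unique[OF s j _ _ that])
  have "D = (\<lambda>h. \<Sum>l\<in>UNIV. D (hat (chart j l)) * \<beta> l h)"
  proof
   fix h
   show "D h = (\<Sum>l\<in>UNIV. D (hat (chart j l)) * \<beta> l h)"
   proof (cases "h \<in> hat ` S")
    case True
    then obtain f where f: "f \<in> S" "h = hat f" by auto
    show ?thesis using \<delta>0[OF f(1)] by (simp add: \<delta>_def f \<beta>hat)
   next
    case False
    thus ?thesis using D unfolding tangent_space_iff by (simp add: \<beta>_def)
   qed
  qed
  moreover have "(\<lambda>h. \<Sum>l\<in>UNIV. D (hat (chart j l)) * \<beta> l h) \<in> fun_vs.span (range \<beta>)"
   by (rule fun_span_sum) (intro fun_vs.span_scale fun_vs.span_base rangeI)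
  ultimately show "D \<in> fun_vs.span (range \<beta>)" by (simp only:)
 qed
 have "fun_vs.dim ?T = CARD('n)"
  by (rule fun_vs.dim_unique[OF _ span ind]) (use \<beta>T in "auto simp: card_image[OF inj]")
 thus ?thesis unfolding smooth_at_def variety_dim_A_var by simp
qed

text \<open>Smoothness in a form that can be pulled back along an automorphism: \<open>n\<close>
  functions detect every point derivation.\<close>

lemma smooth_criterion:
 assumes s: "s = 0" and x: "x ~= 0"
 obtains u :: "'n => 'k ^ 'n => 'k" where "!!i. u i \<in> S"
  "!!\<delta> f. point_derivation x \<delta> ==> (!!i. \<delta> (u i) = 0) ==> f \<in> S ==> \<delta> f = 0"
proof -
 obtain j where j: "x $ j ~= 0" using x by (auto simp: vec_eq_iff)
 show ?thesis
  by (rule that[of "chart j"]) (use chart_S[OF s] point_derivation_chart_unique[OF s j] in auto)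
qed

text \<open>
 The forms of degree \<open>d\<close> are evaluated at the unit vectors and at the sum of two of them; these
 \<open>n + 1\<close> point derivations at the origin are separated by \<open>x k ^ d\<close> and \<open>x i ^ (d - 1) * x i'\<close>.
\<close>

lemma singular_criterion:
 fixes u :: "'n => 'k ^ 'n => 'k"
 assumes s: "s = 0" and d2: "2 \<le> d" and n: "2 \<le> CARD('n)" and u: "!!i. u i \<in> S"
 obtains \<delta> f where "point_derivation 0 \<delta>" "!!i. \<delta> (u i) = 0" "f \<in> S" "\<delta> f ~= 0"
proof -
 obtain i i' :: 'n where ii: "i ~= i'"
  using n card_le_Suc0_iff_eq[of "UNIV :: 'n set"] by (auto simp: numeral_2_eq_2 not_less_eq_eq[symmetric])
 define z where "z l = (case l of None => axis i 1 + axis i' 1 | Some j => axis j (1::'k))" for l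
 define U where "U l = (\<chi> j. hcomp d (u j) (z l))" for l
 \<comment> \<open>The vectors \<open>U l\<close> are \<open>n + 1\<close> in number and lie in
   \<open>k ^ n\<close>. A relation among them combines the derivations into one that kills all the
   \<open>u i\<close>.\<close>
 have "\<exists>c. (\<exists>l\<in>UNIV. c l ~= 0) \<and> (\<Sum>l\<in>UNIV. c l *s U l) = 0"
 proof (rule vec.family_dependent[of UNIV cart_basis])
  show "U l \<in> vec.span cart_basis" for l by (metis UNIV_I span_cart_basis)
  show "card (cart_basis :: ('k ^ 'n) set) < card (UNIV :: 'n option set)"
   by (simp add: card_cart_basis)
 qed (simp_all add: finite_cart_basis)
 then obtain c where c: "\<exists>l. c l ~= 0" "(\<Sum>l\<in>UNIV. c l *s U l) = 0" by auto
 define \<delta> where "\<delta> f = (\<Sum>l\<in>UNIV. c l * hcomp d f (z l))" for f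
 have pdz: "point_derivation 0 (\<lambda>f. hcomp d f (z l))" for l by (rule hcomp_is_point_derivation[OF s])
 have pd: "point_derivation 0 \<delta>"
  unfolding point_derivation_def
 proof (intro conjI allI ballI)
  fix f g assume f: "f \<in> S" and g: "g \<in> S"
  show "\<delta> (\<lambda>x. f x + g x) = \<delta> f + \<delta> g"
   unfolding \<delta>_def pd_add[OF pdz f g] by (simp add: algebra_simps sum.distrib)
  show "\<delta> (\<lambda>x. f x * g x) = \<delta> f * g 0 + f 0 * \<delta> g"
   unfolding \<delta>_def pd_mult[OF pdz f g] by (simp add: algebra_simps sum.distrib sum_distrib_left)
 next
  fix f c assume f: "f \<in> S"
  show "\<delta> (\<lambda>x. c * f x) = c * \<delta> f"
   unfolding \<delta>_def pd_scale[OF pdz f] by (simp add: algebra_simps sum_distrib_left)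
 qed
 have \<delta>u: "\<delta> (u j) = 0" for j
 proof -
  have "(\<Sum>l\<in>UNIV. c l *s U l) $ j = 0" using c(2) by simp
  thus ?thesis by (simp add: \<delta>_def U_def sum_component)
 qed
 have hd: "hcomp d f = f" if "!!t x. f (t *s x) = t ^ d * f x" for f :: "'k ^ 'n => 'k"
  using hcomp_homogeneous[OF that, of d] by simp
 define m where "m = (\<lambda>x::'k ^ 'n. x $ i ^ (d - 1) * x $ i')"
 have tp: "t ^ d = t * t ^ (d - 1)" for t :: 'k using d_pos by (simp flip: power_Suc)
 have mh: "m (t *s x) = t ^ d * m x" for t x by (simp add: m_def power_mult_distrib tp)
 have mS: "m \<in> S"
  by (rule homogI[OF _ mh]) (auto simp: m_def admissible_def s intro!: polys_mult polys_power)
 have pS: "(\<lambda>x. x $ k ^ d) \<in> S" for k by (rule coord_power) (simp add: admissible_def s)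
 have "\<exists>f\<in>S. \<delta> f ~= 0"
 proof (rule ccontr)
  assume "\<not> (\<exists>f\<in>S. \<delta> f ~= 0)"
  hence \<delta>0: "\<delta> f = 0" if "f \<in> S" for f using that by blast
  have "m (z (Some j)) = 0" for j using ii d2 by (auto simp: m_def z_def axis_def power_0_left)
  moreover have "m (z None) = 1" using ii by (simp add: m_def z_def axis_def)
  ultimately have "\<delta> m = c None"
   unfolding \<delta>_def hd[OF mh] by (simp add: UNIV_option_conv sum.reindex)
  hence c0: "c None = 0" using \<delta>0[OF mS] by simp
  have "c (Some k) = 0" for k
  proof -
   have "z (Some j) $ k ^ d = (if j = k then 1 else 0)" for j using d_pos by (auto simp: z_def axis_def)
   hence "\<delta> (\<lambda>x. x $ k ^ d) = c (Some k)"
    unfolding \<delta>_def using hd[of "\<lambda>x. x $ k ^ d"] c0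
    by (simp add: power_mult_distrib UNIV_option_conv sum.reindex)
   thus ?thesis using \<delta>0[OF pS] by simp
  qed
  with c0 have "c l = 0" for l by (cases l) auto
  thus False using c(1) by blast
 qed
 then obtain f where "f \<in> S" "\<delta> f ~= 0" by (elim bexE)
 thus ?thesis using that[OF pd \<delta>u] by blast
qed

end

section \<open>Automorphisms of the spectra\<close>

lemma carrier_Aut: "\<phi> \<in> carrier (Aut X) \<longleftrightarrow> \<phi> \<in> extensional (pts X) \<and> isomorph X X \<phi>"
 by (simp add: Aut_def)

lemma carrier_Aut_Bij: "\<phi> \<in> carrier (Aut X) ==> \<phi> \<in> Bij (pts X)"
 by (simp add: carrier_Aut isomorph_def Bij_def)

lemma mult_Aut:
 "\<phi> \<in> carrier (Aut X) ==> \<psi> \<in> carrier (Aut X) ==> \<phi> \<otimes>\<^bsub>Aut X\<^esub> \<psi> = compose (pts X) \<phi> \<psi>"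
 using carrier_Aut_Bij[of \<phi> X] carrier_Aut_Bij[of \<psi> X] by (simp add: Aut_def BijGroup_def)

context graded_ring
begin

lemma morph_pullback:
 assumes \<phi>: "morph Z Z \<phi>" and y: "!!x. \<phi> (ev x) = ev (y x)" and f: "f \<in> S"
 shows "(\<lambda>x. f (y x)) \<in> S"
proof -
 have "hat f \<in> coord_ring Z" using f coord_ring_A_var by blast
 hence "(\<lambda>p\<in>pts Z. hat f (\<phi> p)) \<in> hat ` S"
  using morph_coord_ring[OF \<phi>] unfolding coord_ring_A_var by blast
 then obtain g where g: "g \<in> S" "(\<lambda>p\<in>pts Z. hat f (\<phi> p)) = hat g" by (elim imageE) simp
 have "f (y x) = g x" for x
  using fun_cong[OF g(2), of "ev x"] g(1) f by (simp add: pts_A_var hat_ev y)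
 hence "(\<lambda>x. f (y x)) = g" by (rule ext)
 thus ?thesis using g(1) by (simp only:)
qed

lemma morph_of_pullback:
 assumes y: "!!x. \<phi> (ev x) = ev (y x)" and f: "!!f. f \<in> S ==> (\<lambda>x. f (y x)) \<in> S"
 shows "morph Z Z \<phi>"
proof -
 have "morph Z (frac_space {(range ev, hat ` S)}) \<phi>"
 proof (rule morph_into_single[OF fun_space_A_var subalg_hat])
  show "\<phi> p \<in> range ev" if "p \<in> pts Z" for p using that y by (auto simp: pts_A_var)
  fix h assume "h \<in> hat ` S"
  then obtain f where f': "f \<in> S" "h = hat f" by auto
  have "(\<lambda>p\<in>range ev. h (\<phi> p)) = hat (\<lambda>x. f (y x))"
   by (rule restrict_hat[OF f[OF f'(1)]]) (simp add: f' y hat_ev)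
  thus "(\<lambda>p\<in>pts Z. h (\<phi> p)) \<in> coord_ring Z"
   unfolding coord_ring_A_var unfolding pts_A_var using f[OF f'(1)] by (simp only: imageI)
 qed
 thus ?thesis by (simp only: A_var_eq[symmetric])
qed

text \<open>The maps \<open>y\<close> and \<open>y'\<close> merely choose representatives and need
  not be polynomial; only their composites with members of \<open>S\<close> are.\<close>

definition represents :: "('k ^ 'n => 'k ^ 'n) => ('k ^ 'n => 'k ^ 'n) => ((('k ^ 'n => 'k) => 'k) => (('k ^ 'n => 'k) => 'k)) => bool" where
 "represents y y' \<phi> \<longleftrightarrow> \<phi> \<in> extensional (range ev) \<and> (\<forall>x. \<phi> (ev x) = ev (y x)) \<and>
   (\<forall>x. ev (y (y' x)) = ev x) \<and> (\<forall>x. ev (y' (y x)) = ev x) \<and>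
   (\<forall>f\<in>S. (\<lambda>x. f (y x)) \<in> S) \<and> (\<forall>f\<in>S. (\<lambda>x. f (y' x)) \<in> S)"

lemma representsD:
 assumes "represents y y' \<phi>"
 shows "\<phi> \<in> extensional (range ev)" "\<phi> (ev x) = ev (y x)" "ev (y (y' x)) = ev x" "ev (y' (y x)) = ev x"
  "f \<in> S ==> (\<lambda>x. f (y x)) \<in> S" "f \<in> S ==> (\<lambda>x. f (y' x)) \<in> S"
 using assms by (simp_all add: represents_def)

lemma ev_cong:
 assumes "!!f. f \<in> S ==> (\<lambda>x. f (y x)) \<in> S" "ev x = ev x'" shows "ev (y x) = ev (y x')"
 unfolding ev_eq_iff
proof
 fix f assume "f \<in> S"
 from bspec[OF assms(2)[unfolded ev_eq_iff] assms(1)[OF this]] show "f (y x) = f (y x')" .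
qed

lemma represents_inverse:
 assumes r: "represents y y' \<phi>"
 shows "inv_into (range ev) \<phi> (ev x) = ev (y' x)" "bij_betw \<phi> (range ev) (range ev)"
  "represents y' y (restrict (inv_into (range ev) \<phi>) (range ev))"
proof -
 note r' = representsD[OF r]
 have cong: "ev (y' x) = ev (y' x')" if "ev x = ev x'" for x x'
  by (rule ev_cong[of y', OF _ that], rule r'(6))
 have inj: "inj_on \<phi> (range ev)"
 proof (rule inj_onI, elim rangeE)
  fix p q x x' assume "\<phi> p = \<phi> q" and pq: "p = ev x" "q = ev x'"
  hence "ev (y x) = ev (y x')" using r'(2) by simp
  from cong[OF this] show "p = q" using r'(4) pq by simp
 qed
 have surj: "\<phi> ` range ev = range ev"
 proof (intro equalityI subsetI)
  fix p assume "p \<in> range ev"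
  then obtain x where "p = ev x" by auto
  hence "p = \<phi> (ev (y' x))" using r'(2,3) by simp
  thus "p \<in> \<phi> ` range ev" by simp
 qed (use r'(2) in auto)
 show "bij_betw \<phi> (range ev) (range ev)" using inj surj by (simp add: bij_betw_def)
 show *: "inv_into (range ev) \<phi> (ev x) = ev (y' x)" for x
  by (rule inv_into_f_eq[OF inj]) (simp_all add: r')
 show "represents y' y (restrict (inv_into (range ev) \<phi>) (range ev))"
  unfolding represents_def using * r' by simp
qed

lemma Aut_represented:
 "\<phi> \<in> carrier (Aut Z) \<longleftrightarrow> (\<exists>y y'. represents y y' \<phi>)"
proof
 assume \<phi>: "\<phi> \<in> carrier (Aut Z)"
 hence 1: "\<phi> \<in> extensional (range ev)" "bij_betw \<phi> (range ev) (range ev)"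
   "morph Z Z \<phi>" "morph Z Z (inv_into (range ev) \<phi>)"
  unfolding carrier_Aut isomorph_def pts_A_var by blast+
 have "\<exists>y. \<phi> (ev x) = ev y" for x using bij_betw_apply[OF 1(2), of "ev x"] by auto
 then obtain y where y: "!!x. \<phi> (ev x) = ev (y x)" by metis
 have "\<exists>y. inv_into (range ev) \<phi> (ev x) = ev y" for x
  using bij_betw_apply[OF bij_betw_inv_into[OF 1(2)], of "ev x"] by auto
 then obtain y' where y': "!!x. inv_into (range ev) \<phi> (ev x) = ev (y' x)" by metis
 have "ev (y (y' x)) = ev x" for x
  using bij_betw_inv_into_right[OF 1(2), of "ev x"] by (simp add: y y')
 moreover have "ev (y' (y x)) = ev x" for x
  using bij_betw_inv_into_left[OF 1(2), of "ev x"] by (simp add: y y')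
 ultimately have "represents y y' \<phi>"
  unfolding represents_def using 1(1) y morph_pullback[OF 1(3) y] morph_pullback[OF 1(4) y'] by simp
 thus "\<exists>y y'. represents y y' \<phi>" by blast
next
 assume "\<exists>y y'. represents y y' \<phi>"
 then obtain y y' where r: "represents y y' \<phi>" by blast
 note r' = representsD[OF r]
 show "\<phi> \<in> carrier (Aut Z)"
  unfolding carrier_Aut isomorph_def pts_A_var
  using r'(1) represents_inverse(2)[OF r] morph_of_pullback[of \<phi> y, OF r'(2,5)]
   morph_of_pullback[of "inv_into (range ev) \<phi>" y', OF represents_inverse(1)[OF r] r'(6)] by simp
qed

lemma represents_compose:
 assumes "represents y y' \<phi>" "represents z z' \<psi>"
 shows "represents (\<lambda>x. y (z x)) (\<lambda>x. z' (y' x)) (compose (range ev) \<phi> \<psi>)"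
proof -
 note 1 = representsD[OF assms(1)] and 2 = representsD[OF assms(2)]
 have cong: "ev (y x) = ev (y x')" if "ev x = ev x'" for x x'
  by (rule ev_cong[of y, OF _ that], rule 1(5))
 have cong': "ev (z' x) = ev (z' x')" if "ev x = ev x'" for x x'
  by (rule ev_cong[of z', OF _ that], rule 2(6))
 show ?thesis
  unfolding represents_def
 proof (intro conjI allI ballI)
  show "compose (range ev) \<phi> \<psi> (ev x) = ev (y (z x))" for x by (simp add: compose_def 1 2)
  show "ev (y (z (z' (y' x)))) = ev x" for x using cong[OF 2(3)] 1(3) by simp
  show "ev (z' (y' (y (z x)))) = ev x" for x using cong'[OF 1(4)] 2(4) by simp
  show "(\<lambda>x. f (y (z x))) \<in> S" if "f \<in> S" for f by (rule 2(5)[OF 1(5)[OF that]])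
  show "(\<lambda>x. f (z' (y' x))) \<in> S" if "f \<in> S" for f by (rule 1(6)[OF 2(6)[OF that]])
 qed simp
qed

lemma group_Aut: "group (Aut Z)"
proof -
 have "subgroup (carrier (Aut Z)) (BijGroup (pts Z))"
 proof (rule group.subgroupI[OF group_BijGroup])
  show "carrier (Aut Z) \<subseteq> carrier (BijGroup (pts Z))"
   using carrier_Aut_Bij by (auto simp: BijGroup_def)
  have "represents (\<lambda>x. x) (\<lambda>x. x) (\<lambda>p\<in>range ev. p)" by (simp add: represents_def)
  thus "carrier (Aut Z) ~= {}" using Aut_represented by blast
 next
  fix \<phi> assume \<phi>: "\<phi> \<in> carrier (Aut Z)"
  then obtain y y' where "represents y y' \<phi>" using Aut_represented by blast
  from represents_inverse(3)[OF this] have "restrict (inv_into (range ev) \<phi>) (range ev) \<in> carrier (Aut Z)"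
   using Aut_represented by blast
  thus "inv\<^bsub>BijGroup (pts Z)\<^esub> \<phi> \<in> carrier (Aut Z)"
   using inv_BijGroup[OF carrier_Aut_Bij[OF \<phi>]] by (simp add: pts_A_var)
 next
  fix \<phi> \<psi> assume \<phi>: "\<phi> \<in> carrier (Aut Z)" and \<psi>: "\<psi> \<in> carrier (Aut Z)"
  then obtain y y' z z' where "represents y y' \<phi>" "represents z z' \<psi>" using Aut_represented by blast
  from represents_compose[OF this] have "compose (range ev) \<phi> \<psi> \<in> carrier (Aut Z)"
   using Aut_represented by blast
  thus "\<phi> \<otimes>\<^bsub>BijGroup (pts Z)\<^esub> \<psi> \<in> carrier (Aut Z)"
   using mult_Aut[OF \<phi> \<psi>] by (simp add: Aut_def pts_A_var)
 qed
 from subgroup.subgroup_is_group[OF this group_BijGroup] show ?thesis by (simp add: Aut_def)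
qed

text \<open>If the origin moved to another point, the \<open>n\<close> functions detecting point
  derivations there would pull back to \<open>n\<close> functions detecting those at the origin,
  which \<open>singular_criterion\<close> excludes.\<close>

lemma Aut_fixes_origin:
 assumes s: "s = 0" and d2: "2 \<le> d" and n: "2 \<le> CARD('n)" and r: "represents y y' \<phi>"
 shows "ev (y 0) = ev 0"
proof (rule ccontr)
 assume ne: "ev (y 0) ~= ev 0"
 note r' = representsD[OF r]
 have "y 0 ~= 0" using ne by auto
 then obtain u :: "'n => 'k ^ 'n => 'k" where u: "!!i. u i \<in> S"
  "!!\<delta> f. point_derivation (y 0) \<delta> ==> (!!i. \<delta> (u i) = 0) ==> f \<in> S ==> \<delta> f = 0"
  by (rule smooth_criterion[OF s]) blast
 obtain \<delta> f where \<delta>: "point_derivation 0 \<delta>" "!!i. \<delta> (\<lambda>x. u i (y x)) = 0" "f \<in> S" "\<delta> f ~= 0"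
  by (rule singular_criterion[OF s d2 n, of "\<lambda>i x. u i (y x)"]) (use r'(5)[OF u(1)] in blast)+
 have "point_derivation (y 0) (\<lambda>g. \<delta> (\<lambda>x. g (y x)))"
  unfolding point_derivation_def
 proof (intro conjI allI ballI)
  fix f g assume f: "f \<in> S" and g: "g \<in> S"
  show "\<delta> (\<lambda>x. f (y x) + g (y x)) = \<delta> (\<lambda>x. f (y x)) + \<delta> (\<lambda>x. g (y x))"
   by (rule pd_add[OF \<delta>(1) r'(5)[OF f] r'(5)[OF g]])
  show "\<delta> (\<lambda>x. f (y x) * g (y x)) = \<delta> (\<lambda>x. f (y x)) * g (y 0) + f (y 0) * \<delta> (\<lambda>x. g (y x))"
   by (rule pd_mult[OF \<delta>(1) r'(5)[OF f] r'(5)[OF g]])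
 next
  fix f c assume f: "f \<in> S"
  show "\<delta> (\<lambda>x. c * f (y x)) = c * \<delta> (\<lambda>x. f (y x))" by (rule pd_scale[OF \<delta>(1) r'(5)[OF f]])
 qed
 hence "\<delta> (\<lambda>x. f (y' (y x))) = 0"
  by (rule u(2)) (rule \<delta>(2), rule r'(6)[OF \<delta>(3)])
 moreover have "f (y' (y x)) = f x" for x
  by (rule bspec[OF r'(4)[of x, unfolded ev_eq_iff] \<delta>(3)])
 ultimately show False using \<delta>(4) by simp
qed

end

section \<open>Order of vanishing and the pair of rings\<close>

definition order_ge :: "('k::field_char_0 ^ 'n::finite => 'k) => nat => bool" where
 "order_ge f m \<longleftrightarrow> (\<forall>i<m. hcomp i f = (\<lambda>x. 0))"

lemma order_ge_mult:
 assumes "f \<in> polys" "g \<in> polys" "order_ge f a" "order_ge g b"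
 shows "order_ge (\<lambda>x. f x * g x) (a + b)"
 unfolding order_ge_def
proof (intro allI impI)
 fix i assume i: "i < a + b"
 have "hcomp k f x * hcomp (i - k) g x = 0" if "k \<le> i" for k x
 proof (cases "k < a")
  case True
  thus ?thesis using assms(3) by (simp add: order_ge_def)
 next
  case False
  hence "i - k < b" using i that by linarith
  thus ?thesis using assms(4) by (simp add: order_ge_def)
 qed
 thus "hcomp i (\<lambda>x. f x * g x) = (\<lambda>x. 0)"
  by (subst hcomp_mult[OF assms(1,2)]) (auto intro!: ext sum.neutral simp del: mult_eq_0_iff)
qed

locale invariants_pair =
 fixes d s :: nat and A R :: "('k::{alg_closed_field, field_char_0} ^ 'n::finite => 'k) set"
 assumes d_pos: "0 < d" and A_eq: "A = A_ring d s" and R_eq: "R = A_ring d 0"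
begin

sublocale A: graded_ring d s A by unfold_locales (fact d_pos A_eq)+
sublocale R: graded_ring d 0 R by unfold_locales (fact d_pos R_eq)+

abbreviation \<eta> where "\<eta> \<equiv> eta_map d s :: (('k ^ 'n => 'k) => 'k) => (('k ^ 'n => 'k) => 'k)"

lemma A_subset_R: "f \<in> A ==> f \<in> R"
 using A.subset_invariants R_eq by blast

lemma A_iff_order: "f \<in> A \<longleftrightarrow> f \<in> R \<and> (\<forall>i. 0 < i \<and> i < s * d --> hcomp i f = (\<lambda>x. 0))"
proof
 assume f: "f \<in> A"
 thus "f \<in> R \<and> (\<forall>i. 0 < i \<and> i < s * d --> hcomp i f = (\<lambda>x. 0))"
  using A_subset_R A.hcomp_zero[OF f] by (auto simp: admissible_def)
next
 assume f: "f \<in> R \<and> (\<forall>i. 0 < i \<and> i < s * d --> hcomp i f = (\<lambda>x. 0))"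
 have "hcomp i f = (\<lambda>x. 0)" if i: "\<not> admissible d s i" for i
 proof (cases "d dvd i")
  case True
  hence "0 < i" "i < s * d" using i by (auto simp: admissible_def)
  thus ?thesis using f by blast
 next
  case False
  hence "\<not> admissible d 0 i" using i by (auto simp: admissible_def)
  thus ?thesis using f R.hcomp_zero by blast
 qed
 thus "f \<in> A" using f R.polys unfolding A_eq A_ring_iff[OF d_pos] by blast
qed

text \<open>The exponent is positive and admissible for every \<open>s\<close>, so these powers are
  the denominators by which members of \<open>R\<close> are expressed through
  \<open>A\<close>.\<close>

lemma power_A: "(\<lambda>x. x $ j ^ (Suc s * d)) \<in> A"
 by (intro A.coord_power admissible_large) simp

lemma mult_power_A: "f \<in> R ==> (\<lambda>x. f x * x $ j ^ (Suc s * d)) \<in> A"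
 by (rule A.conductor[where k = "Suc s"]) (auto simp: R_eq power_mult_distrib intro: polys_power polys_coord)

text \<open>Where some coordinate is nonzero, an invariant is the quotient of two members of
  \<open>A\<close>, so its value is determined by theirs. This covers everything but the case of two
  zero vectors.\<close>

lemma ev_eq: "A.ev x = A.ev y \<longleftrightarrow> R.ev x = R.ev y"
proof
 assume "R.ev x = R.ev y"
 thus "A.ev x = A.ev y" unfolding A.ev_eq_iff R.ev_eq_iff using A_subset_R by blast
next
 assume *: "A.ev x = A.ev y"
 have eq: "R.ev x = R.ev y" if "x $ j ~= 0" "A.ev x = A.ev y" for x y j
  unfolding R.ev_eq_iff
 proof
  fix f assume f: "f \<in> R"
  have 1: "x $ j ^ (Suc s * d) = y $ j ^ (Suc s * d)"
   by (rule bspec[OF that(2)[unfolded A.ev_eq_iff] power_A])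
  have "f x * x $ j ^ (Suc s * d) = f y * y $ j ^ (Suc s * d)"
   by (rule bspec[OF that(2)[unfolded A.ev_eq_iff] mult_power_A[OF f]])
  hence "f x * x $ j ^ (Suc s * d) = f y * x $ j ^ (Suc s * d)" by (simp only: 1)
  thus "f x = f y" using that(1) by simp
 qed
 show "R.ev x = R.ev y"
 proof (cases "x = 0 \<and> y = 0")
  case False
  then obtain j where "x $ j ~= 0 \<or> y $ j ~= 0" by (auto simp: vec_eq_iff)
  thus ?thesis using eq[of x j y] eq[of y j x] * by auto
 qed simp
qed

lemma eta_ev [simp]: "\<eta> (R.ev x) = A.ev x"
 using A_subset_R unfolding eta_map_def A_eq[symmetric] R.ev_def A.ev_def by (auto simp: restrict_def fun_eq_iff)

lemma inj_eta: "inj_on \<eta> (range R.ev)"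
 by (rule inj_onI) (auto simp: ev_eq)

lemma bij_eta: "bij_betw \<eta> (range R.ev) (range A.ev)"
 unfolding bij_betw_def using inj_eta by (auto simp: image_image)

definition \<zeta> where "\<zeta> = inv_into (range R.ev) \<eta>"

lemma \<zeta>_ev [simp]: "\<zeta> (A.ev x) = R.ev x"
 unfolding \<zeta>_def by (rule inv_into_f_eq[OF inj_eta]) simp_all

lemma morph_eta: "morph R.Z A.Z \<eta>"
proof -
 have "morph R.Z (frac_space {(range A.ev, A.hat ` A)}) \<eta>"
 proof (rule morph_into_single[OF R.fun_space_A_var A.subalg_hat])
  show "\<eta> p \<in> range A.ev" if "p \<in> pts R.Z" for p using that by (auto simp: R.pts_A_var)
  fix h assume "h \<in> A.hat ` A"
  then obtain f where f: "f \<in> A" "h = A.hat f" by auto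
  have "(\<lambda>p\<in>range R.ev. h (\<eta> p)) = R.hat f"
   by (rule R.restrict_hat[OF A_subset_R[OF f(1)]]) (simp add: f A.hat_ev)
  thus "(\<lambda>p\<in>pts R.Z. h (\<eta> p)) \<in> coord_ring R.Z"
   unfolding R.coord_ring_A_var unfolding R.pts_A_var using A_subset_R[OF f(1)] by (simp only: imageI)
 qed
 thus ?thesis by (simp only: A.A_var_eq[symmetric])
qed

subsection \<open>The normalization map\<close>

text \<open>The components of degree at most \<open>s * d\<close> are combinations of finitely many
  monomials with constant coefficients; the rest of an invariant lies in \<open>A\<close> and
  becomes part of the coefficient of the monomial 1.\<close>

lemma finite_morph_eta: "finite_morph R.Z A.Z \<eta>"
 unfolding finite_morph_def
proof (intro conjI morph_eta)
 define Mon :: "('k ^ 'n => 'k) set" where "Mon = {monomial e |e. admissible d 0 (sum e UNIV) \<and> sum e UNIV \<le> s * d}"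
 have Mon: "finite Mon" unfolding Mon_def by (rule finite_monomials)
 have MonR: "Mon \<subseteq> R" unfolding Mon_def using R.monomial by auto
 have one: "(\<lambda>x. 1) \<in> Mon" unfolding Mon_def by (intro CollectI exI[of _ "\<lambda>_. 0"]) (simp add: monomial_def fun_eq_iff admissible_def)
 have inj: "inj_on R.hat Mon" by (rule inj_onI) (use R.hat_inj MonR in blast)
 have "\<exists>a. (\<forall>f\<in>R.hat ` Mon. a f \<in> coord_ring A.Z) \<and> (\<forall>p\<in>pts R.Z. h p = (\<Sum>f\<in>R.hat ` Mon. a f (\<eta> p) * f p))"
  if "h \<in> coord_ring R.Z" for h
 proof -
  from that obtain f where f: "f \<in> R" "h = R.hat f" unfolding R.coord_ring_A_var by (elim imageE)
  define low where "low = (\<lambda>x. \<Sum>i\<le>s * d. hcomp i f x)"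
  define high where "high = (\<lambda>x. f x + -1 * low x)"
  have lowR: "low \<in> R" unfolding low_def by (intro R.sum R.hcomp f)
  have hlow: "hcomp i low = (\<lambda>x. if i \<le> s * d then hcomp i f x else 0)" for i
  proof
   fix x
   have "hcomp i low x = (\<Sum>j\<le>s * d. hcomp i (hcomp j f) x)"
    unfolding low_def by (subst hcomp_sum) (auto intro: R.polys f)
   also have "\<dots> = (\<Sum>j\<le>s * d. if j = i then hcomp i f x else 0)"
    by (intro sum.cong refl) (auto simp: hcomp_hcomp[OF R.polys[OF f(1)]])
   finally show "hcomp i low x = (if i \<le> s * d then hcomp i f x else 0)" by simp
  qed
  have "low \<in> fun_vs.span Mon"
   unfolding Mon_def by (rule R.span_monomials[OF lowR]) (simp add: hlow)
  then obtain c where c: "low = (\<Sum>m\<in>Mon. (\<lambda>x. c m * m x))"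
   using fun_vs.span_finite[OF Mon] by auto
  have highR: "high \<in> R" unfolding high_def by (rule R.add[OF f(1) R.scale[OF lowR]])
  have "hcomp i high = (\<lambda>x. 0)" if "i < s * d" for i
  proof -
   have "hcomp i (\<lambda>x. f x + -1 * low x) = (\<lambda>x. hcomp i f x + -1 * hcomp i low x)"
    using hcomp_add[OF R.polys[OF f(1)] polys_scale[OF R.polys[OF lowR]], of i "-1"]
    unfolding hcomp_scale[OF R.polys[OF lowR]] .
   thus ?thesis using that by (simp add: high_def hlow)
  qed
  hence highA: "high \<in> A" unfolding A_iff_order using highR by blast
  have cf: "(\<lambda>x. c m + (if m = (\<lambda>x. 1) then high x else 0)) \<in> A" for m
   by (cases "m = (\<lambda>x. 1)") (auto intro: A.add A.const highA)
  \<comment> \<open>The generators are functions on the spectrum, the coefficients \<open>c\<close>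
    belong to polynomials; composition with \<open>R.ev\<close> recovers the monomial from its
    function.\<close>
  define a where "a g = A.hat (\<lambda>x. c (\<lambda>x. g (R.ev x)) + (if (\<lambda>x. g (R.ev x)) = (\<lambda>x. 1) then high x else 0))" for g
  have am: "a (R.hat m) = A.hat (\<lambda>x. c m + (if m = (\<lambda>x. 1) then high x else 0))" if "m \<in> Mon" for m
  proof -
   have "(\<lambda>x. R.hat m (R.ev x)) = m" using MonR that by (auto simp: R.hat_ev)
   thus ?thesis by (simp add: a_def)
  qed
  have "\<forall>f\<in>R.hat ` Mon. a f \<in> coord_ring A.Z"
   unfolding A.coord_ring_A_var using am cf by auto
  moreover have "h p = (\<Sum>f\<in>R.hat ` Mon. a f (\<eta> p) * f p)" if p: "p \<in> pts R.Z" for p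
  proof -
   obtain x where x: "p = R.ev x" using p unfolding R.pts_A_var by (elim rangeE)
   have "(\<Sum>f\<in>R.hat ` Mon. a f (\<eta> p) * f p) = (\<Sum>m\<in>Mon. a (R.hat m) (\<eta> p) * R.hat m p)"
    by (simp add: sum.reindex[OF inj])
   also have "\<dots> = (\<Sum>m\<in>Mon. c m * m x + (if m = (\<lambda>x. 1) then high x else 0))"
   proof (rule sum.cong[OF refl])
    fix m assume m: "m \<in> Mon"
    hence "m \<in> R" using MonR by blast
    thus "a (R.hat m) (\<eta> p) * R.hat m p = c m * m x + (if m = (\<lambda>x. 1) then high x else 0)"
     using am[OF m] cf[of m] by (simp add: x A.hat_ev R.hat_ev algebra_simps)
   qed
   also have "\<dots> = (\<Sum>m\<in>Mon. c m * m x) + high x" using Mon one by (simp add: sum.distrib)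
   also have "(\<Sum>m\<in>Mon. c m * m x) = low x" using fun_cong[OF c, of x] unfolding sum_fun_eq[symmetric] by simp
   also have "low x + high x = h p" using f by (simp add: high_def x R.hat_ev)
   finally show ?thesis by simp
  qed
  ultimately show ?thesis by blast
 qed
 moreover have "R.hat ` Mon \<subseteq> coord_ring R.Z" unfolding R.coord_ring_A_var using MonR by blast
 ultimately show "\<exists>F. finite F \<and> F \<subseteq> coord_ring R.Z \<and> (\<forall>h\<in>coord_ring R.Z. \<exists>a. (\<forall>f\<in>F. a f \<in> coord_ring A.Z) \<and>
      (\<forall>x\<in>pts R.Z. h x = (\<Sum>f\<in>F. a f (\<eta> x) * f x)))"
  using Mon by (intro exI[of _ "R.hat ` Mon"] conjI ballI finite_imageI) simp_all
qed

text \<open>Away from a coordinate hyperplane, \<open>R\<close> and \<open>A\<close> have the same fractions.\<close>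

lemma birational_eta: "birational_morph R.Z A.Z \<eta>"
 unfolding birational_morph_def
proof (intro conjI morph_eta)
 define j :: 'n where "j = undefined"
 define U where "U = R.ev ` {x. x $ j ^ (Suc s * d) ~= 0}"
 define V where "V = A.ev ` {x. x $ j ^ (Suc s * d) ~= 0}"
 have oU: "openin (ftop R.Z) U" unfolding U_def by (rule R.openin_A_var_nonzero[OF A_subset_R[OF power_A]])
 have oV: "openin (ftop A.Z) V" unfolding V_def by (rule A.openin_A_var_nonzero[OF power_A])
 have j1: "(vec 1 :: 'k ^ 'n) $ j ^ (Suc s * d) ~= 0" by simp
 have memV: "A.ev x \<in> V \<longleftrightarrow> x $ j ^ (Suc s * d) ~= 0" for x
 proof
  assume "A.ev x \<in> V"
  then obtain y where y: "A.ev x = A.ev y" "y $ j ^ (Suc s * d) ~= 0" unfolding V_def by (elim imageE CollectE)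
  have "x $ j ^ (Suc s * d) = y $ j ^ (Suc s * d)" using y(1) power_A[of j] unfolding A.ev_eq_iff by (rule bspec)
  thus "x $ j ^ (Suc s * d) ~= 0" using y(2) by simp
 qed (simp add: V_def)
 have sub: "U \<subseteq> pts R.Z" "V \<subseteq> pts A.Z" by (auto simp: U_def V_def R.pts_A_var A.pts_A_var)
 have UV: "\<eta> ` U = V" by (simp add: U_def V_def image_image)
 have injU: "inj_on \<eta> U" using inj_eta by (rule inj_on_subset) (auto simp: U_def)
 have pU: "pts (induced R.Z U) = U" using pts_induced[OF R.fun_space_A_var] sub by auto
 have pV: "pts (induced A.Z V) = V" using pts_induced[OF A.fun_space_A_var] sub by auto
 have inv: "inv_into U \<eta> (A.ev x) = R.ev x" if "x $ j ^ (Suc s * d) ~= 0" for x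
  by (rule inv_into_f_eq[OF injU]) (use that in "auto simp: U_def")
 have "morph (induced R.Z U) (induced A.Z V) \<eta>"
 proof (rule morph_induced[OF R.fun_space_A_var A.fun_space_A_var])
  fix W f assume f: "f \<in> freg A.Z W"
  have W: "openin (ftop A.Z) W" by (rule fun_space_freg_openin[OF A.fun_space_A_var f])
  have g: "(\<lambda>x\<in>{x \<in> pts R.Z. \<eta> x \<in> W}. f (\<eta> x)) \<in> freg R.Z {x \<in> pts R.Z. \<eta> x \<in> W}"
   by (rule morph_freg[OF morph_eta f W])
  show "\<exists>g W'. g \<in> freg R.Z W' \<and> W' \<inter> U = {x \<in> U. \<eta> x \<in> W} \<and> (\<forall>x\<in>U. \<eta> x \<in> W --> g x = f (\<eta> x))"
   using sub(1)
   by (intro exI[of _ "\<lambda>x\<in>{x \<in> pts R.Z. \<eta> x \<in> W}. f (\<eta> x)"] exI[of _ "{x \<in> pts R.Z. \<eta> x \<in> W}"] conjI g) auto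
 qed (use sub UV in auto)
 moreover have "morph (induced A.Z V) (induced R.Z U) (inv_into U \<eta>)"
 proof (rule morph_induced[OF A.fun_space_A_var R.fun_space_A_var])
  show "V \<subseteq> pts A.Z" by (rule sub)
  show "inv_into U \<eta> ` V \<subseteq> U" "inv_into U \<eta> ` V \<subseteq> pts R.Z"
   using inv sub(1) by (auto simp: V_def U_def R.pts_A_var)
  fix W f assume f: "f \<in> freg R.Z W"
  have W: "openin (ftop R.Z) W" by (rule fun_space_freg_openin[OF R.fun_space_A_var f])
  define W' where "W' = {p \<in> V. inv_into U \<eta> p \<in> W}"
  have memW': "A.ev x \<in> W' \<longleftrightarrow> x $ j ^ (Suc s * d) ~= 0 \<and> R.ev x \<in> W" for x
   using inv[of x] memV[of x] by (auto simp: W'_def)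
  have oW': "openin (ftop A.Z) W'"
   unfolding A.openin_A_var
  proof (intro conjI allI impI)
   show "W' \<subseteq> range A.ev" by (auto simp: W'_def V_def)
   fix x assume x: "A.ev x \<in> W'"
   hence xW: "R.ev x \<in> W" using memW' by blast
   obtain u where u: "u \<in> R" "u x ~= 0" "!!y. u y ~= 0 ==> R.ev y \<in> W" by (rule R.openin_A_varE[OF W xW]) blast
   show "\<exists>u\<in>A. u x ~= 0 \<and> (\<forall>y. u y ~= 0 --> A.ev y \<in> W')"
    using u x by (intro bexI[OF _ mult_power_A[OF u(1), of j]]) (simp add: memW')
  qed
  define g where "g = (\<lambda>p\<in>W'. f (inv_into U \<eta> p))"
  have "g \<in> freg A.Z W'"
   unfolding A.freg_A_var
  proof (intro conjI allI impI oW')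
   fix x assume x: "A.ev x \<in> W'"
   hence xW: "R.ev x \<in> W" using memW' by blast
   obtain a b where ab: "a \<in> R" "b \<in> R" "b x ~= 0" "!!y. b y ~= 0 ==> R.ev y \<in> W" "!!y. b y ~= 0 ==> f (R.ev y) = a y / b y"
    by (rule R.freg_A_varE[OF f xW]) blast
   show "\<exists>a\<in>A. \<exists>b\<in>A. b x ~= 0 \<and> (\<forall>y. b y ~= 0 --> A.ev y \<in> W' \<and> g (A.ev y) = a y / b y)"
   proof (rule bexI[OF _ mult_power_A[OF ab(1), of j]], rule bexI[OF _ mult_power_A[OF ab(2), of j]], intro conjI allI impI)
    show "b x * x $ j ^ (Suc s * d) ~= 0" using ab(3) x memW' by simp
    fix y assume "b y * y $ j ^ (Suc s * d) ~= 0"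
    hence b: "b y ~= 0" and y: "y $ j ^ (Suc s * d) ~= 0" by auto
    show *: "A.ev y \<in> W'" using ab(4)[OF b] y memW' by blast
    show "g (A.ev y) = a y * y $ j ^ (Suc s * d) / (b y * y $ j ^ (Suc s * d))"
     using * y ab(5)[OF b] inv[OF y] by (simp add: g_def)
   qed
  qed (simp add: g_def)
  thus "\<exists>g W'. g \<in> freg A.Z W' \<and> W' \<inter> V = {x \<in> V. inv_into U \<eta> x \<in> W} \<and> (\<forall>x\<in>V. inv_into U \<eta> x \<in> W --> g x = f (inv_into U \<eta> x))"
   by (intro exI[of _ g] exI[of _ W']) (auto simp: W'_def g_def)
 qed
 moreover have "bij_betw \<eta> U V" using injU UV by (simp add: bij_betw_def)
 ultimately have "isomorph (induced R.Z U) (induced A.Z V) \<eta>" unfolding isomorph_def pU pV by simp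
 moreover have "U ~= {}" "V ~= {}" using j1 unfolding U_def V_def by blast+
 ultimately show "\<exists>U V. openin (ftop R.Z) U \<and> openin (ftop A.Z) V \<and> U ~= {} \<and> V ~= {} \<and> isomorph (induced R.Z U) (induced A.Z V) \<eta>"
  using oU oV by blast
qed

lemma normalization_eta: "normalization_map R.Z A.Z \<eta>"
 unfolding normalization_map_def
 using R.affine_variety_A_var A.affine_variety_A_var R.irreducible_A_var A.irreducible_A_var
  R.normal_A_var finite_morph_eta birational_eta by simp

subsection \<open>Lifting automorphisms\<close>

text \<open>An invariant without constant term has order at least \<open>d\<close> at the origin, so
  its \<open>m\<close>-th power has order at least \<open>m * d\<close>.\<close>

lemma power_in_A:
 assumes g: "g \<in> R" "g 0 = 0" and m: "s \<le> m" shows "(\<lambda>x. g x ^ m) \<in> A"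
proof -
 have "order_ge g d"
  unfolding order_ge_def
 proof (intro allI impI)
  fix i assume i: "i < d"
  show "hcomp i g = (\<lambda>x. 0)"
  proof (cases "i = 0")
   case True
   thus ?thesis using hcomp_0[OF R.polys[OF g(1)]] g(2) by auto
  next
   case False
   hence "\<not> d dvd i" using i by (auto dest: dvd_imp_le)
   hence "\<not> admissible d 0 i" using False by (simp add: admissible_def)
   thus ?thesis by (rule R.hcomp_zero[OF g(1)])
  qed
 qed
 hence "order_ge (\<lambda>x. g x ^ m) (m * d)" for m
 proof (induction m)
  case (Suc m)
  thus ?case using order_ge_mult[OF R.polys[OF g(1)] polys_power[OF R.polys[OF g(1)], of m], of d "m * d"] by simp
 qed (simp add: order_ge_def)
 moreover have "s * d \<le> m * d" using m by simp
 ultimately have "hcomp i (\<lambda>x. g x ^ m) = (\<lambda>x. 0)" if "i < s * d" for i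
  using that unfolding order_ge_def by (meson less_le_trans)
 thus ?thesis unfolding A_iff_order using R.power[OF g(1)] by blast
qed

text \<open>High powers of \<open>G\<close>, and its product with some nonzero \<open>b\<close> of
  \<open>A\<close>, are pullbacks of members of \<open>A\<close>. Hence \<open>G\<close> is integral
  over the polynomials and is a quotient of two of them, so it is a polynomial; it is invariant
  since \<open>y\<close> respects the classes.\<close>

lemma lift_regular:
 assumes y: "!!f. f \<in> A ==> (\<lambda>x. f (y x)) \<in> A" and surj: "!!x. \<exists>z. A.ev (y z) = A.ev x" and f: "f \<in> R"
 shows "(\<lambda>x. f (y x)) \<in> R"
proof -
 \<comment> \<open>The constant term is removed so that the high powers of \<open>g\<close> lie in
   \<open>A\<close>.\<close>
 define g where "g = (\<lambda>x. f x + - f 0)"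
 have g: "g \<in> R" "g 0 = 0" unfolding g_def by (rule R.add[OF f R.const]) simp
 define G where "G = (\<lambda>x. g (y x))"
 define j :: 'n where "j = undefined"
 define b where "b = (\<lambda>x. y x $ j ^ (Suc s * d))"
 define c where "c = (\<lambda>x. g (y x) * y x $ j ^ (Suc s * d))"
 have bA: "b \<in> A" unfolding b_def by (rule y[OF power_A])
 have cA: "c \<in> A" unfolding c_def by (rule y[OF mult_power_A[OF g(1)]])
 have pA: "(\<lambda>x. G x ^ m) \<in> A" if "s \<le> m" for m unfolding G_def by (rule y[OF power_in_A[OF g that]])
 have cb: "c x = G x * b x" for x by (simp add: c_def G_def b_def)
 \<comment> \<open>A point sent to the class of the vector of ones, where \<open>b\<close> takes the
   value 1.\<close>
 obtain z where z: "A.ev (y z) = A.ev (vec 1)" using surj by blast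
 have "b z = (vec 1 :: 'k ^ 'n) $ j ^ (Suc s * d)" unfolding b_def using z power_A[of j] unfolding A.ev_eq_iff by (rule bspec)
 hence bz: "b z ~= 0" by simp
 obtain p where p: "p \<in> polys" "!!x. c x = b x * p x"
 proof (rule polys_integral[of c b z "Suc s" "\<lambda>i x. if i = 0 then -1 * G x ^ Suc s else 0"])
  show "(\<lambda>x. if i = 0 then -1 * G x ^ Suc s else 0) \<in> polys" for i :: nat
  proof (cases "i = 0")
   case True
   thus ?thesis using polys_scale[OF A.polys[OF pA[of "Suc s"]], of "-1"] by simp
  qed simp
  fix x
  have "(\<Sum>i<Suc s. (if i = 0 then -1 * G x ^ Suc s else 0) * c x ^ i * b x ^ (Suc s - i)) =
    (\<Sum>i<Suc s. if i = 0 then -1 * G x ^ Suc s * b x ^ Suc s else 0)"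
   by (intro sum.cong) auto
  also have "\<dots> = -1 * G x ^ Suc s * b x ^ Suc s" by (subst sum.delta) auto
  finally show "c x ^ Suc s + (\<Sum>i<Suc s. (if i = 0 then -1 * G x ^ Suc s else 0) * c x ^ i * b x ^ (Suc s - i)) = 0"
   by (simp only: cb power_mult_distrib) simp
 qed (use bz A.polys[OF bA] A.polys[OF cA] in auto)
 have Gp: "G x ^ m = p x ^ m" if "s \<le> m" for x m
 proof (rule polys_eq_dense[of "\<lambda>x. G x ^ m" "\<lambda>x. p x ^ m" b z])
  show "G x ^ m = p x ^ m" if "b x ~= 0" for x using p(2)[of x] cb[of x] that by simp
 qed (use A.polys[OF pA[OF that]] p(1) A.polys[OF bA] bz in auto)
 have "G x = p x" for x
 proof (cases "p x = 0")
  case True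
  thus ?thesis using Gp[of "Suc s" x] by auto
 next
  case False
  \<comment> \<open>Dividing off \<open>b\<close> only gives equality where \<open>b\<close> is
    nonzero. The powers agree everywhere by density, and two consecutive exponents determine the
    base.\<close>
  have "G x ^ Suc s * G x = p x ^ Suc s * p x"
   using Gp[of "Suc (Suc s)" x] by (simp only: power_Suc2[symmetric])
  thus ?thesis using Gp[of "Suc s" x] False by simp
 qed
 hence Gpoly: "G \<in> polys" using p(1) by (simp add: ext[of G p])
 have "G (t *s x) = G x" if t: "t ^ d = 1" for t x
 proof -
  have "h (t *s x) = h x" if "h \<in> R" for h
   using that t unfolding R_eq invariants_iff[OF d_pos] by simp
  hence "A.ev (t *s x) = A.ev x" unfolding A.ev_eq_iff using A_subset_R by blast
  hence "A.ev (y (t *s x)) = A.ev (y x)" by (rule A.ev_cong[of y, rotated]) (rule y)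
  hence "R.ev (y (t *s x)) = R.ev (y x)" by (simp only: ev_eq)
  thus ?thesis unfolding G_def R.ev_eq_iff using g(1) by (rule bspec)
 qed
 hence "G \<in> R" using Gpoly unfolding R_eq invariants_iff[OF d_pos] by blast
 from R.add[OF this R.const[of "f 0"]] show ?thesis by (simp add: G_def g_def)
qed

text \<open>As the origin is fixed, monomials of degree \<open>d\<close> pull back to invariants
  vanishing there, hence of order at least \<open>d\<close>. Splitting off such factors, monomials
  of degree \<open>k * d\<close> pull back to order at least \<open>k * d\<close>, and
  \<open>A\<close> is defined inside \<open>R\<close> by a condition on low degrees.\<close>

lemma descend_regular:
 assumes y: "!!f. f \<in> R ==> (\<lambda>x. f (y x)) \<in> R" and y0: "R.ev (y 0) = R.ev 0" and f: "f \<in> A"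
 shows "(\<lambda>x. f (y x)) \<in> A"
proof -
 have mon: "(\<lambda>x. monomial e (y x)) \<in> R \<and> order_ge (\<lambda>x. monomial e (y x)) (k * d)" if "sum e UNIV = k * d" for e :: "'n => nat" and k
  using that
 proof (induction k arbitrary: e)
  case 0
  hence "monomial e \<in> R" by (intro R.monomial) (simp add: admissible_def)
  thus ?case using y by (simp add: order_ge_def)
 next
  case (Suc k)
  hence "d \<le> sum e UNIV" by simp
  then obtain e1 where e1: "!!i. e1 i \<le> e i" "sum e1 UNIV = d" using exists_sum_le by blast
  have e2: "sum (\<lambda>i. e i - e1 i) UNIV = k * d"
   using e1 Suc.prems by (simp add: sum_subtractf_nat)
  have m1: "(\<lambda>x. monomial e1 (y x)) \<in> R"
   by (rule y[OF R.monomial]) (simp add: e1 admissible_def)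
  have "monomial e1 (y 0) = monomial e1 (0 :: 'k ^ 'n)"
   using y0 R.monomial[of e1] unfolding R.ev_eq_iff by (simp add: e1 admissible_def)
  also have "\<dots> = 0" using monomial_smult[of e1 0 "0 :: 'k ^ 'n"] e1(2) d_pos by (simp add: power_0_left)
  finally have z: "monomial e1 (y 0) = 0" .
  have o1: "order_ge (\<lambda>x. monomial e1 (y x)) d"
   unfolding order_ge_def
  proof (intro allI impI)
   fix i assume i: "i < d"
   show "hcomp i (\<lambda>x. monomial e1 (y x)) = (\<lambda>x. 0)"
   proof (cases "i = 0")
    case True
    thus ?thesis using hcomp_0[OF R.polys[OF m1]] z by auto
   next
    case False
    hence "\<not> d dvd i" using i by (auto dest: dvd_imp_le)
    hence "\<not> admissible d 0 i" using False by (simp add: admissible_def)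
    thus ?thesis by (rule R.hcomp_zero[OF m1])
   qed
  qed
  have e: "(\<lambda>x. monomial e (y x)) = (\<lambda>x. monomial e1 (y x) * monomial (\<lambda>i. e i - e1 i) (y x))"
   using e1(1) by (simp add: monomial_mult)
  note IH = Suc.IH[OF e2]
  show ?case
   unfolding e
   using R.mult[OF m1 conjunct1[OF IH]] order_ge_mult[OF R.polys[OF m1] R.polys[OF conjunct1[OF IH]] o1 conjunct2[OF IH]]
   by simp
 qed
 obtain D where D: "degree_le f D" using degree_le_exists[OF A.polys[OF f]] by blast
 have "f \<in> fun_vs.span {monomial e |e. admissible d s (sum e UNIV) \<and> sum e UNIV \<le> D}"
  using D by (intro A.span_monomials[OF f]) (simp add: degree_le_def)
 thus ?thesis
 proof (induction rule: fun_span_induct)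
  case zero
  show ?case by (rule A.const)
 next
  case (step c f g)
  then obtain e where e: "f = monomial e" "admissible d s (sum e UNIV)" by auto
  have "(\<lambda>x. monomial e (y x)) \<in> A"
  proof (cases "sum e UNIV = 0")
   case True
   hence "(\<lambda>x. monomial e (y x)) = (\<lambda>x. 1)" by (simp add: monomial_def)
   thus ?thesis using A.const by simp
  next
   case False
   with e(2)[unfolded admissible_def] have "d dvd sum e UNIV"
    by (elim disjE conjE) (simp_all only: simp_thms)
   then obtain k where k: "sum e UNIV = k * d" by (metis dvd_def mult.commute)
   have "s * d \<le> k * d" using False e(2) k by (simp add: admissible_def)
   thus ?thesis using mon[OF k] unfolding A_iff_order order_ge_def by (meson less_le_trans)
  qed
  thus ?case using step(3) by (auto simp: e intro!: A.add A.scale)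
 qed
qed

text \<open>By \<open>ev_eq\<close> the classes for the two rings coincide, so the same maps of
  representatives serve for both.\<close>

lemma lift_represents:
 assumes "A.represents y y' \<phi>"
 shows "R.represents y y' (\<lambda>p\<in>range R.ev. \<zeta> (\<phi> (\<eta> p)))"
proof -
 note 1 = A.representsD[OF assms]
 show ?thesis
  unfolding R.represents_def
 proof (intro conjI allI ballI)
  show "(\<lambda>p\<in>range R.ev. \<zeta> (\<phi> (\<eta> p))) (R.ev x) = R.ev (y x)" for x by (simp add: 1)
  show "R.ev (y (y' x)) = R.ev x" "R.ev (y' (y x)) = R.ev x" for x using 1(3,4)[of x] by (simp_all add: ev_eq)
  show "(\<lambda>x. f (y x)) \<in> R" if "f \<in> R" for f by (rule lift_regular[OF 1(5) _ that]) (use 1(3) in blast)+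
  show "(\<lambda>x. f (y' x)) \<in> R" if "f \<in> R" for f by (rule lift_regular[OF 1(6) _ that]) (use 1(4) in blast)+
 qed simp
qed

lemma is_lift_iff:
 assumes "\<phi> \<in> carrier (Aut A.Z)"
 shows "is_lift R.Z \<eta> \<phi> \<psi> \<longleftrightarrow> \<psi> = (\<lambda>p\<in>range R.ev. \<zeta> (\<phi> (\<eta> p)))"
proof
 obtain y y' where r: "A.represents y y' \<phi>" using assms A.Aut_represented by blast
 note r' = R.representsD[OF lift_represents[OF r]]
 assume l: "is_lift R.Z \<eta> \<phi> \<psi>"
 show "\<psi> = (\<lambda>p\<in>range R.ev. \<zeta> (\<phi> (\<eta> p)))"
 proof (rule extensionalityI)
  show "\<psi> \<in> extensional (range R.ev)" using l by (simp add: is_lift_def carrier_Aut R.pts_A_var)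
  fix p assume p: "p \<in> range R.ev"
  obtain z z' where z: "R.represents z z' \<psi>" using l R.Aut_represented by (auto simp: is_lift_def)
  obtain x where x: "p = R.ev x" using p by auto
  have "\<eta> (\<psi> p) = \<phi> (\<eta> p)" using l p unfolding is_lift_def R.pts_A_var by blast
  hence "\<zeta> (\<phi> (\<eta> p)) = \<zeta> (\<eta> (\<psi> p))" by simp
  also have "\<dots> = \<psi> p" unfolding x R.representsD(2)[OF z] by simp
  finally show "\<psi> p = (\<lambda>p\<in>range R.ev. \<zeta> (\<phi> (\<eta> p))) p" using p by simp
 qed simp
next
 obtain y y' where r: "A.represents y y' \<phi>" using assms A.Aut_represented by blast
 note r' = lift_represents[OF r]
 assume \<psi>: "\<psi> = (\<lambda>p\<in>range R.ev. \<zeta> (\<phi> (\<eta> p)))"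
 have "\<eta> (\<psi> (R.ev x)) = \<phi> (\<eta> (R.ev x))" for x
  unfolding \<psi> R.representsD(2)[OF r'] eta_ev A.representsD(2)[OF r] ..
 thus "is_lift R.Z \<eta> \<phi> \<psi>"
  unfolding is_lift_def R.pts_A_var using r' R.Aut_represented \<psi> by blast
qed

abbreviation "\<theta> \<equiv> lift_aut R.Z \<eta>"

lemma lift_aut_eq: "\<phi> \<in> carrier (Aut A.Z) ==> \<theta> \<phi> = (\<lambda>p\<in>range R.ev. \<zeta> (\<phi> (\<eta> p)))"
 unfolding lift_aut_def by (rule the_equality) (simp_all add: is_lift_iff)

lemma lift_aut_represents: "A.represents y y' \<phi> ==> R.represents y y' (\<theta> \<phi>)"
 using lift_represents lift_aut_eq A.Aut_represented by metis

text \<open>The lift keeps the representing maps, which gives the homomorphism property and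
  injectivity. Surjectivity is the point where the fixed origin is needed, for the automorphism and
  for its inverse.\<close>

lemma lift_aut_iso:
 assumes d2: "2 \<le> d" and n: "2 \<le> CARD('n)"
 shows "\<theta> \<in> iso (Aut A.Z) (Aut R.Z)"
proof (rule isoI)
 have closed: "\<theta> \<phi> \<in> carrier (Aut R.Z)" if "\<phi> \<in> carrier (Aut A.Z)" for \<phi>
  using that A.Aut_represented R.Aut_represented lift_aut_represents by meson
 show "\<theta> \<in> hom (Aut A.Z) (Aut R.Z)"
 proof (rule homI[OF closed])
  fix \<phi> \<psi> assume \<phi>: "\<phi> \<in> carrier (Aut A.Z)" and \<psi>: "\<psi> \<in> carrier (Aut A.Z)"
  obtain y y' where y: "A.represents y y' \<phi>" using \<phi> A.Aut_represented by blast
  obtain z z' where z: "A.represents z z' \<psi>" using \<psi> A.Aut_represented by blast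
  have 1: "R.represents (\<lambda>x. y (z x)) (\<lambda>x. z' (y' x)) (\<theta> (compose (range A.ev) \<phi> \<psi>))"
   by (rule lift_aut_represents[OF A.represents_compose[OF y z]])
  have 2: "R.represents (\<lambda>x. y (z x)) (\<lambda>x. z' (y' x)) (compose (range R.ev) (\<theta> \<phi>) (\<theta> \<psi>))"
   by (rule R.represents_compose[OF lift_aut_represents[OF y] lift_aut_represents[OF z]])
  have "\<theta> (compose (range A.ev) \<phi> \<psi>) = compose (range R.ev) (\<theta> \<phi>) (\<theta> \<psi>)"
   by (rule extensionalityI[OF R.representsD(1)[OF 1] R.representsD(1)[OF 2]])
    (auto simp: R.representsD(2)[OF 1] R.representsD(2)[OF 2])
  thus "\<theta> (\<phi> \<otimes>\<^bsub>Aut A.Z\<^esub> \<psi>) = \<theta> \<phi> \<otimes>\<^bsub>Aut R.Z\<^esub> \<theta> \<psi>"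
   unfolding mult_Aut[OF \<phi> \<psi>] mult_Aut[OF closed[OF \<phi>] closed[OF \<psi>]] by (simp add: A.pts_A_var R.pts_A_var)
 qed
 show "bij_betw \<theta> (carrier (Aut A.Z)) (carrier (Aut R.Z))"
  unfolding bij_betw_def
 proof (intro conjI inj_onI equalityI subsetI)
  fix \<phi> \<psi> assume \<phi>: "\<phi> \<in> carrier (Aut A.Z)" and \<psi>: "\<psi> \<in> carrier (Aut A.Z)" and eq: "\<theta> \<phi> = \<theta> \<psi>"
  obtain y y' where y: "A.represents y y' \<phi>" using \<phi> A.Aut_represented by blast
  obtain z z' where z: "A.represents z z' \<psi>" using \<psi> A.Aut_represented by blast
  show "\<phi> = \<psi>"
  proof (rule extensionalityI[OF A.representsD(1)[OF y] A.representsD(1)[OF z]])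
   fix p assume "p \<in> range A.ev"
   then obtain x where x: "p = A.ev x" by auto
   have "R.ev (y x) = R.ev (z x)"
    using eq R.representsD(2)[OF lift_aut_represents[OF y], of x] R.representsD(2)[OF lift_aut_represents[OF z], of x] by simp
   thus "\<phi> p = \<psi> p" unfolding x A.representsD(2)[OF y] A.representsD(2)[OF z] by (simp only: ev_eq)
  qed
 next
  fix \<psi> assume "\<psi> \<in> \<theta> ` carrier (Aut A.Z)"
  thus "\<psi> \<in> carrier (Aut R.Z)" using closed by blast
 next
  fix \<psi> assume "\<psi> \<in> carrier (Aut R.Z)"
  then obtain y y' where r: "R.represents y y' \<psi>" using R.Aut_represented by blast
  note 1 = R.representsD[OF r]
  have y0: "R.ev (y 0) = R.ev 0" by (rule R.Aut_fixes_origin[OF refl d2 n r])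
  have y'0: "R.ev (y' 0) = R.ev 0" by (rule R.Aut_fixes_origin[OF refl d2 n R.represents_inverse(3)[OF r]])
  define \<phi> where "\<phi> = (\<lambda>p\<in>range A.ev. \<eta> (\<psi> (\<zeta> p)))"
  have \<phi>: "A.represents y y' \<phi>"
   unfolding A.represents_def
  proof (intro conjI allI ballI)
   show "\<phi> (A.ev x) = A.ev (y x)" for x by (simp add: \<phi>_def 1)
   show "A.ev (y (y' x)) = A.ev x" "A.ev (y' (y x)) = A.ev x" for x using 1(3,4)[of x] by (simp_all add: ev_eq)
   show "(\<lambda>x. f (y x)) \<in> A" if "f \<in> A" for f by (rule descend_regular[of y, OF 1(5) y0 that])
   show "(\<lambda>x. f (y' x)) \<in> A" if "f \<in> A" for f by (rule descend_regular[of y', OF 1(6) y'0 that])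
  qed (simp add: \<phi>_def)
  have "\<theta> \<phi> = \<psi>"
   by (rule extensionalityI[OF R.representsD(1)[OF lift_aut_represents[OF \<phi>]] 1(1)])
    (auto simp: R.representsD(2)[OF lift_aut_represents[OF \<phi>]] 1(2))
  moreover have "\<phi> \<in> carrier (Aut A.Z)" using \<phi> A.Aut_represented by blast
  ultimately show "\<psi> \<in> \<theta> ` carrier (Aut A.Z)" by blast
 qed
qed

end

section \<open>Transport of structure\<close>

lemma morph_id: "fun_space X ==> morph X X (\<lambda>x. x)"
 unfolding morph_def
proof (intro conjI allI impI)
 fix V f assume X: "fun_space X" and f: "openin (ftop X) V \<and> f \<in> freg X V"
 have e: "{x \<in> pts X. x \<in> V} = V" using f openin_subset[of "ftop X" V] by auto
 have "restrict f V = f" using fun_space_freg_ext[OF X] f by (simp add: extensional_restrict)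
 thus "(\<lambda>x\<in>{x \<in> pts X. x \<in> V}. f x) \<in> freg X {x \<in> pts X. x \<in> V}" unfolding e using f by simp
qed (simp add: continuous_map_id[unfolded id_def])

lemma fun_space_eqI:
 assumes X: "fun_space X" and Y: "fun_space Y" and XY: "morph X Y (\<lambda>x. x)" and YX: "morph Y X (\<lambda>x. x)"
 shows "X = (Y :: ('p, 'k::field) fspace)"
proof -
 have p: "pts X = pts Y" using morph_funcset[OF XY] morph_funcset[OF YX] by auto
 have e: "{x \<in> pts X. x \<in> V} = V" if "V \<subseteq> pts X" for V using that by auto
 have o: "openin (ftop X) V \<longleftrightarrow> openin (ftop Y) V" for V
 proof
  assume o: "openin (ftop X) V"
  thus "openin (ftop Y) V" using morph_preimage[OF YX o] openin_subset[OF o] e[of V] by (simp add: p)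
 next
  assume o: "openin (ftop Y) V"
  thus "openin (ftop X) V" using morph_preimage[OF XY o] openin_subset[OF o] e[of V] by (simp add: p)
 qed
 have sub: "freg X' V \<subseteq> freg Y' V" if X': "fun_space X'" and YX': "morph Y' X' (\<lambda>x. x)" and p': "pts X' = pts Y'"
  for X' Y' :: "('p, 'k) fspace" and V
 proof
  fix f assume f: "f \<in> freg X' V"
  have oV: "openin (ftop X') V" by (rule fun_space_freg_openin[OF X' f])
  have e': "{x \<in> pts Y'. x \<in> V} = V" using openin_subset[OF oV] p' by auto
  have "restrict f V = f" using fun_space_freg_ext[OF X' f] by (simp add: extensional_restrict)
  thus "f \<in> freg Y' V" using morph_freg[OF YX' f oV] unfolding e' by simp
 qed
 have "ftop X = ftop Y" by (rule topology_eq[THEN iffD2]) (use o in blast)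
 moreover have "freg X V = freg Y V" for V
  using sub[OF X YX p] sub[OF Y XY p[symmetric]] by blast
 hence "freg X = freg Y" by (rule ext)
 ultimately show ?thesis by (rule fspace.equality) simp
qed

lemma morph_prod:
 assumes "fun_space X" "fun_space Y" "fun_space X'" "fun_space Y'" and \<phi>: "morph X X' \<phi>" and \<psi>: "morph Y Y' \<psi>"
 shows "morph (fprod X Y) (fprod X' Y') (\<lambda>z. (\<phi> (fst z), \<psi> (snd z)))"
proof -
 let ?B = "{(U \<times> V, tensor_algebra (freg X' U) (freg Y' V) U V) |U V. openin (ftop X') U \<and> openin (ftop Y') V}"
 have "morph (fprod X Y) (frac_space ?B) (\<lambda>z. (\<phi> (fst z), \<psi> (snd z)))"
 proof (rule morph_into_frac[OF fun_space_fprod[OF assms(1,2)]])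
  show "(\<phi> (fst z), \<psi> (snd z)) \<in> pts (frac_space ?B)" if "z \<in> pts (fprod X Y)" for z
   using that pts_fprod[OF assms(1,2)] pts_fprod[OF assms(3,4)] morph_funcset[OF \<phi>] morph_funcset[OF \<psi>]
   by (auto simp: fprod_eq[symmetric])
  fix W F h assume "(W, F) \<in> ?B" and h: "h \<in> F"
  then obtain U V where W: "W = U \<times> V" "F = tensor_algebra (freg X' U) (freg Y' V) U V"
    "openin (ftop X') U" "openin (ftop Y') V" by auto
  obtain m :: nat and f g where 1: "h = (\<lambda>z\<in>U \<times> V. \<Sum>i<m. f i (fst z) * g i (snd z))"
   "!!i. i < m ==> f i \<in> freg X' U" "!!i. i < m ==> g i \<in> freg Y' V"
   using h unfolding W by (rule tensor_algebraE) blast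
  let ?U = "{x \<in> pts X. \<phi> x \<in> U}" and ?V = "{y \<in> pts Y. \<psi> y \<in> V}"
  have e: "{z \<in> pts (fprod X Y). (\<phi> (fst z), \<psi> (snd z)) \<in> W} = ?U \<times> ?V"
   using pts_fprod[OF assms(1,2)] by (auto simp: W)
  have o: "openin (ftop X) ?U" "openin (ftop Y) ?V" using morph_preimage[OF \<phi> W(3)] morph_preimage[OF \<psi> W(4)] by auto
  have "(\<lambda>z\<in>?U \<times> ?V. \<Sum>i<m. (\<lambda>x\<in>?U. f i (\<phi> x)) (fst z) * (\<lambda>y\<in>?V. g i (\<psi> y)) (snd z))
    \<in> tensor_algebra (freg X ?U) (freg Y ?V) ?U ?V"
   by (rule tensor_algebraI[OF _ morph_freg[OF \<phi> _ W(3)] morph_freg[OF \<psi> _ W(4)]]) (use 1 in auto)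
  also have "(\<lambda>z\<in>?U \<times> ?V. \<Sum>i<m. (\<lambda>x\<in>?U. f i (\<phi> x)) (fst z) * (\<lambda>y\<in>?V. g i (\<psi> y)) (snd z))
    = (\<lambda>z\<in>?U \<times> ?V. h (\<phi> (fst z), \<psi> (snd z)))"
   unfolding 1 restrict_def by (intro ext) auto
  finally have t: "(\<lambda>z\<in>?U \<times> ?V. h (\<phi> (fst z), \<psi> (snd z))) \<in> tensor_algebra (freg X ?U) (freg Y ?V) ?U ?V" .
  have "(?U \<times> ?V, tensor_algebra (freg X ?U) (freg Y ?V) ?U ?V)
    \<in> {(U \<times> V, tensor_algebra (freg X U) (freg Y V) U V) |U V. openin (ftop X) U \<and> openin (ftop Y) V}"
   using o by blast
  from freg_frac_space_incl[OF frac_base_fprod[OF assms(1,2)] this t]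
  have "(\<lambda>z\<in>?U \<times> ?V. h (\<phi> (fst z), \<psi> (snd z))) \<in> freg (fprod X Y) (?U \<times> ?V)" unfolding fprod_eq .
  thus "(\<lambda>z\<in>{z \<in> pts (fprod X Y). (\<phi> (fst z), \<psi> (snd z)) \<in> W}. h (\<phi> (fst z), \<psi> (snd z)))
    \<in> freg (fprod X Y) {z \<in> pts (fprod X Y). (\<phi> (fst z), \<psi> (snd z)) \<in> W}"
   unfolding e .
 qed
 thus ?thesis by (simp only: fprod_eq[symmetric])
qed

lemma morph_slice_snd:
 assumes X: "fun_space X" and Y: "fun_space Y" and x: "x \<in> pts X"
 shows "morph Y (fprod X Y) (\<lambda>y. (x, y))"
 unfolding fprod_eq
proof (rule morph_into_frac[OF Y])
 show "(x, y) \<in> pts (frac_space {(U \<times> V, tensor_algebra (freg X U) (freg Y V) U V) |U V. openin (ftop X) U \<and> openin (ftop Y) V})"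
  if "y \<in> pts Y" for y
  using pts_fprod[OF X Y] that x unfolding fprod_eq by auto
 fix W F h assume "(W, F) \<in> {(U \<times> V, tensor_algebra (freg X U) (freg Y V) U V) |U V. openin (ftop X) U \<and> openin (ftop Y) V}"
  and h: "h \<in> F"
 then obtain U V where W: "W = U \<times> V" "F = tensor_algebra (freg X U) (freg Y V) U V" "openin (ftop X) U" "openin (ftop Y) V"
  by auto
 show "(\<lambda>y\<in>{y \<in> pts Y. (x, y) \<in> W}. h (x, y)) \<in> freg Y {y \<in> pts Y. (x, y) \<in> W}"
 proof (cases "x \<in> U")
  case True
  obtain m :: nat and f g where 1: "h = (\<lambda>z\<in>U \<times> V. \<Sum>i<m. f i (fst z) * g i (snd z))"
   "!!i. i < m ==> f i \<in> freg X U" "!!i. i < m ==> g i \<in> freg Y V"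
   using h unfolding W by (rule tensor_algebraE) blast
  have e: "{y \<in> pts Y. (x, y) \<in> W} = V" using W True openin_subset[OF W(4)] by auto
  have "(\<lambda>y\<in>V. \<Sum>i<m. (\<lambda>y\<in>V. f i x * g i y) y) \<in> freg Y V"
   using 1 W by (intro subalg_sum[OF fun_space_subalg[OF Y]] subalg_scale[OF fun_space_subalg[OF Y]]) auto
  also have "(\<lambda>y\<in>V. \<Sum>i<m. (\<lambda>y\<in>V. f i x * g i y) y) = (\<lambda>y\<in>V. h (x, y))"
   unfolding 1 using True by (intro ext) (auto simp: restrict_def)
  finally show ?thesis unfolding e .
 next
  case False
  hence e: "{y \<in> pts Y. (x, y) \<in> W} = {}" using W by auto
  show ?thesis unfolding e by (rule fun_space_local[OF Y]) (auto simp: extensional_def)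
 qed
qed

text \<open>Affineness includes an equality of spaces. It follows once the identity is a morphism in
  both directions; out of the generated space it is the composite of \<open>\<psi>\<close> and
  \<open>\<phi>\<close>.\<close>

lemma affine_variety_isomorph:
 fixes X :: "('p, 'k::field) fspace" and Y :: "('q, 'k) fspace"
 assumes Y: "fun_space Y" and iso: "isomorph X Y \<phi>" and aff: "affine_variety X"
 shows "affine_variety Y"
proof -
 define \<psi> where "\<psi> = inv_into (pts X) \<phi>"
 have bij: "bij_betw \<phi> (pts X) (pts Y)" and \<phi>: "morph X Y \<phi>" and \<psi>: "morph Y X \<psi>"
  using iso by (auto simp: isomorph_def \<psi>_def)
 have inv: "\<psi> (\<phi> x) = x" if "x \<in> pts X" for x using bij_betw_inv_into_left[OF bij that] by (simp add: \<psi>_def)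
 have inv': "\<phi> (\<psi> y) = y" if "y \<in> pts Y" for y using bij_betw_inv_into_right[OF bij that] by (simp add: \<psi>_def)
 note mem = morph_funcset[OF \<phi>] morph_funcset[OF \<psi>]
 have Xeq: "X = frac_space {(pts X, coord_ring X)}" and Xs: "subalg (pts X) (coord_ring X)"
  and Xh: "\<forall>\<phi>\<in>alg_homs (pts X) (coord_ring X). \<exists>!x. x \<in> pts X \<and> (\<forall>f\<in>coord_ring X. \<phi> f = f x)"
  using aff unfolding affine_variety_def by blast+
 obtain F where F: "finite F" "F \<subseteq> coord_ring X" "coord_ring X = alg_generated (pts X) F"
  using aff unfolding affine_variety_def by blast
 have Ys: "subalg (pts Y) (coord_ring Y)" by (rule fun_space_subalg[OF Y openin_topspace])
 define T where "T f = (\<lambda>y\<in>pts Y. f (\<psi> y))" for f :: "'p => 'k"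
 have T: "T f \<in> coord_ring Y" if "f \<in> coord_ring X" for f unfolding T_def by (rule morph_coord_ring[OF \<psi> that])
 have Tinv: "\<exists>f\<in>coord_ring X. g = T f" if g: "g \<in> coord_ring Y" for g
 proof (rule bexI[OF _ morph_coord_ring[OF \<phi> g]])
  show "g = T (\<lambda>x\<in>pts X. g (\<phi> x))"
   using subalg_ext[OF Ys g] mem inv' by (intro extensionalityI[of _ "pts Y"]) (auto simp: T_def)
 qed
 let ?Y = "frac_space {(pts Y, coord_ring Y)}"
 have fY: "fun_space ?Y" by (rule fun_space_frac_space[OF frac_base_single[OF Ys]])
 have pY: "pts ?Y = pts Y" using pts_frac_space[OF frac_base_single[OF Ys]] by simp
 have cY: "coord_ring Y \<subseteq> coord_ring ?Y"
  unfolding pY using freg_frac_space_incl[OF frac_base_single[OF Ys]] by blast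
 have "Y = ?Y"
 proof (rule fun_space_eqI[OF Y fY])
  show "morph Y ?Y (\<lambda>x. x)"
  proof (rule morph_into_single[OF Y Ys])
   fix f assume f: "f \<in> coord_ring Y"
   hence "(\<lambda>x\<in>pts Y. f x) = f" using subalg_ext[OF Ys f] by (simp add: extensional_restrict)
   thus "(\<lambda>x\<in>pts Y. f x) \<in> coord_ring Y" using f by simp
  qed
  have "morph ?Y (frac_space {(pts X, coord_ring X)}) \<psi>"
  proof (rule morph_into_single[OF fY Xs])
   show "(\<lambda>x\<in>pts ?Y. f (\<psi> x)) \<in> coord_ring ?Y" if "f \<in> coord_ring X" for f
    using T[OF that] cY unfolding T_def pY by blast
  qed (use mem pY in simp)
  hence "morph ?Y X \<psi>" by (simp only: Xeq[symmetric])
  from morph_compose[OF this \<phi>] show "morph ?Y Y (\<lambda>x. x)"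
   by (rule morph_cong[rotated]) (use inv' pY in simp)
 qed
 moreover have "\<exists>F. finite F \<and> F \<subseteq> coord_ring Y \<and> coord_ring Y = alg_generated (pts Y) F"
 proof (intro exI[of _ "T ` F"] conjI equalityI)
  show "finite (T ` F)" using F(1) by simp
  show TF: "T ` F \<subseteq> coord_ring Y" using F(2) T by blast
  show "alg_generated (pts Y) (T ` F) \<subseteq> coord_ring Y" by (rule alg_generated_least[OF Ys TF])
  have G: "subalg (pts Y) (alg_generated (pts Y) (T ` F))" by (rule subalg_alg_generated) (auto simp: T_def)
  have "T f \<in> alg_generated (pts Y) (T ` F)" if "f \<in> alg_generated (pts X) F" for f
  proof (rule alg_generated_induct[OF that, of "\<lambda>f. T f \<in> alg_generated (pts Y) (T ` F)"])
   show "F \<subseteq> extensional (pts X)" using F(2) subalg_ext[OF Xs] by blast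
   have "T (\<lambda>x\<in>pts X. c) = (\<lambda>y\<in>pts Y. c)" for c using mem by (auto simp: T_def restrict_def)
   thus "T (\<lambda>x\<in>pts X. c) \<in> alg_generated (pts Y) (T ` F)" for c using subalg_const[OF G] by metis
  next
   show "T f \<in> alg_generated (pts Y) (T ` F)" if "f \<in> F" for f using alg_generated_incl that by blast
  next
   fix f g assume fg: "T f \<in> alg_generated (pts Y) (T ` F)" "T g \<in> alg_generated (pts Y) (T ` F)"
   have "T (\<lambda>x\<in>pts X. f x + g x) = (\<lambda>y\<in>pts Y. T f y + T g y)" using mem by (auto simp: T_def restrict_def)
   thus "T (\<lambda>x\<in>pts X. f x + g x) \<in> alg_generated (pts Y) (T ` F)" using subalg_add[OF G fg] by (simp only:)
   have "T (\<lambda>x\<in>pts X. f x * g x) = (\<lambda>y\<in>pts Y. T f y * T g y)" using mem by (auto simp: T_def restrict_def)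
   thus "T (\<lambda>x\<in>pts X. f x * g x) \<in> alg_generated (pts Y) (T ` F)" using subalg_mult[OF G fg] by (simp only:)
  qed
  thus "coord_ring Y \<subseteq> alg_generated (pts Y) (T ` F)" using Tinv F(3) by blast
 qed
 moreover have "\<exists>!y. y \<in> pts Y \<and> (\<forall>g\<in>coord_ring Y. \<omega> g = g y)" if \<omega>: "\<omega> \<in> alg_homs (pts Y) (coord_ring Y)" for \<omega>
 proof -
  have c: "T (\<lambda>x\<in>pts X. c) = (\<lambda>y\<in>pts Y. c)" for c using mem by (auto simp: T_def restrict_def)
  have a: "T (\<lambda>x\<in>pts X. f x + g x) = (\<lambda>y\<in>pts Y. T f y + T g y)"
   and m: "T (\<lambda>x\<in>pts X. f x * g x) = (\<lambda>y\<in>pts Y. T f y * T g y)" for f g using mem by (auto simp: T_def restrict_def)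
  have "(\<lambda>f\<in>coord_ring X. \<omega> (T f)) \<in> alg_homs (pts X) (coord_ring X)"
   unfolding alg_homs_def
  proof (intro CollectI conjI allI ballI)
   show "(\<lambda>f\<in>coord_ring X. \<omega> (T f)) (\<lambda>x\<in>pts X. e) = e" for e
    using subalg_const[OF Xs] \<omega> by (simp add: c alg_homs_def)
   fix f g assume fg: "f \<in> coord_ring X" "g \<in> coord_ring X"
   have "\<omega> (\<lambda>y\<in>pts Y. T f y + T g y) = \<omega> (T f) + \<omega> (T g) \<and> \<omega> (\<lambda>y\<in>pts Y. T f y * T g y) = \<omega> (T f) * \<omega> (T g)"
    using \<omega> T[OF fg(1)] T[OF fg(2)] unfolding alg_homs_def by blast
   thus "(\<lambda>f\<in>coord_ring X. \<omega> (T f)) (\<lambda>x\<in>pts X. f x + g x) =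
     (\<lambda>f\<in>coord_ring X. \<omega> (T f)) f + (\<lambda>f\<in>coord_ring X. \<omega> (T f)) g"
    "(\<lambda>f\<in>coord_ring X. \<omega> (T f)) (\<lambda>x\<in>pts X. f x * g x) =
     (\<lambda>f\<in>coord_ring X. \<omega> (T f)) f * (\<lambda>f\<in>coord_ring X. \<omega> (T f)) g"
    by (simp_all only: restrict_apply' subalg_add[OF Xs fg] subalg_mult[OF Xs fg] fg a m)
  qed simp
  from bspec[OF Xh this] obtain x where x: "x \<in> pts X" "\<forall>f\<in>coord_ring X. (\<lambda>f\<in>coord_ring X. \<omega> (T f)) f = f x"
   and uniq: "!!x'. x' \<in> pts X ==> \<forall>f\<in>coord_ring X. (\<lambda>f\<in>coord_ring X. \<omega> (T f)) f = f x' ==> x' = x"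
   by (rule ex1E) blast
  have xT: "\<omega> (T f) = f x" if "f \<in> coord_ring X" for f using x(2) that by simp
  show ?thesis
  proof (rule ex1I[of _ "\<phi> x"], intro conjI ballI)
   show "\<phi> x \<in> pts Y" using mem x(1) by simp
   fix g assume "g \<in> coord_ring Y"
   then obtain f where f: "f \<in> coord_ring X" "g = T f" using Tinv by blast
   show "\<omega> g = g (\<phi> x)" unfolding f(2) xT[OF f(1)] using x(1) mem inv by (simp add: T_def)
  next
   fix y assume y: "y \<in> pts Y \<and> (\<forall>g\<in>coord_ring Y. \<omega> g = g y)"
   have "\<psi> y = x"
   proof (rule uniq)
    show "\<psi> y \<in> pts X" using y mem by simp
    show "\<forall>f\<in>coord_ring X. (\<lambda>f\<in>coord_ring X. \<omega> (T f)) f = f (\<psi> y)"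
    proof
     fix f assume f: "f \<in> coord_ring X"
     have "\<omega> (T f) = T f y" using y T[OF f] by blast
     thus "(\<lambda>f\<in>coord_ring X. \<omega> (T f)) f = f (\<psi> y)" using f y by (simp add: T_def)
    qed
   qed
   thus "y = \<phi> x" using inv'[of y] y by simp
  qed
 qed
 ultimately show ?thesis unfolding affine_variety_def using Ys by blast
qed

text \<open>An algebraic subgroup carries its variety structure on its own elements. This moves the
  structure to the images under an injective map.\<close>

definition transport :: "('p => 'q) => ('p, 'k::field) fspace => ('q, 'k) fspace" where
 "transport h X = \<lparr>ftop = pullback_topology (h ` pts X) (inv_into (pts X) h) (ftop X),
   freg = (\<lambda>W. {f. W \<subseteq> h ` pts X \<and> f \<in> extensional W \<and>
    (\<lambda>x\<in>{x\<in>pts X. h x \<in> W}. f (h x)) \<in> freg X {x\<in>pts X. h x \<in> W}})\<rparr>"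

context
 fixes h :: "'p => 'q" and X :: "('p, 'k::field) fspace"
 assumes inj: "inj_on h (pts X)" and X: "fun_space X"
begin

lemma pts_transport: "pts (transport h X) = h ` pts X"
 unfolding transport_def by (auto simp: topspace_pullback_topology inv_into_f_f[OF inj])

lemma openin_transport: "openin (ftop (transport h X)) W \<longleftrightarrow> W \<subseteq> h ` pts X \<and> openin (ftop X) {x\<in>pts X. h x \<in> W}"
proof
 assume "openin (ftop (transport h X)) W"
 then obtain U where U: "openin (ftop X) U" "W = inv_into (pts X) h -` U \<inter> h ` pts X"
  unfolding transport_def by (auto simp: openin_pullback_topology)
 have "{x\<in>pts X. h x \<in> W} = U" using openin_subset[OF U(1)] by (auto simp: U(2) inv_into_f_f[OF inj] inj_on_eq_iff[OF inj])
 thus "W \<subseteq> h ` pts X \<and> openin (ftop X) {x\<in>pts X. h x \<in> W}" using U by auto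
next
 assume W: "W \<subseteq> h ` pts X \<and> openin (ftop X) {x\<in>pts X. h x \<in> W}"
 hence "W = inv_into (pts X) h -` {x\<in>pts X. h x \<in> W} \<inter> h ` pts X"
  by (auto simp: inv_into_f_f[OF inj])
 thus "openin (ftop (transport h X)) W"
  unfolding transport_def using W by (auto simp: openin_pullback_topology)
qed

lemma freg_transport: "f \<in> freg (transport h X) W \<longleftrightarrow> W \<subseteq> h ` pts X \<and> f \<in> extensional W \<and>
    (\<lambda>x\<in>{x\<in>pts X. h x \<in> W}. f (h x)) \<in> freg X {x\<in>pts X. h x \<in> W}"
 by (simp add: transport_def)

lemma fun_space_transport: "fun_space (transport h X)"
 unfolding fun_space_def
proof (intro conjI allI impI ballI)
 fix U assume "\<not> openin (ftop (transport h X)) U"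
 thus "freg (transport h X) U = {}"
  using fun_space_freg_openin[OF X] by (auto simp: freg_transport openin_transport)
next
 fix U assume U: "openin (ftop (transport h X)) U"
 let ?U = "{x\<in>pts X. h x \<in> U}"
 have S: "subalg ?U (freg X ?U)" using U fun_space_subalg[OF X] by (simp add: openin_transport)
 have UX: "U \<subseteq> h ` pts X" using U by (simp add: openin_transport)
 show "subalg U (freg (transport h X) U)"
  unfolding subalg_def
 proof (intro conjI allI ballI)
  show "freg (transport h X) U \<subseteq> extensional U" by (auto simp: freg_transport)
  fix c :: 'k
  have "(\<lambda>x\<in>?U. (\<lambda>x\<in>U. c) (h x)) = (\<lambda>x\<in>?U. c)" by (auto simp: restrict_def)
  thus "(\<lambda>x\<in>U. c) \<in> freg (transport h X) U"
   unfolding freg_transport using UX subalg_const[OF S] by simp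
 next
  fix f g assume "f \<in> freg (transport h X) U" "g \<in> freg (transport h X) U"
  hence fg: "(\<lambda>x\<in>?U. f (h x)) \<in> freg X ?U" "(\<lambda>x\<in>?U. g (h x)) \<in> freg X ?U" by (auto simp: freg_transport)
  have "(\<lambda>x\<in>?U. (\<lambda>x\<in>U. f x + g x) (h x)) = (\<lambda>x\<in>?U. (\<lambda>x\<in>?U. f (h x)) x + (\<lambda>x\<in>?U. g (h x)) x)"
   "(\<lambda>x\<in>?U. (\<lambda>x\<in>U. f x * g x) (h x)) = (\<lambda>x\<in>?U. (\<lambda>x\<in>?U. f (h x)) x * (\<lambda>x\<in>?U. g (h x)) x)"
   by (auto simp: restrict_def)
  thus "(\<lambda>x\<in>U. f x + g x) \<in> freg (transport h X) U" "(\<lambda>x\<in>U. f x * g x) \<in> freg (transport h X) U"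
   unfolding freg_transport using UX subalg_add[OF S fg] subalg_mult[OF S fg] by simp_all
 qed
next
 fix \<U> and f :: "'q => 'k" assume U: "\<forall>U\<in>\<U>. openin (ftop (transport h X)) U" and f: "f \<in> extensional (\<Union>\<U>)"
 let ?V = "(\<lambda>U. {x\<in>pts X. h x \<in> U}) ` \<U>"
 have e: "{x\<in>pts X. h x \<in> \<Union>\<U>} = \<Union>?V" by auto
 have sub: "U \<subseteq> h ` pts X" if "U \<in> \<U>" for U using U that by (simp add: openin_transport)
 have "(\<lambda>x\<in>\<Union>?V. f (h x)) \<in> freg X (\<Union>?V) \<longleftrightarrow> (\<forall>V\<in>?V. restrict (\<lambda>x\<in>\<Union>?V. f (h x)) V \<in> freg X V)"
  by (rule fun_space_glue[OF X]) (use U in "auto simp: openin_transport")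
 also have "\<dots> \<longleftrightarrow> (\<forall>U\<in>\<U>. (\<lambda>x\<in>{x\<in>pts X. h x \<in> U}. restrict f U (h x)) \<in> freg X {x\<in>pts X. h x \<in> U})"
 proof -
  have "restrict (\<lambda>x\<in>\<Union>?V. f (h x)) {x\<in>pts X. h x \<in> U} = (\<lambda>x\<in>{x\<in>pts X. h x \<in> U}. restrict f U (h x))"
   if "U \<in> \<U>" for U using that by (auto simp: restrict_def fun_eq_iff)
  thus ?thesis by (simp cong: ball_cong)
 qed
 finally show "f \<in> freg (transport h X) (\<Union>\<U>) \<longleftrightarrow> (\<forall>U\<in>\<U>. restrict f U \<in> freg (transport h X) U)"
  unfolding freg_transport e using sub f by auto
next
 fix U f assume "f \<in> freg (transport h X) U"
 hence f: "U \<subseteq> h ` pts X" "(\<lambda>x\<in>{x\<in>pts X. h x \<in> U}. f (h x)) \<in> freg X {x\<in>pts X. h x \<in> U}" (is "?f \<in> freg X ?U")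
  by (auto simp: freg_transport)
 have e: "{x \<in> pts X. h x \<in> {x\<in>U. f x ~= 0}} = {x\<in>?U. ?f x ~= 0}" by auto
 show "openin (ftop (transport h X)) {x\<in>U. f x ~= 0}"
  unfolding openin_transport e using f(1) fun_space_nonzero[OF X f(2)] by auto
 have "(\<lambda>x\<in>{x\<in>?U. ?f x ~= 0}. (\<lambda>x\<in>{x\<in>U. f x ~= 0}. inverse (f x)) (h x)) = (\<lambda>x\<in>{x\<in>?U. ?f x ~= 0}. inverse (?f x))"
  by (auto simp: restrict_def fun_eq_iff)
 thus "(\<lambda>x\<in>{x\<in>U. f x ~= 0}. inverse (f x)) \<in> freg (transport h X) {x\<in>U. f x ~= 0}"
  unfolding freg_transport e using f(1) fun_space_inverse[OF X f(2)] by auto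
qed

lemma morph_transport: "morph X (transport h X) h"
 unfolding morph_def
proof (intro conjI allI impI)
 show "continuous_map (ftop X) (ftop (transport h X)) h"
  by (auto simp: continuous_map_def pts_transport openin_transport)
qed (simp add: freg_transport)

lemma morph_transport_inv: "morph (transport h X) X (inv_into (pts X) h)"
proof -
 have e: "{x \<in> pts X. h x \<in> {y \<in> h ` pts X. inv_into (pts X) h y \<in> U}} = U" if "openin (ftop X) U" for U
  using openin_subset[OF that] by (auto simp: inv_into_f_f[OF inj] inj_on_eq_iff[OF inj] subset_iff)
 show ?thesis
  unfolding morph_def
 proof (intro conjI allI impI)
  show "continuous_map (ftop (transport h X)) (ftop X) (inv_into (pts X) h)"
   using e by (auto simp: continuous_map_def pts_transport openin_transport inv_into_f_f[OF inj])
  fix U f assume f: "openin (ftop X) U \<and> f \<in> freg X U"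
  have "(\<lambda>x\<in>U. (\<lambda>y\<in>{y \<in> h ` pts X. inv_into (pts X) h y \<in> U}. f (inv_into (pts X) h y)) (h x)) = restrict f U"
   using openin_subset[of "ftop X" U] f by (auto simp: restrict_def fun_eq_iff inv_into_f_f[OF inj] subset_iff)
  also have "\<dots> = f" using fun_space_freg_ext[OF X] f by (simp add: extensional_restrict)
  finally show "(\<lambda>y\<in>{y \<in> pts (transport h X). inv_into (pts X) h y \<in> U}. f (inv_into (pts X) h y))
    \<in> freg (transport h X) {y \<in> pts (transport h X). inv_into (pts X) h y \<in> U}"
   unfolding freg_transport pts_transport using f e by (simp add: Collect_conj_eq)
 qed
qed

lemma variety_transport:
 assumes v: "variety X" shows "variety (transport h X)"
 unfolding variety_def
proof (intro conjI fun_space_transport)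
 let ?W = "transport h X" and ?g = "inv_into (pts X) h"
 obtain \<U> where \<U>: "finite \<U>" "\<Union>\<U> = pts X" "\<forall>U\<in>\<U>. openin (ftop X) U \<and> affine_variety (induced X U)"
  using v unfolding variety_def by blast
 have "openin (ftop ?W) (h ` U) \<and> affine_variety (induced ?W (h ` U))" if U: "U \<in> \<U>" for U
 proof
  have oU: "openin (ftop X) U" and UX: "U \<subseteq> pts X" using \<U> U by auto
  have e: "{x\<in>pts X. h x \<in> h ` U} = U" using UX inj by (auto dest: inj_onD)
  show "openin (ftop ?W) (h ` U)" unfolding openin_transport e using oU UX by auto
  have inj': "inj_on h U" using inj UX by (rule inj_on_subset)
  have p: "pts (induced X U) = U" "pts (induced ?W (h ` U)) = h ` U"
   using pts_induced[OF X, of U] pts_induced[OF fun_space_transport, of "h ` U"] UX by (auto simp: pts_transport)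
  have "morph (induced X U) (induced ?W (h ` U)) h"
  proof (rule morph_induced[OF X fun_space_transport UX])
   fix V f assume f: "f \<in> freg ?W V"
   have "(\<lambda>x\<in>{x\<in>pts X. h x \<in> V}. f (h x)) \<in> freg X {x\<in>pts X. h x \<in> V}" using f by (simp add: freg_transport)
   thus "\<exists>g W. g \<in> freg X W \<and> W \<inter> U = {x \<in> U. h x \<in> V} \<and> (\<forall>x\<in>U. h x \<in> V --> g x = f (h x))"
    using UX by (intro exI[of _ "\<lambda>x\<in>{x\<in>pts X. h x \<in> V}. f (h x)"] exI[of _ "{x\<in>pts X. h x \<in> V}"] conjI) auto
  qed (use UX pts_transport in auto)
  moreover have "morph (induced ?W (h ` U)) (induced X U) (inv_into U h)"
  proof (rule morph_induced[OF fun_space_transport X])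
   have iv: "inv_into U h p = ?g p" if "p \<in> h ` U" for p
    using that UX by (auto simp: inv_into_f_f[OF inj'] inv_into_f_f[OF inj] subset_iff)
   fix V f assume f: "f \<in> freg X V"
   have oV: "openin (ftop X) V" by (rule fun_space_freg_openin[OF X f])
   have "(\<lambda>y\<in>{y \<in> pts ?W. ?g y \<in> V}. f (?g y)) \<in> freg ?W {y \<in> pts ?W. ?g y \<in> V}"
    by (rule morph_freg[OF morph_transport_inv f oV])
   moreover have sub: "h ` U \<subseteq> h ` pts X" using UX by blast
   have eq: "p \<in> {y \<in> pts ?W. ?g y \<in> V} \<inter> h ` U \<longleftrightarrow> p \<in> {x \<in> h ` U. inv_into U h x \<in> V}" for p
   proof (cases "p \<in> h ` U")
    case True
    thus ?thesis using subsetD[OF sub True] by (simp only: pts_transport iv Int_iff mem_Collect_eq simp_thms)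
   qed simp
   have "{y \<in> pts ?W. ?g y \<in> V} \<inter> h ` U = {x \<in> h ` U. inv_into U h x \<in> V}"
    by (rule Set.set_eqI, rule eq)
   moreover have "\<forall>x\<in>h ` U. inv_into U h x \<in> V --> (\<lambda>y\<in>{y \<in> pts ?W. ?g y \<in> V}. f (?g y)) x = f (inv_into U h x)"
   proof (intro ballI impI)
    fix p assume p: "p \<in> h ` U" "inv_into U h p \<in> V"
    thus "(\<lambda>y\<in>{y \<in> pts ?W. ?g y \<in> V}. f (?g y)) p = f (inv_into U h p)"
     using subsetD[OF sub p(1)] by (simp add: pts_transport iv)
   qed
   ultimately show "\<exists>g W. g \<in> freg ?W W \<and> W \<inter> h ` U = {x \<in> h ` U. inv_into U h x \<in> V} \<and>
     (\<forall>x\<in>h ` U. inv_into U h x \<in> V --> g x = f (inv_into U h x))"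
    by (intro exI conjI)
  qed (use UX in "auto simp: pts_transport inv_into_f_f[OF inj']")
  moreover have "bij_betw h U (h ` U)" using inj' by (simp add: bij_betw_def)
  ultimately have "isomorph (induced X U) (induced ?W (h ` U)) h" unfolding isomorph_def p by simp
  thus "affine_variety (induced ?W (h ` U))"
   using affine_variety_isomorph[OF fun_space_induced[OF fun_space_transport]] \<U>(3) U by blast
 qed
 moreover have "\<Union>((`) h ` \<U>) = pts ?W" using \<U>(2) by (auto simp: pts_transport)
 ultimately show "\<exists>\<U>. finite \<U> \<and> \<Union>\<U> = pts ?W \<and> (\<forall>U\<in>\<U>. openin (ftop ?W) U \<and> affine_variety (induced ?W U))"
  using \<U>(1) by (intro exI[of _ "(`) h ` \<U>"]) auto
 have "morph (fprod ?W ?W) (fprod X X) (\<lambda>z. (?g (fst z), ?g (snd z)))"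
  by (intro morph_prod fun_space_transport X morph_transport_inv)
 hence "closedin (ftop (fprod ?W ?W)) {z \<in> pts (fprod ?W ?W). (?g (fst z), ?g (snd z)) \<in> {(x, x) |x. x \<in> pts X}}"
  using v by (intro closedin_continuous_map_preimage) (auto simp: morph_def variety_def)
 moreover have "{z \<in> pts (fprod ?W ?W). (?g (fst z), ?g (snd z)) \<in> {(x, x) |x. x \<in> pts X}} = {(x, x) |x. x \<in> pts ?W}"
  unfolding pts_fprod[OF fun_space_transport fun_space_transport] pts_transport
  by (auto simp: inv_into_f_f[OF inj])
 ultimately show "closedin (ftop (fprod ?W ?W)) {(x, x) |x. x \<in> pts ?W}" by (simp only:)
qed

end

text \<open>With the transported structure, the group axioms are automatic. Preservation of
  algebraic subgroups is thereby reduced to the regularity of the action of \<open>V\<close> on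
  \<open>Y\<close> through \<open>\<tau>\<close>.\<close>

lemma alg_subgroup_transport:
 assumes GX: "group (Aut X)" and GY: "group (Aut Y)" and \<tau>: "\<tau> \<in> iso (Aut X) (Aut Y)" and Y: "fun_space Y"
  and H: "alg_subgroup_of_Aut X H V" and act: "morph (fprod V Y) Y (\<lambda>(v, y). \<tau> v y)"
 shows "alg_subgroup_of_Aut Y (\<tau> ` H) (transport \<tau> V) \<and> morph V (transport \<tau> V) \<tau>"
proof -
 have sub: "subgroup H (Aut X)" and ag: "algebraic_group ((Aut X)\<lparr>carrier := H\<rparr>) V"
  using H by (auto simp: alg_subgroup_of_Aut_def)
 have v: "variety V" and pV: "pts V = H" and mult: "morph (fprod V V) V (\<lambda>(g, h). g \<otimes>\<^bsub>Aut X\<^esub> h)"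
  and inv: "morph V V (\<lambda>g. inv\<^bsub>(Aut X)\<lparr>carrier := H\<rparr>\<^esub> g)"
  using ag by (auto simp: algebraic_group_def)
 have V: "fun_space V" using v by (simp add: variety_def)
 have hom: "group_hom (Aut X) (Aut Y) \<tau>" using GX GY \<tau> by (simp add: group_hom_def group_hom_axioms_def iso_def)
 have HX: "H \<subseteq> carrier (Aut X)" by (rule subgroup.subset[OF sub])
 have inj: "inj_on \<tau> (pts V)" unfolding pV using \<tau> HX by (auto simp: iso_def bij_betw_def intro: inj_on_subset)
 have sub': "subgroup (\<tau> ` H) (Aut Y)" by (rule group_hom.subgroup_img_is_subgroup[OF hom sub])
 let ?W = "transport \<tau> V" and ?g = "inv_into (pts V) \<tau>" and ?G = "(Aut X)\<lparr>carrier := H\<rparr>" and ?G' = "(Aut Y)\<lparr>carrier := \<tau> ` H\<rparr>"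
 have W: "fun_space ?W" and pW: "pts ?W = \<tau> ` H" and g: "morph ?W V ?g" and \<tau>W: "morph V ?W \<tau>"
  using fun_space_transport[OF inj V] pts_transport[OF inj V] morph_transport_inv[OF inj V] morph_transport[OF inj V] pV by auto
 have gm: "?g a \<in> H" "\<tau> (?g a) = a" if "a \<in> \<tau> ` H" for a
  using that inv_into_into[of a \<tau> "pts V"] f_inv_into_f[of a \<tau> "pts V"] by (auto simp: pV)
 have G: "group ?G" by (rule subgroup.subgroup_is_group[OF sub GX])
 have G': "group ?G'" by (rule subgroup.subgroup_is_group[OF sub' GY])
 have hom': "group_hom ?G ?G' \<tau>"
  unfolding group_hom_def group_hom_axioms_def
  using G G' HX \<tau> by (auto simp: iso_def hom_def subset_iff)
 have mult': "morph (fprod ?W ?W) ?W (\<lambda>(a, b). a \<otimes>\<^bsub>Aut Y\<^esub> b)"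
 proof (rule morph_cong)
  show "morph (fprod ?W ?W) ?W (\<lambda>z. \<tau> ((\<lambda>(g, h). g \<otimes>\<^bsub>Aut X\<^esub> h) (?g (fst z), ?g (snd z))))"
   by (rule morph_compose[OF morph_compose[OF morph_prod[OF W W V V g g] mult] \<tau>W])
  fix z assume "z \<in> pts (fprod ?W ?W)"
  hence z: "fst z \<in> \<tau> ` H" "snd z \<in> \<tau> ` H" by (auto simp: pts_fprod[OF W W] pW)
  have "\<tau> (?g (fst z) \<otimes>\<^bsub>Aut X\<^esub> ?g (snd z)) = \<tau> (?g (fst z)) \<otimes>\<^bsub>Aut Y\<^esub> \<tau> (?g (snd z))"
   using gm[OF z(1)] gm[OF z(2)] HX by (intro group_hom.hom_mult[OF hom]) auto
  thus "\<tau> ((\<lambda>(g, h). g \<otimes>\<^bsub>Aut X\<^esub> h) (?g (fst z), ?g (snd z))) = (case z of (a, b) => a \<otimes>\<^bsub>Aut Y\<^esub> b)"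
   using gm(2)[OF z(1)] gm(2)[OF z(2)] by (simp add: case_prod_beta)
 qed
 have inv': "morph ?W ?W (\<lambda>a. inv\<^bsub>?G'\<^esub> a)"
 proof (rule morph_cong)
  show "morph ?W ?W (\<lambda>a. \<tau> (inv\<^bsub>?G\<^esub> (?g a)))"
   by (rule morph_compose[OF morph_compose[OF g inv] \<tau>W])
  fix a assume "a \<in> pts ?W"
  hence a: "a \<in> \<tau> ` H" by (simp add: pW)
  have "\<tau> (inv\<^bsub>?G\<^esub> (?g a)) = inv\<^bsub>?G'\<^esub> (\<tau> (?g a))"
   by (rule group_hom.hom_inv[OF hom']) (simp add: gm[OF a])
  thus "\<tau> (inv\<^bsub>?G\<^esub> (?g a)) = inv\<^bsub>?G'\<^esub> a" by (simp only: gm(2)[OF a])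
 qed
 have act': "morph (fprod ?W Y) Y (\<lambda>(a, y). a y)"
 proof (rule morph_cong)
  show "morph (fprod ?W Y) Y (\<lambda>z. (\<lambda>(v, y). \<tau> v y) (?g (fst z), snd z))"
   by (rule morph_compose[OF morph_prod[OF W Y V Y g morph_id[OF Y]] act])
  fix z assume "z \<in> pts (fprod ?W Y)"
  hence z: "fst z \<in> \<tau> ` H" by (auto simp: pts_fprod[OF W Y] pW)
  thus "(\<lambda>(v, y). \<tau> v y) (?g (fst z), snd z) = (case z of (a, y) => a y)"
   using gm(2)[OF z] by (simp add: case_prod_beta)
 qed
 show ?thesis
  unfolding alg_subgroup_of_Aut_def algebraic_group_def
  using sub' G' variety_transport[OF inj V v] pW mult' inv' act' \<tau>W by simp
qed

subsection \<open>Actions of algebraic groups of automorphisms\<close>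

text \<open>Near \<open>(v0, ev 0)\<close> the pullback is a quotient of sums of products. For fixed
  \<open>v\<close>, cleared numerators are combinations of finitely many polynomials independent of
  \<open>v\<close>, so their degrees are bounded; and \<open>f (y v x)\<close> divides such a
  numerator, so its degree is no larger.\<close>

lemma (in graded_ring) action_degree_bounded:
 assumes V: "fun_space V" and m: "morph (fprod V Z) Z m" and y: "!!v x. v \<in> pts V ==> m (v, ev x) = ev (y v x)"
  and pull: "!!v f. v \<in> pts V ==> f \<in> S ==> (\<lambda>x. f (y v x)) \<in> S" and f: "f \<in> S" and v0: "v0 \<in> pts V"
 obtains V0 D where "openin (ftop V) V0" "v0 \<in> V0" "!!v. v \<in> V0 ==> degree_le (\<lambda>x. f (y v x)) D"
proof -
 let ?P = "fprod V Z"
 have pP: "pts ?P = pts V \<times> range ev" using pts_fprod[OF V fun_space_A_var] by (simp only: pts_A_var)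
 have "hat f \<in> coord_ring Z" using f coord_ring_A_var by blast
 hence F: "(\<lambda>z\<in>pts ?P. hat f (m z)) \<in> coord_ring ?P" by (rule morph_coord_ring[OF m])
 have z0: "(v0, ev 0) \<in> pts ?P" using v0 by (simp add: pP)
 obtain W F a b N where N: "(W, F) \<in> {(U \<times> V', tensor_algebra (freg V U) (freg Z V') U V') |U V'. openin (ftop V) U \<and> openin (ftop Z) V'}"
   "a \<in> F" "b \<in> F" "openin (ftop ?P) N" "(v0, ev 0) \<in> N" "N \<subseteq> pts ?P" "N \<subseteq> W"
   "\<forall>z\<in>N. b z ~= 0 \<and> (\<lambda>z\<in>pts ?P. hat f (m z)) z = a z / b z"
  by (rule freg_frac_spaceE[OF F[unfolded fprod_eq] z0[unfolded fprod_eq], folded fprod_eq]) blast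
 from N(1) obtain U U' where U: "W = U \<times> U'" "F = tensor_algebra (freg V U) (freg Z U') U U'"
  "openin (ftop V) U" "openin (ftop Z) U'" by auto
 obtain p :: nat and a1 a2 where a: "a = (\<lambda>z\<in>U \<times> U'. \<Sum>i<p. a1 i (fst z) * a2 i (snd z))"
  "!!i. i < p ==> a1 i \<in> freg V U" "!!i. i < p ==> a2 i \<in> freg Z U'"
  using N(2) unfolding U by (rule tensor_algebraE) blast
 obtain q :: nat and b1 b2 where b: "b = (\<lambda>z\<in>U \<times> U'. \<Sum>i<q. b1 i (fst z) * b2 i (snd z))"
  "!!i. i < q ==> b1 i \<in> freg V U" "!!i. i < q ==> b2 i \<in> freg Z U'"
  using N(3) unfolding U by (rule tensor_algebraE) blast
 have e0: "ev 0 \<in> U'" using N(5,7) U(1) by auto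
 \<comment> \<open>One denominator for all second factors of numerator and denominator. It depends
   on the point of the spectrum only, not on \<open>v\<close>.\<close>
 have "\<exists>e\<in>S. e 0 ~= 0 \<and> (\<forall>y. e y ~= 0 --> ev y \<in> U') \<and>
   (\<forall>i\<in>{..<p} <+> {..<q}. \<exists>c\<in>S. \<forall>y. e y ~= 0 --> c y = e y * case_sum a2 b2 i (ev y))"
  by (rule common_denominator) (use a(3) b(3) U(4) e0 in auto)
 then obtain e where e: "e \<in> S" "e 0 ~= 0" "\<forall>y. e y ~= 0 --> ev y \<in> U'"
  "\<forall>i\<in>{..<p} <+> {..<q}. \<exists>c\<in>S. \<forall>y. e y ~= 0 --> c y = e y * case_sum a2 b2 i (ev y)" by (elim bexE conjE)
 from bchoice[OF e(4)[unfolded Bex_def]] obtain c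
  where c: "\<forall>i\<in>{..<p} <+> {..<q}. c i \<in> S \<and> (\<forall>y. e y ~= 0 --> c i y = e y * case_sum a2 b2 i (ev y))" by (elim exE)
 define A where "A i = c (Inl i)" for i
 define B where "B i = c (Inr i)" for i
 have A: "A i \<in> S" "!!y. e y ~= 0 ==> A i y = e y * a2 i (ev y)" if "i < p" for i
  using bspec[OF c, of "Inl i"] that by (auto simp: A_def)
 have B: "B i \<in> S" "!!y. e y ~= 0 ==> B i y = e y * b2 i (ev y)" if "i < q" for i
  using bspec[OF c, of "Inr i"] that by (auto simp: B_def)
 have "\<exists>D. \<forall>i<p'. degree_le (A i) D" if "p' \<le> p" for p'
  using that
 proof (induction p')
  case (Suc n)
  then obtain D where D: "\<forall>i<n. degree_le (A i) D" by auto
  obtain D' where D': "degree_le (A n) D'" using degree_le_exists[OF polys[OF A(1)[of n]]] Suc.prems by auto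
  show ?case
   by (intro exI[of _ "max D D'"]) (use D D' in "auto simp: less_Suc_eq intro: degree_le_mono")
 qed simp
 then obtain D where D: "!!i. i < p ==> degree_le (A i) D" by blast
 \<comment> \<open>For these \<open>v\<close> the slice of \<open>N\<close> contains the origin, so
   the denominator \<open>Pb\<close> is nonzero there.\<close>
 define V0 where "V0 = {v \<in> pts V. (v, ev 0) \<in> N}"
 have "morph V ?P (\<lambda>v. (v, ev 0))" by (rule morph_slice[OF V fun_space_A_var]) (simp add: pts_A_var)
 hence oV0: "openin (ftop V) V0" unfolding V0_def by (rule morph_preimage[OF _ N(4)])
 have "degree_le (\<lambda>x. f (y v x)) D" if v: "v \<in> V0" for v
 proof -
  have vN: "(v, ev 0) \<in> N" and vV: "v \<in> pts V" using v by (auto simp: V0_def)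
  define Pa where "Pa = (\<lambda>x. \<Sum>i<p. a1 i v * A i x)"
  define Pb where "Pb = (\<lambda>x. \<Sum>i<q. b1 i v * B i x)"
  have PaS: "Pa \<in> S" unfolding Pa_def using A(1) by (intro sum scale) auto
  have PbS: "Pb \<in> S" unfolding Pb_def using B(1) by (intro sum scale) auto
  have Pae: "Pa x = e x * a (v, ev x)" and Pbe: "Pb x = e x * b (v, ev x)" if "(v, ev x) \<in> N" "e x ~= 0" for x
  proof -
   have "(v, ev x) \<in> U \<times> U'" using that N(7) U(1) by auto
   thus "Pa x = e x * a (v, ev x)" "Pb x = e x * b (v, ev x)"
    using A(2)[OF _ that(2)] B(2)[OF _ that(2)]
    by (auto simp: Pa_def Pb_def a(1) b(1) sum_distrib_left mult_ac intro!: sum.cong)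
  qed
  have Pb0: "Pb 0 ~= 0" using Pbe[OF vN e(2)] N(8) vN e(2) by simp
  have "morph Z ?P (\<lambda>w. (v, w))" by (rule morph_slice_snd[OF V fun_space_A_var vV])
  hence oN: "openin (ftop Z) {w \<in> pts Z. (v, w) \<in> N}" by (rule morph_preimage[OF _ N(4)])
  obtain u where u: "u \<in> S" "u 0 ~= 0" "!!x. u x ~= 0 ==> ev x \<in> {w \<in> pts Z. (v, w) \<in> N}"
   by (rule openin_A_varE[OF oN, of 0]) (use vN in \<open>simp add: pts_A_var\<close>, blast)
  have eq: "Pb x * f (y v x) = Pa x" for x
  proof (rule polys_eq_dense[of "\<lambda>x. Pb x * f (y v x)" Pa "\<lambda>x. u x * e x" 0])
   fix x assume "u x * e x ~= 0"
   hence ux: "u x ~= 0" and ex: "e x ~= 0" by auto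
   have xN: "(v, ev x) \<in> N" using u(3)[OF ux] by simp
   have "hat f (m (v, ev x)) = a (v, ev x) / b (v, ev x)" "b (v, ev x) ~= 0"
    using bspec[OF N(8) xN] subsetD[OF N(6) xN] by auto
   hence "b (v, ev x) * f (y v x) = a (v, ev x)" using f by (simp add: y[OF vV] hat_ev)
   thus "Pb x * f (y v x) = Pa x" unfolding Pae[OF xN ex] Pbe[OF xN ex] by (simp add: mult.assoc)
  qed (use u(2) e(2) polys[OF PaS] polys[OF PbS] polys[OF pull[OF vV f]] polys[OF u(1)] polys[OF e(1)] in auto)
  have Pad: "degree_le Pa D"
   unfolding degree_le_def
  proof (intro allI impI)
   fix i assume i: "D < i"
   have "hcomp i Pa = (\<lambda>x. \<Sum>j<p. hcomp i (\<lambda>x. a1 j v * A j x) x)"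
    unfolding Pa_def by (rule hcomp_sum) (use A(1) polys in auto)
   moreover have "hcomp i (\<lambda>x. a1 j v * A j x) x = 0" if "j < p" for j x
    using D[OF that] i by (simp add: hcomp_scale[OF polys[OF A(1)[OF that]]] degree_le_def)
   ultimately show "hcomp i Pa = (\<lambda>x. 0)" by simp
  qed
  show ?thesis
   by (rule degree_le_factor[OF polys[OF pull[OF vV f]] polys[OF PbS] Pb0]) (use eq Pad in simp)
 qed
 moreover have "v0 \<in> V0" using v0 N(5) by (simp add: V0_def)
 ultimately show ?thesis by (intro that[OF oV0, of D])
qed

text \<open>
 Interpolation on the finite-dimensional space of polynomials of bounded degree writes the
 action near \<open>v0\<close> as a sum of products, whose first factors are values at fixed points.
\<close>

lemma (in graded_ring) action_morphI:
 assumes V: "fun_space V" and y: "!!v x. v \<in> pts V ==> m (v, ev x) = ev (y v x)"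
  and pull: "!!v f. v \<in> pts V ==> f \<in> S ==> (\<lambda>x. f (y v x)) \<in> S"
  and slice: "!!f x. f \<in> S ==> (\<lambda>v\<in>pts V. f (y v x)) \<in> coord_ring V"
  and bd: "!!f v0. f \<in> S ==> v0 \<in> pts V ==>
   \<exists>V0 D. openin (ftop V) V0 \<and> v0 \<in> V0 \<and> (\<forall>v\<in>V0. degree_le (\<lambda>x. f (y v x)) D)"
 shows "morph (fprod V Z) Z m"
proof -
 let ?P = "fprod V Z"
 have pP: "pts ?P = pts V \<times> range ev" using pts_fprod[OF V fun_space_A_var] by (simp only: pts_A_var)
 have P: "fun_space ?P" by (rule fun_space_fprod[OF V fun_space_A_var])
 have "morph ?P (frac_space {(range ev, hat ` S)}) m"
 proof (rule morph_into_single[OF P subalg_hat])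
  show "m z \<in> range ev" if "z \<in> pts ?P" for z using that y by (auto simp: pP)
  fix h assume "h \<in> hat ` S"
  then obtain f where f: "f \<in> S" "h = hat f" by auto
  show "(\<lambda>z\<in>pts ?P. h (m z)) \<in> coord_ring ?P"
  proof (rule fun_space_local[OF P])
   fix z0 assume z0: "z0 \<in> pts ?P"
   then obtain v0 where v0: "fst z0 = v0" "v0 \<in> pts V" by (auto simp: pP)
   obtain V0 D where V0: "openin (ftop V) V0" "v0 \<in> V0" "!!v. v \<in> V0 ==> degree_le (\<lambda>x. f (y v x)) D"
    using bd[OF f(1) v0(2)] by blast
   have V0V: "V0 \<subseteq> pts V" by (rule openin_subset[OF V0(1)])
   obtain n :: nat and p L where L: "!!l. l < n ==> L l \<in> S"
    and rep: "!!f z. f \<in> S ==> degree_le f D ==> f z = (\<Sum>l<n. f (p l) * L l z)"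
    by (rule interpolation_A_ring[of D]) blast
   have "(\<lambda>z\<in>V0 \<times> pts Z. \<Sum>l<n. restrict (\<lambda>v\<in>pts V. f (y v (p l))) V0 (fst z) * hat (L l) (snd z))
     \<in> tensor_algebra (freg V V0) (coord_ring Z) V0 (pts Z)"
    by (rule tensor_algebraI[OF _ fun_space_restrict[OF V slice[OF f(1)] V0(1) V0V]])
     (use L coord_ring_A_var in auto)
   hence t: "(\<lambda>z\<in>V0 \<times> pts Z. \<Sum>l<n. restrict (\<lambda>v\<in>pts V. f (y v (p l))) V0 (fst z) * hat (L l) (snd z))
     \<in> freg ?P (V0 \<times> pts Z)"
    unfolding fprod_eq using V0(1) by (intro freg_frac_space_incl[OF frac_base_fprod[OF V fun_space_A_var]]) auto
   have "(\<lambda>z\<in>V0 \<times> pts Z. \<Sum>l<n. restrict (\<lambda>v\<in>pts V. f (y v (p l))) V0 (fst z) * hat (L l) (snd z))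
     = restrict (\<lambda>z\<in>pts ?P. h (m z)) (V0 \<times> pts Z)"
   proof (rule extensionalityI[of _ "V0 \<times> pts Z"])
    fix z assume z: "z \<in> V0 \<times> pts Z"
    then obtain v x where vx: "z = (v, ev x)" "v \<in> V0" by (auto simp: pts_A_var)
    have vV: "v \<in> pts V" using vx V0V by blast
    have "(\<Sum>l<n. restrict (\<lambda>v\<in>pts V. f (y v (p l))) V0 (fst z) * hat (L l) (snd z)) = (\<Sum>l<n. f (y v (p l)) * L l x)"
     using vx vV L by (intro sum.cong) (auto simp: hat_ev)
    also have "\<dots> = f (y v x)" by (rule rep[OF pull[OF vV f(1)] V0(3)[OF vx(2)], symmetric])
    also have "\<dots> = h (m z)" using f by (simp add: vx y[OF vV] hat_ev)
    finally show "(\<lambda>z\<in>V0 \<times> pts Z. \<Sum>l<n. restrict (\<lambda>v\<in>pts V. f (y v (p l))) V0 (fst z) * hat (L l) (snd z)) z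
      = restrict (\<lambda>z\<in>pts ?P. h (m z)) (V0 \<times> pts Z) z"
     using z vx vV by (simp add: pP)
   qed (rule restrict_extensional)+
   hence "restrict (\<lambda>z\<in>pts ?P. h (m z)) (V0 \<times> pts Z) \<in> freg ?P (V0 \<times> pts Z)" using t by simp
   moreover have "z0 \<in> V0 \<times> pts Z" using z0 v0 V0(2) by (auto simp: pP pts_A_var)
   moreover have "V0 \<times> pts Z \<subseteq> pts ?P" using V0V by (auto simp: pP pts_A_var)
   ultimately show "\<exists>N. z0 \<in> N \<and> N \<subseteq> pts ?P \<and> restrict (\<lambda>z\<in>pts ?P. h (m z)) N \<in> freg ?P N"
    by (intro exI conjI)
  qed simp
 qed
 thus ?thesis by (simp only: A_var_eq[symmetric])
qed

lemma (in graded_ring) action_slice: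
 assumes V: "fun_space V" and m: "morph (fprod V Z) Z m" and y: "!!v x. v \<in> pts V ==> m (v, ev x) = ev (y v x)"
  and f: "f \<in> S"
 shows "(\<lambda>v\<in>pts V. f (y v x)) \<in> coord_ring V"
proof -
 have "morph V (fprod V Z) (\<lambda>v. (v, ev x))" by (rule morph_slice[OF V fun_space_A_var]) (simp add: pts_A_var)
 from morph_compose[OF this m] have mm: "morph V Z (\<lambda>v. m (v, ev x))" .
 have "hat f \<in> coord_ring Z" using f coord_ring_A_var by blast
 from morph_coord_ring[OF mm this] have "(\<lambda>v\<in>pts V. hat f (m (v, ev x))) \<in> coord_ring V" .
 moreover have "(\<lambda>v\<in>pts V. hat f (m (v, ev x))) = (\<lambda>v\<in>pts V. f (y v x))"
  using f by (auto simp: restrict_def y hat_ev)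
 ultimately show ?thesis by simp
qed

section \<open>Families of automorphisms of both spectra\<close>

context invariants_pair
begin

context
 fixes V :: "('v, 'k) fspace" and y y' :: "'v => 'k ^ 'n => 'k ^ 'n" and \<rho> \<rho>'
 assumes V: "fun_space V" and rA: "!!v. v \<in> pts V ==> A.represents (y v) (y' v) (\<rho> v)"
  and rR: "!!v. v \<in> pts V ==> R.represents (y v) (y' v) (\<rho>' v)"
begin

text \<open>Functions of \<open>A\<close> are functions of \<open>R\<close>, so their slices and
  local degree bounds come from the action on the larger ring; only the stability of
  \<open>A\<close> under pullback is specific to \<open>A\<close>.\<close>

lemma action_descends:
 assumes m: "morph (fprod V R.Z) R.Z (\<lambda>(v, p). \<rho>' v p)"
 shows "morph (fprod V A.Z) A.Z (\<lambda>(v, p). \<rho> v p)"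
proof (rule A.action_morphI[OF V, of _ y])
 have yR: "(\<lambda>(v, p). \<rho>' v p) (v, R.ev x) = R.ev (y v x)" if "v \<in> pts V" for v x
  using R.representsD(2)[OF rR[OF that]] by simp
 show "(\<lambda>(v, p). \<rho> v p) (v, A.ev x) = A.ev (y v x)" if "v \<in> pts V" for v x
  using A.representsD(2)[OF rA[OF that]] by simp
 show "(\<lambda>x. f (y v x)) \<in> A" if "v \<in> pts V" "f \<in> A" for v f
  by (rule A.representsD(5)[OF rA[OF that(1)] that(2)])
 show "(\<lambda>v\<in>pts V. f (y v x)) \<in> coord_ring V" if "f \<in> A" for f x
  by (rule R.action_slice[OF V m _ A_subset_R[OF that]]) (rule yR)
 show "\<exists>V0 D. openin (ftop V) V0 \<and> v0 \<in> V0 \<and> (\<forall>v\<in>V0. degree_le (\<lambda>x. f (y v x)) D)"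
  if "f \<in> A" "v0 \<in> pts V" for f v0
 proof (rule R.action_degree_bounded[OF V m yR _ A_subset_R[OF that(1)] that(2)])
  show "(\<lambda>x. f (y v x)) \<in> R" if "v \<in> pts V" "f \<in> R" for v f
   by (rule R.representsD(5)[OF rR[OF that(1)] that(2)])
 qed blast+
qed

text \<open>A function of \<open>R\<close> times a power of a coordinate lies in \<open>A\<close>.
  Dividing again yields the regularity of slices off the origin, and the bounded degree, since the
  degree of a factor is at most that of the product.\<close>

lemma action_lifts:
 assumes m: "morph (fprod V A.Z) A.Z (\<lambda>(v, p). \<rho> v p)" and d2: "2 \<le> d" and n: "2 \<le> CARD('n)"
 shows "morph (fprod V R.Z) R.Z (\<lambda>(v, p). \<rho>' v p)"
proof (rule R.action_morphI[OF V, of _ y])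
 have yA: "(\<lambda>(v, p). \<rho> v p) (v, A.ev x) = A.ev (y v x)" if "v \<in> pts V" for v x
  using A.representsD(2)[OF rA[OF that]] by simp
 have pullA: "(\<lambda>x. f (y v x)) \<in> A" if "v \<in> pts V" "f \<in> A" for v f
  by (rule A.representsD(5)[OF rA[OF that(1)] that(2)])
 have sliceA: "(\<lambda>v\<in>pts V. f (y v x)) \<in> coord_ring V" if "f \<in> A" for f x
  by (rule A.action_slice[OF V m _ that]) (rule yA)
 show "(\<lambda>(v, p). \<rho>' v p) (v, R.ev x) = R.ev (y v x)" if "v \<in> pts V" for v x
  using R.representsD(2)[OF rR[OF that]] by simp
 show pullR: "(\<lambda>x. f (y v x)) \<in> R" if "v \<in> pts V" "f \<in> R" for v f
  by (rule R.representsD(5)[OF rR[OF that(1)] that(2)])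
 show "(\<lambda>v\<in>pts V. f (y v x)) \<in> coord_ring V" if f: "f \<in> R" for f x
 proof (cases "R.ev x = R.ev 0")
  case True
  \<comment> \<open>The automorphisms fix the origin, so the slice through it is constant.\<close>
  have "f (y v x) = f 0" if v: "v \<in> pts V" for v
  proof -
   have "R.ev (y v x) = R.ev (y v 0)" by (rule R.ev_cong[of "y v", OF _ True]) (rule pullR[OF v])
   also have "\<dots> = R.ev 0" by (rule R.Aut_fixes_origin[OF refl d2 n rR[OF v]])
   finally show ?thesis unfolding R.ev_eq_iff using f by (rule bspec)
  qed
  hence "(\<lambda>v\<in>pts V. f (y v x)) = (\<lambda>v\<in>pts V. f 0)" by (auto simp: restrict_def)
  thus ?thesis using subalg_const[OF fun_space_subalg[OF V openin_topspace], of "f 0"] by simp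
 next
  case False
  show ?thesis
  proof (rule fun_space_local[OF V])
   fix v0 assume v0: "v0 \<in> pts V"
   have "y v0 x ~= 0"
   proof
    assume "y v0 x = 0"
    hence "R.ev (y v0 x) = R.ev (y v0 0)" using R.Aut_fixes_origin[OF refl d2 n rR[OF v0]] by simp
    hence "R.ev (y' v0 (y v0 x)) = R.ev (y' v0 (y v0 0))"
     by (rule R.ev_cong[of "y' v0", rotated]) (rule R.representsD(6)[OF rR[OF v0]])
    thus False using False R.representsD(4)[OF rR[OF v0]] by simp
   qed
   then obtain j where j: "y v0 x $ j ~= 0" by (auto simp: vec_eq_iff)
   define b where "b = (\<lambda>v\<in>pts V. y v x $ j ^ (Suc s * d))"
   define a where "a = (\<lambda>v\<in>pts V. f (y v x) * y v x $ j ^ (Suc s * d))"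
   have aV: "a \<in> coord_ring V" unfolding a_def by (rule sliceA[OF mult_power_A[OF f]])
   have bV: "b \<in> coord_ring V" unfolding b_def by (rule sliceA[OF power_A])
   define N where "N = {v \<in> pts V. b v ~= 0}"
   have oN: "openin (ftop V) N" unfolding N_def by (rule fun_space_nonzero[OF V bV])
   have NV: "N \<subseteq> pts V" by (auto simp: N_def)
   have "(\<lambda>v\<in>N. restrict a N v / restrict b N v) \<in> freg V N"
    by (rule fun_space_divide[OF V fun_space_restrict[OF V aV oN NV] fun_space_restrict[OF V bV oN NV]]) (simp add: N_def)
   moreover have "(\<lambda>v\<in>N. restrict a N v / restrict b N v) = restrict (\<lambda>v\<in>pts V. f (y v x)) N"
    by (rule extensionalityI[of _ N]) (auto simp: N_def a_def b_def)
   ultimately have "restrict (\<lambda>v\<in>pts V. f (y v x)) N \<in> freg V N" by simp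
   moreover have "v0 \<in> N" using v0 j by (simp add: N_def b_def)
   ultimately show "\<exists>N. v0 \<in> N \<and> N \<subseteq> pts V \<and> restrict (\<lambda>v\<in>pts V. f (y v x)) N \<in> freg V N"
    using NV by (intro exI conjI)
  qed simp
 qed
 show "\<exists>V0 D. openin (ftop V) V0 \<and> v0 \<in> V0 \<and> (\<forall>v\<in>V0. degree_le (\<lambda>x. f (y v x)) D)"
  if f: "f \<in> R" and v0: "v0 \<in> pts V" for f v0
 proof -
  define j :: 'n where "j = undefined"
  obtain V0 D where V0: "openin (ftop V) V0" "v0 \<in> V0"
   "!!v. v \<in> V0 ==> degree_le (\<lambda>x. f (y v x) * y v x $ j ^ (Suc s * d)) D"
   by (rule A.action_degree_bounded[OF V m yA pullA mult_power_A[OF f, of j] v0]) blast+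
  have "degree_le (\<lambda>x. f (y v x)) D" if v: "v \<in> V0" for v
  proof -
   have vV: "v \<in> pts V" using openin_subset[OF V0(1)] v by blast
   \<comment> \<open>The factor pulled back from \<open>A\<close> is not the zero polynomial: it is
     1 at a representative sent to the class of the vector of ones.\<close>
   have "A.ev (y v (y' v (vec 1))) = A.ev (vec 1)" by (rule A.representsD(3)[OF rA[OF vV]])
   hence "y v (y' v (vec 1)) $ j ^ (Suc s * d) = (vec 1 :: 'k ^ 'n) $ j ^ (Suc s * d)"
    unfolding A.ev_eq_iff using power_A by (rule bspec)
   hence nz: "y v (y' v (vec 1)) $ j ^ (Suc s * d) ~= 0" by simp
   show ?thesis
    by (rule degree_le_factor[OF R.polys[OF pullR[OF vV f]] A.polys[OF pullA[OF vV power_A]] nz])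
     (use V0(3)[OF v] in "simp only: mult.commute")
  qed
  thus ?thesis using V0 by blast
 qed
qed

end

lemma lift_aut_preserves:
 assumes d2: "2 \<le> d" and n: "2 \<le> CARD('n)"
 shows "iso_preserves_alg_subgroups A.Z R.Z \<theta>"
proof -
 note iso = lift_aut_iso[OF d2 n]
 define \<theta>' where "\<theta>' = inv_into (carrier (Aut A.Z)) \<theta>"
 have bij: "bij_betw \<theta> (carrier (Aut A.Z)) (carrier (Aut R.Z))" using iso by (simp add: iso_def)
 have iso': "\<theta>' \<in> iso (Aut R.Z) (Aut A.Z)"
  unfolding \<theta>'_def by (rule group.iso_set_sym[OF A.group_Aut iso])
 have 1: "\<exists>W. alg_subgroup_of_Aut R.Z (\<theta> ` H) W \<and> morph V W \<theta>" if H: "alg_subgroup_of_Aut A.Z H V" for H V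
 proof -
  have m: "morph (fprod V A.Z) A.Z (\<lambda>(v, p). v p)" and V: "fun_space V" and pV: "pts V = H" and HA: "H \<subseteq> carrier (Aut A.Z)"
   using H subgroup.subset by (auto simp: alg_subgroup_of_Aut_def algebraic_group_def variety_def)
  have "\<forall>v\<in>H. \<exists>y y'. A.represents y y' v" using HA A.Aut_represented by blast
  then obtain y y' where yy: "!!v. v \<in> H ==> A.represents (y v) (y' v) v" by metis
  have "morph (fprod V R.Z) R.Z (\<lambda>(v, p). \<theta> v p)"
   by (rule action_lifts[OF V _ _ m d2 n, of y y']) (use yy lift_aut_represents pV in auto)
  thus ?thesis
   using alg_subgroup_transport[OF A.group_Aut R.group_Aut iso R.fun_space_A_var H] by blast
 qed
 have 2: "\<exists>W. alg_subgroup_of_Aut A.Z (\<theta>' ` H) W \<and> morph V W \<theta>'" if H: "alg_subgroup_of_Aut R.Z H V" for H V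
 proof -
  have m: "morph (fprod V R.Z) R.Z (\<lambda>(v, p). v p)" and V: "fun_space V" and pV: "pts V = H" and HR: "H \<subseteq> carrier (Aut R.Z)"
   using H subgroup.subset by (auto simp: alg_subgroup_of_Aut_def algebraic_group_def variety_def)
  have th: "\<theta>' v \<in> carrier (Aut A.Z)" "\<theta> (\<theta>' v) = v" if "v \<in> H" for v
   using bij_betw_inv_into_right[OF bij] bij_betw_apply[OF bij_betw_inv_into[OF bij]] HR that by (auto simp: \<theta>'_def)
  have "\<forall>v\<in>H. \<exists>y y'. A.represents y y' (\<theta>' v)" using th(1) A.Aut_represented by blast
  then obtain y y' where yy: "!!v. v \<in> H ==> A.represents (y v) (y' v) (\<theta>' v)" by metis
  have "R.represents (y v) (y' v) v" if "v \<in> H" for v using lift_aut_represents[OF yy[OF that]] th(2)[OF that] by simp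
  hence "morph (fprod V A.Z) A.Z (\<lambda>(v, p). \<theta>' v p)"
   by (intro action_descends[OF V _ _ m, of y y']) (use yy pV in auto)
  thus ?thesis
   using alg_subgroup_transport[OF R.group_Aut A.group_Aut iso' A.fun_space_A_var H] by blast
 qed
 show ?thesis
  unfolding iso_preserves_alg_subgroups_def hom_preserves_alg_subgroups_def
  using iso iso' 1 2 by (auto simp: iso_def \<theta>'_def)
qed

end

section \<open>The special linear group\<close>

abbreviation SL :: "('k::field ^ 'n::finite ^ 'n) set" where
 "SL \<equiv> {M. det M = 1}"

definition SL_ring :: "('k::field ^ 'n::finite ^ 'n => 'k) set" where
 "SL_ring = alg_generated SL {\<lambda>M\<in>SL. M $ i $ j |i j. True}"

lemma subalg_SL_ring: "subalg SL (SL_ring :: ('k::field ^ 'n::finite ^ 'n => 'k) set)"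
 unfolding SL_ring_def by (rule subalg_alg_generated) auto

lemma SL_space_eq: "SL_space = frac_space {(SL, SL_ring :: ('k::field ^ 'n::finite ^ 'n => 'k) set)}"
 by (simp add: SL_space_def SL_ring_def)

lemma fun_space_SL: "fun_space (SL_space :: ('k::field ^ 'n::finite ^ 'n, 'k) fspace)"
 unfolding SL_space_eq by (rule fun_space_frac_space[OF frac_base_single[OF subalg_SL_ring]])

lemma pts_SL: "pts (SL_space :: ('k::field ^ 'n::finite ^ 'n, 'k) fspace) = SL"
 unfolding SL_space_eq using pts_frac_space[OF frac_base_single[OF subalg_SL_ring]] by simp

lemma SL_ring_subset: "SL_ring \<subseteq> coord_ring (SL_space :: ('k::field ^ 'n::finite ^ 'n, 'k) fspace)"
 unfolding pts_SL unfolding SL_space_eq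
 using freg_frac_space_incl[OF frac_base_single[OF subalg_SL_ring]] by blast

lemma subalg_coord_SL: "subalg SL (coord_ring (SL_space :: ('k::field ^ 'n::finite ^ 'n, 'k) fspace))"
 using fun_space_subalg[OF fun_space_SL openin_topspace] by (simp add: pts_SL)

lemma coord_SL_entry: "(\<lambda>M\<in>SL. M $ i $ j) \<in> coord_ring (SL_space :: ('k::field ^ 'n::finite ^ 'n, 'k) fspace)"
 by (rule subsetD[OF SL_ring_subset]) (auto simp: SL_ring_def intro!: subsetD[OF alg_generated_incl])

lemma morph_into_SL:
 fixes X :: "('p, 'k::field) fspace" and \<phi> :: "'p => 'k ^ 'n::finite ^ 'n"
 assumes X: "fun_space X" and fs: "!!x. x \<in> pts X ==> \<phi> x \<in> SL"
  and reg: "!!i j. (\<lambda>x\<in>pts X. \<phi> x $ i $ j) \<in> coord_ring X"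
 shows "morph X SL_space \<phi>"
 unfolding SL_space_def
proof (rule morph_into_alg_generated[OF X _ fs])
 fix f :: "'k ^ 'n ^ 'n => 'k" assume "f \<in> {\<lambda>M\<in>SL. M $ i $ j |i j. True}"
 then obtain i j where f: "f = (\<lambda>M\<in>SL. M $ i $ j)" by auto
 have "(\<lambda>x\<in>pts X. f (\<phi> x)) = (\<lambda>x\<in>pts X. \<phi> x $ i $ j)" unfolding f using fs by (intro restrict_ext) simp
 thus "(\<lambda>x\<in>pts X. f (\<phi> x)) \<in> coord_ring X" using reg by simp
qed auto

lemma subalg_matrix_mult:
 fixes N N' :: "'p => 'k::field ^ 'n::finite ^ 'n"
 assumes S: "subalg P A" and N: "!!i j. (\<lambda>x\<in>P. N x $ i $ j) \<in> A" and N': "!!i j. (\<lambda>x\<in>P. N' x $ i $ j) \<in> A"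
 shows "(\<lambda>x\<in>P. (N x ** N' x) $ i $ j) \<in> A"
proof -
 have "(\<lambda>x\<in>P. \<Sum>k\<in>UNIV. (\<lambda>x\<in>P. (\<lambda>x\<in>P. N x $ i $ k) x * (\<lambda>x\<in>P. N' x $ k $ j) x) x) \<in> A"
  by (intro subalg_sum[OF S] subalg_mult[OF S] N N')
 also have "(\<lambda>x\<in>P. \<Sum>k\<in>UNIV. (\<lambda>x\<in>P. (\<lambda>x\<in>P. N x $ i $ k) x * (\<lambda>x\<in>P. N' x $ k $ j) x) x)
   = (\<lambda>x\<in>P. (N x ** N' x) $ i $ j)" by (intro restrict_ext) (simp add: matrix_matrix_mult_def)
 finally show ?thesis .
qed

lemma subalg_matrix_vector_mult:
 fixes N :: "'p => 'k::field ^ 'n::finite ^ 'n"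
 assumes S: "subalg P A" and N: "!!i j. (\<lambda>x\<in>P. N x $ i $ j) \<in> A"
 shows "(\<lambda>x\<in>P. (N x *v v) $ i) \<in> A"
proof -
 have "(\<lambda>x\<in>P. \<Sum>k\<in>UNIV. (\<lambda>x\<in>P. (\<lambda>x\<in>P. N x $ i $ k) x * (\<lambda>x\<in>P. v $ k) x) x) \<in> A"
  by (intro subalg_sum[OF S] subalg_mult[OF S] N subalg_const[OF S])
 also have "(\<lambda>x\<in>P. \<Sum>k\<in>UNIV. (\<lambda>x\<in>P. (\<lambda>x\<in>P. N x $ i $ k) x * (\<lambda>x\<in>P. v $ k) x) x)
   = (\<lambda>x\<in>P. (N x *v v) $ i)" by (intro restrict_ext) (simp add: matrix_vector_mult_def)
 finally show ?thesis .
qed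

lemma subalg_det:
 fixes N :: "'p => 'k::field ^ 'n::finite ^ 'n"
 assumes S: "subalg P A" and N: "!!i j. (\<lambda>x\<in>P. N x $ i $ j) \<in> A"
 shows "(\<lambda>x\<in>P. det (N x)) \<in> A"
proof -
 have "(\<lambda>x\<in>P. \<Sum>p\<in>{p. p permutes UNIV}. (\<lambda>x\<in>P. (\<lambda>x\<in>P. of_int (sign p)) x * (\<lambda>x\<in>P. \<Prod>i\<in>UNIV. (\<lambda>x\<in>P. N x $ i $ p i) x) x) x) \<in> A"
  by (intro subalg_sum[OF S] subalg_mult[OF S] subalg_const[OF S] subalg_prod[OF S] N)
 also have "(\<lambda>x\<in>P. \<Sum>p\<in>{p. p permutes UNIV}. (\<lambda>x\<in>P. (\<lambda>x\<in>P. of_int (sign p)) x * (\<lambda>x\<in>P. \<Prod>i\<in>UNIV. (\<lambda>x\<in>P. N x $ i $ p i) x) x) x)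
   = (\<lambda>x\<in>P. det (N x))" by (intro restrict_ext) (simp add: det_def)
 finally show ?thesis .
qed

lemma matrix_right_inverse_of_left: "A ** B = mat 1 ==> B ** A = mat 1" for A B :: "'k::field ^ 'n::finite ^ 'n"
 using matrix_left_right_inverse by blast

lemma group_SL: "group (SL_grp :: ('k::field ^ 'n::finite ^ 'n) monoid)"
proof (rule groupI)
 fix M :: "'k ^ 'n ^ 'n" assume M: "M \<in> carrier SL_grp"
 hence "invertible M" by (simp add: SL_grp_def invertible_det_nz)
 then obtain N where N: "N ** M = mat 1" unfolding invertible_def by blast
 have "det N * det M = 1" unfolding det_mul[symmetric] N by simp
 hence "N \<in> carrier SL_grp" using M by (simp add: SL_grp_def)
 thus "\<exists>N\<in>carrier SL_grp. N \<otimes>\<^bsub>SL_grp\<^esub> M = \<one>\<^bsub>SL_grp\<^esub>" using N by (auto simp: SL_grp_def)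
qed (auto simp: SL_grp_def det_mul matrix_mul_assoc)

abbreviation SL_inv :: "'k::field ^ 'n::finite ^ 'n => 'k ^ 'n ^ 'n" where
 "SL_inv M \<equiv> inv\<^bsub>SL_grp\<^esub> M"

lemma SL_inv: "det M = 1 ==> det (SL_inv M) = 1" "det M = 1 ==> M ** SL_inv M = mat 1" "det M = 1 ==> SL_inv M ** M = mat 1"
 for M :: "'k::field ^ 'n::finite ^ 'n"
 using group.inv_closed[OF group_SL, of M] group.r_inv[OF group_SL, of M] group.l_inv[OF group_SL, of M]
 by (simp_all add: SL_grp_def)

lemma SL_inv_apply [simp]: "det M = 1 ==> M *v (SL_inv M *v x) = x" "det M = 1 ==> SL_inv M *v (M *v x) = x"
 for M :: "'k::field ^ 'n::finite ^ 'n"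
 by (simp_all add: matrix_vector_mul_assoc SL_inv)

lemma SL_grp_simps [simp]: "carrier SL_grp = SL" "A \<otimes>\<^bsub>SL_grp\<^esub> B = A ** B" "\<one>\<^bsub>SL_grp\<^esub> = mat 1"
 by (simp_all add: SL_grp_def)

lemma SL_subgroup:
 fixes G :: "('k::field ^ 'n::finite ^ 'n) set"
 assumes "subgroup G SL_grp"
 shows "M \<in> G ==> det M = 1" "M \<in> G ==> N \<in> G ==> M ** N \<in> G" "mat 1 \<in> G" "M \<in> G ==> SL_inv M \<in> G"
 using subgroup.subset[OF assms] subgroup.m_closed[OF assms, of M N] subgroup.one_closed[OF assms] subgroup.m_inv_closed[OF assms, of M]
 by auto

text \<open>By Cramer's rule and \<open>det M = 1\<close>, the entry is the determinant of
  \<open>M\<close> with one column replaced by a unit vector.\<close>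

lemma coord_SL_inv_entry: "(\<lambda>M\<in>SL. SL_inv M $ i $ j) \<in> coord_ring (SL_space :: ('k::field ^ 'n::finite ^ 'n, 'k) fspace)"
proof -
 let ?N = "\<lambda>M::'k ^ 'n ^ 'n. \<chi> a b. if b = i then (axis j 1 :: 'k ^ 'n) $ a else M $ a $ b"
 have "(\<lambda>M\<in>SL. ?N M $ a $ b) \<in> coord_ring (SL_space :: ('k ^ 'n ^ 'n, 'k) fspace)" for a b
  by (cases "b = i") (simp_all add: subalg_const[OF subalg_coord_SL] coord_SL_entry)
 hence "(\<lambda>M\<in>SL. det (?N M)) \<in> coord_ring (SL_space :: ('k ^ 'n ^ 'n, 'k) fspace)"
  by (rule subalg_det[OF subalg_coord_SL])
 also have "(\<lambda>M\<in>SL. det (?N M)) = (\<lambda>M\<in>SL. SL_inv M $ i $ j)"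
 proof (rule restrict_ext)
  fix M :: "'k ^ 'n ^ 'n" assume "M \<in> SL"
  hence M: "det M = 1" by simp
  have "M *v (SL_inv M *v axis j 1) = axis j 1" using M by simp
  hence e: "SL_inv M *v axis j 1 = (\<chi> k. det (\<chi> a b. if b = k then (axis j 1 :: 'k ^ 'n) $ a else M $ a $ b) / det M)"
   using cramer[of M "SL_inv M *v axis j 1" "axis j 1"] M by simp
  have "(SL_inv M *v axis j 1) $ i = SL_inv M $ i $ j"
   by (simp add: matrix_vector_mult_def axis_def)
  thus "det (?N M) = SL_inv M $ i $ j" unfolding e using M by simp
 qed
 finally show ?thesis .
qed

lemma morph_SL_I:
 fixes \<phi> :: "'k::field ^ 'n::finite ^ 'n => 'k ^ 'n ^ 'n"
 assumes "!!x. det x = 1 ==> det (\<phi> x) = 1" "!!i j. (\<lambda>x\<in>SL. \<phi> x $ i $ j) \<in> coord_ring SL_space"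
 shows "continuous_map (ftop SL_space) (ftop SL_space) \<phi>"
proof -
 have "morph SL_space SL_space \<phi>" by (rule morph_into_SL[OF fun_space_SL]) (use assms in "simp_all add: pts_SL")
 thus ?thesis by (simp add: morph_def)
qed

lemmas coord_SL_intros = subalg_matrix_mult[OF subalg_coord_SL] coord_SL_entry coord_SL_inv_entry subalg_const[OF subalg_coord_SL]

section \<open>Closed and connected subsets of the special linear group\<close>

lemma closedin_SL_zero:
 fixes f :: "'k::field ^ 'n::finite ^ 'n => 'k"
 assumes f: "(\<lambda>M\<in>SL. f M) \<in> coord_ring SL_space"
 shows "closedin (ftop SL_space) {M \<in> SL. f M = 0}"
proof -
 have "openin (ftop SL_space) {M \<in> SL. (\<lambda>M\<in>SL. f M) M ~= 0}"
  using fun_space_nonzero[OF fun_space_SL f] by (simp add: pts_SL)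
 moreover have "{M \<in> SL. (\<lambda>M\<in>SL. f M) M ~= 0} = pts SL_space - {M \<in> SL. f M = 0}" by (auto simp: pts_SL)
 ultimately show ?thesis unfolding closedin_def by (auto simp: pts_SL)
qed

text \<open>The other members of the cover have a closed union, by finiteness, so the part in
  \<open>C m\<close> is both open and closed. The members will be indexed by eigenvalues.\<close>

lemma connectedin_cases:
 assumes G: "connectedin X G" and L: "finite L" and cl: "!!l. l \<in> L ==> closedin X (C l)"
  and cover: "!!x. x \<in> G ==> \<exists>l\<in>L. x \<in> C l"
  and disj: "!!l l' x. x \<in> G ==> x \<in> C l ==> x \<in> C l' ==> l = l'" and x0: "x0 \<in> G" "x0 \<in> C m" "m \<in> L" and x: "x \<in> G"
 shows "x \<in> C m"
proof (rule ccontr)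
 assume nx: "x \<notin> C m"
 have c1: "closedin X (C m)" by (rule cl[OF x0(3)])
 have c2: "closedin X (\<Union>(C ` (L - {m})))" using L cl by (intro closedin_Union) auto
 have "G \<subseteq> C m \<union> \<Union>(C ` (L - {m}))"
 proof
  fix y assume "y \<in> G"
  then obtain l where "l \<in> L" "y \<in> C l" using cover by blast
  thus "y \<in> C m \<union> \<Union>(C ` (L - {m}))" by (cases "l = m") auto
 qed
 moreover have "C m \<inter> \<Union>(C ` (L - {m})) \<inter> G = {}" using disj[of _ m] by blast
 moreover have "C m \<inter> G ~= {}" using x0 by blast
 moreover have "\<Union>(C ` (L - {m})) \<inter> G ~= {}" using cover[OF x] x nx by blast
 ultimately show False using G c1 c2 unfolding connectedin_closedin by blast
qed

text \<open>Every element of the derived group lies in a connected subset that contains 1. Only maps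
  in one matrix variable have to be continuous: commutators with a fixed \<open>g\<close>, and
  translations.\<close>

lemma connectedin_derived:
 fixes G :: "('k::field ^ 'n::finite ^ 'n) set"
 assumes G: "subgroup G SL_grp" and conn: "connectedin (ftop SL_space) G"
 shows "connectedin (ftop SL_space) (derived SL_grp G)"
proof -
 interpret SL: group "SL_grp :: ('k ^ 'n ^ 'n) monoid" by (rule group_SL)
 let ?T = "ftop (SL_space :: ('k ^ 'n ^ 'n, 'k) fspace)" and ?D = "derived SL_grp G"
 have D: "subgroup ?D SL_grp" by (rule SL.derived_is_subgroup[OF subgroup.subset[OF G]])
 note Dsub = SL_subgroup[OF D] and Gsub = SL_subgroup[OF G]
 define \<U> where "\<U> = {S. connectedin ?T S \<and> mat 1 \<in> S \<and> S \<subseteq> ?D}"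
 have comm: "\<exists>S\<in>\<U>. g ** h ** SL_inv g ** SL_inv h \<in> S" if gh: "g \<in> G" "h \<in> G" for g h
 proof -
  let ?c = "\<lambda>h. g ** h ** SL_inv g ** SL_inv h"
  have g: "det g = 1" by (rule Gsub(1)[OF gh(1)])
  have "continuous_map ?T ?T ?c"
   by (rule morph_SL_I) (simp add: det_mul g SL_inv, intro coord_SL_intros)
  from connectedin_continuous_map_image[OF this conn] have "connectedin ?T (?c ` G)" .
  moreover have "?c ` G \<subseteq> ?D"
   unfolding derived_def using gh(1) by (auto intro!: generate.incl)
  moreover have "mat 1 \<in> ?c ` G"
   using SL.inv_one by (intro image_eqI[of _ _ "mat 1"] Gsub(3)) (simp add: SL_inv(2)[OF g])
  ultimately show ?thesis using gh by (intro bexI[of _ "?c ` G"]) (auto simp: \<U>_def)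
 qed
 have piece: "\<exists>S\<in>\<U>. M \<in> S" if "M \<in> generate SL_grp (derived_set SL_grp G)" for M
  using that
 proof (induction rule: generate.induct)
  case one
  show ?case by (intro bexI[of _ "{mat 1}"]) (use Dsub in "auto simp: \<U>_def connectedin_sing pts_SL")
 next
  case (incl M)
  thus ?case using comm by auto
 next
  case (inv M)
  then obtain g h where gh: "g \<in> G" "h \<in> G" "M = g ** h ** SL_inv g ** SL_inv h" by auto
  have g: "det g = 1" and h: "det h = 1" using gh Gsub(1) by auto
  have "SL_inv M = h ** g ** SL_inv h ** SL_inv g"
   using SL.inv_mult_group[of "g ** h ** SL_inv g" "SL_inv h"] SL.inv_mult_group[of "g ** h" "SL_inv g"] SL.inv_mult_group[of g h]
    SL.inv_inv[of g] SL.inv_inv[of h]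
   by (simp add: gh(3) g h SL_inv det_mul matrix_mul_assoc)
  thus ?case using comm[OF gh(2,1)] by simp
 next
  \<comment> \<open>The translate of \<open>S\<close> by \<open>N\<close> contains \<open>N\<close>,
    since \<open>S\<close> contains 1; there it meets \<open>S'\<close>, which contains 1.\<close>
  case (eng M N)
  then obtain S S' where S: "S \<in> \<U>" "M \<in> S" and S': "S' \<in> \<U>" "N \<in> S'" by blast
  have ND: "N \<in> ?D" using S' by (auto simp: \<U>_def)
  have N: "det N = 1" by (rule Dsub(1)[OF ND])
  have "continuous_map ?T ?T (\<lambda>M. M ** N)"
   by (rule morph_SL_I) (simp add: det_mul N, intro coord_SL_intros)
  hence "connectedin ?T ((\<lambda>M. M ** N) ` S)" using S(1) by (intro connectedin_continuous_map_image) (auto simp: \<U>_def)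
  moreover have N1: "N \<in> (\<lambda>M. M ** N) ` S" using S(1) by (intro image_eqI[of _ _ "mat 1"]) (auto simp: \<U>_def)
  ultimately have "connectedin ?T (S' \<union> (\<lambda>M. M ** N) ` S)"
  proof (intro connectedin_Un)
   show "connectedin ?T S'" using S'(1) by (simp add: \<U>_def)
   show "S' \<inter> (\<lambda>M. M ** N) ` S ~= {}" using S'(2) N1 by blast
  qed
  moreover have "(\<lambda>M. M ** N) ` S \<subseteq> ?D" using S(1) Dsub(2)[OF _ ND] by (auto simp: \<U>_def)
  ultimately show ?case using S S' by (intro bexI[of _ "S' \<union> (\<lambda>M. M ** N) ` S"]) (auto simp: \<U>_def)
 qed
 have "\<Union>\<U> = ?D" using piece by (auto simp: \<U>_def derived_def)
 moreover have "connectedin ?T (\<Union>\<U>)" by (rule connectedin_Union) (auto simp: \<U>_def)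
 ultimately show ?thesis by simp
qed

section \<open>The Lie-Kolchin theorem\<close>

lemma det_poly:
 fixes A B :: "'k::field_char_0 ^ 'n::finite ^ 'n"
 shows "\<exists>p. \<forall>t. poly p t = det (\<chi> i j. A $ i $ j + t * B $ i $ j)"
proof (intro exI allI)
 show "poly (\<Sum>p\<in>{p. p permutes UNIV}. of_int (sign p) * (\<Prod>i\<in>UNIV. [:A $ i $ p i, B $ i $ p i:])) t
   = det (\<chi> i j. A $ i $ j + t * B $ i $ j)" for t
  by (simp add: det_def poly_sum poly_prod)
qed

lemma matrix_vector_diff: "(A - B) *v x = A *v x - B *v x" for A B :: "'k::field ^ 'n::finite ^ 'm::finite"
 by (simp add: vec_eq_iff matrix_vector_mult_def sum_subtractf algebra_simps)

text \<open>The injective map \<open>M\<close> sends \<open>U\<close> into itself, so by dimension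
  onto itself.\<close>

lemma subspace_stable_inverse:
 fixes M N :: "'k::field ^ 'n::finite ^ 'n"
 assumes U: "vec.subspace U" and stab: "!!x. x \<in> U ==> M *v x \<in> U" and NM: "N ** M = mat 1" and x: "M *v x \<in> U"
 shows "x \<in> U"
proof -
 have inj: "inj ((*v) M)" by (rule inj_on_inverseI[of _ "(*v) N"]) (simp add: matrix_vector_mul_assoc NM)
 have d: "vec.dim ((*v) M ` U) = vec.dim U"
  by (rule vec.dim_image_eq[OF matrix_vector_mul_linear_gen]) (use inj in "auto intro: inj_on_subset")
 have "vec.subspace ((*v) M ` U)" by (rule vec.subspace_image[OF U])
 hence "(*v) M ` U = U" using U stab d by (intro vec.subspace_dim_equal) auto
 hence "M *v x \<in> (*v) M ` U" using x by simp
 thus ?thesis using inj by (auto dest: injD)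
qed

text \<open>Membership in \<open>U\<close> becomes a system of linear equations, so conditions
  modulo \<open>U\<close> on matrices define closed sets.\<close>

lemma exists_kernel_matrix:
 fixes U :: "('k::field ^ 'n::finite) set"
 assumes U: "vec.subspace U"
 shows "\<exists>Q :: 'k ^ 'n ^ 'n. \<forall>x. Q *v x = 0 \<longleftrightarrow> x \<in> U"
proof -
 obtain B where B: "B \<subseteq> U" "vec.independent B" "U \<subseteq> vec.span B" using vec.basis_exists by metis
 obtain C where C: "B \<subseteq> C" "vec.independent C" "vec.span C = UNIV"
  using vec.extend_basis_superset[OF B(2)] vec.independent_extend_basis[OF B(2)] vec.span_extend_basis[OF B(2)] by blast
 obtain f where f: "Vector_Spaces.linear (*s) (*s) f" "\<forall>x\<in>C. f x = (if x \<in> B then 0 else x)"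
  using vec.linear_independent_extend[OF C(2), of "\<lambda>x. if x \<in> B then 0 else x"] by (elim exE conjE)
 have fin: "finite C" by (rule vec.finiteI_independent[OF C(2)])
 have lin: "f (\<Sum>c\<in>C. u c *s c) = (\<Sum>c\<in>C. u c *s f c)" for u
  using f(1) by (simp add: vec.linear_sum vec.linear_scale)
 have UB: "U = vec.span B" using B vec.span_minimal[OF B(1) U] by blast
 have "f x = 0 \<longleftrightarrow> x \<in> U" for x
 proof
  assume "x \<in> U"
  hence "x \<in> vec.span B" by (simp add: UB)
  thus "f x = 0"
   by (rule vec.linear_eq_0_on_span[OF f(1), rotated]) (use f(2) C(1) in auto)
 next
  assume f0: "f x = 0"
  have "x \<in> vec.span C" using C(3) by simp
  then obtain u where u: "x = (\<Sum>c\<in>C. u c *s c)" unfolding vec.span_finite[OF fin] by auto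
  have "(\<Sum>c\<in>C. (if c \<in> B then 0 else u c) *s c) = f x"
   unfolding u lin using f(2) by (intro sum.cong) auto
  hence "(\<Sum>c\<in>C. (if c \<in> B then 0 else u c) *s c) = 0" using f0 by simp
  hence z: "(if c \<in> B then 0 else u c) = 0" if "c \<in> C" for c
   by (rule vec.independentD[OF C(2) fin subset_refl _ that, of "\<lambda>c. if c \<in> B then 0 else u c"])
  have "u c *s c = 0" if "c \<in> C" "c \<notin> B" for c using z[OF that(1)] that(2) by simp
  hence "x = (\<Sum>c\<in>B. u c *s c)"
   unfolding u using C(1) fin by (intro sum.mono_neutral_right) blast+
  thus "x \<in> U" unfolding UB by (auto intro: vec.span_sum vec.span_scale vec.span_base)
 qed
 thus ?thesis using matrix_works[OF f(1)] by (intro exI[of _ "matrix f"]) simp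
qed

text \<open>For an eigenvalue \<open>l \<noteq> 0\<close> modulo \<open>U\<close>, the matrix
  \<open>1 - M / l\<close> sends a vector outside \<open>U\<close> into \<open>U\<close> and
  stabilizes \<open>U\<close>, so it is singular. Its determinant is a polynomial in
  \<open>1 / l\<close> with value 1 at 0.\<close>

lemma finite_eigenvalues:
 fixes M :: "'k::field_char_0 ^ 'n::finite ^ 'n"
 assumes U: "vec.subspace U" and stab: "!!x. x \<in> U ==> M *v x \<in> U"
 shows "finite {l. \<exists>x. x \<notin> U \<and> M *v x - l *s x \<in> U}"
proof -
 obtain p where p: "!!t. poly p t = det (\<chi> i j. (mat 1 :: 'k ^ 'n ^ 'n) $ i $ j + t * (- M) $ i $ j)"
  using det_poly[of "mat 1" "- M"] by blast
 have "poly p 0 = 1" by (simp add: p)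
 hence "p ~= 0" by auto
 hence fin: "finite {t. poly p t = 0}" by (rule poly_roots_finite)
 have "{l. \<exists>x. x \<notin> U \<and> M *v x - l *s x \<in> U} \<subseteq> insert 0 (inverse ` {t. poly p t = 0})"
 proof
  fix l assume "l \<in> {l. \<exists>x. x \<notin> U \<and> M *v x - l *s x \<in> U}"
  then obtain x where x: "x \<notin> U" "M *v x - l *s x \<in> U" by blast
  show "l \<in> insert 0 (inverse ` {t. poly p t = 0})"
  proof (cases "l = 0")
   case False
   define N where "N = (\<chi> i j. (mat 1 :: 'k ^ 'n ^ 'n) $ i $ j + inverse l * (- M) $ i $ j)"
   have N: "N *v y = y - inverse l *s (M *v y)" for y
   proof -
    have "N = mat 1 - (\<chi> i j. inverse l * M $ i $ j)" by (simp add: N_def vec_eq_iff)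
    moreover have "(\<chi> i j. inverse l * M $ i $ j) *v y = inverse l *s (M *v y)"
     by (simp add: vec_eq_iff matrix_vector_mult_def sum_distrib_left mult.assoc)
    ultimately show ?thesis by (simp add: matrix_vector_diff)
   qed
   have "det N = 0"
   proof (rule ccontr)
    assume "det N ~= 0"
    then obtain N' where N': "N' ** N = mat 1" using invertible_det_nz[of N] unfolding invertible_def by blast
    have "N *v x = (- inverse l) *s (M *v x - l *s x)" using False
     by (simp add: N vec_eq_iff algebra_simps)
    hence "N *v x \<in> U" using vec.subspace_scale[OF U x(2), of "- inverse l"] by (simp only:)
    hence "x \<in> U"
     by (intro subspace_stable_inverse[OF U _ N', of x])
      (use U stab in "auto simp: N intro!: vec.subspace_diff vec.subspace_scale")
    thus False using x(1) by simp
   qed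
   hence "poly p (inverse l) = 0" by (simp add: p N_def)
   thus ?thesis by (intro insertI2 image_eqI[of _ _ "inverse l"]) simp_all
  qed simp
 qed
 thus ?thesis using fin by (meson finite_imageI finite_insert finite_subset)
qed

text \<open>
 A nonzero polynomial \<open>p\<close> of least degree with \<open>p(M) w \<in> U\<close> is divided by \<open>X - l\<close> for a root \<open>l\<close>;
 the quotient, applied to \<open>w\<close>, is the eigenvector.
\<close>

lemma exists_eigenvector:
 fixes M :: "'k::{alg_closed_field, field_char_0} ^ 'n::finite ^ 'n"
 assumes U: "vec.subspace U" and W: "vec.subspace W" and UW: "U \<subset> W"
  and stab: "!!x. x \<in> W ==> M *v x \<in> W"
 shows "\<exists>l. \<exists>x\<in>W - U. M *v x - l *s x \<in> U"
proof -
 obtain w where w: "w \<in> W" "w \<notin> U" using UW by blast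
 define P where "P i = ((*v) M ^^ i) w" for i
 have P0: "P 0 = w" and PS: "P (Suc i) = M *v P i" for i by (simp_all add: P_def)
 have PW: "P i \<in> W" for i by (induction i) (simp_all add: P0 PS w stab)
 define ap where "ap p = (\<Sum>i\<le>degree p. coeff p i *s P i)" for p
 have ap: "ap p = (\<Sum>i\<le>N. coeff p i *s P i)" if "degree p \<le> N" for p N
  unfolding ap_def using that by (intro sum.mono_neutral_left) (auto simp: coeff_eq_0)
 have apW: "ap p \<in> W" for p unfolding ap_def by (intro vec.subspace_sum[OF W] vec.subspace_scale[OF W] PW)
 have ap_mult: "ap ([:- l, 1:] * q) = M *v ap q - l *s ap q" for l q
 proof -
  have d: "degree ([:- l, 1:] * q) \<le> Suc (degree q)" using degree_mult_le[of "[:- l, 1:]" q] by simp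
  have "ap ([:- l, 1:] * q) = (\<Sum>i\<le>Suc (degree q). coeff (pCons 0 q) i *s P i) - (\<Sum>i\<le>Suc (degree q). (l * coeff q i) *s P i)"
   unfolding ap[OF d] by (simp add: sum_subtractf[symmetric] vec.scale_left_diff_distrib del: sum.atMost_Suc)
  moreover have "(\<Sum>i\<le>Suc (degree q). coeff (pCons 0 q) i *s P i) = M *v ap q"
   unfolding sum.atMost_Suc_shift ap_def
   by (simp add: PS vec.linear_sum[OF matrix_vector_mul_linear_gen] vector_scalar_commute)
  moreover have "(\<Sum>i\<le>Suc (degree q). (l * coeff q i) *s P i) = l *s ap q"
   unfolding ap[of q "Suc (degree q)", OF le_SucI[OF order_refl]] vec.scale_sum_right by simp
  ultimately show ?thesis by simp
 qed
 have "\<exists>c. (\<exists>i\<in>{..CARD('n)}. c i ~= 0) \<and> (\<Sum>i\<in>{..CARD('n)}. c i *s P i) = 0"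
  by (rule vec.family_dependent[of _ cart_basis]) (simp_all add: vec.span_Basis card_cart_basis finite_cart_basis)
 then obtain c where c: "\<exists>i\<in>{..CARD('n)}. c i ~= 0" "(\<Sum>i\<le>CARD('n). c i *s P i) = 0" by blast
 define p0 where "p0 = (\<Sum>i\<le>CARD('n). monom (c i) i)"
 have cp: "coeff p0 i = (if i \<le> CARD('n) then c i else 0)" for i
  by (simp add: p0_def coeff_sum sum.delta)
 have "p0 ~= 0" using c(1) cp by (metis atMost_iff coeff_0)
 moreover have "ap p0 = 0"
 proof -
  have "degree p0 \<le> CARD('n)" by (rule Polynomial.degree_le) (simp add: cp)
  hence "ap p0 = (\<Sum>i\<le>CARD('n). coeff p0 i *s P i)" by (rule ap)
  also have "\<dots> = (\<Sum>i\<le>CARD('n). c i *s P i)" by (intro sum.cong) (simp_all add: cp)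
  finally show ?thesis using c(2) by simp
 qed
 ultimately have "\<exists>p. p ~= 0 \<and> ap p \<in> U" using vec.subspace_0[OF U] by auto
 then obtain p where p: "p ~= 0" "ap p \<in> U" "!!q. q ~= 0 ==> ap q \<in> U ==> degree p \<le> degree q"
  using exists_least_iff[of "\<lambda>m. \<exists>p. p ~= 0 \<and> ap p \<in> U \<and> degree p = m"] by (metis not_le)
 have "degree p ~= 0"
 proof
  assume "degree p = 0"
  then obtain a where a: "p = [:a:]" by (rule degree_eq_zeroE)
  hence "a *s w \<in> U" "a ~= 0" using p by (auto simp: ap_def P0)
  hence "inverse a *s (a *s w) \<in> U" using vec.subspace_scale[OF U] by blast
  thus False using w \<open>a ~= 0\<close> by simp
 qed
 then obtain l where "poly p l = 0" using alg_closed_imp_poly_has_root[of p] by auto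
 then obtain q where q: "p = [:- l, 1:] * q" unfolding poly_eq_0_iff_dvd by (elim dvdE)
 have q0: "q ~= 0" using p(1) q by auto
 have "degree p = Suc (degree q)" unfolding q using q0 by (subst degree_mult_eq) auto
 hence "ap q \<notin> U" using p(3)[OF q0] by auto
 moreover have "M *v ap q - l *s ap q \<in> U" using p(2) unfolding q ap_mult .
 ultimately show ?thesis using apW by blast
qed

lemma (in group) derived_seq_consistent:
 assumes H: "subgroup H G"
 shows "(derived (G\<lparr>carrier := H\<rparr>) ^^ m) H = (derived G ^^ m) H"
proof -
 have "(derived G ^^ m) H \<subseteq> H \<and> (derived (G\<lparr>carrier := H\<rparr>) ^^ m) H = (derived G ^^ m) H"
  by (induction m) (use derived_incl[OF _ H] derived_consistent[OF _ H] in simp_all)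
 thus ?thesis ..
qed

text \<open>The conjugate is \<open>g\<close> times the commutator of the inverses of
  \<open>g\<close> and \<open>h\<close>.\<close>

lemma (in group) conjugate_in_derived:
 assumes G: "subgroup H G" and g: "g \<in> derived G H" and h: "h \<in> H"
 shows "inv h \<otimes> g \<otimes> h \<in> derived G H"
proof -
 have gH: "g \<in> H" using derived_incl[OF subset_refl G] g by blast
 have c: "g \<in> carrier G" "h \<in> carrier G" using subgroup.subset[OF G] gH h by auto
 have "g \<otimes> (inv g \<otimes> inv h \<otimes> g \<otimes> h) = inv h \<otimes> g \<otimes> h" using c by (simp add: m_assoc[symmetric])
 moreover have "inv g \<otimes> inv h \<otimes> inv (inv g) \<otimes> inv (inv h) \<in> derived G H"
  unfolding derived_def by (rule generate.incl) (use subgroup.m_inv_closed[OF G gH] subgroup.m_inv_closed[OF G h] in blast)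
 hence "inv g \<otimes> inv h \<otimes> g \<otimes> h \<in> derived G H" using c by simp
 from subgroup.m_closed[OF derived_is_subgroup[OF subgroup.subset[OF G]] g this]
 have "g \<otimes> (inv g \<otimes> inv h \<otimes> g \<otimes> h) \<in> derived G H" .
 ultimately show ?thesis by (simp only:)
qed

text \<open>\<open>W\<close> is minimal among the stable subspaces strictly containing
  \<open>U\<close>; modulo \<open>U\<close> it is an irreducible representation of
  \<open>G\<close>.\<close>

context
 fixes G :: "('k::{alg_closed_field, field_char_0} ^ 'n::finite ^ 'n) set" and U W
 assumes G: "subgroup G SL_grp" and conn: "connectedin (ftop SL_space) G"
  and U: "vec.subspace U" and GU: "!!h x. h \<in> G ==> x \<in> U ==> h *v x \<in> U"
  and W: "vec.subspace W" and GW: "!!h x. h \<in> G ==> x \<in> W ==> h *v x \<in> W" and UW: "U \<subset> W"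
  and min: "!!E. vec.subspace E ==> U \<subset> E ==> E \<subseteq> W ==> (!!h x. h \<in> G ==> x \<in> E ==> h *v x \<in> E) ==> E = W"
begin

lemma preserved_U: "h \<in> G ==> h *v x \<in> U ==> x \<in> U"
 by (rule subspace_stable_inverse[OF U GU, of h "SL_inv h"]) (auto simp: SL_inv SL_subgroup[OF G])

text \<open>
 The connected group \<open>G\<close> permutes the eigenspaces modulo \<open>U\<close>, of which there are finitely many;
 hence it stabilizes each of them.
\<close>

lemma common_eigenspace_total:
 assumes NG: "N \<subseteq> G"
  and eig: "!!w h g. w \<in> W ==> (!!g. g \<in> N ==> g *v w - c g *s w \<in> U) ==> h \<in> G ==> g \<in> N ==>
   \<exists>l. g *v (h *v w) - l *s (h *v w) \<in> U"
  and v: "v \<in> W" "v \<notin> U" "!!g. g \<in> N ==> g *v v - c g *s v \<in> U" and w: "w \<in> W" and g: "g \<in> N"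
 shows "g *v w - c g *s w \<in> U"
proof -
 \<comment> \<open>The common eigenspace modulo \<open>U\<close> for the eigenvalues
   \<open>c\<close>. It contains \<open>v\<close>, and once it is seen to be stable under
   \<open>G\<close>, minimality makes it all of \<open>W\<close>.\<close>
 define E where "E = {w \<in> W. \<forall>g\<in>N. g *v w - c g *s w \<in> U}"
 note sub = vec.subspace_add vec.subspace_diff vec.subspace_scale vec.subspace_0
 have "vec.subspace E"
  unfolding vec.subspace_def
 proof (intro conjI allI ballI)
  show "0 \<in> E" using vec.subspace_0[OF U] vec.subspace_0[OF W] by (simp add: E_def)
  fix x assume x: "x \<in> E"
  show "x + y \<in> E" if y: "y \<in> E" for y
  proof -
   have "g *v (x + y) - c g *s (x + y) = (g *v x - c g *s x) + (g *v y - c g *s y)" for g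
    by (simp add: matrix_vector_right_distrib vec.scale_right_distrib)
   hence "g *v (x + y) - c g *s (x + y) \<in> U" if "g \<in> N" for g
    using that x y vec.subspace_add[OF U] unfolding E_def by (simp only: mem_Collect_eq)
   thus ?thesis using x y vec.subspace_add[OF W] unfolding E_def by blast
  qed
  show "a *s x \<in> E" for a
  proof -
   have "g *v (a *s x) - c g *s (a *s x) = a *s (g *v x - c g *s x)" for g
    by (simp add: vector_scalar_commute vec.scale_right_diff_distrib mult.commute)
   hence "g *v (a *s x) - c g *s (a *s x) \<in> U" if "g \<in> N" for g
    using that x vec.subspace_scale[OF U] unfolding E_def by (simp only: mem_Collect_eq)
   thus ?thesis using x vec.subspace_scale[OF W] unfolding E_def by blast
  qed
 qed
 moreover have "U \<subset> E"
 proof -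
  have "x \<in> E" if "x \<in> U" for x
   using that UW NG GU by (auto simp: E_def intro!: vec.subspace_diff[OF U] vec.subspace_scale[OF U])
  moreover have "v \<in> E" using v by (simp add: E_def)
  ultimately show ?thesis using v(2) by blast
 qed
 moreover have "E \<subseteq> W" by (auto simp: E_def)
 moreover have "h *v x \<in> E" if h: "h \<in> G" and x: "x \<in> E" for h x
 proof (cases "x \<in> U")
  case True
  thus ?thesis using GU[OF h] \<open>U \<subset> E\<close> by blast
 next
  case False
  have xW: "x \<in> W" and xe: "!!g. g \<in> N ==> g *v x - c g *s x \<in> U" using x by (auto simp: E_def)
  obtain Q :: "'k ^ 'n ^ 'n" where Q: "!!x. Q *v x = 0 \<longleftrightarrow> x \<in> U" using exists_kernel_matrix[OF U] by blast
  have "g *v (h *v x) - c g *s (h *v x) \<in> U" if g: "g \<in> N" for g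
  proof -
   \<comment> \<open>The matrices moving \<open>x\<close> to an eigenvector with eigenvalue
     \<open>l\<close> modulo \<open>U\<close>. On \<open>G\<close> these closed sets are disjoint,
     and finitely many of them cover it.\<close>
   define C where "C l = {h \<in> SL. g *v (h *v x) - l *s (h *v x) \<in> U}" for l
   have cl: "closedin (ftop SL_space) (C l)" for l
   proof -
    define f where "f i h = ((Q ** (g - mat l) ** h) *v x) $ i" for i h
    have "mat l *v y = l *s y" for y :: "'k ^ 'n"
     by (simp add: vec_eq_iff matrix_vector_mult_def mat_def if_distrib[of "\<lambda>a. a * _"] cong: if_cong)
    hence rep: "f i h = (Q *v (g *v (h *v x) - l *s (h *v x))) $ i" for i h
     by (simp add: f_def matrix_vector_mul_assoc[symmetric] matrix_vector_diff)
    have "closedin (ftop SL_space) {h \<in> SL. f i h = 0}" for i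
     unfolding f_def
    proof (rule closedin_SL_zero, rule subalg_matrix_vector_mult[OF subalg_coord_SL])
     show "(\<lambda>M\<in>SL. (Q ** (g - mat l) ** M) $ a $ b) \<in> coord_ring SL_space" for a b
      by (intro coord_SL_intros)
    qed
    hence "closedin (ftop SL_space) (\<Inter>i. {h \<in> SL. f i h = 0})" by (intro closedin_INT) auto
    moreover have "(\<Inter>i. {h \<in> SL. f i h = 0}) = C l"
     by (auto simp: C_def rep Q[symmetric] vec_eq_iff)
    ultimately show ?thesis by simp
   qed
   have "h \<in> C (c g)"
   proof (rule connectedin_cases[OF conn, of "{l. \<exists>x. x \<notin> U \<and> g *v x - l *s x \<in> U}" C "mat 1"])
    show "finite {l. \<exists>x. x \<notin> U \<and> g *v x - l *s x \<in> U}"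
     by (rule finite_eigenvalues[OF U]) (use GU NG g in blast)
    show "closedin (ftop SL_space) (C l)" for l by (rule cl)
    show "\<exists>l\<in>{l. \<exists>x. x \<notin> U \<and> g *v x - l *s x \<in> U}. h \<in> C l" if hG: "h \<in> G" for h
    proof -
     have "\<exists>l. g *v (h *v x) - l *s (h *v x) \<in> U" by (rule eig[OF xW _ hG g]) (rule xe)
     then obtain l where l: "g *v (h *v x) - l *s (h *v x) \<in> U" ..
     moreover have "h *v x \<notin> U" using preserved_U[OF hG] False by blast
     ultimately show ?thesis using SL_subgroup(1)[OF G hG] by (auto simp: C_def)
    qed
    show "l = l'" if "h \<in> G" "h \<in> C l" "h \<in> C l'" for l l' h
    proof (rule ccontr)
     assume ne: "l ~= l'"
     have "(g *v (h *v x) - l *s (h *v x)) - (g *v (h *v x) - l' *s (h *v x)) \<in> U"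
      by (rule vec.subspace_diff[OF U]) (use that(2,3) in "simp_all add: C_def")
     also have "(g *v (h *v x) - l *s (h *v x)) - (g *v (h *v x) - l' *s (h *v x)) = (l' - l) *s (h *v x)"
      by (simp add: vec.scale_left_diff_distrib)
     finally have "inverse (l' - l) *s ((l' - l) *s (h *v x)) \<in> U" by (rule vec.subspace_scale[OF U])
     moreover have "inverse (l' - l) * (l' - l) = 1" using ne by simp
     ultimately have "h *v x \<in> U" by (simp only: vec.scale_scale vec.scale_one)
     thus False using preserved_U[OF that(1)] False by blast
    qed
    show "mat 1 \<in> G" by (rule SL_subgroup(3)[OF G])
    show "mat 1 \<in> C (c g)" using xe[OF g] by (simp add: C_def)
    show "c g \<in> {l. \<exists>x. x \<notin> U \<and> g *v x - l *s x \<in> U}" using xe[OF g] False by blast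
   qed (rule h)
   thus ?thesis by (simp add: C_def)
  qed
  thus ?thesis using GW[OF h xW] by (simp add: E_def)
 qed
 ultimately have "E = W" by (rule min)
 thus ?thesis using w g by (auto simp: E_def)
qed

text \<open>
 If \<open>[G, G]\<close> acts by scalars modulo \<open>U\<close>, then every \<open>h \<in> G\<close> maps an eigenvector of \<open>g \<in> G\<close>
 modulo \<open>U\<close> to another one, because \<open>g h = h g [g\<inverse>, h\<inverse>]\<close>.
\<close>

lemma acts_by_scalars:
 assumes v: "v \<in> W" "v \<notin> U" "!!g. g \<in> derived SL_grp G ==> \<exists>l. g *v v - l *s v \<in> U"
  and g: "g \<in> G" and w: "w \<in> W"
 shows "\<exists>l. g *v w - l *s w \<in> U"
proof -
 interpret SL: group "SL_grp :: ('k ^ 'n ^ 'n) monoid" by (rule group_SL)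
 note Gs = SL_subgroup[OF G]
 have DG: "derived SL_grp G \<subseteq> G" by (rule SL.derived_incl[OF subset_refl G])
 obtain c where c: "!!g. g \<in> derived SL_grp G ==> g *v v - c g *s v \<in> U" using v(3) by metis
 have D: "g *v w - c g *s w \<in> U" if "g \<in> derived SL_grp G" "w \<in> W" for g w
 proof (rule common_eigenspace_total[OF DG _ v(1,2) c that(2,1)])
  fix w h g assume w: "w \<in> W" "!!g. g \<in> derived SL_grp G ==> g *v w - c g *s w \<in> U"
   and h: "h \<in> G" and g: "g \<in> derived SL_grp G"
  let ?g = "SL_inv h ** g ** h"
  have dh: "det h = 1" by (rule Gs(1)[OF h])
  have "?g \<in> derived SL_grp G" using SL.conjugate_in_derived[OF G g h] by simp
  hence "h *v (?g *v w - c ?g *s w) \<in> U" by (intro GU[OF h] w(2))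
  moreover have "h *v (?g *v w) = g *v (h *v w)"
   by (simp add: matrix_vector_mul_assoc[symmetric] dh)
  ultimately have "g *v (h *v w) - c ?g *s (h *v w) \<in> U"
   by (simp add: matrix_vector_mult_diff_distrib vector_scalar_commute)
  thus "\<exists>l. g *v (h *v w) - l *s (h *v w) \<in> U" ..
 qed
 obtain l u where u: "u \<in> W" "u \<notin> U" "g *v u - l *s u \<in> U"
  using exists_eigenvector[OF U W UW, of g] GW[OF g] by blast
 \<comment> \<open>The eigenspace argument again, now for the single element \<open>g\<close>
   instead of the derived group.\<close>
 have "g *v w - (\<lambda>_. l) g *s w \<in> U"
 proof (rule common_eigenspace_total[where N = "{g}", OF _ _ u(1,2) _ w])
  show "{g} \<subseteq> G" using g by simp
  fix w h g' assume w: "w \<in> W" "!!g'. g' \<in> {g} ==> g' *v w - l *s w \<in> U" and h: "h \<in> G" and g': "g' \<in> {g}"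
  let ?k = "SL_inv g ** SL_inv h ** g ** h"
  have dh: "det h = 1" and dg: "det g = 1" by (rule Gs(1)[OF h], rule Gs(1)[OF g])
  have "SL_inv g ** SL_inv h ** SL_inv (SL_inv g) ** SL_inv (SL_inv h) \<in> derived SL_grp G"
   unfolding derived_def using Gs(4)[OF g] Gs(4)[OF h] by (force intro!: generate.incl)
  hence "?k \<in> derived SL_grp G" using SL.inv_inv[of g] SL.inv_inv[of h] dh dg by simp
  hence "h *v (g *v (?k *v w - c ?k *s w)) \<in> U" using D w(1) by (intro GU[OF h] GU[OF g]) simp
  moreover have "h *v (g *v (?k *v w)) = g *v (h *v w)"
   by (simp add: matrix_vector_mul_assoc[symmetric] dh dg)
  ultimately have 1: "g *v (h *v w) - c ?k *s (h *v (g *v w)) \<in> U"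
   by (simp add: matrix_vector_mult_diff_distrib vector_scalar_commute)
  have "h *v (g *v w - l *s w) \<in> U" using w(2) by (intro GU[OF h]) simp
  hence "c ?k *s (h *v (g *v w) - l *s (h *v w)) \<in> U"
   by (intro vec.subspace_scale[OF U]) (simp add: matrix_vector_mult_diff_distrib vector_scalar_commute)
  from vec.subspace_add[OF U 1 this] have "g *v (h *v w) - (c ?k * l) *s (h *v w) \<in> U"
   by (simp add: vec.scale_right_diff_distrib)
  thus "\<exists>l. g' *v (h *v w) - l *s (h *v w) \<in> U" using g' by auto
 qed (use u in auto)
 thus ?thesis by blast
qed

end

text \<open>By induction on the length of the derived series: the derived group is again connected
  and has a common eigenvector modulo \<open>U\<close>; on a minimal stable subspace this makes all
  of \<open>G\<close> act by scalars modulo \<open>U\<close>.\<close>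

theorem lie_kolchin_relative:
 fixes G :: "('k::{alg_closed_field, field_char_0} ^ 'n::finite ^ 'n) set"
 assumes "subgroup G SL_grp" "connectedin (ftop SL_space) G" "(derived SL_grp ^^ m) G = {mat 1}"
  and "vec.subspace U" "!!h x. h \<in> G ==> x \<in> U ==> h *v x \<in> U"
  and "vec.subspace W" "!!h x. h \<in> G ==> x \<in> W ==> h *v x \<in> W" "U \<subset> W"
 shows "\<exists>w\<in>W - U. \<forall>g\<in>G. \<exists>l. g *v w - l *s w \<in> U"
 using assms
proof (induction m arbitrary: G W)
 case 0
 then obtain w where w: "w \<in> W" "w \<notin> U" by blast
 have "mat 1 *v w - 1 *s w \<in> U" using vec.subspace_0[OF 0(4)] by simp
 thus ?case using w 0(3) by (intro bexI[of _ w] ballI exI[of _ 1]) auto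
next
 case (Suc m)
 interpret SL: group "SL_grp :: ('k ^ 'n ^ 'n) monoid" by (rule group_SL)
 note G = Suc.prems(1) and U = Suc.prems(4) and GU = Suc.prems(5)
 let ?D = "derived SL_grp G"
 have DG: "?D \<subseteq> G" by (rule SL.derived_incl[OF subset_refl G])
 \<comment> \<open>A stable subspace of least dimension is minimal; it replaces
   \<open>W\<close>.\<close>
 define stable where "stable E \<longleftrightarrow> vec.subspace E \<and> U \<subset> E \<and> E \<subseteq> W \<and> (\<forall>h\<in>G. \<forall>x\<in>E. h *v x \<in> E)" for E
 have "stable W" using Suc.prems by (simp add: stable_def)
 then obtain W0 where W0: "stable W0" and least: "!!E. stable E ==> vec.dim W0 \<le> vec.dim E"
  using ex_has_least_nat[of stable W vec.dim] by blast
 have W0s: "vec.subspace W0" "U \<subset> W0" "W0 \<subseteq> W" "!!h x. h \<in> G ==> x \<in> W0 ==> h *v x \<in> W0"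
  using W0 by (auto simp: stable_def)
 have min: "E = W0" if "vec.subspace E" "U \<subset> E" "E \<subseteq> W0" "!!h x. h \<in> G ==> x \<in> E ==> h *v x \<in> E" for E
 proof -
  have "stable E" using that W0s(3) by (auto simp: stable_def)
  thus ?thesis using vec.subspace_dim_equal[OF that(1) W0s(1) that(3)] least by blast
 qed
 have "\<exists>w\<in>W0 - U. \<forall>g\<in>?D. \<exists>l. g *v w - l *s w \<in> U"
 proof (rule Suc.IH)
  show "subgroup ?D SL_grp" by (rule SL.derived_is_subgroup[OF subgroup.subset[OF G]])
  show "connectedin (ftop SL_space) ?D" by (rule connectedin_derived[OF G Suc.prems(2)])
  show "(derived SL_grp ^^ m) ?D = {mat 1}" using Suc.prems(3) by (simp add: funpow_swap1)
 qed (use U GU W0s DG in blast)+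
 then obtain v where v: "v \<in> W0" "v \<notin> U" "!!g. g \<in> ?D ==> \<exists>l. g *v v - l *s v \<in> U" by blast
 have "\<exists>l. g *v v - l *s v \<in> U" if "g \<in> G" for g
  by (rule acts_by_scalars[OF G Suc.prems(2) U GU W0s(1,4,2) min v that v(1)])
 thus ?case using v(1,2) W0s(3) by blast
qed

section \<open>Borel subgroups of the special linear group\<close>

text \<open>The index type carries no order; a fixed enumeration from 0 provides the standard flag
  and the notion of a triangular matrix.\<close>

definition idx :: "'n::finite => nat" where
 "idx = (SOME f. bij_betw f UNIV {0..<CARD('n)})"

lemma idx_bij: "bij_betw (idx :: 'n::finite => nat) UNIV {0..<CARD('n)}"
 unfolding idx_def using someI_ex[OF ex_bij_betw_finite_nat[OF finite_class.finite_UNIV]] .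

lemma idx_less [simp]: "idx (i :: 'n::finite) < CARD('n)"
 using bij_betw_apply[OF idx_bij, of i] by simp

lemma idx_eq_iff [simp]: "idx i = idx j \<longleftrightarrow> i = (j :: 'n::finite)"
 using bij_betw_imp_inj_on[OF idx_bij] by (auto dest: injD)

lemma idx_surj: "k < CARD('n) ==> \<exists>i :: 'n::finite. idx i = k"
 using bij_betw_imp_surj_on[OF idx_bij] by (metis atLeastLessThan_iff imageE zero_le)

definition std_flag :: "nat => ('k::field ^ 'n::finite) set" where
 "std_flag k = {x. \<forall>j. k \<le> idx j --> x $ j = 0}"

lemma subspace_std_flag: "vec.subspace (std_flag k)"
 by (auto simp: vec.subspace_def std_flag_def)

lemma std_flag_0: "x \<in> std_flag 0 \<longleftrightarrow> x = 0"
 by (simp add: std_flag_def vec_eq_iff)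

lemma std_flag_top: "x \<in> (std_flag CARD('n) :: ('k::field ^ 'n::finite) set)"
 by (auto simp: std_flag_def dest: leD)

lemma std_flag_mono: "x \<in> std_flag k ==> k \<le> l ==> x \<in> std_flag l"
 by (auto simp: std_flag_def)

lemma axis_std_flag: "(axis j 1 :: 'k::field ^ 'n::finite) \<in> std_flag k \<longleftrightarrow> idx j < k"
 by (auto simp: std_flag_def axis_def not_le[symmetric])

lemma matrix_axis: "(M *v axis j 1) $ i = M $ i $ j" for M :: "'k::field ^ 'n::finite ^ 'n"
 by (simp add: matrix_vector_mult_def axis_def)

section \<open>Triangular matrices and their derived series\<close>

definition upper_triangular :: "'k::field ^ 'n::finite ^ 'n => bool" where
 "upper_triangular M \<longleftrightarrow> (\<forall>i j. idx j < idx i --> M $ i $ j = 0)"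

lemma upper_triangular_iff: "upper_triangular M \<longleftrightarrow> (\<forall>k. \<forall>x\<in>std_flag k. M *v x \<in> std_flag k)"
proof
 assume M: "upper_triangular M"
 show "\<forall>k. \<forall>x\<in>std_flag k. M *v x \<in> std_flag k"
 proof (intro allI ballI)
  fix k and x :: "'a ^ 'b" assume x: "x \<in> std_flag k"
  have z: "M $ i $ j * x $ j = 0" if "k \<le> idx i" for i j
   using M x that unfolding upper_triangular_def std_flag_def by (cases "idx j < idx i") auto
  show "M *v x \<in> std_flag k"
   unfolding std_flag_def by (auto simp: matrix_vector_mult_def z intro!: sum.neutral)
 qed
next
 assume M: "\<forall>k. \<forall>x\<in>std_flag k. M *v x \<in> std_flag k"
 have "M $ i $ j = 0" if "idx j < idx i" for i j
 proof -
  have "M *v axis j 1 \<in> std_flag (Suc (idx j))" using M by (simp add: axis_std_flag)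
  thus ?thesis using that matrix_axis[of M j i] by (auto simp: std_flag_def)
 qed
 thus "upper_triangular M" by (simp add: upper_triangular_def)
qed

text \<open>
 \<open>lev 0\<close> are the upper triangular matrices, \<open>lev 1\<close> the unipotent ones; the levels are the
 steps of the derived series.
\<close>

definition lev :: "nat => 'k::field ^ 'n::finite ^ 'n => bool" where
 "lev m M \<longleftrightarrow> (\<forall>k. \<forall>x\<in>std_flag k. M *v x - x \<in> std_flag (k - m))"

lemma lev_stable: "lev m M ==> x \<in> std_flag k ==> M *v x \<in> std_flag k"
 using vec.subspace_add[OF subspace_std_flag, of "M *v x - x" k x] std_flag_mono[of "M *v x - x" "k - m" k]
 by (auto simp: lev_def)

lemma lev_0: "lev 0 M \<longleftrightarrow> upper_triangular M"
proof
 show "lev 0 M ==> upper_triangular M" unfolding upper_triangular_iff using lev_stable by blast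
 assume "upper_triangular M"
 hence M: "M *v x \<in> std_flag k" if "x \<in> std_flag k" for k x using that unfolding upper_triangular_iff by blast
 show "lev 0 M" unfolding lev_def diff_zero
  by (intro allI ballI, rule vec.subspace_diff[OF subspace_std_flag M])
qed

lemma lev_id: "lev m (mat 1)"
 by (simp add: lev_def vec.subspace_0[OF subspace_std_flag])

lemma lev_top: "lev CARD('n) M ==> M = mat 1" for M :: "'k::field ^ 'n::finite ^ 'n"
proof -
 assume M: "lev CARD('n) M"
 have "M *v x = mat 1 *v x" for x
  using M std_flag_top[of x] std_flag_0[of "M *v x - x"] unfolding lev_def by (metis diff_self_eq_0 eq_iff_diff_eq_0 matrix_vector_mul_lid)
 thus ?thesis by (simp add: matrix_eq)
qed

lemma lev_mult: "lev m A ==> lev m B ==> lev m (A ** B)"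
proof -
 assume A: "lev m A" and B: "lev m B"
 show "lev m (A ** B)"
  unfolding lev_def
 proof (intro allI ballI)
  fix k and x :: "'a ^ 'b" assume x: "x \<in> std_flag k"
  have "(A *v (B *v x) - B *v x) + (B *v x - x) \<in> std_flag (k - m)"
   using A B x lev_stable[OF B x] by (intro vec.subspace_add[OF subspace_std_flag]) (auto simp: lev_def)
  thus "A ** B *v x - x \<in> std_flag (k - m)" by (simp add: matrix_vector_mul_assoc)
 qed
qed

lemma lev_inverse:
 fixes A B :: "'k::field ^ 'n::finite ^ 'n"
 assumes A: "lev m A" and AB: "A ** B = mat 1" shows "lev m B"
 unfolding lev_def
proof (intro allI ballI)
 fix k and x :: "'k ^ 'n" assume x: "x \<in> std_flag k"
 have AB': "A *v (B *v x) = x" by (simp add: matrix_vector_mul_assoc AB)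
 have Bx: "B *v x \<in> std_flag k"
  by (rule subspace_stable_inverse[OF subspace_std_flag lev_stable[OF A] matrix_right_inverse_of_left[OF AB]])
   (simp_all add: AB' x)
 hence "A *v (B *v x) - B *v x \<in> std_flag (k - m)" using A by (simp add: lev_def)
 hence "- (A *v (B *v x) - B *v x) \<in> std_flag (k - m)" by (rule vec.subspace_neg[OF subspace_std_flag])
 thus "B *v x - x \<in> std_flag (k - m)" by (simp add: AB')
qed

lemma triangular_diagonal:
 assumes A: "lev 0 A" and x: "x \<in> std_flag (Suc (idx j))"
 shows "(A *v x) $ j = A $ j $ j * x $ j"
proof -
 have summand: "A $ j $ l * x $ l = (if l = j then A $ j $ j * x $ j else 0)" for l
 proof (cases "idx l" "idx j" rule: linorder_cases)
  case less
  thus ?thesis using A unfolding lev_0 upper_triangular_def by auto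
 next
  case equal
  thus ?thesis by simp
 next
  case greater
  hence "x $ l = 0" using x by (simp add: std_flag_def)
  thus ?thesis using greater by auto
 qed
 have "(A *v x) $ j = (\<Sum>l\<in>UNIV. A $ j $ l * x $ l)" by (simp add: matrix_vector_mult_def)
 also have "\<dots> = (\<Sum>l\<in>UNIV. if l = j then A $ j $ j * x $ j else 0)" by (rule sum.cong[OF refl summand])
 finally show ?thesis by simp
qed

text \<open>For \<open>m = 0\<close> both products multiply the leading coordinate of a flag vector
  by the same two diagonal entries. For \<open>m > 0\<close> the difference is the commutator of
  \<open>A - 1\<close> and \<open>B - 1\<close>, which drops by \<open>2 * m\<close> steps.\<close>

lemma lev_commute:
 fixes A B :: "'k::field ^ 'n::finite ^ 'n"
 assumes A: "lev m A" and B: "lev m B" and y: "y \<in> std_flag k"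
 shows "A *v (B *v y) - B *v (A *v y) \<in> std_flag (k - Suc m)"
proof (cases m)
 case 0
 show ?thesis
 proof (cases k)
  case 0
  thus ?thesis using y by (simp add: std_flag_0)
 next
  case (Suc k')
  have s: "A *v (B *v y) \<in> std_flag k" "B *v (A *v y) \<in> std_flag k" "A *v y \<in> std_flag k" "B *v y \<in> std_flag k"
   using lev_stable[OF A] lev_stable[OF B] y by auto
  have "(A *v (B *v y)) $ j = (B *v (A *v y)) $ j" if "k' \<le> idx j" for j
  proof (cases "idx j = k'")
   case True
   have 1: "lev 0 A" "lev 0 B" using A B by (simp_all add: \<open>m = 0\<close>)
   have 2: "y \<in> std_flag (Suc (idx j))" "A *v y \<in> std_flag (Suc (idx j))" "B *v y \<in> std_flag (Suc (idx j))"
    using y s by (simp_all add: True Suc)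
   show ?thesis
    by (simp only: triangular_diagonal[OF 1(1) 2(1)] triangular_diagonal[OF 1(1) 2(3)]
      triangular_diagonal[OF 1(2) 2(1)] triangular_diagonal[OF 1(2) 2(2)] mult.left_commute)
  next
   case False
   thus ?thesis using s that Suc by (simp add: std_flag_def)
  qed
  thus ?thesis using 0 Suc by (simp add: std_flag_def)
 qed
next
 case (Suc m')
 have 1: "A *v y - y \<in> std_flag (k - m)" "B *v y - y \<in> std_flag (k - m)" using A B y by (auto simp: lev_def)
 have "A *v (B *v y - y) - (B *v y - y) \<in> std_flag (k - m - m)" "B *v (A *v y - y) - (A *v y - y) \<in> std_flag (k - m - m)"
  using A B 1 unfolding lev_def by blast+
 hence "(A *v (B *v y - y) - (B *v y - y)) - (B *v (A *v y - y) - (A *v y - y)) \<in> std_flag (k - m - m)"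
  by (rule vec.subspace_diff[OF subspace_std_flag])
 also have "(A *v (B *v y - y) - (B *v y - y)) - (B *v (A *v y - y) - (A *v y - y)) = A *v (B *v y) - B *v (A *v y)"
  by (simp add: matrix_vector_mult_diff_distrib)
 finally show ?thesis by (rule std_flag_mono) (use Suc in simp)
qed

text \<open>The vector \<open>y\<close>, obtained from \<open>x\<close> by the inverses of
  \<open>B\<close> and then of \<open>A\<close>, satisfies \<open>B A y = x\<close>; so commutator
  minus identity at \<open>x\<close> is \<open>A B y - B A y\<close>.\<close>

lemma lev_commutator:
 fixes A B A' B' :: "'k::field ^ 'n::finite ^ 'n"
 assumes A: "lev m A" and B: "lev m B" and A': "A ** A' = mat 1" and B': "B ** B' = mat 1"
 shows "lev (Suc m) (A ** B ** A' ** B')"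
 unfolding lev_def
proof (intro allI ballI)
 fix k and x :: "'k ^ 'n" assume x: "x \<in> std_flag k"
 define y where "y = A' *v (B' *v x)"
 have y: "y \<in> std_flag k"
  unfolding y_def using x lev_stable[OF lev_inverse[OF A A']] lev_stable[OF lev_inverse[OF B B']] by blast
 have "A *v y = B' *v x" unfolding y_def by (simp add: matrix_vector_mul_assoc[of A] A')
 hence "B *v (A *v y) = x" by (simp add: matrix_vector_mul_assoc B')
 moreover have "A ** B ** A' ** B' *v x = A *v (B *v y)"
  by (simp add: y_def matrix_vector_mul_assoc[symmetric])
 ultimately show "A ** B ** A' ** B' *v x - x \<in> std_flag (k - Suc m)"
  using lev_commute[OF A B y] by simp
qed

text \<open>Below, \<open>h\<close> is the inverse of \<open>g\<close>, so that the basis consists of the columns of \<open>g\<close>.\<close>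

definition triangular_grp :: "'k::field ^ 'n::finite ^ 'n => 'k ^ 'n ^ 'n => nat => ('k ^ 'n ^ 'n) set" where
 "triangular_grp g h m = {M \<in> SL. lev m (h ** M ** g)}"

context
 fixes g h :: "'k::{alg_closed_field, field_char_0} ^ 'n::finite ^ 'n"
 assumes hg: "h ** g = mat 1"
begin

private lemma gh: "g ** h = mat 1" by (rule matrix_right_inverse_of_left[OF hg])

private lemma conj_mult: "h ** (M ** N) ** g = (h ** M ** g) ** (h ** N ** g)"
proof -
 have "(h ** M ** g) ** (h ** N ** g) = h ** M ** (g ** h) ** N ** g" by (simp only: matrix_mul_assoc)
 thus ?thesis by (simp add: gh matrix_mul_assoc)
qed

lemma subgroup_triangular_grp: "subgroup (triangular_grp g h m) SL_grp"
proof
 show "triangular_grp g h m \<subseteq> carrier SL_grp" by (auto simp: triangular_grp_def)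
 show "M \<otimes>\<^bsub>SL_grp\<^esub> N \<in> triangular_grp g h m" if "M \<in> triangular_grp g h m" "N \<in> triangular_grp g h m" for M N
  using that lev_mult by (auto simp: triangular_grp_def det_mul conj_mult)
 show "\<one>\<^bsub>SL_grp\<^esub> \<in> triangular_grp g h m" by (simp add: triangular_grp_def hg lev_id)
 show "SL_inv M \<in> triangular_grp g h m" if "M \<in> triangular_grp g h m" for M
 proof -
  have M: "det M = 1" "lev m (h ** M ** g)" using that by (auto simp: triangular_grp_def)
  have "(h ** M ** g) ** (h ** SL_inv M ** g) = mat 1" unfolding conj_mult[symmetric] using M(1) by (simp add: SL_inv hg)
  from lev_inverse[OF M(2) this] show ?thesis using M(1) by (simp add: triangular_grp_def SL_inv)
 qed
qed

lemma derived_triangular_grp: "derived SL_grp (triangular_grp g h m) \<subseteq> triangular_grp g h (Suc m)"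
 unfolding derived_def
proof (rule group.generate_subgroup_incl[OF group_SL _ subgroup_triangular_grp])
 show "derived_set SL_grp (triangular_grp g h m) \<subseteq> triangular_grp g h (Suc m)"
 proof
  fix M assume "M \<in> derived_set SL_grp (triangular_grp g h m)"
  then obtain A B where AB: "A \<in> triangular_grp g h m" "B \<in> triangular_grp g h m" "M = A ** B ** SL_inv A ** SL_inv B"
   by auto
  have d: "det A = 1" "det B = 1" and l: "lev m (h ** A ** g)" "lev m (h ** B ** g)" using AB by (auto simp: triangular_grp_def)
  have "(h ** A ** g) ** (h ** SL_inv A ** g) = mat 1" "(h ** B ** g) ** (h ** SL_inv B ** g) = mat 1"
   unfolding conj_mult[symmetric] using d by (simp_all add: SL_inv hg)
  from lev_commutator[OF l this] have "lev (Suc m) (h ** M ** g)"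
   unfolding AB(3) conj_mult by simp
  thus "M \<in> triangular_grp g h (Suc m)" using d by (simp add: triangular_grp_def AB(3) det_mul SL_inv)
 qed
qed

lemma solvable_triangular_grp: "solvable (SL_grp\<lparr>carrier := triangular_grp g h 0\<rparr>)"
proof -
 let ?T = "triangular_grp g h 0"
 interpret SL: group "SL_grp :: ('k ^ 'n ^ 'n) monoid" by (rule group_SL)
 interpret T: group "SL_grp\<lparr>carrier := ?T\<rparr>" by (rule subgroup.subgroup_is_group[OF subgroup_triangular_grp group_SL])
 have incl: "(derived SL_grp ^^ m) ?T \<subseteq> triangular_grp g h m" for m
 proof (induction m)
  case (Suc m)
  show ?case using order_trans[OF SL.mono_derived[OF Suc] derived_triangular_grp[of m]] by simp
 qed simp
 have "h ** M ** g = mat 1 ==> M = mat 1" for M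
 proof -
  assume "h ** M ** g = mat 1"
  hence "g ** (h ** M ** g) ** h = mat 1" by (simp add: gh)
  moreover have "g ** (h ** M ** g) ** h = (g ** h) ** M ** (g ** h)" by (simp only: matrix_mul_assoc)
  ultimately show ?thesis by (simp add: gh)
 qed
 hence "triangular_grp g h CARD('n) \<subseteq> {mat 1}" using lev_top by (auto simp: triangular_grp_def)
 moreover have "mat 1 \<in> (derived SL_grp ^^ CARD('n)) ?T"
  using subgroup.one_closed[OF SL.exp_of_derived_is_subgroup[OF subgroup_triangular_grp]] by simp
 ultimately have "(derived SL_grp ^^ CARD('n)) ?T = {mat 1}" using incl[of "CARD('n)"] by blast
 thus ?thesis unfolding T.solvable_iff_trivial_derived_seq
  using SL.derived_seq_consistent[OF subgroup_triangular_grp] by auto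
qed

lemma closedin_triangular_grp: "closedin (ftop SL_space) (triangular_grp g h 0)"
proof -
 have "closedin (ftop SL_space) {M \<in> SL. (if idx j < idx i then (h ** M ** g) $ i $ j else 0) = 0}" for i j
 proof (cases "idx j < idx i")
  case True
  have "closedin (ftop SL_space) {M \<in> SL. (h ** M ** g) $ i $ j = 0}" by (intro closedin_SL_zero coord_SL_intros)
  thus ?thesis using True by simp
 next
  case False
  thus ?thesis using closedin_topspace[of "ftop (SL_space :: ('k ^ 'n ^ 'n, 'k) fspace)"] by (simp add: pts_SL)
 qed
 hence "closedin (ftop SL_space) (\<Inter>i. \<Inter>j. {M \<in> SL. (if idx j < idx i then (h ** M ** g) $ i $ j else 0) = 0})"
  by (intro closedin_INT) auto
 moreover have "(\<Inter>i. \<Inter>j. {M \<in> SL. (if idx j < idx i then (h ** M ** g) $ i $ j else 0) = 0}) = triangular_grp g h 0"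
  by (auto simp: triangular_grp_def lev_0 upper_triangular_def)
 ultimately show ?thesis by simp
qed

text \<open>
 Two elements of the group are joined by the segment between them; a row operation in the basis
 of columns of \<open>g\<close> corrects the determinant \<open>D(t)\<close> of its points.
\<close>

lemma connectedin_triangular_grp: "connectedin (ftop SL_space) (triangular_grp g h 0)"
 unfolding connectedin
proof (intro conjI notI)
 let ?T = "triangular_grp g h 0"
 show "?T \<subseteq> topspace (ftop SL_space)" by (auto simp: pts_SL triangular_grp_def)
 assume "\<exists>E1 E2. openin (ftop SL_space) E1 \<and> openin (ftop SL_space) E2 \<and> ?T \<subseteq> E1 \<union> E2 \<and> E1 \<inter> E2 \<inter> ?T = {} \<and> E1 \<inter> ?T ~= {} \<and> E2 \<inter> ?T ~= {}"
 then obtain E1 E2 where E: "openin (ftop SL_space) E1" "openin (ftop SL_space) E2" "E1 \<inter> E2 \<inter> ?T = {}"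
  "E1 \<inter> ?T ~= {}" "E2 \<inter> ?T ~= {}" by (elim exE conjE)
 have basic: "\<exists>f\<in>SL_ring. f M ~= 0 \<and> {M \<in> SL. f M ~= 0} \<subseteq> E" if "openin (ftop SL_space) E" "M \<in> E"
  for E and M :: "'k ^ 'n ^ 'n"
  by (rule openin_frac_spaceE[OF frac_base_single[OF subalg_SL_ring] that(1)[unfolded SL_space_eq] that(2)]) auto
 obtain M0 M1 where M: "M0 \<in> E1" "M0 \<in> ?T" "M1 \<in> E2" "M1 \<in> ?T" using E(4,5) by blast
 obtain f0 where f0: "f0 \<in> SL_ring" "f0 M0 ~= 0" "{M \<in> SL. f0 M ~= 0} \<subseteq> E1" using basic[OF E(1) M(1)] by blast
 obtain f1 where f1: "f1 \<in> SL_ring" "f1 M1 ~= 0" "{M \<in> SL. f1 M ~= 0} \<subseteq> E2" using basic[OF E(2) M(3)] by blast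
 have M01: "det M0 = 1" "det M1 = 1" "upper_triangular (h ** M0 ** g)" "upper_triangular (h ** M1 ** g)"
  using M by (auto simp: triangular_grp_def lev_0)
 define N where "N t = (\<chi> i j. (h ** M0 ** g) $ i $ j + t * (h ** M1 ** g - h ** M0 ** g) $ i $ j)" for t
 obtain D where D: "!!t. poly D t = det (N t)"
  using det_poly[of "h ** M0 ** g" "h ** M1 ** g - h ** M0 ** g"] unfolding N_def by blast
 have N01: "N 0 = h ** M0 ** g" "N 1 = h ** M1 ** g" by (simp_all add: N_def vec_eq_iff)
 have dhg: "det h * det g = 1" unfolding det_mul[symmetric] hg by simp
 have D01: "poly D 0 = 1" "poly D 1 = 1" unfolding D N01 using dhg M01 by (simp_all add: det_mul mult_ac)
 define i0 :: 'n where "i0 = undefined"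
 define R where "R t = (\<chi> i. if i = i0 then inverse (poly D t) *s (N t $ i) else N t $ i)" for t
 have detR: "det (R t) = inverse (poly D t) * poly D t" for t
  unfolding R_def det_row_mul D by simp
 have upR: "upper_triangular (R t)" for t
  using M01(3,4) by (auto simp: upper_triangular_def R_def N_def)
 define P where "P t = g ** R t ** h" for t
 have hPg: "h ** P t ** g = R t" for t
 proof -
  have "h ** P t ** g = (h ** g) ** R t ** (h ** g)" unfolding P_def by (simp only: matrix_mul_assoc)
  thus ?thesis by (simp add: hg)
 qed
 have PT: "P t \<in> ?T" if "poly D t ~= 0" for t
 proof -
  have "det (R t) = 1" using that by (simp add: detR)
  hence "det (P t) = 1" using dhg by (simp add: P_def det_mul mult.commute)
  thus ?thesis using upR by (simp add: triangular_grp_def lev_0 hPg)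
 qed
 have PM: "P t = M" if "N t = h ** M ** g" "poly D t = 1" for t M
 proof -
  have "R t = N t" using that(2) by (simp add: R_def vec_eq_iff)
  hence "P t = (g ** h) ** M ** (g ** h)" unfolding P_def that(1) by (simp only: matrix_mul_assoc)
  thus ?thesis by (simp add: gh)
 qed
 have P01: "P 0 = M0" "P 1 = M1" using PM N01 D01 by auto
 \<comment> \<open>Along the path every regular function is a polynomial in \<open>t\<close> over a
   power of \<open>D\<close>, the only denominator introduced.\<close>
 have clear: "\<exists>p k. \<forall>t. poly D t ~= 0 --> poly p t = f (P t) * poly D t ^ k" if f: "f \<in> SL_ring" for f
 proof (rule alg_generated_induct[OF f[unfolded SL_ring_def],
    of "\<lambda>f. \<exists>p k. \<forall>t. poly D t ~= 0 --> poly p t = f (P t) * poly D t ^ k"])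
  have PSL: "det (P t) = 1" if "poly D t ~= 0" for t using PT[OF that] by (simp add: triangular_grp_def)
  show "\<exists>p k. \<forall>t. poly D t ~= 0 --> poly p t = (\<lambda>M\<in>SL. c) (P t) * poly D t ^ k" for c
   by (rule exI[of _ "[:c:]"], rule exI[of _ 0]) (simp add: PSL)
  show "\<exists>p k. \<forall>t. poly D t ~= 0 --> poly p t = f (P t) * poly D t ^ k" if fm: "f \<in> {\<lambda>M\<in>SL. M $ i $ j |i j. True}" for f
  proof -
   from fm obtain i j where f: "f = (\<lambda>M\<in>SL. M $ i $ j)" by (elim CollectE exE conjE)
   define r where "r a b = (if a = i0 then 1 else D) * [:(h ** M0 ** g) $ a $ b, (h ** M1 ** g - h ** M0 ** g) $ a $ b:]" for a b
   have r: "R t $ a $ b * poly D t = poly (r a b) t" if "poly D t ~= 0" for t a b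
   proof (cases "a = i0")
    case True
    have "inverse (poly D t) * z * poly D t = z" for z using that by simp
    thus ?thesis using True by (simp add: r_def R_def N_def)
   next
    case False
    thus ?thesis by (simp add: r_def R_def N_def algebra_simps)
   qed
   have "poly (\<Sum>b\<in>UNIV. \<Sum>a\<in>UNIV. smult (g $ i $ a * h $ b $ j) (r a b)) t = f (P t) * poly D t ^ 1" if "poly D t ~= 0" for t
   proof -
    have "f (P t) * poly D t ^ 1 = (\<Sum>b\<in>UNIV. \<Sum>a\<in>UNIV. g $ i $ a * R t $ a $ b * h $ b $ j) * poly D t"
     using PSL[OF that] by (simp add: f P_def matrix_matrix_mult_def sum_distrib_right)
    also have "\<dots> = (\<Sum>b\<in>UNIV. \<Sum>a\<in>UNIV. g $ i $ a * h $ b $ j * (R t $ a $ b * poly D t))"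
     by (simp add: sum_distrib_left sum_distrib_right mult_ac)
    finally show ?thesis by (simp add: r[OF that] poly_sum)
   qed
   thus ?thesis by (intro exI allI impI)
  qed
  fix f f' assume "\<exists>p k. \<forall>t. poly D t ~= 0 --> poly p t = f (P t) * poly D t ^ k"
   "\<exists>p k. \<forall>t. poly D t ~= 0 --> poly p t = f' (P t) * poly D t ^ k"
  then obtain p k p' k' where pk: "\<forall>t. poly D t ~= 0 --> poly p t = f (P t) * poly D t ^ k"
   "\<forall>t. poly D t ~= 0 --> poly p' t = f' (P t) * poly D t ^ k'" by (elim exE)
  show "\<exists>p k. \<forall>t. poly D t ~= 0 --> poly p t = (\<lambda>M\<in>SL. f M + f' M) (P t) * poly D t ^ k"
   by (rule exI[of _ "p * D ^ k' + p' * D ^ k"], rule exI[of _ "k + k'"])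
    (simp add: PSL pk power_add algebra_simps)
  show "\<exists>p k. \<forall>t. poly D t ~= 0 --> poly p t = (\<lambda>M\<in>SL. f M * f' M) (P t) * poly D t ^ k"
   by (rule exI[of _ "p * p'"], rule exI[of _ "k + k'"]) (simp add: PSL pk power_add algebra_simps)
 qed auto
 obtain p0 k0 where p0: "\<forall>t. poly D t ~= 0 --> poly p0 t = f0 (P t) * poly D t ^ k0"
  using clear[OF f0(1)] by (elim exE)
 obtain p1 k1 where p1: "\<forall>t. poly D t ~= 0 --> poly p1 t = f1 (P t) * poly D t ^ k1"
  using clear[OF f1(1)] by (elim exE)
 have "poly p0 0 ~= 0" "poly p1 1 ~= 0" using spec[OF p0, of 0] spec[OF p1, of 1] D01 f0(2) f1(2) P01 by auto
 \<comment> \<open>The factors are nonzero because of their values at 0, 0 and 1. At a common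
   non-root the path lies in both open sets.\<close>
 hence "D * p0 * p1 ~= 0" using D01 by auto
 hence "finite {t. poly (D * p0 * p1) t = 0}" by (rule poly_roots_finite)
 from ex_new_if_finite[OF infinite_UNIV_char_0 this] obtain t where t: "poly (D * p0 * p1) t ~= 0"
  unfolding mem_Collect_eq by (elim exE)
 hence Dt: "poly D t ~= 0" and "f0 (P t) ~= 0" "f1 (P t) ~= 0" using spec[OF p0, of t] spec[OF p1, of t] by auto
 hence "P t \<in> E1" "P t \<in> E2" using f0(3) f1(3) PT[OF Dt] by (auto simp: triangular_grp_def)
 thus False using E(3) PT[OF Dt] by blast
qed

lemma closed_conn_solvable_triangular_grp: "closed_conn_solvable SL_grp SL_space (triangular_grp g h 0)"
 by (simp add: closed_conn_solvable_def subgroup_triangular_grp closedin_triangular_grp connectedin_triangular_grp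
   solvable_triangular_grp)

end

section \<open>Stable flags and conjugation into triangular form\<close>

lemma subspace_preimage: "vec.subspace U ==> vec.subspace {x. M *v x \<in> U}" for M :: "'k::field ^ 'n::finite ^ 'm::finite"
 by (auto simp: vec.subspace_def matrix_vector_right_distrib vector_scalar_commute)

text \<open>The next vector comes from the relative theorem, with \<open>U\<close> the span reached
  so far and \<open>W\<close> the whole space; the dimension leaves room as long as \<open>k\<close>
  is smaller than \<open>n\<close>.\<close>

lemma exists_stable_flag:
 fixes G :: "('k::{alg_closed_field, field_char_0} ^ 'n::finite ^ 'n) set"
 assumes G: "closed_conn_solvable SL_grp SL_space G" and k: "k \<le> CARD('n)"
 shows "\<exists>w. \<forall>i<k. w i \<notin> vec.span (w ` {..<i}) \<and> (\<forall>M\<in>G. M *v w i \<in> vec.span (w ` {..i}))"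
 using k
proof (induction k)
 case (Suc k)
 have sub: "subgroup G SL_grp" and conn: "connectedin (ftop SL_space) G" and solv: "solvable (SL_grp\<lparr>carrier := G\<rparr>)"
  using G by (auto simp: closed_conn_solvable_def)
 interpret H: group "SL_grp\<lparr>carrier := G\<rparr>" by (rule subgroup.subgroup_is_group[OF sub group_SL])
 obtain m where m: "(derived SL_grp ^^ m) G = {mat 1}"
  using solv unfolding H.solvable_iff_trivial_derived_seq using group.derived_seq_consistent[OF group_SL sub] by auto
 obtain w where w: "!!i. i < k ==> w i \<notin> vec.span (w ` {..<i})" "!!i M. i < k ==> M \<in> G ==> M *v w i \<in> vec.span (w ` {..i})"
  using Suc.IH Suc.prems by auto
 let ?U = "vec.span (w ` {..<k})"
 have stab: "M *v x \<in> ?U" if "M \<in> G" "x \<in> ?U" for M x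
 proof -
  have "?U \<subseteq> {x. M *v x \<in> ?U}"
  proof (rule vec.span_minimal[OF _ subspace_preimage[OF vec.subspace_span]])
   show "w ` {..<k} \<subseteq> {x. M *v x \<in> ?U}"
   proof clarify
    fix i assume "i < k"
    thus "M *v w i \<in> ?U" using w(2)[OF _ that(1), of i] vec.span_mono[of "w ` {..i}" "w ` {..<k}"] by fastforce
   qed
  qed
  thus ?thesis using that(2) by blast
 qed
 have "vec.dim ?U \<le> card (w ` {..<k})" by (rule vec.dim_le_card) auto
 also have "\<dots> \<le> k" using card_image_le[of "{..<k}" w] by simp
 finally have dim: "vec.dim ?U \<le> k" .
 have "?U ~= UNIV"
 proof
  assume "?U = UNIV"
  hence "vec.dim ?U = CARD('n)" by (simp only: vec_dim_card)
  thus False using dim Suc.prems by linarith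
 qed
 hence "?U \<subset> UNIV" by blast
 from lie_kolchin_relative[OF sub conn m vec.subspace_span stab vec.subspace_UNIV _ this]
 obtain v where v: "v \<notin> ?U" "!!M. M \<in> G ==> \<exists>l. M *v v - l *s v \<in> ?U" by auto
 define w' where "w' = w(k := v)"
 have im: "w' ` {..<i} = w ` {..<i}" if "i \<le> k" for i using that by (auto simp: w'_def)
 have im': "w' ` {..k} = insert v (w ` {..<k})"
 proof -
  have "{..k} = insert k {..<k}" by auto
  hence "w' ` {..k} = insert (w' k) (w' ` {..<k})" by (simp only: image_insert)
  thus ?thesis unfolding im[OF order_refl] by (simp add: w'_def)
 qed
 have "w' i \<notin> vec.span (w' ` {..<i}) \<and> (\<forall>M\<in>G. M *v w' i \<in> vec.span (w' ` {..i}))" if "i < Suc k" for i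
 proof (cases "i = k")
  case True
  have "M *v v \<in> vec.span (insert v (w ` {..<k}))" if "M \<in> G" for M
  proof -
   obtain l where "M *v v - l *s v \<in> ?U" using v(2)[OF \<open>M \<in> G\<close>] by blast
   thus ?thesis unfolding vec.span_insert by blast
  qed
  thus ?thesis using v(1) True im[of k] im' by (simp add: w'_def)
 next
  case False
  hence i: "i < k" using that by simp
  hence "w' i = w i" "w' ` {..i} = w ` {..i}" using im[of "Suc i"] by (auto simp: w'_def lessThan_Suc_atMost)
  thus ?thesis using w[OF i] im[of i] i by simp
 qed
 thus ?case by blast
qed simp

lemma exists_max_idx:
 fixes J :: "'n::finite set"
 assumes "j \<in> J" shows "\<exists>j\<in>J. \<forall>l\<in>J. idx l \<le> idx j"
 using ex_has_greatest_nat[of "\<lambda>j. j \<in> J" j idx "CARD('n)"] assms by auto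

lemma closed_conn_solvable_in_triangular:
 fixes G :: "('k::{alg_closed_field, field_char_0} ^ 'n::finite ^ 'n) set"
 assumes G: "closed_conn_solvable SL_grp SL_space G"
 shows "\<exists>g h. h ** g = mat 1 \<and> G \<subseteq> triangular_grp g h 0"
proof -
 obtain w where w: "!!i. i < CARD('n) ==> w i \<notin> vec.span (w ` {..<i})"
  "!!i M. i < CARD('n) ==> M \<in> G ==> M *v w i \<in> vec.span (w ` {..i})"
  using exists_stable_flag[OF G order_refl] by auto
 define g :: "'k ^ 'n ^ 'n" where "g = (\<chi> i j. w (idx j) $ i)"
 have col: "column j g = w (idx j)" for j by (simp add: column_def g_def vec_eq_iff)
 have ga: "g *v axis j 1 = w (idx j)" for j by (simp add: vec_eq_iff matrix_axis g_def)
 \<comment> \<open>In a relation, the vector of largest index with nonzero coefficient would lie in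
   the span of the earlier ones.\<close>
 have "\<forall>c. (\<Sum>j\<in>UNIV. c j *s column j g) = 0 --> (\<forall>j. c j = 0)"
 proof (intro allI impI, rule ccontr)
  fix c i assume sum: "(\<Sum>j\<in>UNIV. c j *s column j g) = 0" and "c i ~= 0"
  then obtain j where j: "c j ~= 0" "!!l. c l ~= 0 ==> idx l \<le> idx j"
   using exists_max_idx[of i "{j. c j ~= 0}"] by auto
  have "(\<Sum>l\<in>UNIV. c l *s column l g) = c j *s w (idx j) + (\<Sum>l\<in>UNIV - {j}. c l *s column l g)"
   by (subst sum.remove[of _ j]) (simp_all add: col)
  hence "c j *s w (idx j) = - (\<Sum>l\<in>UNIV - {j}. c l *s column l g)" using sum by (simp add: eq_neg_iff_add_eq_0)
  moreover have "c l *s column l g \<in> vec.span (w ` {..<idx j})" if "l \<in> UNIV - {j}" for l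
  proof (cases "c l = 0")
   case False
   hence "idx l < idx j" using j(2)[OF False] that by (simp add: order.strict_iff_order)
   thus ?thesis unfolding col by (intro vec.span_scale vec.span_base) auto
  qed (simp add: vec.span_zero)
  hence "- (\<Sum>l\<in>UNIV - {j}. c l *s column l g) \<in> vec.span (w ` {..<idx j})"
   by (intro vec.span_neg vec.span_sum)
  ultimately have "c j *s w (idx j) \<in> vec.span (w ` {..<idx j})" by (simp only:)
  hence "inverse (c j) *s (c j *s w (idx j)) \<in> vec.span (w ` {..<idx j})" by (rule vec.span_scale)
  moreover have "inverse (c j) *s (c j *s w (idx j)) = w (idx j)" using j(1) by simp
  ultimately show False using w(1)[OF idx_less] by simp
 qed
 then obtain h :: "'k ^ 'n ^ 'n" where hg: "h ** g = mat 1" unfolding matrix_left_invertible_independent_columns[symmetric] by blast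
 have hw: "h *v w (idx j) = axis j 1" for j unfolding ga[symmetric] by (simp add: matrix_vector_mul_assoc hg)
 have "M \<in> triangular_grp g h 0" if M: "M \<in> G" for M
 proof -
  have "det M = 1" using G M subgroup.subset[of G SL_grp] by (auto simp: closed_conn_solvable_def)
  moreover have "(h ** M ** g) $ i $ j = 0" if ij: "idx j < idx i" for i j
  proof -
   have "w ` {..idx j} \<subseteq> {x. h *v x \<in> std_flag (Suc (idx j))}"
   proof clarify
    fix k assume k: "k \<le> idx j"
    then obtain l :: 'n where l: "idx l = k" using idx_surj[of k] le_less_trans[OF k idx_less] by blast
    show "h *v w k \<in> std_flag (Suc (idx j))" unfolding l[symmetric] hw axis_std_flag using k l by simp
   qed
   hence "vec.span (w ` {..idx j}) \<subseteq> {x. h *v x \<in> std_flag (Suc (idx j))}"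
    by (rule vec.span_minimal[OF _ subspace_preimage[OF subspace_std_flag]])
   hence "h *v (M *v w (idx j)) \<in> std_flag (Suc (idx j))" using w(2)[OF idx_less M] by blast
   hence "(h *v (M *v (g *v axis j 1))) $ i = 0" using ij unfolding ga std_flag_def by simp
   thus ?thesis by (simp add: matrix_vector_mul_assoc matrix_axis matrix_mul_assoc)
  qed
  ultimately show ?thesis by (simp add: triangular_grp_def lev_0 upper_triangular_def)
 qed
 thus ?thesis using hg by blast
qed

lemma Borel_subgroup_triangular:
 fixes B :: "('k::{alg_closed_field, field_char_0} ^ 'n::finite ^ 'n) set"
 assumes "Borel_subgroup SL_grp SL_space B"
 shows "\<exists>g h. h ** g = mat 1 \<and> B = triangular_grp g h 0"
proof -
 have B: "closed_conn_solvable SL_grp SL_space B"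
  and max: "!!B'. closed_conn_solvable SL_grp SL_space B' ==> B \<subseteq> B' ==> B' = B"
  using assms by (auto simp: Borel_subgroup_def)
 obtain g h :: "'k ^ 'n ^ 'n" where gh: "h ** g = mat 1" "B \<subseteq> triangular_grp g h 0"
  using closed_conn_solvable_in_triangular[OF B] by blast
 thus ?thesis using max[OF closed_conn_solvable_triangular_grp[OF gh(1)] gh(2)] by blast
qed

section \<open>The standard Borel subgroup\<close>

abbreviation std_Borel :: "('k::field ^ 'n::finite ^ 'n) set" where
 "std_Borel \<equiv> triangular_grp (mat 1) (mat 1) 0"

lemma std_Borel_iff: "M \<in> std_Borel \<longleftrightarrow> det M = 1 \<and> upper_triangular M" for M :: "'k::field ^ 'n::finite ^ 'n"
 by (simp add: triangular_grp_def lev_0)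

lemma transvection:
 fixes i j :: "'n::finite"
 assumes "idx i < idx j"
 shows "\<exists>M\<in>std_Borel. \<forall>x::'k::field ^ 'n. M *v x = x + x $ j *s axis i 1"
proof -
 define M :: "'k ^ 'n ^ 'n" where "M = (\<chi> k. if k = i then row i (mat 1) + 1 *s row j (mat 1) else row k (mat 1))"
 have entry: "M $ a $ b = (if a = b then 1 else 0) + (if a = i \<and> b = j then 1 else 0)" for a b
  by (simp add: M_def row_def mat_def)
 have "(M *v x) $ a = (x + x $ j *s axis i 1) $ a" for x a
 proof -
  have "(M *v x) $ a = (\<Sum>b\<in>UNIV. M $ a $ b * x $ b)" by (simp add: matrix_vector_mult_def)
  also have "\<dots> = (\<Sum>b\<in>UNIV. (if b = a then x $ a else 0) + (if b = j then (if a = i then x $ j else 0) else 0))"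
   unfolding entry by (intro sum.cong) (auto simp: distrib_right)
  finally show ?thesis by (simp add: sum.distrib axis_def)
 qed
 hence "\<forall>x. M *v x = x + x $ j *s axis i 1" unfolding vec_eq_iff by (intro allI)
 moreover have "det M = 1" using det_row_operation[of i j "mat 1" 1] assms unfolding M_def by auto
 moreover have "upper_triangular M" unfolding upper_triangular_def entry using assms by auto
 ultimately show ?thesis unfolding std_Borel_iff by (intro bexI[of _ M] CollectI conjI) (simp_all add: std_Borel_iff)
qed

text \<open>Let \<open>j\<close> be the largest index of a coordinate that is nonzero somewhere on
  \<open>W\<close>. Transvections produce the unit vectors of smaller index, and subtracting these
  from the vector leaves the one of index \<open>j\<close>.\<close>

lemma std_Borel_stable_subspace:
 fixes W :: "('k::field ^ 'n::finite) set"
 assumes W: "vec.subspace W" and stab: "!!M x. M \<in> std_Borel ==> x \<in> W ==> M *v x \<in> W"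
 shows "\<exists>k\<le>CARD('n). W = std_flag k"
proof (cases "W \<subseteq> {0}")
 case True
 hence "W = std_flag 0" using vec.subspace_0[OF W] std_flag_0 by auto
 thus ?thesis by blast
next
 case False
 then obtain x0 where x0: "x0 \<in> W" "x0 ~= 0" by blast
 then obtain i where "x0 $ i ~= 0" by (auto simp: vec_eq_iff)
 then obtain j where j: "\<exists>x\<in>W. x $ j ~= 0" and max: "!!l x. x \<in> W ==> x $ l ~= 0 ==> idx l \<le> idx j"
  using exists_max_idx[of i "{j. \<exists>x\<in>W. x $ j ~= 0}"] x0(1) by blast
 obtain x where x: "x \<in> W" "x $ j ~= 0" using j by blast
 have axl: "axis l 1 \<in> W" if lj: "idx l < idx j" for l
 proof -
  obtain M where M: "M \<in> std_Borel" "\<forall>x::'k ^ 'n. M *v x = x + x $ j *s axis l 1" using transvection[OF lj] by (elim bexE)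
  have "(M *v x) - x \<in> W" using stab[OF M(1) x(1)] x(1) by (rule vec.subspace_diff[OF W])
  hence "x $ j *s axis l 1 \<in> W" using M(2) by simp
  hence "inverse (x $ j) *s (x $ j *s axis l 1) \<in> W" by (rule vec.subspace_scale[OF W])
  thus ?thesis using x(2) by simp
 qed
 have zero: "x $ l *s axis l 1 \<in> W" if "l \<in> UNIV - {j}" for l
 proof (cases "idx l < idx j")
  case True
  thus ?thesis by (intro vec.subspace_scale[OF W] axl)
 next
  case False
  hence "x $ l = 0" using max[OF x(1), of l] that by (metis Diff_iff idx_eq_iff insertI1 le_neq_implies_less)
  thus ?thesis using vec.subspace_0[OF W] by simp
 qed
 have "x = x $ j *s axis j 1 + (\<Sum>l\<in>UNIV - {j}. x $ l *s axis l 1)"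
  by (subst (1) basis_expansion[of x, symmetric], subst sum.remove[of _ j]) simp_all
 hence "x $ j *s axis j 1 = x - (\<Sum>l\<in>UNIV - {j}. x $ l *s axis l 1)" by (simp add: algebra_simps)
 also have "\<dots> \<in> W" by (intro vec.subspace_diff[OF W x(1)] vec.subspace_sum[OF W] zero)
 finally have "inverse (x $ j) *s (x $ j *s axis j 1) \<in> W" by (rule vec.subspace_scale[OF W])
 hence axj: "axis j 1 \<in> W" using x(2) by simp
 have "W = std_flag (Suc (idx j))"
 proof
  show "W \<subseteq> std_flag (Suc (idx j))" using max by (force simp: std_flag_def)
  show "std_flag (Suc (idx j)) \<subseteq> W"
  proof
   fix y :: "'k ^ 'n" assume y: "y \<in> std_flag (Suc (idx j))"
   have "y $ l *s axis l 1 \<in> W" for l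
   proof (cases "idx l" "idx j" rule: linorder_cases)
    case less
    thus ?thesis by (intro vec.subspace_scale[OF W] axl)
   next
    case equal
    thus ?thesis using vec.subspace_scale[OF W axj] by simp
   next
    case greater
    hence "y $ l = 0" using y by (simp add: std_flag_def)
    thus ?thesis using vec.subspace_0[OF W] by simp
   qed
   hence "(\<Sum>l\<in>UNIV. y $ l *s axis l 1) \<in> W" by (intro vec.subspace_sum[OF W])
   thus "y \<in> W" by (simp only: basis_expansion)
  qed
 qed
 thus ?thesis using idx_less[of j] by (intro exI[of _ "Suc (idx j)"]) (simp add: Suc_le_eq)
qed

text \<open>The flag fixed by the larger group is stable under the standard one, so its members are
  members of the standard flag. Being strictly increasing, it is the standard flag.\<close>

lemma triangular_grp_eq_std_Borel:
 fixes g h :: "'k::{alg_closed_field, field_char_0} ^ 'n::finite ^ 'n"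
 assumes hg: "h ** g = mat 1" and sub: "std_Borel \<subseteq> triangular_grp g h 0"
 shows "triangular_grp g h 0 \<subseteq> std_Borel"
proof -
 have gh: "g ** h = mat 1" by (rule matrix_right_inverse_of_left[OF hg])
 define F where "F k = {x. h *v x \<in> std_flag k}" for k
 have Fs: "M *v x \<in> F k" if "M \<in> triangular_grp g h 0" "x \<in> F k" for M x k
 proof -
  have "lev 0 (h ** M ** g)" using that by (simp add: triangular_grp_def)
  hence "(h ** M ** g) *v (h *v x) \<in> std_flag k" using that(2) by (intro lev_stable[of 0 "h ** M ** g"]) (simp_all add: F_def)
  moreover have "(h ** M ** g) *v (h *v x) = h *v (M *v ((g ** h) *v x))" by (simp add: matrix_vector_mul_assoc matrix_mul_assoc)
  ultimately show ?thesis by (simp add: F_def gh)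
 qed
 have "\<exists>k'\<le>CARD('n). F k = std_flag k'" for k
 proof (rule std_Borel_stable_subspace)
  show "vec.subspace (F k)" unfolding F_def by (rule subspace_preimage[OF subspace_std_flag])
 qed (use Fs sub in blast)
 then obtain \<kappa> where \<kappa>: "!!k. \<kappa> k \<le> CARD('n)" "!!k. F k = std_flag (\<kappa> k)" by metis
 have strict: "\<kappa> k < \<kappa> (Suc k)" if k: "k < CARD('n)" for k
 proof (rule ccontr)
  assume "\<not> \<kappa> k < \<kappa> (Suc k)"
  hence "F (Suc k) \<subseteq> F k" unfolding \<kappa> using std_flag_mono by (meson not_less subsetI)
  moreover obtain l :: 'n where l: "idx l = k" using idx_surj[OF k] by blast
  have "h *v (g *v axis l 1) = axis l 1" by (simp add: matrix_vector_mul_assoc hg)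
  hence "g *v axis l 1 \<in> F (Suc k)" "g *v axis l 1 \<notin> F k" using l by (simp_all add: F_def axis_std_flag)
  ultimately show False by blast
 qed
 \<comment> \<open>A strictly increasing map of \<open>0, ..., n\<close> into itself is the
   identity: counting up from 0 bounds it below, counting down from \<open>n\<close> bounds it
   above.\<close>
 have lower: "k \<le> CARD('n) ==> k \<le> \<kappa> k" for k
 proof (induction k)
  case (Suc k)
  thus ?case using strict[of k] by simp
 qed simp
 have upper: "j \<le> CARD('n) ==> \<kappa> (CARD('n) - j) + j \<le> CARD('n)" for j
 proof (induction j)
  case (Suc j)
  thus ?case using strict[of "CARD('n) - Suc j"] by (simp add: Suc_diff_Suc)
 qed (simp add: \<kappa>(1))
 have F: "F k = std_flag k" if "k \<le> CARD('n)" for k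
 proof -
  have "CARD('n) - (CARD('n) - k) = k" using that by simp
  hence "\<kappa> k + (CARD('n) - k) \<le> CARD('n)" using upper[of "CARD('n) - k"] by (simp only: diff_le_self)
  hence "\<kappa> k = k" using lower[OF that] that by linarith
  thus ?thesis using \<kappa>(2)[of k] by simp
 qed
 have "upper_triangular M" if M: "M \<in> triangular_grp g h 0" for M
  unfolding upper_triangular_iff
 proof (intro allI ballI)
  fix k and x :: "'k ^ 'n" assume x: "x \<in> std_flag k"
  show "M *v x \<in> std_flag k"
  proof (cases "k \<le> CARD('n)")
   case True
   thus ?thesis using Fs[OF M, of x k] x F by simp
  next
   case False
   thus ?thesis by (intro std_flag_mono[OF std_flag_top]) simp
  qed
 qed
 moreover have "det M = 1" if "M \<in> triangular_grp g h 0" for M using that by (simp add: triangular_grp_def)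
 ultimately show ?thesis by (simp add: std_Borel_iff subset_iff)
qed

lemma Borel_std_Borel: "Borel_subgroup SL_grp SL_space (std_Borel :: ('k::{alg_closed_field, field_char_0} ^ 'n::finite ^ 'n) set)"
 unfolding Borel_subgroup_def
proof (intro conjI allI impI)
 show "closed_conn_solvable SL_grp SL_space (std_Borel :: ('k ^ 'n ^ 'n) set)"
  by (rule closed_conn_solvable_triangular_grp) simp
 fix B' :: "('k ^ 'n ^ 'n) set" assume B': "closed_conn_solvable SL_grp SL_space B' \<and> std_Borel \<subseteq> B'"
 then obtain g h where gh: "h ** g = mat 1" "B' \<subseteq> triangular_grp g h 0" using closed_conn_solvable_in_triangular by blast
 thus "B' = std_Borel" using triangular_grp_eq_std_Borel[OF gh(1)] B' by blast
qed

section \<open>The last coordinate and the open orbit\<close>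

definition last_idx :: "'n::finite" where
 "last_idx = (SOME i. idx i = CARD('n) - 1)"

lemma idx_last: "idx (last_idx :: 'n::finite) = CARD('n) - 1"
 unfolding last_idx_def by (rule someI_ex[OF idx_surj]) simp

text \<open>A unipotent-like matrix with prescribed last column has the last coordinate of that
  column as its determinant. Rescaling the first row, which differs from the last as
  \<open>n \<ge> 2\<close>, corrects this.\<close>

lemma std_Borel_orbit:
 fixes x :: "'k::field ^ 'n::finite"
 assumes x: "x $ last_idx ~= 0" and n: "2 \<le> CARD('n)"
 shows "\<exists>M\<in>std_Borel. M *v axis last_idx 1 = x"
proof -
 let ?l = "last_idx :: 'n"
 obtain j :: 'n where j: "idx j = 0" using idx_surj[of 0] n by auto
 have jl: "j ~= ?l" using j idx_last[where 'n = 'n] n by auto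
 \<comment> \<open>The first coordinate is multiplied in advance by the factor that the rescaling of
   the row removes.\<close>
 define x' where "x' = (\<chi> i. if i = j then x $ j * x $ ?l else x $ i)"
 define N :: "'k ^ 'n ^ 'n" where "N = (\<chi> a b. if b = ?l then (mat 1 *v x') $ a else mat 1 $ a $ b)"
 define M where "M = (\<chi> a. if a = j then inverse (x $ ?l) *s (N $ a) else N $ a)"
 have "det N = x' $ ?l * det (mat 1 :: 'k ^ 'n ^ 'n)" unfolding N_def by (rule cramer_lemma)
 hence "det N = x $ ?l" using jl by (simp add: x'_def)
 moreover have "det M = inverse (x $ ?l) * det N" unfolding M_def det_row_mul by simp
 ultimately have "det M = 1" using x by simp
 moreover have "upper_triangular M"
  unfolding upper_triangular_def
 proof (intro allI impI)
  fix a b :: 'n assume ab: "idx b < idx a"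
  have "b ~= ?l"
  proof
   assume "b = ?l"
   hence "idx b = CARD('n) - 1" by (simp only: idx_last)
   thus False using ab idx_less[of a] by linarith
  qed
  thus "M $ a $ b = 0" using ab by (auto simp: M_def N_def mat_def)
 qed
 moreover have "M *v axis ?l 1 = x"
  using x by (auto simp: vec_eq_iff matrix_axis M_def N_def x'_def)
 ultimately show ?thesis by (auto simp: std_Borel_iff)
qed

text \<open>
 The linear form whose \<open>d\<close>-th power is the semi-invariant distinguishing the weight monoids.
\<close>

definition last_form :: "'k::field ^ 'n::finite ^ 'n => 'k ^ 'n => 'k" where
 "last_form h x = (h *v x) $ last_idx"

context
 fixes g h :: "'k::field ^ 'n::finite ^ 'n"
 assumes hg: "h ** g = mat 1"
begin

lemma last_form_base: "last_form h (g *v axis last_idx 1) = 1"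
 by (simp add: last_form_def matrix_vector_mul_assoc hg axis_def)

text \<open>In the basis of columns of \<open>g\<close> the matrix is upper triangular, so its last
  row consists of a diagonal entry only; that entry is the value of the form at the image of the
  last basis vector.\<close>

lemma last_form_semi_invariant:
 assumes M: "M \<in> triangular_grp g h 0"
 shows "last_form h (M *v x) = last_form h (M *v (g *v axis last_idx 1)) * last_form h x"
proof -
 have gh: "g ** h = mat 1" by (rule matrix_right_inverse_of_left[OF hg])
 have l: "lev 0 (h ** M ** g)" using M by (simp add: triangular_grp_def)
 have "y \<in> std_flag (Suc (idx (last_idx :: 'n)))" for y :: "'k ^ 'n"
  using std_flag_top[of y] by (simp add: idx_last)
 hence t: "last_form h (M *v (g *v y)) = (h ** M ** g) $ last_idx $ last_idx * y $ last_idx" for y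
  using triangular_diagonal[OF l, of y last_idx] by (simp add: last_form_def matrix_vector_mul_assoc matrix_mul_assoc)
 have "x = g *v (h *v x)" by (simp add: matrix_vector_mul_assoc gh)
 thus ?thesis using t[of "h *v x"] t[of "axis last_idx 1"] by (simp add: last_form_def axis_def)
qed

lemma triangular_orbit:
 assumes x: "last_form h x ~= 0" and n: "2 \<le> CARD('n)"
 shows "\<exists>M\<in>triangular_grp g h 0. M *v (g *v axis last_idx 1) = x"
proof -
 have gh: "g ** h = mat 1" by (rule matrix_right_inverse_of_left[OF hg])
 obtain N where N: "N \<in> std_Borel" "N *v axis last_idx 1 = h *v x"
  using std_Borel_orbit[of "h *v x"] x n unfolding last_form_def by blast
 have d: "det h * det g = 1" unfolding det_mul[symmetric] hg by simp
 have "h ** (g ** N ** h) ** g = (h ** g) ** N ** (h ** g)" by (simp only: matrix_mul_assoc)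
 hence "h ** (g ** N ** h) ** g = N" by (simp add: hg)
 hence "g ** N ** h \<in> triangular_grp g h 0" using N(1) d by (simp add: triangular_grp_def lev_0 std_Borel_iff det_mul mult.commute)
 moreover have "(g ** N ** h) *v (g *v axis last_idx 1) = x"
 proof -
  have "(g ** N ** h) *v (g *v axis last_idx 1) = g *v (N *v ((h ** g) *v axis last_idx 1))"
   by (simp add: matrix_vector_mul_assoc matrix_mul_assoc)
  thus ?thesis by (simp add: hg N(2) matrix_vector_mul_assoc gh)
 qed
 ultimately show ?thesis by blast
qed

end

section \<open>The action of the special linear group\<close>

lemma degree_le_matrix:
 assumes "f \<in> polys" "degree_le f D" shows "degree_le (\<lambda>x. f (M *v x)) D"
 using assms by (simp add: degree_le_def hcomp_matrix)

context graded_ring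
begin

text \<open>For \<open>s = 0\<close> this is \<open>SL_action d\<close>; the same formula on the
  smaller ring gives the action that makes \<open>eta_map\<close> equivariant.\<close>

definition act :: "'k ^ 'n ^ 'n => (('k ^ 'n => 'k) => 'k) => (('k ^ 'n => 'k) => 'k)" where
 "act M = (\<lambda>p\<in>range ev. \<lambda>f\<in>S. p (\<lambda>x. f (M *v x)))"

lemma act_ev [simp]: "act M (ev x) = ev (M *v x)"
 by (auto simp: act_def ev_def matrix restrict_def fun_eq_iff)

lemma group_action_act: "group_action SL_grp (pts Z) act"
proof -
 have b: "bij_betw (act M) (range ev) (range ev)" if "det M = 1" for M
  by (rule bij_betw_byWitness[of _ "act (SL_inv M)"]) (use that in auto)
 have B: "act M \<in> Bij (range ev)" if "det M = 1" for M
  using b[OF that] by (simp add: Bij_def act_def)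
 have "group_hom SL_grp (BijGroup (range ev)) act"
  unfolding group_hom_def group_hom_axioms_def hom_def
 proof (intro conjI CollectI ballI funcsetI group_SL group_BijGroup)
  show "act M \<in> carrier (BijGroup (range ev))" if "M \<in> carrier SL_grp" for M
   using B that by (simp add: BijGroup_def)
  fix M N :: "'k ^ 'n ^ 'n" assume MN: "M \<in> carrier SL_grp" "N \<in> carrier SL_grp"
  have "act (M ** N) = compose (range ev) (act M) (act N)"
  proof (rule extensionalityI[of _ "range ev"])
   fix p assume "p \<in> range ev"
   thus "act (M ** N) p = compose (range ev) (act M) (act N) p"
    by (auto simp: compose_def matrix_vector_mul_assoc)
  qed (simp_all add: act_def)
  thus "act (M \<otimes>\<^bsub>SL_grp\<^esub> N) = act M \<otimes>\<^bsub>BijGroup (range ev)\<^esub> act N"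
   using MN B by (simp add: BijGroup_def)
 qed
 thus ?thesis by (simp add: group_action_def pts_A_var)
qed

lemma regular_action_act: "regular_action SL_grp SL_space Z act"
 unfolding regular_action_def
proof (intro conjI group_action_act)
 show "morph (fprod SL_space Z) Z (\<lambda>(M, p). act M p)"
 proof (rule action_morphI[OF fun_space_SL, of _ "\<lambda>M x. M *v x"])
  show "(\<lambda>x. f (M *v x)) \<in> S" if "f \<in> S" for f and M :: "'k ^ 'n ^ 'n" by (rule matrix[OF that])
  show "(\<lambda>M\<in>pts SL_space. f (M *v x)) \<in> coord_ring SL_space" if "f \<in> S" for f x
  proof -
   have "(\<lambda>M\<in>SL. f (\<chi> i. (\<lambda>M\<in>SL. (M *v x) $ i) M)) \<in> coord_ring (SL_space :: ('k ^ 'n ^ 'n, 'k) fspace)"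
    by (rule polys_subst[OF polys[OF that] subalg_coord_SL])
     (rule subalg_matrix_vector_mult[OF subalg_coord_SL coord_SL_entry])
   also have "(\<lambda>M\<in>SL. f (\<chi> i. (\<lambda>M\<in>SL. (M *v x) $ i) M)) = (\<lambda>M\<in>SL. f (M *v x))" by (intro restrict_ext) simp
   finally show ?thesis by (simp only: pts_SL)
  qed
  show "\<exists>V0 D. openin (ftop SL_space) V0 \<and> v0 \<in> V0 \<and> (\<forall>M\<in>V0. degree_le (\<lambda>x. f (M *v x)) D)"
   if f: "f \<in> S" and v0: "v0 \<in> pts SL_space" for f and v0 :: "'k ^ 'n ^ 'n"
  proof -
   obtain D where D: "degree_le f D" by (rule degree_le_exists[OF polys[OF f]])
   have "\<forall>M\<in>pts SL_space. degree_le (\<lambda>x. f (M *v x)) D" by (intro ballI degree_le_matrix[OF polys[OF f] D])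
   with v0 show ?thesis by (intro exI[of _ "pts SL_space"] exI[of _ D] conjI openin_topspace)
  qed
 qed simp
qed

text \<open>The orbit of the last unit vector is the set where the last coordinate is nonzero; in an
  irreducible space a nonempty open set is dense.\<close>

lemma open_dense_Borel_orbit:
 assumes n: "2 \<le> CARD('n)" and s: "s = 0"
 shows "has_open_dense_Borel_orbit SL_grp SL_space Z act"
proof -
 let ?l = "last_idx :: 'n"
 let ?e = "axis ?l 1 :: 'k ^ 'n"
 let ?O = "orbit (SL_grp\<lparr>carrier := std_Borel\<rparr>) act (ev ?e)"
 have u: "(\<lambda>x. x $ ?l ^ d) \<in> S" by (rule coord_power) (simp add: admissible_def s)
 have "M *v ?e \<in> {x. x $ ?l ^ d ~= 0}" if M: "M \<in> std_Borel" for M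
 proof -
  have M': "det M = 1" "upper_triangular M" using M by (auto simp: std_Borel_iff)
  have "(M *v ?e) $ ?l ~= 0"
  proof
   assume z: "(M *v ?e) $ ?l = 0"
   \<comment> \<open>If the last coordinate vanished, the image would lie in the previous step of
     the flag, which the inverse of \<open>M\<close> stabilizes; but the last unit vector does not
     lie there.\<close>
   have "M *v ?e \<in> std_flag (idx ?l)"
    unfolding std_flag_def
   proof (intro CollectI allI impI)
    fix j :: 'n assume "idx ?l \<le> idx j"
    hence "idx j = idx ?l" using idx_less[of j] unfolding idx_last by linarith
    thus "(M *v ?e) $ j = 0" using z by simp
   qed
   moreover have "SL_inv M \<in> std_Borel"
    using SL_subgroup(4)[OF subgroup_triangular_grp M] by simp
   ultimately have "SL_inv M *v (M *v ?e) \<in> std_flag (idx ?l)"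
    unfolding std_Borel_iff upper_triangular_iff by blast
   thus False using M'(1) by (simp add: axis_std_flag)
  qed
  thus ?thesis by simp
 qed
 moreover have "\<exists>M\<in>std_Borel. x = M *v ?e" if "x \<in> {x. x $ ?l ^ d ~= 0}" for x
  using std_Borel_orbit[of x] that n d_pos by fastforce
 ultimately have "(\<lambda>M. M *v ?e) ` std_Borel = {x. x $ ?l ^ d ~= 0}" by blast
 moreover have "?O = ev ` (\<lambda>M. M *v ?e) ` std_Borel" by (auto simp: orbit_def)
 ultimately have O: "?O = ev ` {x. x $ ?l ^ d ~= 0}" by simp
 have o: "openin (ftop Z) ?O" unfolding O by (rule openin_A_var_nonzero[OF u])
 have "ev ?e \<in> ?O" unfolding O by (intro imageI) (simp add: axis_def)
 hence "ftop Z closure_of ?O = pts Z"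
  unfolding dense_intersects_open using irreducible_A_var o unfolding irreducible_space_def by blast
 thus ?thesis
  unfolding has_open_dense_Borel_orbit_def using Borel_std_Borel o
  by (intro exI[of _ std_Borel] conjI bexI[of _ "ev ?e"]) (simp_all add: pts_A_var)
qed

text \<open>The invariants \<open>x i ^ (d - 1) * x j\<close>, evaluated at unit vectors and at the
  vector of ones, force a matrix acting trivially to be a scalar \<open>z\<close> with
  \<open>z ^ d = 1\<close>. The determinant gives \<open>z ^ n = 1\<close>, so coprimality leaves
  only 1.\<close>

lemma faithful_act:
 assumes co: "coprime CARD('n) d" and s: "s = 0"
 shows "faithful_action SL_grp (pts Z) act"
proof -
 have id: "P = mat 1" if P: "det P = 1" "!!x. ev (P *v x) = ev x" for P :: "'k ^ 'n ^ 'n"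
 proof -
  have inv: "(P *v x) $ i ^ (d - 1) * (P *v x) $ j = x $ i ^ (d - 1) * x $ j" for x i j
  proof -
   have "(\<lambda>x :: 'k ^ 'n. x $ i ^ (d - 1) * x $ j) \<in> S"
   proof (rule homogI[where m = d])
    show "(\<lambda>x :: 'k ^ 'n. x $ i ^ (d - 1) * x $ j) \<in> polys" by (intro polys_mult polys_power polys_coord)
   qed (use d_pos s in "auto simp: admissible_def power_mult_distrib power_eq_if[of _ d]")
   thus ?thesis using P(2)[of x] unfolding ev_eq_iff by (rule bspec[rotated])
  qed
  have pow: "y ^ (d - 1) * y = y ^ d" for y :: 'k using d_pos by (simp add: power_eq_if)
  have off: "P $ i $ j = 0" if "i ~= j" for i j
   using inv[of "axis j 1" i i] that unfolding pow matrix_axis by (simp add: axis_def zero_power[OF d_pos] d_pos)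
  have diag: "P $ i $ i ^ d = 1" for i
   using inv[of "axis i 1" i i] unfolding pow matrix_axis by (simp add: axis_def)
  define u :: "'k ^ 'n" where "u = (\<chi> i. 1)"
  have Pu: "(P *v u) $ i = P $ i $ i" for i
  proof -
   have "(P *v u) $ i = (\<Sum>j\<in>UNIV. P $ i $ j * u $ j)" by (simp add: matrix_vector_mult_def)
   also have "\<dots> = (\<Sum>j\<in>UNIV. if j = i then P $ i $ i else 0)"
    by (intro sum.cong) (use off in "auto simp: u_def")
   finally show ?thesis by simp
  qed
  have eq: "P $ j $ j = P $ i $ i" for i j
  proof -
   have "P $ i $ i ^ (d - 1) * P $ j $ j = P $ i $ i ^ (d - 1) * P $ i $ i"
    using inv[of u i j] inv[of u i i] unfolding Pu by (simp add: u_def)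
   moreover have "P $ i $ i ~= 0" using diag[of i] by (auto simp: zero_power[OF d_pos])
   ultimately show ?thesis by simp
  qed
  define z where "z = P $ undefined $ undefined"
  have "det P = (\<Prod>i\<in>UNIV. P $ i $ i)" by (rule det_diagonal) (rule off)
  also have "\<dots> = (\<Prod>i\<in>(UNIV :: 'n set). z)" unfolding z_def by (intro prod.cong refl eq)
  finally have zn: "z ^ CARD('n) = 1" using P(1) by simp
  have zd: "z ^ d = 1" by (simp add: z_def diag)
  obtain a b where "CARD('n) * a = d * b + 1"
   using bezout_nat[of "CARD('n)" d] co by (auto simp: coprime_iff_gcd_eq_1)
  hence "z ^ (CARD('n) * a) = z ^ (d * b + 1)" by simp
  hence "z = 1" by (simp add: power_mult power_add zn zd)
  hence "P $ i $ j = mat 1 $ i $ j" for i j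
   using off[of i j] eq[of i undefined] by (auto simp: z_def mat_def)
  thus ?thesis by (simp add: vec_eq_iff)
 qed
 have "inj_on act SL"
 proof (rule inj_onI)
  fix M N :: "'k ^ 'n ^ 'n" assume MN: "M \<in> SL" "N \<in> SL" "act M = act N"
  hence d: "det M = 1" "det N = 1" by auto
  have "ev (M *v x) = ev (N *v x)" for x using arg_cong[OF MN(3), of "\<lambda>f. f (ev x)"] by simp
  hence "act (SL_inv N) (ev (M *v x)) = act (SL_inv N) (ev (N *v x))" for x by simp
  hence "ev ((SL_inv N ** M) *v x) = ev x" for x using d by (simp add: matrix_vector_mul_assoc SL_inv)
  moreover have "det (SL_inv N ** M) = 1" using d by (simp add: det_mul SL_inv)
  ultimately have "SL_inv N ** M = mat 1" by (intro id)
  hence "N ** (SL_inv N ** M) = N" by simp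
  thus "M = N" using d by (simp add: matrix_mul_assoc SL_inv)
 qed
 thus ?thesis
  unfolding faithful_action_def faithful_action_axioms_def using group_action_act by simp
qed

end

section \<open>Weights\<close>

context
 fixes g h :: "'k::{alg_closed_field, field_char_0} ^ 'n::finite ^ 'n" and B and d :: nat
 assumes hg: "h ** g = mat 1" and B: "B = triangular_grp g h 0"
begin

text \<open>The form is 1 at the base vector, so its value at the image of this vector is the factor
  by which \<open>M\<close> multiplies the form.\<close>

definition last_char :: "'k ^ 'n ^ 'n => 'k" where
 "last_char M = last_form h (M *v (g *v axis last_idx 1))"

text \<open>The inverse reflects the action on functions, which goes through the inverse group
  element; the exponent \<open>d\<close> makes the power of the form an invariant of the roots of
  unity.\<close>

definition last_weight :: "'k ^ 'n ^ 'n => 'k" where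
 "last_weight = (\<lambda>M\<in>B. last_char (SL_inv M) ^ d)"

lemma subgroup_B: "subgroup B SL_grp"
 unfolding B by (rule subgroup_triangular_grp[OF hg])

lemma last_char_mult: "M \<in> B ==> last_char (M ** N) = last_char M * last_char N"
 using last_form_semi_invariant[OF hg, of M "N *v (g *v axis last_idx 1)"]
 by (simp add: last_char_def B matrix_vector_mul_assoc matrix_mul_assoc)

lemma last_char_inverse:
 assumes "M \<in> B" shows "last_char (SL_inv M) * last_char M = 1"
proof -
 have "last_char (SL_inv M ** M) = 1"
  using SL_subgroup(1)[OF subgroup_B assms] last_form_base[OF hg] by (simp add: SL_inv last_char_def)
 thus ?thesis using last_char_mult[OF SL_subgroup(4)[OF subgroup_B assms]] by simp
qed

lemma last_weight_in_characters: "last_weight \<in> characters SL_grp SL_space B"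
proof -
 interpret SL: group "SL_grp :: ('k ^ 'n ^ 'n) monoid" by (rule group_SL)
 note Bs = SL_subgroup[OF subgroup_B]
 let ?X = "induced SL_space B"
 have X: "fun_space ?X" by (rule fun_space_induced[OF fun_space_SL])
 have BSL: "SL \<inter> B = B" using Bs(1) by blast
 have pX: "pts ?X = B" using pts_induced[OF fun_space_SL, of B] by (simp add: pts_SL BSL)
 have S: "subalg B (coord_ring ?X)" using fun_space_subalg[OF X openin_topspace] by (simp only: pX)
 have res: "restrict f B \<in> coord_ring ?X" if "(\<lambda>M\<in>SL. f M) \<in> coord_ring SL_space" for f
 proof -
  have "restrict (\<lambda>M\<in>SL. f M) (pts SL_space \<inter> B) \<in> freg ?X (pts SL_space \<inter> B)"
   by (rule freg_induced_restrict[OF fun_space_SL that])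
  thus ?thesis unfolding pts_SL restrict_restrict Int_assoc[symmetric] Int_absorb BSL pX .
 qed
 have "(\<lambda>M\<in>SL. ((h ** M) *v (g *v axis last_idx 1)) $ last_idx) \<in> coord_ring SL_space"
  by (rule subalg_matrix_vector_mult[OF subalg_coord_SL], intro coord_SL_intros)
 hence c: "(\<lambda>M\<in>B. last_char M) \<in> coord_ring ?X"
  by (intro res) (simp add: last_char_def last_form_def matrix_vector_mul_assoc matrix_mul_assoc)
 have "(\<lambda>M\<in>SL. ((h ** SL_inv M) *v (g *v axis last_idx 1)) $ last_idx) \<in> coord_ring SL_space"
  by (rule subalg_matrix_vector_mult[OF subalg_coord_SL], intro coord_SL_intros)
 hence ci: "(\<lambda>M\<in>B. last_char (SL_inv M)) \<in> coord_ring ?X"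
  by (intro res) (simp add: last_char_def last_form_def matrix_vector_mul_assoc matrix_mul_assoc)
 have nz: "last_weight M ~= 0" and iv: "inverse (last_weight M) = last_char M ^ d" if M: "M \<in> B" for M
 proof -
  have e: "last_char (SL_inv M) ^ d * last_char M ^ d = 1" using last_char_inverse[OF M] by (simp add: power_mult_distrib[symmetric])
  hence "last_char (SL_inv M) ^ d ~= 0" by (metis mult_zero_left zero_neq_one)
  thus "last_weight M ~= 0" unfolding last_weight_def restrict_apply'[OF M] .
  show "inverse (last_weight M) = last_char M ^ d" using e M by (simp add: last_weight_def inverse_unique)
 qed
 have "morph ?X mult_grp_space last_weight"
  unfolding mult_grp_space_def
 proof (rule morph_into_alg_generated[OF X])
  show "{\<lambda>t\<in>- {0}. t, \<lambda>t\<in>- {0}. inverse t} \<subseteq> extensional (- {0::'k})" by auto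
  show "last_weight x \<in> - {0}" if "x \<in> pts ?X" for x using nz that by (simp add: pX)
  fix f assume f: "f \<in> {\<lambda>t\<in>- {0::'k}. t, \<lambda>t\<in>- {0}. inverse t}"
  have 1: "(\<lambda>M\<in>B. (\<lambda>M\<in>B. last_char (SL_inv M)) M ^ d) \<in> coord_ring ?X" by (rule subalg_power[OF S ci])
  have 2: "(\<lambda>M\<in>B. (\<lambda>M\<in>B. last_char M) M ^ d) \<in> coord_ring ?X" by (rule subalg_power[OF S c])
  have "(\<lambda>M\<in>B. (\<lambda>t\<in>- {0}. t) (last_weight M)) = (\<lambda>M\<in>B. (\<lambda>M\<in>B. last_char (SL_inv M)) M ^ d)"
   "(\<lambda>M\<in>B. (\<lambda>t\<in>- {0}. inverse t) (last_weight M)) = (\<lambda>M\<in>B. (\<lambda>M\<in>B. last_char M) M ^ d)"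
   using nz iv by (auto intro!: restrict_ext simp: last_weight_def)
  thus "(\<lambda>x\<in>pts ?X. f (last_weight x)) \<in> coord_ring ?X" using f 1 2 unfolding pX by auto
 qed
 moreover have "last_weight \<in> hom (SL_grp\<lparr>carrier := B\<rparr>) mult_grp"
 proof (rule homI)
  show "last_weight M \<in> carrier mult_grp" if "M \<in> carrier (SL_grp\<lparr>carrier := B\<rparr>)" for M
   using nz that by (simp add: mult_grp_def)
  fix M N assume "M \<in> carrier (SL_grp\<lparr>carrier := B\<rparr>)" "N \<in> carrier (SL_grp\<lparr>carrier := B\<rparr>)"
  hence MN: "M \<in> B" "N \<in> B" by auto
  have "SL_inv (M ** N) = SL_inv N ** SL_inv M" using SL.inv_mult_group[of M N] Bs(1) MN by simp
  hence "last_char (SL_inv (M ** N)) = last_char (SL_inv N) * last_char (SL_inv M)"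
   using last_char_mult[OF Bs(4)[OF MN(2)]] by simp
  thus "last_weight (M \<otimes>\<^bsub>SL_grp\<lparr>carrier := B\<rparr>\<^esub> N) = last_weight M \<otimes>\<^bsub>mult_grp\<^esub> last_weight N"
   using MN Bs(2)[OF MN] by (simp add: last_weight_def mult_grp_def power_mult_distrib mult.commute)
 qed
 moreover have "last_weight \<in> extensional B" by (simp add: last_weight_def)
 ultimately show ?thesis by (simp add: characters_def)
qed

lemma last_form_act: "M \<in> B ==> last_form h (M *v x) = last_char M * last_form h x"
 unfolding last_char_def B by (rule last_form_semi_invariant[OF hg])

lemma last_weight_in_weight_monoid:
 assumes S: "graded_ring d 0 S"
 shows "last_weight \<in> weight_monoid SL_grp SL_space B (A_var d 0) (graded_ring.act S)"
proof -
 interpret graded_ring d 0 S by (rule S)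
 have f: "(\<lambda>x. last_form h x ^ d) \<in> S"
  unfolding last_form_def by (rule matrix[OF coord_power[of d last_idx], of h]) (simp add: admissible_def)
 show ?thesis
  unfolding weight_monoid_def
 proof (intro CollectI conjI last_weight_in_characters bexI[of _ "hat (\<lambda>x. last_form h x ^ d)"])
  show "hat (\<lambda>x. last_form h x ^ d) \<in> coord_ring Z" using f coord_ring_A_var by blast
  show "\<exists>p\<in>pts Z. hat (\<lambda>x. last_form h x ^ d) p ~= 0"
   by (rule bexI[of _ "ev (g *v axis last_idx 1)"]) (simp_all add: hat_ev[OF f] last_form_base[OF hg] pts_A_var)
  show "\<forall>b\<in>B. \<forall>p\<in>pts Z. hat (\<lambda>x. last_form h x ^ d) (act (SL_inv b) p) = last_weight b * hat (\<lambda>x. last_form h x ^ d) p"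
  proof (intro ballI)
   fix b p assume b: "b \<in> B" and "p \<in> pts Z"
   then obtain x where x: "p = ev x" by (auto simp: pts_A_var)
   show "hat (\<lambda>x. last_form h x ^ d) (act (SL_inv b) p) = last_weight b * hat (\<lambda>x. last_form h x ^ d) p"
    using last_form_act[OF SL_subgroup(4)[OF subgroup_B b], of x] b
    by (simp add: x hat_ev[OF f] last_weight_def power_mult_distrib)
  qed
 qed
qed

text \<open>
 A semi-invariant of this weight is a multiple of the \<open>d\<close>-th power of the linear form, because
 \<open>B\<close> has a dense orbit; but for \<open>s \<ge> 2\<close> the ring has no elements of degree \<open>d\<close>.
\<close>

lemma last_weight_notin_weight_monoid:
 assumes S: "graded_ring d s S" and s: "2 \<le> s" and n: "2 \<le> CARD('n)"
 shows "last_weight \<notin> weight_monoid SL_grp SL_space B (A_var d s) (graded_ring.act S)"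
proof
 interpret graded_ring d s S by (rule S)
 interpret SL: group "SL_grp :: ('k ^ 'n ^ 'n) monoid" by (rule group_SL)
 note Bs = SL_subgroup[OF subgroup_B]
 assume "last_weight \<in> weight_monoid SL_grp SL_space B Z act"
 then obtain f where f: "f \<in> coord_ring Z" "\<exists>p\<in>pts Z. f p ~= 0"
  and semi: "\<forall>b\<in>B. \<forall>p\<in>pts Z. f (act (SL_inv b) p) = last_weight b * f p"
  unfolding weight_monoid_def by blast
 obtain F where F: "F \<in> S" "f = hat F" using f(1) coord_ring_A_var by blast
 obtain z where z: "F z ~= 0" using f(2) by (auto simp: pts_A_var F hat_ev[OF F(1)])
 let ?x = "g *v axis last_idx 1"
 have FB: "F (M *v x) = last_char M ^ d * F x" if M: "M \<in> B" for M x
 proof -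
  have "SL_inv (SL_inv M) = M" using SL.inv_inv[of M] Bs(1)[OF M] by simp
  moreover have "f (act (SL_inv (SL_inv M)) (ev x)) = last_weight (SL_inv M) * f (ev x)"
   using semi Bs(4)[OF M] by (auto simp: pts_A_var)
  ultimately show ?thesis using Bs(4)[OF M] by (simp add: F hat_ev[OF F(1)] last_weight_def)
 qed
 have l: "last_form h \<in> polys"
  unfolding last_form_def by (simp add: matrix_vector_mult_def, intro polys_sum polys_scale polys_coord)
 have F_eq: "F y = F ?x * last_form h y ^ d" for y
 proof (rule polys_eq_dense[of F "\<lambda>y. F ?x * last_form h y ^ d" "last_form h" ?x])
  fix y assume y: "last_form h y ~= 0"
  then obtain M where M: "M \<in> B" "M *v ?x = y" using triangular_orbit[OF hg _ n] unfolding B by blast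
  thus "F y = F ?x * last_form h y ^ d" using FB[OF M(1), of ?x] by (simp add: last_char_def)
 qed (use polys[OF F(1)] l last_form_base[OF hg] in auto)
 have "\<not> admissible d s d" using s d_pos by (auto simp: admissible_def)
 hence "hcomp d F = (\<lambda>x. 0)" by (rule hcomp_zero[OF F(1)])
 moreover have "hcomp d F = (\<lambda>x. if d = d then F x else 0)"
 proof (rule hcomp_homogeneous)
  fix t x
  have "last_form h (t *s x) = t * last_form h x" by (simp add: last_form_def vector_scalar_commute)
  thus "F (t *s x) = t ^ d * F x" unfolding F_eq[of "t *s x"] F_eq[of x] by (simp add: power_mult_distrib)
 qed
 ultimately show False using z by (metis (full_types))
qed

end

section \<open>The quotient and its non-normal variants\<close>

theorem lemma9p1:
  fixes d s :: nat
    and X Y :: "(('k::{alg_closed_field, field_char_0} ^ 'n::finite \<Rightarrow> 'k) \<Rightarrow> 'k, 'k) fspace"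
    and \<pi> :: "'k ^ 'n \<Rightarrow> ('k ^ 'n \<Rightarrow> 'k) \<Rightarrow> 'k"
    and \<eta> :: "(('k ^ 'n \<Rightarrow> 'k) \<Rightarrow> 'k) \<Rightarrow> (('k ^ 'n \<Rightarrow> 'k) \<Rightarrow> 'k)"
    and G :: "('k ^ 'n ^ 'n) monoid"
    and V :: "('k ^ 'n ^ 'n, 'k) fspace"
  assumes "CARD('n) \<ge> 2" and "d \<ge> 2" and "s \<ge> 2"
  defines "X \<equiv> mu_quotient d" and "Y \<equiv> A_var d s"
    and "\<pi> \<equiv> mu_proj d" and "\<eta> \<equiv> eta_map d s"
    and "G \<equiv> SL_grp" and "V \<equiv> SL_space"
  shows
    "(spherical_mod_kernel G V X (SL_action d) \<and>
      (coprime CARD('n) d \<longrightarrow> spherical G V X (SL_action d)) \<and>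
      (\<forall>p\<in>pts X - {\<pi> 0}. smooth_at X p)) \<and>
     (\<exists>\<rho>. regular_action G V Y \<rho> \<and>
        (\<forall>g\<in>carrier G. \<forall>x\<in>pts X. \<eta> (SL_action d g x) = \<rho> g (\<eta> x)) \<and>
        (\<forall>B. Borel_subgroup G V B \<longrightarrow>
           weight_monoid G V B Y \<rho> \<noteq> weight_monoid G V B X (SL_action d))) \<and>
     (normalization_map X Y \<eta> \<and> bij_betw \<eta> (pts X) (pts Y)) \<and>
     ((\<forall>\<phi>\<in>carrier (Aut Y). \<exists>!\<psi>. is_lift X \<eta> \<phi> \<psi>) \<and>
      iso_preserves_alg_subgroups Y X (lift_aut X \<eta>)) \<and>
     \<not> normal_variety Y"
proof -
 have d0: "0 < d" using assms(2) by simp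
 note n = assms(1) and d2 = assms(2) and s2 = assms(3)
 interpret P: invariants_pair d s "A_ring d s" "A_ring d 0 :: ('k ^ 'n => 'k) set"
  by unfold_locales (use d0 in simp_all)
 have mu: "mu_invariants d = (A_ring d 0 :: ('k ^ 'n => 'k) set)" by (rule mu_invariants_eq[OF d0])
 have X: "X = A_var d 0" by (simp add: X_def mu_quotient_def A_var_def mu)
 have pX: "pts X = range P.R.ev" unfolding X by (rule P.R.pts_A_var)
 have act: "SL_action d = P.R.act"
  using pX by (simp add: SL_action_def P.R.act_def mu X_def fun_eq_iff)
 have pi: "\<pi> x = P.R.ev x" for x by (simp add: \<pi>_def mu_proj_def mu P.R.ev_def)
 have sph: "spherical_mod_kernel G V X (SL_action d)"
  unfolding spherical_mod_kernel_def G_def V_def X act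
  using P.R.regular_action_act P.R.open_dense_Borel_orbit[OF n refl] ..
 have faithful: "spherical G V X (SL_action d)" if "coprime CARD('n) d"
  using sph P.R.faithful_act[OF that refl] by (simp add: spherical_def G_def X act)
 have smooth: "smooth_at X p" if p: "p \<in> pts X - {\<pi> 0}" for p
 proof -
  obtain x where x: "p = P.R.ev x" using p pX by blast
  hence "x ~= 0" using p pi by auto
  thus ?thesis unfolding X x by (rule P.R.smooth_A_var[OF refl])
 qed
 have equiv: "\<eta> (SL_action d M p) = P.A.act M (\<eta> p)" if "p \<in> pts X" for M p
  using that unfolding pX act \<eta>_def by auto
 have weights: "weight_monoid G V B Y P.A.act ~= weight_monoid G V B X (SL_action d)"
  if B: "Borel_subgroup G V B" for B
 proof -
  obtain g h where gh: "h ** g = mat 1" "B = triangular_grp g h 0"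
   using Borel_subgroup_triangular B unfolding G_def V_def by blast
  show ?thesis
   unfolding G_def V_def Y_def X act
   using last_weight_in_weight_monoid[OF gh P.R.graded_ring_axioms]
    last_weight_notin_weight_monoid[OF gh P.A.graded_ring_axioms s2 n] by blast
 qed
 have lifts: "\<exists>!\<psi>. is_lift X \<eta> \<phi> \<psi>" if "\<phi> \<in> carrier (Aut Y)" for \<phi>
  unfolding X \<eta>_def P.is_lift_iff[OF that[unfolded Y_def]] by blast
 have bij: "bij_betw \<eta> (pts X) (pts Y)"
  unfolding pX Y_def \<eta>_def P.A.pts_A_var by (rule P.bij_eta)
 show ?thesis
 proof (intro conjI impI ballI exI[of _ P.A.act] allI)
  show "regular_action G V Y P.A.act" unfolding G_def V_def Y_def by (rule P.A.regular_action_act)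
  show "normalization_map X Y \<eta>" unfolding X Y_def \<eta>_def by (rule P.normalization_eta)
  show "iso_preserves_alg_subgroups Y X (lift_aut X \<eta>)"
   unfolding X Y_def \<eta>_def by (rule P.lift_aut_preserves[OF d2 n])
  show "\<not> normal_variety Y" unfolding Y_def by (rule P.A.not_normal_A_var[OF s2])
 qed (use sph faithful smooth equiv weights lifts bij in blast)+
qed

end
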